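(* Let $Z$ be a (real or complex) point exposed (PE), neutral, atomic, strongly facially symmetric space, and suppose there exists a geometric tripotent $e \in Z^*$ with $Z_2(e)=Z$. Let $\nabla=\{u : u \text{ is a geometric tripotent},\ u\le e\}\cup\{0\}$. If $\nabla$ is a Boolean algebra, then $Z$ is isometrically isomorphic to the space $\ell_1(\mathrm{T})$, where $\mathrm{T}=\{v_i\}_{i\in J}$ is a maximal family of mutually orthogonal minimal geometric tripotents from $Z^*$.
   Context: Let $Z$ be a real or complex normed space, $U=Z^*$ its dual, $Z_1=\{x\in Z:\|x\|\le 1\}$. Elements $x,y\in Z$ are orthogonal, $x\diamondsuit y$, if $\|x+y\|=\|x-y\|=\|x\|+\|y\|$. For $S\subset Z$, $S^\diamondsuit=\{x\in Z: x\diamondsuit y\ \forall y\in S\}$. A norm exposed face of $Z_1$ is a set $F_u=\{x\in Z_1: u(x)=1\}$ with $u\in Z^*$, $\|u\|=1$. An element $u\in Z^*$ is a projective unit if $\|u\|=1$ and $u(y)=0$ for all $y\in F_u^\diamondsuit$. Write $\overline{sp}F$ for the closed linear hull of $F$. A norm exposed face $F_u$ is a symmetric face if there is a linear isometry $S_u:Z\to Z$ with $S_u^2=I$ whose fixed point set is the topological direct sum $(\overline{sp}F_u)\oplus F_u^\diamondsuit$. $Z$ is weakly facially symmetric (WFS) if every norm exposed face of $Z_1$ is symmetric. $Z$ is strongly facially symmetric (SFS) if it is WFS and for each norm exposed face $F_u$ and each $g\in Z^*$ with $\|g\|=1$ and $F_u\subset F_g$ one has $S_u^*g=g$. For a symmetric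 face $F_u$ the geometric Peirce projections are: $P_1(F_u)=(I-S_u)/2$, and $P_2(F_u)$, $P_0(F_u)$ the projections of $Z$ onto $\overline{sp}F_u$ and $F_u^\diamondsuit$ respectively, so that $P_2(F_u)+P_0(F_u)=(I+S_u)/2$. A geometric tripotent is a projective unit $u\in Z^*$ such that $F_u$ is a symmetric face and $S_u^*u=u$. For a geometric tripotent $u$ put $P_k(u)=P_k(F_u)$, $Z_k(u)=P_k(u)Z$, $U_k(u)=P_k(u)^*(U)$, $k=0,1,2$. Geometric tripotents $u,v$ are orthogonal, $u\diamondsuit v$, if $u\in U_0(v)$ (equivalently $v\in U_0(u)$). A geometric tripotent $u$ is minimal if $\dim U_2(u)=1$. For geometric tripotents, $u\le v$ means $F_u\subset F_v$; $0$ is taken as least element. A contractive projection $Q$ on $Z$ is neutral if $\|Qx\|=\|x\|$ implies $Qx=x$. $Z$ is neutral if $P_2(F_u)$ is neutral for every symmetric face $F_u$. $Z$ is atomic if each symmetric face of $Z_1$ contains an extreme point. A neutral SFS space $Z$ is point exposed (PE) if each extreme point $x$ of $Z_1$ is norm exposed, i.e. $\{x\}$ is a norm exposed face. For a neutral SFS space with $Z_2(e)=Z$, the set $\nabla$ is known to be a complete orthomodular lattice with respect to $\le$ with orthocomplement $u^\perp=e-u$; "$\nabla$ is a Boolean algebra" means that this lattice is distributive. Maximal family $\mathrm{T}=\{v_i\}_{i\in J}$ of mutually orthogonal minimal geometric tripotents: each $v_i$ is a minimal geometric tripotent in $Z^*$, $v_i\diamondsuit v_j$ for $i\ne j$, and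 no minimal geometric tripotent is orthogonal to all $v_i$, $i\in J$. The space $\ell_1(\mathrm{T})=\{\{\lambda_i\}_{i\in J}:\sum_{i\in J}|\lambda_i|<+\infty\}$ has norm $\|\{\lambda_i\}\|=\sum_{i\in J}|\lambda_i|$, with scalars from the scalar field of $Z$.
   Formalization: Z is additionally assumed complete (a Banach space): for an incomplete Z, such as finitely supported sequences with the l1-norm, the claim fails because l1(T) is complete; norm exposed faces are taken to be non-empty. *)

theory Defs
  imports "HOL-Analysis.Analysis" "HOL-Algebra.Lattice"
begin

section \<open>Real or complex normed spaces\<close>

text \<open>
  A field of this class is \<open>\<real>\<close> (take \<open>\<iota> = 0\<close>) or \<open>\<real>(\<iota>)\<close> with \<open>\<iota>\<^sup>2 = -1\<close>. The norm of
  a \<^class>\<open>real_normed_field\<close> is multiplicative and extends the absolute value of \<open>\<real>\<close>,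
  so up to isometric isomorphism there are no members besides \<open>real\<close> and \<open>complex\<close>.
\<close>

class real_or_complex = real_normed_field +
  assumes real_or_complex:
    "\<exists>\<iota>. (\<iota> = 0 \<or> \<iota> * \<iota> = - 1) \<and> (\<forall>x. \<exists>a b. x = a *\<^sub>R 1 + b *\<^sub>R \<iota>)"

instance real :: real_or_complex
proof
  show "\<exists>\<iota>::real. (\<iota> = 0 \<or> \<iota> * \<iota> = - 1) \<and> (\<forall>x. \<exists>a b. x = a *\<^sub>R 1 + b *\<^sub>R \<iota>)"
    by (rule exI[of _ 0]) simp
qed

instance complex :: real_or_complex
proof
  have "\<exists>a b. x = a *\<^sub>R 1 + b *\<^sub>R \<i>" for x :: complex
    by (intro exI[of _ "Re x"] exI[of _ "Im x"]) (simp add: complex_eq_iff)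
  then show "\<exists>\<iota>::complex. (\<iota> = 0 \<or> \<iota> * \<iota> = - 1) \<and> (\<forall>x. \<exists>a b. x = a *\<^sub>R 1 + b *\<^sub>R \<iota>)"
    by (intro exI[of _ \<i>]) simp
qed

text \<open>
  The normed space \<open>Z\<close> over the scalar field \<open>'k\<close>; the type class supplies its underlying real
  normed space.
\<close>

locale normed_space_over = vector_space scale
  for scale :: "'k::real_or_complex \<Rightarrow> 'z::real_normed_vector \<Rightarrow> 'z" +
  assumes norm_scale: "norm (scale c x) = norm c * norm x"
    and scale_of_real: "scale (of_real r) x = r *\<^sub>R x"

lemma normed_space_over_real:
  "normed_space_over (scaleR :: real \<Rightarrow> 'z::real_normed_vector \<Rightarrow> 'z)"
  by unfold_locales (simp_all add: algebra_simps)

lemma normed_space_over_self: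
  "normed_space_over ((*) :: 'k::real_or_complex \<Rightarrow> 'k \<Rightarrow> 'k)"
  by unfold_locales (simp_all add: algebra_simps norm_mult scaleR_conv_of_real)


section \<open>Orthogonality and norm exposed faces\<close>

definition diamond :: "'z::real_normed_vector \<Rightarrow> 'z \<Rightarrow> bool" (infix \<open>\<diamondsuit>\<close> 50) where
  "x \<diamondsuit> y \<longleftrightarrow> norm (x + y) = norm (x - y) \<and> norm (x - y) = norm x + norm y"

definition diamond_compl :: "'z::real_normed_vector set \<Rightarrow> 'z set" where
  "diamond_compl S = {x. \<forall>y\<in>S. x \<diamondsuit> y}"

definition face :: "('z::real_normed_vector \<Rightarrow>\<^sub>L 'k::real_or_complex) \<Rightarrow> 'z set" where
  "face u = {x \<in> cball 0 1. blinfun_apply u x = 1}"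

definition dual_scale ::
  "'k::real_or_complex \<Rightarrow> ('z::real_normed_vector \<Rightarrow>\<^sub>L 'k) \<Rightarrow> ('z \<Rightarrow>\<^sub>L 'k)" where
  "dual_scale c u = blinfun_mult_right c o\<^sub>L u"

lemma blinfun_apply_dual_scale [simp]: "blinfun_apply (dual_scale c u) x = c * blinfun_apply u x"
  by (simp add: dual_scale_def)

lemma vector_space_dual_scale: "vector_space dual_scale"
  by unfold_locales (auto intro!: blinfun_eqI simp: blinfun.add_left algebra_simps)


section \<open>Facially symmetric spaces\<close>

context normed_space_over
begin

text \<open>
  Bounded linear maps of the library are linear over the reals, and the norm of
  \<open>'z \<Rightarrow>\<^sub>L 'k\<close> is the operator norm. The dual consists of those linear over \<open>'k\<close>.
\<close>

definition dual :: "('z \<Rightarrow>\<^sub>L 'k) set" where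
  "dual = {u. \<forall>c x. blinfun_apply u (scale c x) = c * blinfun_apply u x}"

text \<open>
  Norm exposed faces are non-empty, as in the work of Friedman and Russo. The empty set, which
  \<open>face u\<close> is when \<open>u\<close> does not attain its norm, could never contain an extreme point.
\<close>

definition norm_exposed_face :: "'z set \<Rightarrow> bool" where
  "norm_exposed_face F \<longleftrightarrow> F \<noteq> {} \<and> (\<exists>u\<in>dual. norm u = 1 \<and> F = face u)"

definition projective_unit :: "('z \<Rightarrow>\<^sub>L 'k) \<Rightarrow> bool" where
  "projective_unit u \<longleftrightarrow>
     u \<in> dual \<and> norm u = 1 \<and> (\<forall>y\<in>diamond_compl (face u). blinfun_apply u y = 0)"

definition closed_span :: "'z set \<Rightarrow> 'z set" where
  "closed_span F = closure (span F)"

text \<open>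
  The bound expresses continuity of the projection of \<open>W\<close> onto \<open>A\<close> along \<open>B\<close>, and hence of the
  projection onto \<open>B\<close>.
\<close>

definition topological_direct_sum :: "'z set \<Rightarrow> 'z set \<Rightarrow> 'z set \<Rightarrow> bool" where
  "topological_direct_sum A B W \<longleftrightarrow>
     subspace A \<and> subspace B \<and> A \<inter> B = {0} \<and> W = {a + b | a b. a \<in> A \<and> b \<in> B} \<and>
     (\<exists>C. \<forall>a\<in>A. \<forall>b\<in>B. norm a \<le> C * norm (a + b))"

definition is_symmetry :: "'z set \<Rightarrow> ('z \<Rightarrow>\<^sub>L 'z) \<Rightarrow> bool" where
  "is_symmetry F S \<longleftrightarrow>
     (\<forall>c x. blinfun_apply S (scale c x) = scale c (blinfun_apply S x)) \<and>
     (\<forall>x. norm (blinfun_apply S x) = norm x) \<and>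
     S o\<^sub>L S = id_blinfun \<and>
     topological_direct_sum (closed_span F) (diamond_compl F) {x. blinfun_apply S x = x}"

definition symmetric_face :: "'z set \<Rightarrow> bool" where
  "symmetric_face F \<longleftrightarrow> norm_exposed_face F \<and> (\<exists>S. is_symmetry F S)"

lemma is_symmetry_involution:
  assumes "is_symmetry F S"
  shows "blinfun_apply S (blinfun_apply S x) = x"
proof -
  have "blinfun_apply (S o\<^sub>L S) x = blinfun_apply id_blinfun x"
    using assms by (simp add: is_symmetry_def)
  then show ?thesis by simp
qed

lemma is_symmetry_unique:
  assumes S: "is_symmetry F S" and S': "is_symmetry F S'"
  shows "S = S'"
proof (rule blinfun_eqI)
  fix x
  let ?S = "blinfun_apply S" and ?S' = "blinfun_apply S'"
  have inv: "?S (?S y) = y" "?S' (?S' y) = y" for y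
    using is_symmetry_involution[OF S] is_symmetry_involution[OF S'] by blast+
  have fix_eq: "?S y = y \<longleftrightarrow> ?S' y = y" for y
  proof -
    have "{x. ?S x = x} = {x. ?S' x = x}"
      using S S' unfolding is_symmetry_def topological_direct_sum_def by simp
    then show ?thesis by blast
  qed
  define n where "n = ?S (?S' x) - x"
  have "?S' (x + ?S' x) = x + ?S' x" by (simp add: blinfun.add_right inv)
  then have a: "?S (x + ?S' x) = x + ?S' x" using fix_eq by blast
  have b: "?S (x + ?S x) = x + ?S x" by (simp add: blinfun.add_right inv)
  have n_eq: "n = ?S' x - ?S x"
    using a by (simp add: n_def blinfun.add_right algebra_simps)
  have "?S n = n" using a b unfolding n_eq
    by (simp add: blinfun.diff_right blinfun.add_right inv algebra_simps)
  then have n_fix: "?S n = n" "?S' n = n" using fix_eq by blast+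
  have SS': "?S (?S' x) = x + n" by (simp add: n_def)
  have iter: "((\<lambda>y. ?S (?S' y)) ^^ k) x = x + real k *\<^sub>R n" for k
  proof (induction k)
    case (Suc k)
    have "?S (?S' (x + real k *\<^sub>R n)) = (x + n) + real k *\<^sub>R n"
      by (simp add: blinfun.add_right blinfun.scaleR_right n_fix SS')
    with Suc show ?case by (simp add: algebra_simps)
  qed simp
  have iso: "norm (((\<lambda>y. ?S (?S' y)) ^^ k) x) = norm x" for k
    using S S' by (induction k) (simp_all add: is_symmetry_def)
  have bound: "real k * norm n \<le> 2 * norm x" for k
  proof -
    have "real k * norm n = norm ((x + real k *\<^sub>R n) - x)" by simp
    also have "\<dots> \<le> norm (x + real k *\<^sub>R n) + norm x" by (rule norm_triangle_ineq4)
    also have "\<dots> = 2 * norm x" using iso[of k] by (simp add: iter)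
    finally show ?thesis .
  qed
  have "norm n = 0"
  proof (rule ccontr)
    assume "norm n \<noteq> 0"
    then obtain k :: nat where "2 * norm x < real k * norm n"
      using ex_less_of_nat_mult[of "norm n" "2 * norm x"] by auto
    with bound[of k] show False by simp
  qed
  then show "?S x = ?S' x" using n_eq by simp
qed

definition symmetry :: "'z set \<Rightarrow> 'z \<Rightarrow>\<^sub>L 'z" where
  "symmetry F = (THE S. is_symmetry F S)"

lemma is_symmetry_symmetry: "symmetric_face F \<Longrightarrow> is_symmetry F (symmetry F)"
  unfolding symmetry_def symmetric_face_def 
  by (rule theI') (blast intro: is_symmetry_unique)

definition WFS :: bool where
  "WFS \<longleftrightarrow> (\<forall>F. norm_exposed_face F \<longrightarrow> symmetric_face F)"

text \<open>The adjoint of \<open>S\<close> maps \<open>g\<close> to \<open>g o\<^sub>L S\<close>.\<close>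

definition SFS :: bool where
  "SFS \<longleftrightarrow> WFS \<and>
     (\<forall>F. norm_exposed_face F \<longrightarrow>
       (\<forall>g\<in>dual. norm g = 1 \<and> F \<subseteq> face g \<longrightarrow> g o\<^sub>L symmetry F = g))"


section \<open>Geometric Peirce projections and geometric tripotents\<close>

text \<open>
  \<open>peirce2 F\<close> is \<open>(I + S)/2\<close> followed by the projection of the fixed point set of \<open>S\<close> onto
  the closed span of \<open>F\<close> along the complement.
\<close>

definition peirce2 :: "'z set \<Rightarrow> 'z \<Rightarrow>\<^sub>L 'z" where
  "peirce2 F = (THE P. \<forall>x. blinfun_apply P x \<in> closed_span F \<and>
     (1/2) *\<^sub>R (x + blinfun_apply (symmetry F) x) - blinfun_apply P x \<in> diamond_compl F)"

definition peirce1 :: "'z set \<Rightarrow> 'z \<Rightarrow>\<^sub>L 'z" where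
  "peirce1 F = (1/2) *\<^sub>R (id_blinfun - symmetry F)"

definition peirce0 :: "'z set \<Rightarrow> 'z \<Rightarrow>\<^sub>L 'z" where
  "peirce0 F = (1/2) *\<^sub>R (id_blinfun + symmetry F) - peirce2 F"

lemma real_combination_in_subspace:
  assumes "subspace A" "a \<in> A" "b \<in> A"
  shows "a + b \<in> A" "a - b \<in> A" "r *\<^sub>R a \<in> A"
  using subspace_add[OF assms] subspace_diff[OF assms] subspace_scale[OF assms(1,2), of "of_real r"]
  by (simp_all add: scale_of_real)

lemma peirce2_unique:
  assumes "symmetric_face F"
  shows "\<exists>!P. \<forall>x. blinfun_apply P x \<in> closed_span F \<and>
     (1/2) *\<^sub>R (x + blinfun_apply (symmetry F) x) - blinfun_apply P x \<in> diamond_compl F"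
proof -
  define S A B E where "S = symmetry F" and "A = closed_span F" and "B = diamond_compl F"
    and "E = (\<lambda>x. (1/2) *\<^sub>R (x + blinfun_apply S x))"
  have S: "is_symmetry F S" using assms is_symmetry_symmetry S_def by blast
  then have A: "subspace A" and B: "subspace B" and AB: "A \<inter> B = {0}"
    and W: "{x. blinfun_apply S x = x} = {a + b | a b. a \<in> A \<and> b \<in> B}"
    and "\<exists>C. \<forall>a\<in>A. \<forall>b\<in>B. norm a \<le> C * norm (a + b)"
    unfolding is_symmetry_def topological_direct_sum_def A_def B_def by simp_all
  then obtain C where C: "\<forall>a\<in>A. \<forall>b\<in>B. norm a \<le> C * norm (a + b)" by (elim exE)
  have uniq: "a = a'" if "a \<in> A" "a' \<in> A" "y - a \<in> B" "y - a' \<in> B" for a a' y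
  proof -
    have "a - a' \<in> A" using real_combination_in_subspace[OF A] that by blast
    moreover have "(y - a') - (y - a) \<in> B" using real_combination_in_subspace[OF B] that by blast
    then have "a - a' \<in> B" by simp
    ultimately have "a - a' \<in> A \<inter> B" by (rule IntI)
    then show ?thesis unfolding AB by simp
  qed
  have "\<exists>a. a \<in> A \<and> E x - a \<in> B" for x
  proof -
    have "blinfun_apply S (blinfun_apply S x) = x"
      using S by (rule is_symmetry_involution)
    then have "blinfun_apply S (E x) = E x"
      by (simp add: E_def blinfun.add_right blinfun.scaleR_right add.commute)
    then obtain a b where "E x = a + b" "a \<in> A" "b \<in> B" using W by blast
    then show ?thesis by (intro exI[of _ a]) simp
  qed
  then obtain p where p: "p x \<in> A" "E x - p x \<in> B" for x by metis
  have E_norm: "norm (E x) \<le> norm x" for x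
    using S norm_triangle_ineq[of x "blinfun_apply S x"] unfolding E_def is_symmetry_def by simp
  have "bounded_linear p"
  proof (rule bounded_linear_intro)
    fix x y
    have "(E x - p x) + (E y - p y) \<in> B" using real_combination_in_subspace[OF B] p by blast
    moreover have "(E x - p x) + (E y - p y) = E (x + y) - (p x + p y)"
      by (simp add: E_def blinfun.add_right algebra_simps)
    ultimately show "p (x + y) = p x + p y"
      using uniq[of "p (x + y)" "p x + p y" "E (x + y)"] p real_combination_in_subspace(1)[OF A] by simp
  next
    fix r x
    have "r *\<^sub>R (E x - p x) \<in> B" using real_combination_in_subspace[OF B] p by blast
    moreover have "r *\<^sub>R (E x - p x) = E (r *\<^sub>R x) - r *\<^sub>R p x"
      by (simp add: E_def blinfun.scaleR_right scaleR_add_right scaleR_diff_right mult.commute)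
    ultimately show "p (r *\<^sub>R x) = r *\<^sub>R p x"
      using uniq[of "p (r *\<^sub>R x)" "r *\<^sub>R p x" "E (r *\<^sub>R x)"] p real_combination_in_subspace(3)[OF A p(1) p(1)]
      by simp
  next
    fix x
    have "norm (p x) \<le> C * norm (E x)" using bspec[OF bspec[OF C p(1)] p(2), of x x] by simp
    also have "\<dots> \<le> \<bar>C\<bar> * norm x" by (intro mult_mono E_norm) auto
    finally show "norm (p x) \<le> norm x * \<bar>C\<bar>" by (simp add: mult.commute)
  qed
  then have app: "blinfun_apply (Blinfun p) = p" by (rule bounded_linear_Blinfun_apply)
  show ?thesis unfolding S_def[symmetric] A_def[symmetric] B_def[symmetric] E_def[symmetric]
  proof (rule ex1I[of _ "Blinfun p"])
    show "\<forall>x. blinfun_apply (Blinfun p) x \<in> A \<and>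
      (1/2) *\<^sub>R (x + blinfun_apply S x) - blinfun_apply (Blinfun p) x \<in> B"
      using p by (simp add: app E_def)
  next
    fix P assume P: "\<forall>x. blinfun_apply P x \<in> A \<and> (1/2) *\<^sub>R (x + blinfun_apply S x) - blinfun_apply P x \<in> B"
    show "P = Blinfun p"
    proof (rule blinfun_eqI)
      fix x
      have "blinfun_apply P x = p x"
        using P p uniq[of "blinfun_apply P x" "p x" "E x"] by (simp add: E_def)
      then show "blinfun_apply P x = blinfun_apply (Blinfun p) x" by (simp add: app)
    qed
  qed
qed

definition geometric_tripotent :: "('z \<Rightarrow>\<^sub>L 'k) \<Rightarrow> bool" where
  "geometric_tripotent u \<longleftrightarrow>
     projective_unit u \<and> symmetric_face (face u) \<and> u o\<^sub>L symmetry (face u) = u"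

definition Z2 :: "('z \<Rightarrow>\<^sub>L 'k) \<Rightarrow> 'z set" where
  "Z2 u = range (blinfun_apply (peirce2 (face u)))"

definition U2 :: "('z \<Rightarrow>\<^sub>L 'k) \<Rightarrow> ('z \<Rightarrow>\<^sub>L 'k) set" where
  "U2 u = (\<lambda>f. f o\<^sub>L peirce2 (face u)) ` dual"

definition U0 :: "('z \<Rightarrow>\<^sub>L 'k) \<Rightarrow> ('z \<Rightarrow>\<^sub>L 'k) set" where
  "U0 u = (\<lambda>f. f o\<^sub>L peirce0 (face u)) ` dual"

definition tripotent_orthogonal :: "('z \<Rightarrow>\<^sub>L 'k) \<Rightarrow> ('z \<Rightarrow>\<^sub>L 'k) \<Rightarrow> bool" where
  "tripotent_orthogonal u v \<longleftrightarrow> geometric_tripotent u \<and> geometric_tripotent v \<and> u \<in> U0 v"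

definition minimal_tripotent :: "('z \<Rightarrow>\<^sub>L 'k) \<Rightarrow> bool" where
  "minimal_tripotent u \<longleftrightarrow> geometric_tripotent u \<and> vector_space.dim dual_scale (U2 u) = 1"

definition neutral_projection :: "('z \<Rightarrow>\<^sub>L 'z) \<Rightarrow> bool" where
  "neutral_projection Q \<longleftrightarrow> Q o\<^sub>L Q = Q \<and> norm Q \<le> 1 \<and>
     (\<forall>x. norm (blinfun_apply Q x) = norm x \<longrightarrow> blinfun_apply Q x = x)"

definition neutral :: bool where
  "neutral \<longleftrightarrow> (\<forall>F. symmetric_face F \<longrightarrow> neutral_projection (peirce2 F))"

definition atomic :: bool where
  "atomic \<longleftrightarrow> (\<forall>F. symmetric_face F \<longrightarrow> (\<exists>x\<in>F. x extreme_point_of cball 0 1))"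

definition point_exposed :: bool where
  "point_exposed \<longleftrightarrow> (\<forall>x. x extreme_point_of cball 0 1 \<longrightarrow> norm_exposed_face {x})"


section \<open>The lattice below a geometric tripotent\<close>

definition nabla :: "('z \<Rightarrow>\<^sub>L 'k) \<Rightarrow> ('z \<Rightarrow>\<^sub>L 'k) set" where
  "nabla e = {u. geometric_tripotent u \<and> face u \<subseteq> face e} \<union> {0}"

text \<open>Since \<open>face 0 = {}\<close>, inclusion of faces also makes \<open>0\<close> the least element.\<close>

definition nabla_order :: "('z \<Rightarrow>\<^sub>L 'k) \<Rightarrow> ('z \<Rightarrow>\<^sub>L 'k) gorder" where
  "nabla_order e = \<lparr>carrier = nabla e, eq = (=), le = (\<lambda>u v. face u \<subseteq> face v)\<rparr>"

text \<open>
  In a neutral SFS space with \<open>Z2 e = UNIV\<close> this order is always a complete orthomodular lattice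
  with orthocomplement \<open>e - u\<close>, so distributivity is all that being a Boolean algebra adds.
\<close>

definition nabla_boolean :: "('z \<Rightarrow>\<^sub>L 'k) \<Rightarrow> bool" where
  "nabla_boolean e \<longleftrightarrow>
     (\<forall>u\<in>nabla e. \<forall>v\<in>nabla e. \<forall>w\<in>nabla e.
        u \<sqinter>\<^bsub>nabla_order e\<^esub> (v \<squnion>\<^bsub>nabla_order e\<^esub> w) =
        (u \<sqinter>\<^bsub>nabla_order e\<^esub> v) \<squnion>\<^bsub>nabla_order e\<^esub> (u \<sqinter>\<^bsub>nabla_order e\<^esub> w))"


section \<open>Maximal orthogonal families and the space \<open>\<ell>\<^sub>1(T)\<close>\<close>

text \<open>
  No geometric tripotent is orthogonal to itself, so the members of an orthogonal family are
  pairwise distinct and the family may be given as a set.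
\<close>

definition maximal_orthogonal_family :: "('z \<Rightarrow>\<^sub>L 'k) set \<Rightarrow> bool" where
  "maximal_orthogonal_family T \<longleftrightarrow>
     (\<forall>v\<in>T. minimal_tripotent v) \<and>
     pairwise tripotent_orthogonal T \<and>
     \<not> (\<exists>w. minimal_tripotent w \<and> (\<forall>v\<in>T. tripotent_orthogonal w v))"

end

text \<open>Families indexed by \<open>T\<close> are functions vanishing outside \<open>T\<close>.\<close>

definition ell1 :: "'i set \<Rightarrow> ('i \<Rightarrow> 'k::real_or_complex) set" where
  "ell1 T = {l. (\<forall>i. i \<notin> T \<longrightarrow> l i = 0) \<and> (\<lambda>i. norm (l i)) summable_on T}"

definition ell1_norm :: "'i set \<Rightarrow> ('i \<Rightarrow> 'k::real_or_complex) \<Rightarrow> real" where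
  "ell1_norm T l = (\<Sum>\<^sub>\<infinity>i\<in>T. norm (l i))"

definition (in normed_space_over) isometrically_isomorphic_ell1 :: "'i set \<Rightarrow> bool" where
  "isometrically_isomorphic_ell1 T \<longleftrightarrow>
     (\<exists>\<Phi> :: 'z \<Rightarrow> 'i \<Rightarrow> 'k.
        bij_betw \<Phi> UNIV (ell1 T) \<and>
        (\<forall>x y. \<Phi> (x + y) = (\<lambda>i. \<Phi> x i + \<Phi> y i)) \<and>
        (\<forall>c x. \<Phi> (scale c x) = (\<lambda>i. c * \<Phi> x i)) \<and>
        (\<forall>x. ell1_norm T (\<Phi> x) = norm x))"

end

theory Submission
  imports Defs
begin

text \<open>
  Let \<open>X\<close> consist of the extreme points of the unit ball on the face of \<open>e\<close>, and write \<open>v_x\<close> for the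
  tripotent of \<open>x\<close>. Distributivity makes \<open>X\<close> pairwise orthogonal, and a functional of norm one that is
  \<open>1\<close> at a point \<open>y\<close> of the face is also \<open>1\<close> at each \<open>x \<in> X\<close> with \<open>v_x y \<noteq> 0\<close>. All depends on the
  expansion \<open>y = Q y\<close>, \<open>Q y = \<Sum> v_x(y) x\<close>, on the face, that is, on the claim that \<open>R = 2 Q - I\<close>
  fixes the face.

  If \<open>R\<close> moves a point of the face, then some \<open>f\<close> vanishes on \<open>X\<close> but has positive supremum on the face.
  After subtracting a large multiple of \<open>e - \<Sum> v_x\<close> (finite sum) and a small perturbation, no two
  orthogonal extreme points can both nearly maximize \<open>f\<close> near the face: average the images of each
  \<open>x\<close> under the products of their symmetries. Bishop--Phelps for \<open>e + t f\<close> yields extreme points \<open>z_t\<close>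
  that tend to the face and nearly maximize \<open>f\<close>, and the previous observation forces
  \<open>v_{z_t}(z_s) \<rightarrow> 1\<close> for \<open>s\<close> much smaller than \<open>t\<close>. Products of symmetries then show that the \<open>z_t\<close> are
  totally bounded. A limit point \<open>l\<close> maximizes \<open>f\<close> on the face; for \<open>x \<in> X\<close> with \<open>v_x l \<noteq> 0\<close>
  also \<open>2 l - x\<close> lies on the face, so \<open>f\<close> is maximal at \<open>x\<close> as well, a contradiction.

  For \<open>R\<close> to be an isometry to begin with, the argument is applied inductively to the faces of
  finite subsets of \<open>X\<close>, with the symmetry at one of the points as \<open>R\<close>: the symmetries of these
  faces converge to \<open>2 Q - I\<close>.
\<close>

text \<open>Nothing compact is at hand: a functional need not attain its supremum on the face, and
  the extreme points that Bishop--Phelps supplies lie only near it. So the supremum is replaced by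
  the right derivative of the dual norm at the exposing functional, and facial symmetry by versions
  with tolerances.

  The decisive count concerns the numbers v_x(z) v_z(x). At a near maximizer z the number v_z(R z)
  is known only to be almost nonnegative, so applying v_z to (z + R z)/2 shows that their sum over x
  is about 1/2 or more. One maximizer is harmless, but two orthogonal ones, z and w, together give
  about 1. On the other hand f is almost nonpositive on X, and averaging x over its reflections at z
  and w then yields v_z(x) + v_w(x) \<le> 1 - \<sigma> with a fixed \<sigma> > 0. This is a
  contradiction once v_x(z) and v_x(w) agree and their sums over a finite set of x are nearly 1: the
  first is the purpose of the small perturbation, the second of the large multiple. Both are fixed
  before the tolerances, because errors are multiplied by the size of the finite set.\<close>

notation blinfun_apply (infixl \<open>\<cdot>\<close> 900)

subsection \<open>Scalars\<close>

text \<open>The power trick: a factor that does not depend on \<open>n\<close> disappears on taking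
  n-th roots.\<close>

lemma power_le_twice_imp_le:
  fixes r s :: real
  assumes "\<And>n. r ^ n \<le> 2 * s ^ n" "s > 0"
  shows "r \<le> s"
proof (rule ccontr)
  assume "\<not> r \<le> s"
  then have "1 < r / s" using assms(2) by simp
  then obtain n where "2 < (r / s) ^ n" using real_arch_pow by blast
  then have "2 * s ^ n < r ^ n" using assms(2) by (simp add: power_divide field_simps)
  with assms(1)[of n] show False by simp
qed

text \<open>The class prescribes the algebra, but of the norm it says little more than
  multiplicativity. Coordinates with respect to 1 and \<iota> give a field embedding; it is
  isometric because a crude comparison of the norms, applied to powers and to inverses, becomes an
  equality.\<close>

lemma ex_complex_embedding:
  "\<exists>\<phi> :: 'k::real_or_complex \<Rightarrow> complex.
     (\<forall>x y. \<phi> (x + y) = \<phi> x + \<phi> y) \<and> (\<forall>x y. \<phi> (x * y) = \<phi> x * \<phi> y) \<and>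
     (\<forall>r. \<phi> (of_real r) = of_real r) \<and> (\<forall>x. norm (\<phi> x) = norm x) \<and>
     (\<exists>\<iota>. (\<iota> = 0 \<or> \<iota> * \<iota> = - 1) \<and> Re (\<phi> \<iota>) = 0 \<and> (\<forall>x. \<exists>a b. x = of_real a + of_real b * \<iota>))"
proof -
  obtain \<iota> :: 'k where \<iota>: "\<iota> = 0 \<or> \<iota> * \<iota> = - 1" and rep: "\<forall>x. \<exists>a b. x = of_real a + of_real b * \<iota>"
    using real_or_complex by (auto simp: scaleR_conv_of_real)
  show ?thesis
  proof (cases "\<iota> = 0")
    case True
    then have "\<forall>x::'k. \<exists>a. x = of_real a" using rep by auto
    then obtain g where g: "\<And>x::'k. x = of_real (g x)" by metis
    have [simp]: "g (of_real r) = r" for r by (metis g of_real_eq_iff)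
    have add: "g (x + y) = g x + g y" for x y by (metis g of_real_add of_real_eq_iff)
    have mult: "g (x * y) = g x * g y" for x y by (metis g of_real_mult of_real_eq_iff)
    have "norm (of_real (g x) :: complex) = norm x" for x by (metis g norm_of_real)
    moreover have "Re (of_real (g \<iota>)) = 0" using True by (metis Re_complex_of_real g of_real_0 of_real_eq_iff)
    ultimately show ?thesis using \<iota> rep True
      by (intro exI[of _ "\<lambda>x. of_real (g x)"]) (auto simp: add mult)
  next
    case False
    with \<iota> have ii: "\<iota> * \<iota> = - 1" by simp
    have norm_ii: "norm \<iota> = 1"
    proof -
      have "(norm \<iota>)\<^sup>2 = 1" using arg_cong[OF ii, of norm] by (simp add: norm_mult power2_eq_square)
      then show ?thesis using norm_ge_zero[of \<iota>] unfolding power2_eq_1_iff by linarith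
    qed
    \<comment> \<open>Two different representations would make \<iota> real, and no real number has
      square -1.\<close>
    have uniq: "a = c \<and> b = d" if "of_real a + of_real b * \<iota> = of_real c + of_real d * \<iota>" for a b c d
    proof (rule ccontr)
      assume ne: "\<not> (a = c \<and> b = d)"
      have eq: "of_real (b - d) * \<iota> = of_real (c - a)" using that by (simp add: algebra_simps)
      have "b \<noteq> d"
      proof
        assume "b = d"
        then have "of_real (c - a) = (0::'k)" using eq by simp
        then have "a = c" using of_real_eq_0_iff by simp
        with \<open>b = d\<close> ne show False by simp
      qed
      then have "\<iota> = of_real ((c - a) / (b - d))" using eq
        by (simp add: nonzero_eq_divide_eq of_real_divide mult.commute flip: of_real_diff)
      then have "of_real (((c - a) / (b - d)) * ((c - a) / (b - d))) = (of_real (- 1) :: 'k)"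
        using ii by simp
      then have "((c - a) / (b - d)) * ((c - a) / (b - d)) = - 1" by (simp only: of_real_eq_iff)
      then show False using zero_le_square[of "(c - a) / (b - d)"] by linarith
    qed
    obtain g h where gh: "\<And>x. x = of_real (g x) + of_real (h x) * \<iota>" using rep by metis
    define \<phi> where "\<phi> x = Complex (g x) (h x)" for x
    have val: "\<phi> (of_real a + of_real b * \<iota>) = Complex a b" for a b
      using uniq gh[of "of_real a + of_real b * \<iota>"] unfolding \<phi>_def by metis
    have add: "\<phi> (x + y) = \<phi> x + \<phi> y" for x y
    proof -
      have *: "x + y = of_real (g x + g y) + of_real (h x + h y) * \<iota>"
        by (subst gh[of x], subst gh[of y]) (simp add: algebra_simps)
      show ?thesis unfolding * val by (simp add: \<phi>_def complex_eq_iff)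
    qed
    have mult: "\<phi> (x * y) = \<phi> x * \<phi> y" for x y
    proof -
      have "x * y = of_real (g x) * of_real (g y) + (of_real (g x) * of_real (h y) + of_real (h x) * of_real (g y)) * \<iota>
          + of_real (h x) * of_real (h y) * (\<iota> * \<iota>)"
        by (subst gh[of x], subst gh[of y]) (simp add: algebra_simps)
      also have "\<dots> = of_real (g x * g y - h x * h y) + of_real (g x * h y + h x * g y) * \<iota>"
        by (simp add: ii)
      finally have *: "x * y = \<dots>" .
      show ?thesis unfolding * val by (simp add: \<phi>_def complex_eq_iff)
    qed
    have one: "\<phi> (of_real r) = of_real r" for r using val[of r 0] by (simp add: complex_eq_iff)
    have "\<phi> x \<noteq> 0" if "x \<noteq> 0" for x
    proof
      assume "\<phi> x = 0"
      then have "g x = 0" "h x = 0" by (simp_all add: \<phi>_def complex_eq_iff)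
      with gh[of x] that show False by simp
    qed
    note nz = this
    have pow: "\<phi> (x ^ n) = \<phi> x ^ n" for x n
      by (induction n) (use one[of 1] in \<open>simp_all add: mult\<close>)
    \<comment> \<open>The triangle inequality loses a factor two, which powers remove; the opposite
      inequality is the same one for the inverse.\<close>
    have "norm x \<le> 2 * norm (\<phi> x)" for x
    proof -
      have "norm x \<le> norm (of_real (g x) :: 'k) + norm (of_real (h x) * \<iota>)"
        by (subst gh[of x]) (rule norm_triangle_ineq)
      also have "\<dots> = \<bar>Re (\<phi> x)\<bar> + \<bar>Im (\<phi> x)\<bar>" by (simp add: norm_mult norm_ii \<phi>_def)
      also have "\<dots> \<le> 2 * norm (\<phi> x)" using abs_Re_le_cmod[of "\<phi> x"] abs_Im_le_cmod[of "\<phi> x"] by simp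
      finally show ?thesis .
    qed
    then have "norm x ^ n \<le> 2 * norm (\<phi> x) ^ n" for x n by (metis norm_power pow)
    then have le: "norm x \<le> norm (\<phi> x)" if "x \<noteq> 0" for x
      using power_le_twice_imp_le nz[OF that] by simp
    have "norm (\<phi> x) = norm x" for x
    proof (cases "x = 0")
      case True then show ?thesis using one[of 0] by simp
    next
      case False
      have "\<phi> x * \<phi> (inverse x) = 1" using False one[of 1] by (simp flip: mult)
      then have "norm (\<phi> (inverse x)) = inverse (norm (\<phi> x))"
        by (metis inverse_unique norm_inverse)
      with le[of "inverse x"] False have "inverse (norm x) \<le> inverse (norm (\<phi> x))"
        by (simp add: norm_inverse)
      then have "norm (\<phi> x) \<le> norm x" using False nz[OF False] by simp
      with le[OF False] show ?thesis by simp
    qed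
    moreover have "Re (\<phi> \<iota>) = 0" using val[of 0 1] by simp
    ultimately show ?thesis
      by (intro exI[of _ \<phi>] conjI exI[of _ \<iota>]) (simp_all only: add mult one ii rep simp_thms)
  qed
qed

definition to_complex :: "'k::real_or_complex \<Rightarrow> complex" where
  "to_complex = (SOME \<phi>. (\<forall>x y. \<phi> (x + y) = \<phi> x + \<phi> y) \<and> (\<forall>x y. \<phi> (x * y) = \<phi> x * \<phi> y) \<and>
     (\<forall>r. \<phi> (of_real r) = of_real r) \<and> (\<forall>x. norm (\<phi> x) = norm x) \<and>
     (\<exists>\<iota>. (\<iota> = 0 \<or> \<iota> * \<iota> = - 1) \<and> Re (\<phi> \<iota>) = 0 \<and> (\<forall>x. \<exists>a b. x = of_real a + of_real b * \<iota>)))"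

text \<open>The real part, taken through a chosen embedding into the complex numbers; it lets real
  and complex scalars be treated together.\<close>

definition rp :: "'k::real_or_complex \<Rightarrow> real" where
  "rp x = Re (to_complex x)"

lemmas to_complex_props = someI_ex[OF ex_complex_embedding, folded to_complex_def]

lemma to_complex_add: "to_complex (x + y) = to_complex x + to_complex y"
  and to_complex_mult: "to_complex (x * y) = to_complex x * to_complex y"
  and to_complex_of_real [simp]: "to_complex (of_real r) = of_real r"
  and norm_to_complex [simp]: "norm (to_complex x) = norm x"
  by (simp_all only: to_complex_props)

lemma ex_imaginary_unit:
  "\<exists>\<iota>::'k::real_or_complex. (\<iota> = 0 \<or> \<iota> * \<iota> = - 1) \<and> rp \<iota> = 0 \<and>
     (\<forall>x. \<exists>a b. x = of_real a + of_real b * \<iota>)"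
  unfolding rp_def by (simp only: to_complex_props)

lemma rp_add [simp]: "rp (x + y) = rp x + rp y"
  by (simp add: rp_def to_complex_add)

lemma rp_of_real [simp]: "rp (of_real r) = r"
  by (simp add: rp_def)

lemma rp_0 [simp]: "rp 0 = 0" and rp_1 [simp]: "rp 1 = 1"
  using rp_of_real[of 0] rp_of_real[of 1] by simp_all

lemma rp_of_real_mult [simp]: "rp (of_real r * x) = r * rp x"
  by (simp add: rp_def to_complex_mult)

lemma rp_scaleR [simp]: "rp (r *\<^sub>R x) = r * rp x"
  by (simp add: scaleR_conv_of_real)

lemma rp_minus [simp]: "rp (- x) = - rp x"
  using rp_scaleR[of "-1" x] by simp

lemma rp_diff [simp]: "rp (x - y) = rp x - rp y"
  using rp_add[of x "- y"] by simp

lemma rp_sum: "rp (sum f A) = (\<Sum>x\<in>A. rp (f x))"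
  by (induction A rule: infinite_finite_induct) auto

lemma rp_le_norm: "rp x \<le> norm x" and abs_rp_le_norm: "\<bar>rp x\<bar> \<le> norm x"
  using complex_Re_le_cmod[of "to_complex x"] abs_Re_le_cmod[of "to_complex x"] by (simp_all add: rp_def)

lemma norm_minus_rp_sq: "(norm (x - of_real (rp x)))\<^sup>2 = (norm x)\<^sup>2 - (rp x)\<^sup>2"
proof -
  have "to_complex (x - of_real (rp x)) = to_complex x - of_real (rp x)"
    using to_complex_add[of "x - of_real (rp x)" "of_real (rp x)"] by simp
  then have "norm (x - of_real (rp x)) = norm (to_complex x - of_real (rp x))" by (metis norm_to_complex)
  moreover have "(norm x)\<^sup>2 = (Re (to_complex x))\<^sup>2 + (Im (to_complex x))\<^sup>2"
    by (metis cmod_power2 norm_to_complex)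
  ultimately show ?thesis by (simp add: cmod_power2 rp_def)
qed

lemma eq_norm_if_rp_ge:
  assumes "norm x \<le> rp x"
  shows "x = of_real (norm x)"
proof -
  have "rp x = norm x" using assms rp_le_norm[of x] by simp
  then show ?thesis using norm_minus_rp_sq[of x] by simp
qed

lemma ex_phase: "\<exists>c::'k::real_or_complex. norm c = 1 \<and> c * x = of_real (norm x)"
proof (cases "x = 0")
  case True then show ?thesis by (intro exI[of _ 1]) simp
next
  case False
  then have "norm (of_real (norm x) / x) = 1" "of_real (norm x) / x * x = of_real (norm x)"
    by (simp_all add: norm_divide)
  then show ?thesis by blast
qed

text \<open>Expand |x - 1|^2 = |x|^2 + 1 - 2 Re x. The square root lost here is one source of the
  powers in the later tolerances.\<close>

lemma norm_diff_one_le: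
  assumes "norm x \<le> 1" "rp x \<ge> 1 - \<delta>"
  shows "norm (x - 1) \<le> sqrt (2 * \<delta>)"
proof -
  have "rp (x - 1) = rp x - 1" by simp
  then have "(norm (x - 1))\<^sup>2 = (norm ((x - 1) - of_real (rp (x - 1))))\<^sup>2 + (rp x - 1)\<^sup>2"
    using norm_minus_rp_sq[of "x - 1"] by simp
  also have "(x - 1) - of_real (rp (x - 1)) = x - of_real (rp x)" by simp
  also have "(norm (x - of_real (rp x)))\<^sup>2 + (rp x - 1)\<^sup>2 = (norm x)\<^sup>2 + 1 - 2 * rp x"
    unfolding norm_minus_rp_sq by (simp add: power2_eq_square algebra_simps)
  also have "\<dots> \<le> 1 + 1 - 2 * rp x" using assms(1) by (simp add: power_le_one)
  finally have "(norm (x - 1))\<^sup>2 \<le> 2 * \<delta>" using assms(2) by simp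
  then show ?thesis by (rule real_le_rsqrt)
qed


subsection \<open>The Hahn-Banach theorem\<close>

definition sublinear :: "('z::real_vector \<Rightarrow> real) \<Rightarrow> bool" where
  "sublinear p \<longleftrightarrow> (\<forall>x y. p (x + y) \<le> p x + p y) \<and> (\<forall>r\<ge>0. \<forall>x. p (r *\<^sub>R x) = r * p x)"

lemma sublinearD:
  assumes "sublinear p"
  shows "p (x + y) \<le> p x + p y" "r \<ge> 0 \<Longrightarrow> p (r *\<^sub>R x) = r * p x" "p 0 = 0" "- p (- x) \<le> p x"
proof -
  show *: "p (x + y) \<le> p x + p y" for x y using assms by (simp add: sublinear_def)
  show **: "r \<ge> 0 \<Longrightarrow> p (r *\<^sub>R x) = r * p x" for r x using assms by (simp add: sublinear_def)
  show ***: "p 0 = 0" using **[of 0 0] by simp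
  show "- p (- x) \<le> p x" using *[of x "- x"] *** by simp
qed

text \<open>
  Subtracting the constraints \<open>f c \<ge> a\<close>, \<open>(c, a) \<in> D\<close>, from \<open>p\<close> leaves a sublinear functional.
\<close>

lemma sublinear_constrained:
  fixes p :: "'z::real_vector \<Rightarrow> real" and D :: "('z \<times> real) set"
  assumes p: "sublinear p"
    and D0: "0 \<in> D"
    and Dadd: "\<forall>d\<in>D. \<forall>d'\<in>D. d + d' \<in> D"
    and Dscale: "\<forall>d\<in>D. \<forall>r>0. r *\<^sub>R d \<in> D"
    and le: "\<forall>d\<in>D. snd d \<le> p (fst d)"
    and q_def: "\<forall>h. q h = (INF d\<in>D. p (h + fst d) - snd d)"
  shows "sublinear q" "q h \<le> p h" "(c, a) \<in> D \<Longrightarrow> q (- c) \<le> - a"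
proof -
  note q_def = q_def[rule_format]
  have lower: "- p (- h) \<le> p (h + c) - a" if "(c, a) \<in> D" for h c a
  proof -
    have "a \<le> p c" using le that by force
    also have "p c \<le> p (h + c) + p (- h)" using sublinearD(1)[OF p, of "h + c" "- h"] by simp
    finally show ?thesis by simp
  qed
  have bdd: "bdd_below ((\<lambda>d. p (h + fst d) - snd d) ` D)" for h
    using lower by (intro bdd_belowI2[of _ "- p (- h)"]) auto
  have ne: "D \<noteq> {}" using D0 by auto
  have upper: "q h \<le> p (h + c) - a" if "(c, a) \<in> D" for h c a
    unfolding q_def using cINF_lower[OF bdd that, of h] by simp
  have D0': "(0, 0) \<in> D" using D0 by (simp add: zero_prod_def)
  show "q h \<le> p h" for h using upper[OF D0', of h] by simp
  show "q (- c) \<le> - a" if "(c, a) \<in> D" for c a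
    using upper[OF that, of "- c"] sublinearD(3)[OF p] by simp
  have add: "q (x + y) \<le> q x + q y" for x y
  proof -
    have "q (x + y) - (p (x + c) - a) \<le> p (y + c') - a'" if "(c, a) \<in> D" "(c', a') \<in> D" for c a c' a'
    proof -
      have "(c + c', a + a') \<in> D" using Dadd that by force
      then have "q (x + y) \<le> p ((x + y) + (c + c')) - (a + a')" by (rule upper)
      also have "(x + y) + (c + c') = (x + c) + (y + c')" by simp
      also have "p ((x + c) + (y + c')) \<le> p (x + c) + p (y + c')" by (rule sublinearD(1)[OF p])
      finally show ?thesis by simp
    qed
    then have "q (x + y) - (p (x + c) - a) \<le> q y" if "(c, a) \<in> D" for c a
      unfolding q_def[of] using that by (intro cINF_greatest[OF ne]) (auto simp: q_def)
    then have "q (x + y) - q y \<le> p (x + c) - a" if "(c, a) \<in> D" for c a using that by force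
    then have "q (x + y) - q y \<le> q x"
      by (subst (3) q_def) (intro cINF_greatest[OF ne], auto)
    then show ?thesis by simp
  qed
  have le_scale: "q (r *\<^sub>R x) \<le> r * q x" if r: "r > 0" for r x
  proof -
    have "q (r *\<^sub>R x) / r \<le> p (x + c) - a" if "(c, a) \<in> D" for c a
    proof -
      have "(r *\<^sub>R c, r * a) \<in> D" using Dscale that r by force
      then have "q (r *\<^sub>R x) \<le> p (r *\<^sub>R x + r *\<^sub>R c) - r * a" by (rule upper)
      also have "p (r *\<^sub>R x + r *\<^sub>R c) = r * p (x + c)"
        using sublinearD(2)[OF p, of r "x + c"] r by (simp add: scaleR_add_right)
      finally show ?thesis using r by (simp add: field_simps)
    qed
    then have "q (r *\<^sub>R x) / r \<le> q x"
      by (subst (2) q_def) (intro cINF_greatest[OF ne], auto)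
    then show ?thesis using r by (simp add: field_simps)
  qed
  have zero: "q 0 = 0"
  proof (rule antisym)
    show "q 0 \<le> 0" using upper[OF D0', of 0] sublinearD(3)[OF p] by simp
    show "0 \<le> q 0" unfolding q_def using le by (intro cINF_greatest[OF ne]) auto
  qed
  have "q (r *\<^sub>R x) = r * q x" if "r \<ge> 0" for r x
  proof (cases "r = 0")
    case False
    then have r: "r > 0" using that by simp
    have "q (inverse r *\<^sub>R (r *\<^sub>R x)) \<le> inverse r * q (r *\<^sub>R x)" using r by (intro le_scale) simp
    then have "r * q x \<le> q (r *\<^sub>R x)" using r by (simp add: field_simps)
    with le_scale[OF r, of x] show ?thesis by simp
  qed (simp add: zero)
  with add show "sublinear q" by (simp add: sublinear_def)
qed

text \<open>Imposing the constraint f x \<ge> p x along the ray through \<open>x\<close> gives a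
  sublinear functional below \<open>p\<close>; by minimality it is \<open>p\<close> itself, so p(-x)
  \<le> -p x. A sublinear functional that is odd is linear.\<close>

lemma minimal_sublinear_linear:
  fixes p :: "'z::real_vector \<Rightarrow> real"
  assumes p: "sublinear p" and min: "\<And>q. sublinear q \<Longrightarrow> (\<And>x. q x \<le> p x) \<Longrightarrow> q = p"
  shows "linear p"
proof -
  have neg: "p (- x) = - p x" for x
  proof -
    define D where "D = (\<lambda>s. s *\<^sub>R (x, p x)) ` {0..}"
    define q where "q h = (INF d\<in>D. p (h + fst d) - snd d)" for h
    have "1 *\<^sub>R (x, p x) \<in> D" unfolding D_def by (intro imageI) simp
    then have xD: "(x, p x) \<in> D" by simp
    have "0 *\<^sub>R (x, p x) \<in> D" unfolding D_def by (intro imageI) simp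
    then have D0: "0 \<in> D" by (simp add: zero_prod_def)
    have Dadd: "\<forall>d\<in>D. \<forall>d'\<in>D. d + d' \<in> D"
      unfolding D_def by (auto simp del: scaleR_Pair simp flip: scaleR_add_left)
    have Dscale: "\<forall>d\<in>D. \<forall>r>0. r *\<^sub>R d \<in> D"
      unfolding D_def by (auto simp del: scaleR_Pair)
    have le: "\<forall>d\<in>D. snd d \<le> p (fst d)"
      unfolding D_def using sublinearD(2)[OF p] by auto
    have q_def': "\<forall>h. q h = (INF d\<in>D. p (h + fst d) - snd d)" by (simp add: q_def)
    note q = sublinear_constrained[OF p D0 Dadd Dscale le q_def']
    have "q = p" using min q(1,2) by blast
    then have "p (- x) \<le> - p x" using q(3)[OF xD] by simp
    with sublinearD(4)[OF p, of x] show ?thesis by simp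
  qed
  show ?thesis
  proof (rule linearI)
    fix x y
    have "p (- (x + y)) \<le> p (- x) + p (- y)" using sublinearD(1)[OF p, of "- x" "- y"] by simp
    then have "p x + p y \<le> p (x + y)" unfolding neg by simp
    with sublinearD(1)[OF p, of x y] show "p (x + y) = p x + p y" by simp
  next
    fix r x
    show "p (r *\<^sub>R x) = r *\<^sub>R p x"
    proof (cases "r \<ge> 0")
      case False
      then have "p ((- r) *\<^sub>R x) = (- r) * p x" by (intro sublinearD(2)[OF p]) simp
      then show ?thesis using neg[of "r *\<^sub>R x"] by simp
    qed (simp add: sublinearD(2)[OF p])
  qed
qed

text \<open>Zorn's lemma downwards: \<open>P\<close> is the reversed pointwise order, and a chain is
  bounded by its pointwise infimum, which is finite because every member dominates -p(-x).\<close>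

theorem Hahn_Banach_sublinear:
  fixes p :: "'z::real_vector \<Rightarrow> real"
  assumes p: "sublinear p"
  shows "\<exists>f. linear f \<and> (\<forall>x. f x \<le> p x)"
proof -
  define A where "A = {q. sublinear q \<and> (\<forall>x. q x \<le> p x)}"
  define P where "P = (\<lambda>q r :: 'z \<Rightarrow> real. \<forall>x. r x \<le> q x)"
  have po: "partial_order_on A (relation_of P A)"
    by (rule partial_order_on_relation_ofI) (auto simp: P_def fun_eq_iff intro: order_trans antisym)
  have "\<exists>u\<in>A. \<forall>a\<in>C. P a u" if C: "C \<in> Chains (relation_of P A)" for C
  proof (cases "C = {}")
    case True then show ?thesis using p by (auto simp: A_def)
  next
    case ne: False
    have CA: "C \<subseteq> A" and total: "\<forall>q\<in>C. \<forall>r\<in>C. P q r \<or> P r q"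
      using C unfolding Chains_def relation_of_def by blast+
    have sub: "sublinear q" and qp: "q x \<le> p x" if "q \<in> C" for q x using CA that by (auto simp: A_def)
    define u where "u x = (INF q\<in>C. q x)" for x
    have bdd: "bdd_below ((\<lambda>q. q x) ` C)" for x
    proof (rule bdd_belowI2[of _ "- p (- x)"])
      fix q assume "q \<in> C"
      then show "- p (- x) \<le> q x" using sublinearD(4)[OF sub, of q x] qp[of q "- x"] by simp
    qed
    have uq: "u x \<le> q x" if "q \<in> C" for q x unfolding u_def by (rule cINF_lower[OF bdd that])
    have "u (x + y) \<le> u x + u y" for x y
    proof -
      have *: "u (x + y) \<le> q x + r y" if qr: "q \<in> C" "r \<in> C" for q r
      proof -
        \<comment> \<open>Subadditivity of the infimum needs one member of the chain below both
          \<open>q\<close> and \<open>r\<close> at the relevant points.\<close>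
        obtain s where s: "s \<in> C" "s x \<le> q x" "s y \<le> r y"
          using total qr unfolding P_def by (metis order_refl)
        have "u (x + y) \<le> s x + s y" using uq[OF s(1)] sublinearD(1)[OF sub[OF s(1)]] order_trans by blast
        with s show ?thesis by simp
      qed
      have "u (x + y) - q x \<le> u y" if "q \<in> C" for q
        unfolding u_def[of y] using *[OF that] by (intro cINF_greatest[OF ne]) (simp add: algebra_simps)
      then have "u (x + y) - u y \<le> u x"
        unfolding u_def[of x] by (intro cINF_greatest[OF ne]) (simp add: algebra_simps)
      then show ?thesis by simp
    qed
    moreover have "u (r *\<^sub>R x) = r * u x" if "r \<ge> 0" for r x
    proof -
      have "u (r *\<^sub>R x) = (INF q\<in>C. r * q x)" unfolding u_def
        by (rule INF_cong) (use sublinearD(2)[OF sub] that in auto)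
      also have "\<dots> = r * u x"
      proof (cases "r = 0")
        case False
        then have r: "r > 0" using that by simp
        show ?thesis
        proof (rule antisym)
          have "(INF q\<in>C. r * q x) \<le> r * q x" if "q \<in> C" for q
            using bdd[of "r *\<^sub>R x"] sublinearD(2)[OF sub] r that
            by (intro cINF_lower) (auto simp: image_def cong: conj_cong)
          then have "(INF q\<in>C. r * q x) / r \<le> u x" unfolding u_def
            using r by (intro cINF_greatest[OF ne]) (simp add: field_simps)
          then show "(INF q\<in>C. r * q x) \<le> r * u x" using r by (simp add: field_simps)
          show "r * u x \<le> (INF q\<in>C. r * q x)" using r uq by (intro cINF_greatest[OF ne]) simp
        qed
      qed (use ne in simp)
      finally show ?thesis .
    qed
    ultimately have "sublinear u" by (simp add: sublinear_def)
    moreover have "u x \<le> p x" for x using ne uq qp order_trans by blast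
    ultimately show ?thesis using uq by (intro bexI[of _ u]) (auto simp: A_def P_def)
  qed
  then obtain m where m: "m \<in> A" "\<forall>a\<in>A. P m a \<longrightarrow> a = m"
    using predicate_Zorn[OF po] by blast
  have "q = m" if "sublinear q" "\<And>x. q x \<le> m x" for q
  proof -
    have "q \<in> A" using m(1) that order_trans unfolding A_def by blast
    then show ?thesis using m(2) that by (simp add: P_def)
  qed
  then have "linear m" using m(1) by (intro minimal_sublinear_linear) (auto simp: A_def)
  then show ?thesis using m(1) by (auto simp: A_def)
qed

corollary Hahn_Banach_constrained:
  fixes p :: "'z::real_vector \<Rightarrow> real" and D :: "('z \<times> real) set"
  assumes p: "sublinear p"
    and D0: "0 \<in> D"
    and Dadd: "\<forall>d\<in>D. \<forall>d'\<in>D. d + d' \<in> D"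
    and Dscale: "\<forall>d\<in>D. \<forall>r>0. r *\<^sub>R d \<in> D"
    and le: "\<forall>d\<in>D. snd d \<le> p (fst d)"
  obtains f where "linear f" "\<And>x. f x \<le> p x" "\<And>c a. (c, a) \<in> D \<Longrightarrow> a \<le> f c"
proof -
  define q where "q h = (INF d\<in>D. p (h + fst d) - snd d)" for h
  have q_def': "\<forall>h. q h = (INF d\<in>D. p (h + fst d) - snd d)" by (simp add: q_def)
  note q = sublinear_constrained[OF p D0 Dadd Dscale le q_def']
  obtain f where f: "linear f" "\<And>x. f x \<le> q x" using Hahn_Banach_sublinear[OF q(1)] by blast
  show ?thesis
  proof (rule that[OF f(1)])
    show "f x \<le> p x" for x using f(2)[of x] q(2)[of x] by simp
    show "a \<le> f c" if "(c, a) \<in> D" for c a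
      using f(2)[of "- c"] q(3)[OF that] linear_neg[OF f(1), of c] by simp
  qed
qed

subsection \<open>Functionals in the dual\<close>

context normed_space_over
begin

definition klinear :: "('z \<Rightarrow>\<^sub>L 'z) \<Rightarrow> bool" where
  "klinear T \<longleftrightarrow> (\<forall>c x. T \<cdot> (scale c x) = scale c (T \<cdot> x))"

lemma klinearD: "klinear T \<Longrightarrow> T \<cdot> (scale c x) = scale c (T \<cdot> x)"
  by (simp add: klinear_def)

lemma klinear_id [simp]: "klinear id_blinfun"
  by (simp add: klinear_def)

lemma klinear_comp: "klinear S \<Longrightarrow> klinear T \<Longrightarrow> klinear (S o\<^sub>L T)"
  by (simp add: klinear_def)

lemma dualD: "u \<in> dual \<Longrightarrow> u \<cdot> (scale c x) = c * u \<cdot> x"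
  by (simp add: dual_def)

lemma dual_add: "u \<in> dual \<Longrightarrow> v \<in> dual \<Longrightarrow> u + v \<in> dual"
  and dual_diff: "u \<in> dual \<Longrightarrow> v \<in> dual \<Longrightarrow> u - v \<in> dual"
  and dual_scaleR: "u \<in> dual \<Longrightarrow> r *\<^sub>R u \<in> dual"
  and dual_0: "0 \<in> dual"
  by (simp_all add: dual_def blinfun.add_left blinfun.diff_left blinfun.scaleR_left
      algebra_simps)

lemma dual_sum: "(\<And>i. i \<in> I \<Longrightarrow> u i \<in> dual) \<Longrightarrow> (\<Sum>i\<in>I. u i) \<in> dual"
  by (induction I rule: infinite_finite_induct) (auto intro: dual_0 dual_add)

lemma dual_comp: "u \<in> dual \<Longrightarrow> klinear T \<Longrightarrow> u o\<^sub>L T \<in> dual"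
  by (simp add: dual_def klinear_def)

lemma scaleR_scale: "scale (of_real r) x = r *\<^sub>R x"
  by (rule scale_of_real)

lemma scaleR_in_subspace: "subspace W \<Longrightarrow> x \<in> W \<Longrightarrow> r *\<^sub>R x \<in> W"
  using real_combination_in_subspace(3) by blast

lemma norm_blinfun_le: "norm u \<le> 1 \<Longrightarrow> norm (u \<cdot> x) \<le> norm x"
  using norm_blinfun[of u x] mult_right_mono[of "norm u" 1 "norm x"] by simp

text \<open>Multiplying the argument by a phase turns the modulus of the value into its real
  part.\<close>

lemma norm_dual_le:
  assumes u: "u \<in> dual" and le: "\<And>x. rp (u \<cdot> x) \<le> M * norm x" and M: "M \<ge> 0"
  shows "norm u \<le> M"
proof (rule norm_blinfun_bound[OF M])
  fix x
  obtain c where c: "norm c = 1" "c * u \<cdot> x = of_real (norm (u \<cdot> x))"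
    using ex_phase by blast
  then have "norm (u \<cdot> x) = rp (u \<cdot> (scale c x))"
    by (simp add: dualD[OF u])
  also have "\<dots> \<le> M * norm x" using le[of "scale c x"] c(1) by (simp add: norm_scale)
  finally show "norm (u \<cdot> x) \<le> M * norm x" .
qed

lemma ex_dual_with_rp:
  assumes f: "linear f" and le: "\<And>x. f x \<le> M * norm x" and M: "M \<ge> 0"
  obtains u where "u \<in> dual" "norm u \<le> M" "\<And>x. rp (u \<cdot> x) = f x"
proof -
  obtain \<iota> :: 'k where \<iota>: "\<iota> = 0 \<or> \<iota> * \<iota> = - 1" "rp \<iota> = 0"
    and rep: "\<And>c. \<exists>a b. c = of_real a + of_real b * \<iota>"
    using ex_imaginary_unit by blast
  \<comment> \<open>The linear functional over the scalar field with real part \<open>f\<close>; for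
    \<iota> = 0, the real case, the second term vanishes.\<close>
  define \<Phi> :: "'z \<Rightarrow> 'k" where "\<Phi> x = of_real (f x) - of_real (f (scale \<iota> x)) * \<iota>" for x
  have rp: "rp (\<Phi> x) = f x" for x by (simp add: \<Phi>_def \<iota>(2))
  have add: "\<Phi> (x + y) = \<Phi> x + \<Phi> y" for x y
    by (simp add: \<Phi>_def linear_add[OF f] scale_right_distrib algebra_simps)
  have hom: "\<Phi> (scale c x) = c * \<Phi> x" for c x
  proof -
    obtain a b where c: "c = of_real a + of_real b * \<iota>" using rep by blast
    have split: "scale c y = a *\<^sub>R y + b *\<^sub>R scale \<iota> y" for y
      unfolding c by (simp only: scale_left_distrib scaleR_scale flip: scale_scale)
    have fc: "f (scale c y) = a * f y + b * f (scale \<iota> y)" for y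
      by (simp add: split linear_add[OF f] linear_scale[OF f])
    have "f (scale \<iota> (scale c x)) = f (scale c (scale \<iota> x))" by (simp add: mult.commute)
    also have "\<dots> = a * f (scale \<iota> x) + b * f (scale (\<iota> * \<iota>) x)" by (subst fc) simp
    finally have fic: "f (scale \<iota> (scale c x)) = \<dots>" .
    show ?thesis using \<iota>(1)
    proof
      assume "\<iota> = 0"
      then show ?thesis by (simp add: \<Phi>_def fc c linear_0[OF f] scaleR_scale linear_scale[OF f])
    next
      assume ii: "\<iota> * \<iota> = - 1"
      have "f (scale (\<iota> * \<iota>) x) = - f x" by (simp add: ii linear_neg[OF f])
      then have "\<Phi> (scale c x) = of_real (a * f x + b * f (scale \<iota> x)) -
          of_real (a * f (scale \<iota> x) - b * f x) * \<iota>"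
        by (simp only: \<Phi>_def fc fic) simp
      also have "\<dots> = c * \<Phi> x + of_real (b * f (scale \<iota> x)) * (\<iota> * \<iota> + 1)"
        by (simp add: c \<Phi>_def algebra_simps)
      finally show ?thesis by (simp add: ii)
    qed
  qed
  have bound: "norm (\<Phi> x) \<le> M * norm x" for x
  proof -
    obtain c where c: "norm c = 1" "c * \<Phi> x = of_real (norm (\<Phi> x))" using ex_phase by blast
    then have "norm (\<Phi> x) = rp (\<Phi> (scale c x))" by (simp add: hom)
    also have "\<dots> \<le> M * norm x" using le[of "scale c x"] c(1) by (simp add: rp norm_scale)
    finally show ?thesis .
  qed
  have "bounded_linear \<Phi>"
  proof (rule bounded_linear_intro[OF add])
    show "\<Phi> (r *\<^sub>R x) = r *\<^sub>R \<Phi> x" for r x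
      using hom[of "of_real r" x] by (simp add: scaleR_scale scaleR_conv_of_real)
    show "norm (\<Phi> x) \<le> norm x * M" for x using bound[of x] by (simp add: mult.commute)
  qed
  then have app: "blinfun_apply (Blinfun \<Phi>) = \<Phi>" by (rule bounded_linear_Blinfun_apply)
  show ?thesis
  proof (rule that[of "Blinfun \<Phi>"])
    show "Blinfun \<Phi> \<in> dual" by (simp add: dual_def app hom)
    show "norm (Blinfun \<Phi>) \<le> M" by (rule norm_blinfun_bound[OF M]) (simp add: app bound)
  qed (simp add: app rp)
qed

lemma sublinear_norm: "M \<ge> 0 \<Longrightarrow> sublinear (\<lambda>x. M * norm x)"
  unfolding sublinear_def by (auto simp: distrib_left[symmetric] intro!: mult_left_mono norm_triangle_ineq)

lemma ex_dual_constrained: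
  assumes "M \<ge> 0" "0 \<in> D" "\<forall>d\<in>D. \<forall>d'\<in>D. d + d' \<in> D" "\<forall>d\<in>D. \<forall>r>0. r *\<^sub>R d \<in> D"
    "\<forall>d\<in>D. snd d \<le> M * norm (fst d)"
  obtains u where "u \<in> dual" "norm u \<le> M" "\<And>c a. (c, a) \<in> D \<Longrightarrow> a \<le> rp (u \<cdot> c)"
proof -
  obtain f where f: "linear f" "\<And>x. f x \<le> M * norm x" "\<And>c a. (c, a) \<in> D \<Longrightarrow> a \<le> f c"
    using Hahn_Banach_constrained[OF sublinear_norm[OF assms(1)] assms(2-)] by blast
  obtain u where "u \<in> dual" "norm u \<le> M" "\<And>x. rp (u \<cdot> x) = f x"
    using ex_dual_with_rp[OF f(1,2) assms(1)] by blast
  with f(3) show ?thesis by (intro that[of u]) auto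
qed

text \<open>Where the norm is additive, its graph over the cone is itself a cone of constraints
  compatible with the norm, so a single functional can attain the norm on all of
  \<open>K\<close>.\<close>

lemma ex_dual_norming_cone:
  assumes K: "0 \<in> K" "\<forall>x\<in>K. \<forall>r>0. r *\<^sub>R x \<in> K"
    and add: "\<forall>x\<in>K. \<forall>y\<in>K. x + y \<in> K \<and> norm (x + y) = norm x + norm y"
  obtains u where "u \<in> dual" "norm u \<le> 1" "\<And>x. x \<in> K \<Longrightarrow> u \<cdot> x = of_real (norm x)"
proof -
  define D where "D = (\<lambda>x. (x, norm x)) ` K"
  obtain u where u: "u \<in> dual" "norm u \<le> 1" "\<And>c a. (c, a) \<in> D \<Longrightarrow> a \<le> rp (u \<cdot> c)"
  proof (rule ex_dual_constrained[of 1 D])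
    show "0 \<in> D" using K(1) by (force simp: D_def zero_prod_def)
    show "\<forall>d\<in>D. \<forall>d'\<in>D. d + d' \<in> D" using add by (force simp: D_def)
    show "\<forall>d\<in>D. \<forall>r>0. r *\<^sub>R d \<in> D" using K(2) by (force simp: D_def)
  qed (auto simp: D_def)
  show ?thesis
  proof (rule that[OF u(1,2)])
    fix x assume "x \<in> K"
    then have "norm x \<le> rp (u \<cdot> x)" by (intro u(3)) (simp add: D_def)
    moreover have "norm (u \<cdot> x) \<le> norm x" by (rule norm_blinfun_le[OF u(2)])
    ultimately show "u \<cdot> x = of_real (norm x)"
      by (metis eq_norm_if_rp_ge order_antisym order_trans rp_le_norm)
  qed
qed

lemma ex_dual_norming:
  obtains u where "u \<in> dual" "norm u \<le> 1" "u \<cdot> x = of_real (norm x)"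
proof -
  define K where "K = (\<lambda>r. r *\<^sub>R x) ` {0..}"
  obtain u where "u \<in> dual" "norm u \<le> 1" "\<And>x. x \<in> K \<Longrightarrow> u \<cdot> x = of_real (norm x)"
  proof (rule ex_dual_norming_cone[of K])
    have "0 *\<^sub>R x \<in> K" unfolding K_def by (intro imageI) simp
    then show "0 \<in> K" by simp
    show "\<forall>x\<in>K. \<forall>r>0. r *\<^sub>R x \<in> K" by (auto simp: K_def)
    show "\<forall>x\<in>K. \<forall>y\<in>K. x + y \<in> K \<and> norm (x + y) = norm x + norm y"
      by (auto simp: K_def distrib_right simp flip: scaleR_add_left)
  qed blast
  moreover have "1 *\<^sub>R x \<in> K" unfolding K_def by (intro imageI) simp
  ultimately show ?thesis using that by simp
qed

end


subsection \<open>The theorem of Bishop and Phelps\<close>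

lemma Ekeland:
  fixes S :: "'z::real_normed_vector set" and f :: "'z \<Rightarrow> real"
  assumes S: "complete S" "S \<noteq> {}" and cont: "continuous_on S f" and bdd: "\<And>y. y \<in> S \<Longrightarrow> f y \<le> B"
    and \<epsilon>: "\<epsilon> > 0"
  obtains w where "w \<in> S" "\<And>y. y \<in> S \<Longrightarrow> f y \<le> f w + \<epsilon> * norm (y - w)"
proof -
  \<comment> \<open>The points that beat \<open>w\<close> at rate \<epsilon>. The relation is
    transitive, so these sets decrease along a sequence with \<open>w (Suc n)\<close> in
    \<open>U (w n)\<close>.\<close>
  define U where "U w = {y \<in> S. f w + \<epsilon> * norm (y - w) \<le> f y}" for w
  have self: "w \<in> U w" if "w \<in> S" for w using that by (simp add: U_def)
  have trans: "y \<in> U w" if "y \<in> U w'" "w' \<in> U w" for y w w'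
  proof -
    have "\<epsilon> * norm (y - w) \<le> \<epsilon> * (norm (y - w') + norm (w' - w))"
      using \<epsilon> norm_triangle_ineq[of "y - w'" "w' - w"] by (intro mult_left_mono) auto
    with that show ?thesis by (auto simp: U_def distrib_left)
  qed
  \<comment> \<open>Near maximization over \<open>U w\<close> with geometric slack: a point common
    to all the sets cannot exceed the limit value.\<close>
  have step: "\<exists>w'. w' \<in> U w \<and> (\<forall>y\<in>U w. f y \<le> f w' + (1/2) ^ n)" if "w \<in> S" for w n
  proof -
    have ne: "f ` U w \<noteq> {}" and bd: "bdd_above (f ` U w)"
      using self[OF that] bdd by (auto simp: U_def intro!: bdd_aboveI2)
    have "Sup (f ` U w) - (1/2) ^ n < Sup (f ` U w)" by simp
    then obtain w' where w': "w' \<in> U w" "Sup (f ` U w) - (1/2) ^ n < f w'"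
      using less_cSup_iff[OF ne bd] by blast
    have "f y \<le> f w' + (1/2) ^ n" if "y \<in> U w" for y
      using cSUP_upper[OF that bd] w'(2) by linarith
    with w'(1) show ?thesis by blast
  qed
  obtain w0 where w0: "w0 \<in> S" using S(2) by blast
  obtain w where w: "\<And>n. w n \<in> S" "\<And>n. w (Suc n) \<in> U (w n)"
    "\<And>n y. y \<in> U (w n) \<Longrightarrow> f y \<le> f (w (Suc n)) + (1/2) ^ n"
  proof -
    have "\<exists>w. \<forall>n. w n \<in> S \<and>
      w (Suc n) \<in> U (w n) \<and> (\<forall>y\<in>U (w n). f y \<le> f (w (Suc n)) + (1/2) ^ n)"
    proof (rule dependent_nat_choice)
      show "\<exists>x. x \<in> S" using w0 by blast
      show "\<exists>y. y \<in> S \<and> y \<in> U x \<and> (\<forall>z\<in>U x. f z \<le> f y + (1/2) ^ n)" if "x \<in> S" for x n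
        using step[OF that, of n] by (auto simp: U_def)
    qed
    then show thesis using that by blast
  qed
  have mem: "w m \<in> U (w n)" if "n \<le> m" for n m
    using that
  proof (induction m rule: dec_induct)
    case base then show ?case using self w(1) by blast
  next
    case (step m) then show ?case using trans[OF w(2)] by blast
  qed
  have inc: "f (w n) + \<epsilon> * norm (w m - w n) \<le> f (w m)" if "n \<le> m" for n m
    using mem[OF that] by (simp add: U_def)
  have "incseq (\<lambda>n. f (w n))"
  proof (rule incseq_SucI)
    fix n
    have "0 \<le> \<epsilon> * norm (w (Suc n) - w n)" using \<epsilon> by simp
    then show "f (w n) \<le> f (w (Suc n))" using inc[of n "Suc n"] by simp
  qed
  moreover have "bdd_above (range (\<lambda>n. f (w n)))" using bdd w(1) by (intro bdd_aboveI2) auto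
  ultimately have "convergent (\<lambda>n. f (w n))" by (metis LIMSEQ_incseq_SUP convergentI)
  then have Cf: "Cauchy (\<lambda>n. f (w n))" by (rule convergent_Cauchy)
  have "Cauchy w"
  proof (rule metric_CauchyI)
    fix e :: real assume e: "e > 0"
    then obtain M where M: "\<And>m n. m \<ge> M \<Longrightarrow> n \<ge> M \<Longrightarrow> dist (f (w m)) (f (w n)) < \<epsilon> * e"
      using metric_CauchyD[OF Cf, of "\<epsilon> * e"] \<epsilon> by (metis mult_pos_pos)
    have *: "dist (w m) (w n) < e" if "n \<ge> M" "m \<ge> n" for m n
    proof -
      have "\<epsilon> * norm (w m - w n) < \<epsilon> * e" using inc[OF that(2)] M[of m n] that by (simp add: dist_norm)
      then show ?thesis using \<epsilon> by (simp add: dist_norm)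
    qed
    show "\<exists>M. \<forall>m\<ge>M. \<forall>n\<ge>M. dist (w m) (w n) < e"
    proof (intro exI[of _ M] allI impI)
      fix m n assume "m \<ge> M" "n \<ge> M"
      then show "dist (w m) (w n) < e" using *[of n m] *[of m n] by (cases "n \<le> m") (auto simp: dist_commute)
    qed
  qed
  then obtain v where v: "v \<in> S" "w \<longlonglongrightarrow> v" using S(1) w(1) unfolding complete_def by blast
  have fv: "(\<lambda>n. f (w n)) \<longlonglongrightarrow> f v"
    using cont v w(1) unfolding continuous_on_sequentially by (auto simp: comp_def)
  have vU: "v \<in> U (w n)" for n
  proof -
    have "(\<lambda>m. f (w n) + \<epsilon> * norm (w m - w n)) \<longlonglongrightarrow> f (w n) + \<epsilon> * norm (v - w n)"
      by (intro tendsto_intros v(2))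
    then have "f (w n) + \<epsilon> * norm (v - w n) \<le> f v"
      by (rule LIMSEQ_le[OF _ fv]) (use inc in blast)
    then show ?thesis using v(1) by (simp add: U_def)
  qed
  show thesis
  proof (rule that[OF v(1)])
    fix y assume y: "y \<in> S"
    show "f y \<le> f v + \<epsilon> * norm (y - v)"
    proof (rule ccontr)
      assume neg: "\<not> ?thesis"
      then have "y \<in> U v" using y by (simp add: U_def)
      then have "y \<in> U (w n)" for n using trans vU by blast
      then have le: "f y \<le> f (w (Suc n)) + (1/2) ^ n" for n using w(3) by blast
      have "(\<lambda>n. f (w (Suc n)) + (1/2) ^ n) \<longlonglongrightarrow> f v + 0"
        by (intro tendsto_add LIMSEQ_Suc[OF fv] LIMSEQ_power_zero) simp
      then have "f y \<le> f v + 0" by (rule LIMSEQ_le_const) (use le in blast)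
      moreover have "0 \<le> \<epsilon> * norm (y - v)" using \<epsilon> by simp
      ultimately show False using neg by linarith
    qed
  qed
qed

context normed_space_over
begin

text \<open>The perturbed functional must again factor through the projection \<open>T\<close>, so
  Ekeland's principle is applied in the ball of its range. From the point \<open>w\<close> found
  there \<open>h\<close> grows in no direction faster than \<epsilon>; Hahn--Banach gives \<psi> of
  norm at most \<epsilon> dominating this growth, and h - \<psi> is maximal at
  \<open>w\<close>.\<close>

lemma Bishop_Phelps:
  assumes compl: "complete (UNIV :: 'z set)"
    and W: "subspace W" "closed W"
    and T: "klinear T" "\<And>x. T \<cdot> x \<in> W" "\<And>x. x \<in> W \<Longrightarrow> T \<cdot> x = x"
      "\<And>x. norm (T \<cdot> x) \<le> norm x"
    and h: "h \<in> dual" and \<epsilon>: "\<epsilon> > 0" "\<epsilon> < norm (h o\<^sub>L T)"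
  obtains g w where "g \<in> dual" "w \<in> W" "norm w \<le> 1" "g o\<^sub>L T = g" "norm (g - (h o\<^sub>L T)) \<le> \<epsilon>"
    "norm g > 0" "g \<cdot> w = of_real (norm g)"
proof -
  define C where "C = W \<inter> cball 0 1"
  define f where "f x = rp (h \<cdot> x)" for x
  have lin: "f (x + y) = f x + f y" "f (r *\<^sub>R x) = r * f x" "f (x - y) = f x - f y" for x y r
    by (simp_all add: f_def blinfun.add_right blinfun.scaleR_right blinfun.diff_right)
  have f_le: "\<bar>f x\<bar> \<le> norm h * norm x" for x
    using abs_rp_le_norm[of "h \<cdot> x"] norm_blinfun[of h x] by (simp add: f_def)
  have "bounded_linear f" by (rule bounded_linear_intro[of _ "norm h"]) (use lin f_le in \<open>auto simp: mult.commute\<close>)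
  then have cont: "continuous_on C f" by (rule linear_continuous_on)
  have "closed C" unfolding C_def by (intro closed_Int W(2) closed_cball)
  then have "complete C" using complete_closed_subset[of C UNIV] compl by simp
  moreover have "0 \<in> C" using subspace_0[OF W(1)] by (simp add: C_def)
  moreover have "f y \<le> norm h" if "y \<in> C" for y
    using f_le[of y] that mult_left_mono[of "norm y" 1 "norm h"] by (simp add: C_def)
  ultimately obtain w where w: "w \<in> C" and wmax: "\<And>y. y \<in> C \<Longrightarrow> f y \<le> f w + \<epsilon> * norm (y - w)"
    using Ekeland[OF _ _ cont _ \<epsilon>(1)] by blast
  \<comment> \<open>The cone over all increments from \<open>w\<close>: a functional obeying these
    constraints grows at least as fast as \<open>f\<close> in each direction into
    \<open>C\<close>.\<close>
  define D where "D = {(s *\<^sub>R (y - w), s * (f y - f w)) | s y. s \<ge> 0 \<and> y \<in> C}"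
  have conv: "(s *\<^sub>R y + s' *\<^sub>R y') /\<^sub>R (s + s') \<in> C"
    if "y \<in> C" "y' \<in> C" "s \<ge> 0" "s' \<ge> 0" "s + s' > 0" for y y' s s'
  proof -
    have "norm (s *\<^sub>R y + s' *\<^sub>R y') \<le> s * norm y + s' * norm y'"
      using norm_triangle_ineq[of "s *\<^sub>R y" "s' *\<^sub>R y'"] that by simp
    also have "\<dots> \<le> s * 1 + s' * 1" using that by (intro add_mono mult_left_mono) (auto simp: C_def)
    finally have "norm ((s *\<^sub>R y + s' *\<^sub>R y') /\<^sub>R (s + s')) \<le> 1"
      using that by (simp only: norm_scaleR) (simp add: divide_simps)
    moreover have "(s *\<^sub>R y + s' *\<^sub>R y') /\<^sub>R (s + s') \<in> W"
      using that W(1) by (intro scaleR_in_subspace real_combination_in_subspace(1)) (auto simp: C_def)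
    ultimately show ?thesis by (simp add: C_def)
  qed
  obtain \<psi> where \<psi>: "\<psi> \<in> dual" "norm \<psi> \<le> \<epsilon>" "\<And>c a. (c, a) \<in> D \<Longrightarrow> a \<le> rp (\<psi> \<cdot> c)"
  proof (rule ex_dual_constrained[of \<epsilon> D])
    show "0 \<in> D" unfolding D_def zero_prod_def using w by (intro CollectI exI[of _ 0] exI[of _ w]) simp
    show "\<forall>d\<in>D. \<forall>r>0. r *\<^sub>R d \<in> D"
    proof (intro ballI allI impI)
      fix d r assume "d \<in> D" "(r::real) > 0"
      then obtain s y where "d = (s *\<^sub>R (y - w), s * (f y - f w))" "s \<ge> 0" "y \<in> C" by (auto simp: D_def)
      with \<open>r > 0\<close> show "r *\<^sub>R d \<in> D" unfolding D_def
        by (intro CollectI exI[of _ "r * s"] exI[of _ y]) (simp add: algebra_simps)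
    qed
    show "\<forall>d\<in>D. snd d \<le> \<epsilon> * norm (fst d)"
    proof
      fix d assume "d \<in> D"
      then obtain s y where "d = (s *\<^sub>R (y - w), s * (f y - f w))" "s \<ge> 0" "y \<in> C" by (auto simp: D_def)
      moreover have "s * (f y - f w) \<le> s * (\<epsilon> * norm (y - w))"
        using wmax[OF \<open>y \<in> C\<close>] \<open>s \<ge> 0\<close> by (intro mult_left_mono) auto
      ultimately show "snd d \<le> \<epsilon> * norm (fst d)" by (simp add: mult.left_commute)
    qed
    show "\<forall>d\<in>D. \<forall>d'\<in>D. d + d' \<in> D"
    proof (intro ballI)
      fix d d' assume "d \<in> D" "d' \<in> D"
      then obtain s y s' y' where d: "d = (s *\<^sub>R (y - w), s * (f y - f w))" "s \<ge> 0" "y \<in> C"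
        and d': "d' = (s' *\<^sub>R (y' - w), s' * (f y' - f w))" "s' \<ge> 0" "y' \<in> C" by (auto simp: D_def)
      show "d + d' \<in> D"
      proof (cases "s + s' = 0")
        case True
        then have "s = 0" "s' = 0" using d(2) d'(2) by linarith+
        with d d' have "d + d' = d" by simp
        with \<open>d \<in> D\<close> show ?thesis by simp
      next
        case False
        then have pos: "s + s' > 0" using d(2) d'(2) by linarith
        define y'' where "y'' = (s *\<^sub>R y + s' *\<^sub>R y') /\<^sub>R (s + s')"
        have eq: "(s + s') *\<^sub>R y'' = s *\<^sub>R y + s' *\<^sub>R y'" using pos by (simp add: y''_def)
        have feq: "(s + s') * f y'' = s * f y + s' * f y'"
          using arg_cong[OF eq, of f] by (simp only: lin)
        have "d + d' = ((s + s') *\<^sub>R (y'' - w), (s + s') * (f y'' - f w))"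
          unfolding d(1) d'(1) scaleR_diff_right right_diff_distrib eq feq by (simp add: algebra_simps)
        moreover have "y'' \<in> C" unfolding y''_def by (rule conv) (use d d' pos in auto)
        ultimately show ?thesis using d(2) d'(2) unfolding D_def by fastforce
      qed
    qed
    show "0 \<le> \<epsilon>" using \<epsilon>(1) by simp
  qed blast
  define g where "g = (h - \<psi>) o\<^sub>L T"
  have g: "g \<in> dual" unfolding g_def by (intro dual_comp dual_diff h \<psi>(1) T(1))
  have wW: "w \<in> W" "norm w \<le> 1" using w by (auto simp: C_def)
  \<comment> \<open>\<open>T\<close> maps the ball into \<open>C\<close>, so maximality over
    \<open>C\<close> becomes maximality over the whole ball.\<close>
  have le_w: "rp (g \<cdot> y) \<le> rp (g \<cdot> w)" if "norm y \<le> 1" for y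
  proof -
    have "T \<cdot> y \<in> C" using T(2,4)[of y] that by (simp add: C_def)
    then have "(1 *\<^sub>R (T \<cdot> y - w), 1 * (f (T \<cdot> y) - f w)) \<in> D"
      unfolding D_def by fastforce
    then have "f (T \<cdot> y) - f w \<le> rp (\<psi> \<cdot> (T \<cdot> y - w))"
      using \<psi>(3) by simp
    then show ?thesis using T(3)[OF wW(1)]
      by (simp add: g_def f_def blinfun.diff_left blinfun.diff_right)
  qed
  have nonneg: "0 \<le> rp (g \<cdot> w)" using le_w[of 0] by simp
  have "norm g \<le> rp (g \<cdot> w)"
  proof (rule norm_dual_le[OF g _ nonneg])
    fix x
    show "rp (g \<cdot> x) \<le> rp (g \<cdot> w) * norm x"
    proof (cases "x = 0")
      case False
      then have "rp (g \<cdot> (x /\<^sub>R norm x)) \<le> rp (g \<cdot> w)" by (intro le_w) simp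
      then show ?thesis using False by (simp add: blinfun.scaleR_right field_simps)
    qed simp
  qed
  moreover have "norm (g \<cdot> w) \<le> norm g"
    using norm_blinfun[of g w] wW(2) mult_left_mono[of "norm w" 1 "norm g"] by simp
  ultimately have gw: "g \<cdot> w = of_real (norm g)"
    by (metis eq_norm_if_rp_ge order_antisym order_trans rp_le_norm)
  have "g - (h o\<^sub>L T) = - (\<psi> o\<^sub>L T)"
    by (rule blinfun_eqI) (simp add: g_def blinfun.diff_left blinfun.minus_left)
  moreover have "norm (\<psi> o\<^sub>L T) \<le> \<epsilon>"
  proof (rule norm_blinfun_bound)
    show "0 \<le> \<epsilon>" using \<epsilon>(1) by simp
    fix x
    have "norm ((\<psi> o\<^sub>L T) \<cdot> x) \<le> norm \<psi> * norm (T \<cdot> x)"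
      using norm_blinfun[of \<psi> "T \<cdot> x"] by simp
    also have "\<dots> \<le> \<epsilon> * norm x" using \<psi>(2) T(4)[of x] \<epsilon>(1) by (intro mult_mono) auto
    finally show "norm ((\<psi> o\<^sub>L T) \<cdot> x) \<le> \<epsilon> * norm x" .
  qed
  ultimately have near: "norm (g - (h o\<^sub>L T)) \<le> \<epsilon>" by simp
  have "norm (h o\<^sub>L T) \<le> norm g + norm (g - (h o\<^sub>L T))"
    using norm_triangle_ineq4[of g "g - (h o\<^sub>L T)"] by simp
  then have "norm g > 0" using near \<epsilon>(2) by linarith
  moreover have "g o\<^sub>L T = g"
    by (rule blinfun_eqI) (simp add: g_def T(2,3))
  ultimately show thesis using that g wW near gw by blast
qed

end

subsection \<open>Peirce projections of neutral strongly facially symmetric spaces\<close>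

lemma rp_numeral [simp]: "rp (numeral n) = numeral n"
  by (metis rp_of_real of_real_numeral)

lemma diamond_commute: "x \<diamondsuit> y \<longleftrightarrow> y \<diamondsuit> x"
  by (simp add: diamond_def add.commute norm_minus_commute)

lemma diamondI: "norm x + norm y \<le> norm (x + y) \<Longrightarrow> norm x + norm y \<le> norm (x - y) \<Longrightarrow> x \<diamondsuit> y"
  using norm_triangle_ineq[of x y] norm_triangle_ineq4[of x y] by (simp add: diamond_def)

text \<open>For r \<le> s write s(x + y) = (r x + s y) + (s - r) x; the triangle inequality leaves
  no room.\<close>

lemma norm_add_scaled:
  fixes x y :: "'z::real_normed_vector"
  assumes add: "norm (x + y) = norm x + norm y" and "r \<ge> 0" "s \<ge> 0"
  shows "norm (r *\<^sub>R x + s *\<^sub>R y) = r * norm x + s * norm y"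
proof -
  have *: "r * norm x + s * norm y \<le> norm (r *\<^sub>R x + s *\<^sub>R y)"
    if "norm (x + y) = norm x + norm y" "0 \<le> r" "r \<le> s" for x y :: 'z and r s
  proof -
    have "s *\<^sub>R (x + y) = (r *\<^sub>R x + s *\<^sub>R y) + (s - r) *\<^sub>R x" by (simp add: algebra_simps)
    then have "norm (s *\<^sub>R (x + y)) \<le> norm (r *\<^sub>R x + s *\<^sub>R y) + norm ((s - r) *\<^sub>R x)"
      using norm_triangle_ineq by metis
    then have "s * (norm x + norm y) \<le> norm (r *\<^sub>R x + s *\<^sub>R y) + (s - r) * norm x"
      using that by simp
    then show ?thesis by (simp add: algebra_simps)
  qed
  have "r * norm x + s * norm y \<le> norm (r *\<^sub>R x + s *\<^sub>R y)"
    using *[of x y r s] *[of y x s r] assms by (cases "r \<le> s") (auto simp: add.commute)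
  moreover have "norm (r *\<^sub>R x + s *\<^sub>R y) \<le> r * norm x + s * norm y"
    using norm_triangle_ineq[of "r *\<^sub>R x" "s *\<^sub>R y"] assms by simp
  ultimately show ?thesis by simp
qed

lemma diamond_norm_add: "x \<diamondsuit> y \<Longrightarrow> norm (x + y) = norm x + norm y"
  by (simp add: diamond_def)

lemma diamond_scaleR: "x \<diamondsuit> y \<Longrightarrow> (r *\<^sub>R x) \<diamondsuit> (r *\<^sub>R y)"
  by (simp add: diamond_def flip: scaleR_add_right scaleR_diff_right distrib_left)

lemma diamond_self: "x \<diamondsuit> x \<Longrightarrow> x = 0"
  by (simp add: diamond_def)

lemma closed_diamond_compl: "closed (diamond_compl S)"
proof -
  have "diamond_compl S = (\<Inter>y\<in>S. {x. norm (x + y) = norm (x - y)} \<inter> {x. norm (x - y) = norm x + norm y})"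
    by (auto simp: diamond_compl_def diamond_def)
  then show ?thesis
    by (auto intro!: closed_INT closed_Int closed_Collect_eq continuous_intros)
qed

lemma mem_face: "x \<in> face u \<longleftrightarrow> norm x \<le> 1 \<and> u \<cdot> x = 1"
  by (simp add: face_def)

lemma norm_eq_1_if_face:
  assumes "norm u \<le> 1" "x \<in> face u"
  shows "norm x = 1" "norm u = 1"
proof -
  have "1 \<le> norm u * norm x" using norm_blinfun[of u x] assms(2) by (simp add: mem_face)
  moreover have "norm u * norm x \<le> norm x" "norm u * norm x \<le> norm u"
    using assms mult_right_mono[of "norm u" 1 "norm x"] mult_left_mono[of "norm x" 1 "norm u"]
    by (auto simp: mem_face)
  ultimately show "norm x = 1" "norm u = 1" using assms by (auto simp: mem_face)
qed

lemma face_convex: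
  assumes "x \<in> face u" "y \<in> face u" "s \<ge> 0" "t \<ge> 0" "s + t > 0"
  shows "(s *\<^sub>R x + t *\<^sub>R y) /\<^sub>R (s + t) \<in> face u"
proof -
  have "norm (s *\<^sub>R x + t *\<^sub>R y) \<le> s * norm x + t * norm y"
    using norm_triangle_ineq[of "s *\<^sub>R x" "t *\<^sub>R y"] assms by simp
  also have "\<dots> \<le> s * 1 + t * 1" using assms by (intro add_mono mult_left_mono) (auto simp: mem_face)
  finally have "norm ((s *\<^sub>R x + t *\<^sub>R y) /\<^sub>R (s + t)) \<le> 1"
    using assms by (simp only: norm_scaleR) (simp add: divide_simps)
  moreover have "u \<cdot> ((s *\<^sub>R x + t *\<^sub>R y) /\<^sub>R (s + t)) = (1 / (s + t)) *\<^sub>R (s *\<^sub>R 1 + t *\<^sub>R 1)"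
    using assms by (simp add: mem_face blinfun.scaleR_right blinfun.add_right inverse_eq_divide)
  moreover have "s *\<^sub>R (1::'b) + t *\<^sub>R 1 = (s + t) *\<^sub>R 1" by (simp add: scaleR_add_left)
  ultimately show ?thesis using assms(5) by (simp add: mem_face)
qed

text \<open>Completeness enters three times: in Ekeland's principle, in the compactness argument for
  the approximating extreme points, and in the summation of absolutely summable families.\<close>

locale neutral_sfs = normed_space_over scale
  for scale :: "'k::real_or_complex \<Rightarrow> 'z::real_normed_vector \<Rightarrow> 'z" +
  assumes complete_space: "complete (UNIV :: 'z set)"
    and sfs: SFS
    and neutral_space: neutral
begin

lemma exposedI:
  assumes "u \<in> dual" "norm u \<le> 1" "x \<in> face u"
  shows "norm_exposed_face (face u)"
  using assms norm_eq_1_if_face(2)[OF assms(2,3)] by (auto simp: norm_exposed_face_def)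

lemma exposedE:
  assumes "norm_exposed_face F"
  obtains u where "u \<in> dual" "norm u = 1" "F = face u"
  using assms by (auto simp: norm_exposed_face_def)

lemma norm_exposed: "norm_exposed_face F \<Longrightarrow> x \<in> F \<Longrightarrow> norm x = 1"
  using norm_eq_1_if_face(1)[of _ x] by (metis exposedE order_refl)

lemma symmetric_if_exposed: "norm_exposed_face F \<Longrightarrow> symmetric_face F"
  using sfs by (simp add: SFS_def WFS_def)

text \<open>The linear isometries for which conjugation needs no inverse; the symmetries of exposed
  faces are of this kind.\<close>

definition isoinv :: "('z \<Rightarrow>\<^sub>L 'z) \<Rightarrow> bool" where
  "isoinv \<phi> \<longleftrightarrow> klinear \<phi> \<and> (\<forall>x. norm (\<phi> \<cdot> x) = norm x) \<and>
     (\<forall>x. \<phi> \<cdot> (\<phi> \<cdot> x) = x)"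

lemma isoinvD:
  assumes "isoinv \<phi>"
  shows "klinear \<phi>" "norm (\<phi> \<cdot> x) = norm x" "\<phi> \<cdot> (\<phi> \<cdot> x) = x"
  using assms by (simp_all add: isoinv_def)

lemma closed_span_minimal:
  assumes "F \<subseteq> W" "subspace W" "closed W"
  shows "closed_span F \<subseteq> W"
  unfolding closed_span_def using assms by (intro closure_minimal span_minimal)

context
  fixes F assumes F: "norm_exposed_face F"
begin

lemma is_symmetry: "is_symmetry F (symmetry F)"
  using symmetric_if_exposed[OF F] by (rule is_symmetry_symmetry)

lemma isoinv_symmetry: "isoinv (symmetry F)"
  using is_symmetry is_symmetry_involution[OF is_symmetry]
  by (simp add: isoinv_def klinear_def is_symmetry_def)

lemmas klinear_symmetry = isoinvD(1)[OF isoinv_symmetry]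
  and norm_symmetry [simp] = isoinvD(2)[OF isoinv_symmetry]
  and symmetry_symmetry [simp] = isoinvD(3)[OF isoinv_symmetry]

lemma
  shows subspace_closed_span: "subspace (closed_span F)"
    and subspace_diamond_compl: "subspace (diamond_compl F)"
    and closed_span_Int_diamond_compl: "closed_span F \<inter> diamond_compl F = {0}"
    and fixed_points: "{x. symmetry F \<cdot> x = x} = {a + b | a b. a \<in> closed_span F \<and> b \<in> diamond_compl F}"
  using is_symmetry unfolding is_symmetry_def topological_direct_sum_def by simp_all

lemma closed_closed_span: "closed (closed_span F)"
  by (simp add: closed_span_def)

lemma face_subset_closed_span: "F \<subseteq> closed_span F"
  unfolding closed_span_def using span_superset closure_subset by blast

lemma symmetry_fix: "x \<in> closed_span F \<or> x \<in> diamond_compl F \<Longrightarrow> symmetry F \<cdot> x = x"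
proof -
  assume *: "x \<in> closed_span F \<or> x \<in> diamond_compl F"
  have "0 \<in> closed_span F" "0 \<in> diamond_compl F"
    using subspace_0 subspace_closed_span subspace_diamond_compl by blast+
  then have "x \<in> {a + b | a b. a \<in> closed_span F \<and> b \<in> diamond_compl F}"
    using * by (metis (mono_tags, lifting) add.left_neutral add.right_neutral mem_Collect_eq)
  then show ?thesis unfolding fixed_points[symmetric] by simp
qed

lemma peirce_mem: "peirce2 F \<cdot> x \<in> closed_span F" "peirce0 F \<cdot> x \<in> diamond_compl F"
proof -
  have "\<forall>x. peirce2 F \<cdot> x \<in> closed_span F \<and>
     (1/2) *\<^sub>R (x + symmetry F \<cdot> x) - peirce2 F \<cdot> x \<in> diamond_compl F"
    unfolding peirce2_def by (rule theI'[OF peirce2_unique[OF symmetric_if_exposed[OF F]]])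
  then show "peirce2 F \<cdot> x \<in> closed_span F" "peirce0 F \<cdot> x \<in> diamond_compl F"
    by (auto simp: peirce0_def blinfun.diff_left blinfun.scaleR_left blinfun.add_left)
qed

lemma half_sum_symmetry:
  "(1/2) *\<^sub>R (x + symmetry F \<cdot> x) = peirce2 F \<cdot> x + peirce0 F \<cdot> x"
  by (simp add: peirce0_def blinfun.diff_left blinfun.scaleR_left blinfun.add_left)

lemma peirce_unique:
  assumes a: "a \<in> closed_span F" and b: "b \<in> diamond_compl F"
    and eq: "(1/2) *\<^sub>R (x + symmetry F \<cdot> x) = a + b"
  shows "peirce2 F \<cdot> x = a" "peirce0 F \<cdot> x = b"
proof -
  have sum: "peirce2 F \<cdot> x + peirce0 F \<cdot> x = a + b"
    using eq half_sum_symmetry[of x] by simp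
  then have "peirce2 F \<cdot> x - a = b - peirce0 F \<cdot> x"
    by (simp add: algebra_simps)
  moreover have "peirce2 F \<cdot> x - a \<in> closed_span F"
    using real_combination_in_subspace(2)[OF subspace_closed_span peirce_mem(1) a] .
  moreover have "b - peirce0 F \<cdot> x \<in> diamond_compl F"
    using real_combination_in_subspace(2)[OF subspace_diamond_compl b peirce_mem(2)] .
  ultimately have "peirce2 F \<cdot> x - a \<in> closed_span F \<inter> diamond_compl F" by auto
  then show "peirce2 F \<cdot> x = a" unfolding closed_span_Int_diamond_compl by simp
  with sum show "peirce0 F \<cdot> x = b" by simp
qed

lemma peirce_closed_span: "x \<in> closed_span F \<Longrightarrow> peirce2 F \<cdot> x = x"
    "x \<in> closed_span F \<Longrightarrow> peirce0 F \<cdot> x = 0"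
  using peirce_unique[of x 0 x] subspace_0[OF subspace_diamond_compl] symmetry_fix[of x]
  by (simp_all flip: scaleR_2)

lemma peirce_diamond_compl: "x \<in> diamond_compl F \<Longrightarrow> peirce2 F \<cdot> x = 0"
    "x \<in> diamond_compl F \<Longrightarrow> peirce0 F \<cdot> x = x"
  using peirce_unique[of 0 x x] subspace_0[OF subspace_closed_span] symmetry_fix[of x]
  by (simp_all flip: scaleR_2)

text \<open>Conjugating the symmetry of \<open>F\<close> by \<phi> gives a symmetry of
  \<open>F\<close> again, since \<phi> preserves both summands of the fixed point space. Symmetries
  of a face are unique, so the two maps commute, and the projection follows.\<close>

lemma peirce_commute:
  assumes \<phi>: "isoinv \<phi>" and inv: "\<And>y. y \<in> F \<Longrightarrow> \<phi> \<cdot> y \<in> F"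
  shows "\<phi> \<cdot> (symmetry F \<cdot> x) = symmetry F \<cdot> (\<phi> \<cdot> x)"
    and "\<phi> \<cdot> (peirce2 F \<cdot> x) = peirce2 F \<cdot> (\<phi> \<cdot> x)"
proof -
  note [simp] = isoinvD[OF \<phi>] klinearD[OF isoinvD(1)[OF \<phi>]]
  have \<phi>A: "\<phi> \<cdot> a \<in> closed_span F" if "a \<in> closed_span F" for a
  proof -
    have "closed_span F \<subseteq> {a. \<phi> \<cdot> a \<in> closed_span F}"
    proof (rule closed_span_minimal)
      show "F \<subseteq> {a. \<phi> \<cdot> a \<in> closed_span F}"
        using inv face_subset_closed_span by blast
      show "subspace {a. \<phi> \<cdot> a \<in> closed_span F}"
        using subspace_closed_span by (auto simp: subspace_def blinfun.zero_right blinfun.add_right)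
      show "closed {a. \<phi> \<cdot> a \<in> closed_span F}"
        using closed_vimage[OF closed_closed_span, of "blinfun_apply \<phi>"]
        by (simp add: vimage_def continuous_intros)
    qed
    with that show ?thesis by blast
  qed
  have \<phi>B: "\<phi> \<cdot> b \<in> diamond_compl F" if "b \<in> diamond_compl F" for b
  proof -
    have "\<phi> \<cdot> b \<diamondsuit> y" if y: "y \<in> F" for y
    proof -
      have *: "b \<diamondsuit> \<phi> \<cdot> y" using \<open>b \<in> diamond_compl F\<close> inv[OF y] by (simp add: diamond_compl_def)
      have "norm (\<phi> \<cdot> b + y) = norm (b + \<phi> \<cdot> y)"
        using isoinvD(2)[OF \<phi>, of "b + \<phi> \<cdot> y"] by (simp add: blinfun.add_right)
      moreover have "norm (\<phi> \<cdot> b - y) = norm (b - \<phi> \<cdot> y)"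
        using isoinvD(2)[OF \<phi>, of "b - \<phi> \<cdot> y"] by (simp add: blinfun.diff_right)
      ultimately show ?thesis using * by (simp add: diamond_def)
    qed
    then show ?thesis by (simp add: diamond_compl_def)
  qed
  define S where "S = \<phi> o\<^sub>L symmetry F o\<^sub>L \<phi>"
  have fixd: "symmetry F \<cdot> (\<phi> \<cdot> x) = \<phi> \<cdot> x"
    if "symmetry F \<cdot> x = x" for x
  proof -
    obtain a b where "x = a + b" "a \<in> closed_span F" "b \<in> diamond_compl F"
    proof -
      have "x \<in> {a + b | a b. a \<in> closed_span F \<and> b \<in> diamond_compl F}"
        using \<open>symmetry F \<cdot> x = x\<close> unfolding fixed_points[symmetric] by simp
      then show thesis using that by blast
    qed
    then show ?thesis using symmetry_fix[of "\<phi> \<cdot> a"] symmetry_fix[of "\<phi> \<cdot> b"] \<phi>A \<phi>B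
      by (simp add: blinfun.add_right)
  qed
  have "(S \<cdot> x = x) = (symmetry F \<cdot> x = x)" for x
  proof
    assume "symmetry F \<cdot> x = x"
    then show "S \<cdot> x = x" using fixd[of x] by (simp add: S_def)
  next
    assume "S \<cdot> x = x"
    then have "\<phi> \<cdot> (S \<cdot> x) = \<phi> \<cdot> x" by simp
    then have "symmetry F \<cdot> (\<phi> \<cdot> x) = \<phi> \<cdot> x" by (simp add: S_def)
    from fixd[OF this] show "symmetry F \<cdot> x = x" by simp
  qed
  moreover have "S o\<^sub>L S = id_blinfun" by (rule blinfun_eqI) (simp add: S_def)
  ultimately have "is_symmetry F S"
    using is_symmetry klinear_symmetry unfolding is_symmetry_def by (simp add: S_def klinear_def)
  then have "S = symmetry F" using is_symmetry is_symmetry_unique by blast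
  then have "\<phi> \<cdot> (S \<cdot> x) = \<phi> \<cdot> (symmetry F \<cdot> x)" for x by simp
  then show sym: "\<phi> \<cdot> (symmetry F \<cdot> x) = symmetry F \<cdot> (\<phi> \<cdot> x)" for x
    by (simp add: S_def)
  have "(1/2) *\<^sub>R (\<phi> \<cdot> x + symmetry F \<cdot> (\<phi> \<cdot> x)) =
      \<phi> \<cdot> (peirce2 F \<cdot> x) + \<phi> \<cdot> (peirce0 F \<cdot> x)"
    unfolding sym[symmetric] blinfun.add_right[symmetric] half_sum_symmetry[symmetric]
    by (simp add: blinfun.add_right blinfun.scaleR_right)
  note * = peirce_unique[OF \<phi>A[OF peirce_mem(1)] \<phi>B[OF peirce_mem(2)] this]
  from *(1)[symmetric] show "\<phi> \<cdot> (peirce2 F \<cdot> x) = peirce2 F \<cdot> (\<phi> \<cdot> x)" .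
qed

lemma klinear_peirce: "klinear (peirce2 F)" "klinear (peirce0 F)"
proof -
  have "(1/2) *\<^sub>R (scale c x + symmetry F \<cdot> (scale c x)) =
      scale c (peirce2 F \<cdot> x) + scale c (peirce0 F \<cdot> x)" for c x
  proof -
    have "(1/2) *\<^sub>R (scale c x + symmetry F \<cdot> (scale c x)) =
        scale c ((1/2) *\<^sub>R (x + symmetry F \<cdot> x))"
      by (simp only: klinearD[OF klinear_symmetry] scale_right_distrib[symmetric] scaleR_scale[symmetric]
          scale_scale mult.commute)
    then show ?thesis unfolding half_sum_symmetry by (simp add: scale_right_distrib)
  qed
  note * = peirce_unique[OF subspace_scale[OF subspace_closed_span peirce_mem(1)]
      subspace_scale[OF subspace_diamond_compl peirce_mem(2)] this]
  then show "klinear (peirce2 F)" "klinear (peirce0 F)" by (simp_all add: klinear_def)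
qed

lemma norm_peirce2_le: "norm (peirce2 F \<cdot> x) \<le> norm x"
  and peirce2_neutral: "norm (peirce2 F \<cdot> x) = norm x \<Longrightarrow> peirce2 F \<cdot> x = x"
  using neutral_space symmetric_if_exposed[OF F] norm_blinfun_le[of "peirce2 F" x]
  unfolding neutral_def neutral_projection_def by auto

text \<open>On the cone generated by \<open>F\<close> and a vector \<open>c\<close> orthogonal to it
  the norm is additive: by convexity of \<open>F\<close> each element is a multiple of one point of
  \<open>F\<close> plus a multiple of \<open>c\<close>.\<close>

lemma ex_norming_face_and_compl:
  assumes c: "c \<in> diamond_compl F" "norm c = 1"
  obtains u where "u \<in> dual" "norm u \<le> 1" "u \<cdot> c = 1" "\<And>y. y \<in> F \<Longrightarrow> u \<cdot> y = 1"
proof -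
  obtain u0 :: "'z \<Rightarrow>\<^sub>L 'k" where F_u0: "F = face u0" using exposedE[OF F] by metis
  obtain y0 where y0: "y0 \<in> F" using F by (auto simp: norm_exposed_face_def)
  define K where "K = {s *\<^sub>R y + r *\<^sub>R c | s r y. s \<ge> 0 \<and> r \<ge> 0 \<and> y \<in> F}"
  have norm_K: "norm (s *\<^sub>R y + r *\<^sub>R c) = s + r" if "s \<ge> 0" "r \<ge> 0" "y \<in> F" for s r y
  proof -
    have "c \<diamondsuit> y" using c that by (simp add: diamond_compl_def)
    then have "norm (y + c) = norm y + norm c" using diamond_norm_add diamond_commute by blast
    from norm_add_scaled[OF this that(1,2)] show ?thesis using c norm_exposed[OF F that(3)] by simp
  qed
  obtain u where u: "u \<in> dual" "norm u \<le> 1" "\<And>x. x \<in> K \<Longrightarrow> u \<cdot> x = of_real (norm x)"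
  proof (rule ex_dual_norming_cone[of K])
    show "0 \<in> K" unfolding K_def using y0 by (intro CollectI exI[of _ 0] exI[of _ y0]) simp
    show "\<forall>x\<in>K. \<forall>r>0. r *\<^sub>R x \<in> K"
    proof (intro ballI allI impI)
      fix x t assume "x \<in> K" "(t::real) > 0"
      then obtain s r y where "x = s *\<^sub>R y + r *\<^sub>R c" "s \<ge> 0" "r \<ge> 0" "y \<in> F" by (auto simp: K_def)
      with \<open>t > 0\<close> show "t *\<^sub>R x \<in> K" unfolding K_def
        by (intro CollectI exI[of _ "t * s"] exI[of _ "t * r"] exI[of _ y]) (simp add: scaleR_add_right)
    qed
    show "\<forall>x\<in>K. \<forall>y\<in>K. x + y \<in> K \<and> norm (x + y) = norm x + norm y"
    proof (intro ballI)
      fix x x' assume "x \<in> K" "x' \<in> K"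
      then obtain s r y s' r' y' where x: "x = s *\<^sub>R y + r *\<^sub>R c" "s \<ge> 0" "r \<ge> 0" "y \<in> F"
        and x': "x' = s' *\<^sub>R y' + r' *\<^sub>R c" "s' \<ge> 0" "r' \<ge> 0" "y' \<in> F" by (auto simp: K_def)
      obtain y'' where y'': "y'' \<in> F" "(s + s') *\<^sub>R y'' = s *\<^sub>R y + s' *\<^sub>R y'"
      proof (cases "s + s' = 0")
        case True
        then have "s = 0" "s' = 0" using x x' by linarith+
        then show ?thesis using that[OF y0] by simp
      next
        case False
        then have "s + s' > 0" using x x' by linarith
        then show ?thesis using that[of "(s *\<^sub>R y + s' *\<^sub>R y') /\<^sub>R (s + s')"]
            face_convex[of y u0 y' s s'] x x' F_u0 by simp
      qed
      have sum: "x + x' = (s + s') *\<^sub>R y'' + (r + r') *\<^sub>R c"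
        unfolding y''(2) x(1) x'(1) by (simp add: algebra_simps)
      have "x + x' \<in> K" unfolding sum K_def using x x' y''(1)
        by (intro CollectI exI[of _ "s + s'"] exI[of _ "r + r'"] exI[of _ y'']) simp
      moreover have "norm (x + x') = norm x + norm x'"
        unfolding sum using norm_K x x' y''(1) by simp
      ultimately show "x + x' \<in> K \<and> norm (x + x') = norm x + norm x'" by blast
    qed
  qed blast
  have "c \<in> K" unfolding K_def using y0 by (intro CollectI exI[of _ 0] exI[of _ 1] exI[of _ y0]) simp
  moreover have "y \<in> K" if "y \<in> F" for y
    unfolding K_def using that by (intro CollectI exI[of _ 1] exI[of _ 0] exI[of _ y]) simp
  ultimately show ?thesis using that[OF u(1,2)] u(3) c(2) norm_exposed[OF F] by simp
qed

text \<open>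
  Half the difference of functionals that are \<open>1\<close> on \<open>F\<close> and norm \<open>b\<close> and \<open>- b\<close> respectively
  exposes a face that contains \<open>b / norm b\<close> and is orthogonal to all of \<open>F\<close>.
\<close>

lemma closed_span_diamond:
  assumes h: "h \<in> closed_span F" and b: "b \<in> diamond_compl F"
  shows "h \<diamondsuit> b"
proof (cases "b = 0")
  case True then show ?thesis by (simp add: diamond_def)
next
  case False
  define c where "c = b /\<^sub>R norm b"
  have c: "c \<in> diamond_compl F" "norm c = 1"
    using False b scaleR_in_subspace[OF subspace_diamond_compl] by (simp_all add: c_def)
  then have c': "- c \<in> diamond_compl F" "norm (- c) = 1"
    using subspace_neg[OF subspace_diamond_compl] by simp_all
  obtain p where p: "p \<in> dual" "norm p \<le> 1" "p \<cdot> c = 1" "\<And>y. y \<in> F \<Longrightarrow> p \<cdot> y = 1"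
    using ex_norming_face_and_compl[OF c] by blast
  obtain m where m: "m \<in> dual" "norm m \<le> 1" "m \<cdot> (- c) = 1" "\<And>y. y \<in> F \<Longrightarrow> m \<cdot> y = 1"
    using ex_norming_face_and_compl[OF c'] by blast
  define \<psi> where "\<psi> = (1/2) *\<^sub>R (p - m)"
  have \<psi>: "\<psi> \<in> dual" unfolding \<psi>_def by (intro dual_scaleR dual_diff p m)
  have "norm \<psi> \<le> 1" using norm_triangle_ineq4[of p m] p(2) m(2) by (simp add: \<psi>_def)
  moreover have "c \<in> face \<psi>"
  proof -
    have "m \<cdot> c = - 1" using m(3) by (simp add: blinfun.minus_right minus_equation_iff)
    then have "\<psi> \<cdot> c = (1/2) *\<^sub>R (1 + 1)"
      using p(3) by (simp only: \<psi>_def blinfun.scaleR_left blinfun.diff_left) simp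
    also have "\<dots> = 1" by (simp only: scaleR_2[symmetric]) simp
    finally show ?thesis using c(2) by (simp add: mem_face)
  qed
  ultimately have G: "norm_exposed_face (face \<psi>)" using exposedI[OF \<psi>] by blast
  have "F \<subseteq> diamond_compl (face \<psi>)"
  proof
    fix y assume y: "y \<in> F"
    have "y \<diamondsuit> g" if g: "g \<in> face \<psi>" for g
    proof -
      have ng: "norm g = 1" using norm_exposed[OF G g] .
      have half: "p \<cdot> g - m \<cdot> g = 2"
      proof -
        have "(1/2::real) *\<^sub>R (p \<cdot> g - m \<cdot> g) = 1"
          using g by (simp add: \<psi>_def mem_face blinfun.scaleR_left blinfun.diff_left)
        then have "2 *\<^sub>R ((1/2::real) *\<^sub>R (p \<cdot> g - m \<cdot> g)) = 2 *\<^sub>R 1" by simp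
        then show ?thesis by (simp add: scaleR_2)
      qed
      have r: "rp (p \<cdot> g) - rp (m \<cdot> g) = 2"
        using arg_cong[OF half, of rp] by simp
      moreover have "rp (p \<cdot> g) \<le> 1" "- rp (m \<cdot> g) \<le> 1"
        using abs_rp_le_norm[of "p \<cdot> g"] norm_blinfun_le[OF p(2), of g]
          abs_rp_le_norm[of "m \<cdot> g"] norm_blinfun_le[OF m(2), of g] ng by linarith+
      ultimately have pg: "rp (p \<cdot> g) = 1" "rp (m \<cdot> g) = - 1" by linarith+
      have ny: "norm y = 1" using norm_exposed[OF F y] .
      have "2 = rp (p \<cdot> (y + g))" using p(4)[OF y] pg by (simp add: blinfun.add_right)
      also have "\<dots> \<le> norm (y + g)" using rp_le_norm norm_blinfun_le[OF p(2)] order_trans by blast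
      finally have 1: "2 \<le> norm (y + g)" .
      have "2 = rp (m \<cdot> (y - g))" using m(4)[OF y] pg by (simp add: blinfun.diff_right)
      also have "\<dots> \<le> norm (y - g)" using rp_le_norm norm_blinfun_le[OF m(2)] order_trans by blast
      finally show ?thesis using 1 ny ng by (intro diamondI) auto
    qed
    then show "y \<in> diamond_compl (face \<psi>)" by (simp add: diamond_compl_def)
  qed
  \<comment> \<open>In general the vectors orthogonal to a set do not form a subspace. The symmetry
    of the face of \<psi> makes them one, and this carries orthogonality to \<open>c\<close> from
    \<open>F\<close> to its closed span.\<close>
  moreover have "subspace (diamond_compl (face \<psi>))"
    using symmetric_if_exposed[OF G] is_symmetry_symmetry unfolding is_symmetry_def topological_direct_sum_def by blast
  ultimately have "closed_span F \<subseteq> diamond_compl (face \<psi>)"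
    using closed_span_minimal closed_diamond_compl by blast
  moreover have "h /\<^sub>R norm b \<in> closed_span F" using h scaleR_in_subspace[OF subspace_closed_span] by blast
  ultimately have "h /\<^sub>R norm b \<diamondsuit> c" using \<open>c \<in> face \<psi>\<close> unfolding diamond_compl_def by blast
  from diamond_scaleR[OF this, of "norm b"] show ?thesis using False by (simp add: c_def)
qed

text \<open>The average of \<open>x\<close> and its reflection has at most the norm of
  \<open>x\<close>, and its two parts are orthogonal.\<close>

lemma norm_peirce_add: "norm (peirce2 F \<cdot> x) + norm (peirce0 F \<cdot> x) \<le> norm x"
proof -
  have "norm (peirce2 F \<cdot> x) + norm (peirce0 F \<cdot> x) =
      norm (peirce2 F \<cdot> x + peirce0 F \<cdot> x)"
    using diamond_norm_add[OF closed_span_diamond[OF peirce_mem]] by simp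
  also have "\<dots> = norm ((1/2) *\<^sub>R (x + symmetry F \<cdot> x))" unfolding half_sum_symmetry by simp
  also have "\<dots> \<le> norm x" using norm_triangle_ineq[of x "symmetry F \<cdot> x"] by simp
  finally show ?thesis .
qed

lemma norm_peirce0_le: "norm (peirce0 F \<cdot> x) \<le> norm x"
  using norm_peirce_add[of x] by (smt (verit) norm_ge_zero)

text \<open>Neutrality is postulated for \<open>peirce2\<close> only. If \<open>peirce0 F\<close>
  preserves the norm of \<open>x\<close>, then \<open>peirce2 F\<close> kills \<open>x\<close>. The
  functionals u P2 + f P0 and u P2 - f P0, bounded by the norm because of
  \<open>norm_peirce_add\<close>, show that norms add up in y + x and y - x for every
  \<open>y\<close> in \<open>F\<close>. Hence \<open>x\<close> already lies in the
  complement.\<close>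

lemma peirce0_neutral:
  assumes eq: "norm (peirce0 F \<cdot> x) = norm x"
  shows "peirce0 F \<cdot> x = x"
proof -
  have P2x: "peirce2 F \<cdot> x = 0" using norm_peirce_add[of x] eq by simp
  obtain u where u: "u \<in> dual" "norm u = 1" "F = face u" using F by (rule exposedE)
  obtain f where f: "f \<in> dual" "norm f \<le> 1" "f \<cdot> (peirce0 F \<cdot> x) = of_real (norm (peirce0 F \<cdot> x))"
    by (rule ex_dual_norming)
  have le: "rp (u \<cdot> (peirce2 F \<cdot> h)) + rp (f \<cdot> (peirce0 F \<cdot> h)) \<le> norm h"
    "rp (u \<cdot> (peirce2 F \<cdot> h)) - rp (f \<cdot> (peirce0 F \<cdot> h)) \<le> norm h" for h
    using norm_peirce_add[of h] abs_rp_le_norm[of "u \<cdot> (peirce2 F \<cdot> h)"]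
      norm_blinfun_le[of u "peirce2 F \<cdot> h"] u(2)
      abs_rp_le_norm[of "f \<cdot> (peirce0 F \<cdot> h)"]
      norm_blinfun_le[OF f(2), of "peirce0 F \<cdot> h"] by linarith+
  have "x \<diamondsuit> y" if y: "y \<in> F" for y
  proof -
    have y': "y \<in> closed_span F" using y face_subset_closed_span by blast
    have "norm y + norm x \<le> norm (y + x)" "norm y + norm x \<le> norm (y - x)"
      using le(1)[of "y + x"] le(2)[of "y - x"] norm_exposed[OF F y] y P2x f(3) eq u(3)
      by (simp_all add: blinfun.add_right blinfun.diff_right blinfun.minus_right peirce_closed_span[OF y', unfolded u(3)] mem_face)
    then show ?thesis using diamondI diamond_commute by blast
  qed
  then have "x \<in> diamond_compl F" by (simp add: diamond_compl_def)
  then show ?thesis by (rule peirce_diamond_compl)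
qed

lemma symmetry_invariant:
  assumes g: "g \<in> dual" "norm g \<le> 1" "F \<subseteq> face g"
  shows "g \<cdot> (symmetry F \<cdot> x) = g \<cdot> x"
    and "g \<cdot> (peirce2 F \<cdot> x) + g \<cdot> (peirce0 F \<cdot> x) = g \<cdot> x"
proof -
  obtain y where "y \<in> F" using F by (auto simp: norm_exposed_face_def)
  then have "norm g = 1" using norm_eq_1_if_face(2) g by blast
  then have "g o\<^sub>L symmetry F = g" using sfs F g by (simp add: SFS_def)
  then show *: "g \<cdot> (symmetry F \<cdot> x) = g \<cdot> x"
    by (metis blinfun_apply_blinfun_compose)
  have "g \<cdot> (peirce2 F \<cdot> x) + g \<cdot> (peirce0 F \<cdot> x) =
      g \<cdot> ((1/2) *\<^sub>R (x + symmetry F \<cdot> x))"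
    unfolding half_sum_symmetry by (simp add: blinfun.add_right)
  also have "\<dots> = (1/2::real) *\<^sub>R (g \<cdot> x + g \<cdot> x)"
    by (simp add: blinfun.scaleR_right blinfun.add_right *)
  finally show "g \<cdot> (peirce2 F \<cdot> x) + g \<cdot> (peirce0 F \<cdot> x) = g \<cdot> x"
    by (simp flip: scaleR_2)
qed

lemma dual_eq_on_closed_span:
  assumes "u \<in> dual" "v \<in> dual" "\<And>y. y \<in> F \<Longrightarrow> u \<cdot> y = v \<cdot> y" "x \<in> closed_span F"
  shows "u \<cdot> x = v \<cdot> x"
proof -
  have "closed_span F \<subseteq> {x. u \<cdot> x = v \<cdot> x}"
  proof (rule closed_span_minimal)
    show "subspace {x. u \<cdot> x = v \<cdot> x}"
      using dualD[OF assms(1)] dualD[OF assms(2)] by (auto simp: subspace_def blinfun.zero_right blinfun.add_right)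
    show "closed {x. u \<cdot> x = v \<cdot> x}"
      by (intro closed_Collect_eq continuous_intros)
  qed (use assms(3) in blast)
  with assms(4) show ?thesis by blast
qed

end

subsection \<open>Geometric tripotents\<close>

lemma exposed_face_tripotent: "geometric_tripotent w \<Longrightarrow> norm_exposed_face (face w)"
  by (simp add: geometric_tripotent_def symmetric_face_def)

lemma tripotentD:
  assumes "geometric_tripotent w"
  shows "w \<in> dual" "norm w = 1" "w \<cdot> (peirce2 (face w) \<cdot> x) = w \<cdot> x"
proof -
  show w: "w \<in> dual" "norm w = 1" using assms by (auto simp: geometric_tripotent_def projective_unit_def)
  note F = exposed_face_tripotent[OF assms]
  have "w \<cdot> (peirce0 (face w) \<cdot> x) = 0"
    using assms peirce_mem(2)[OF F] by (simp add: geometric_tripotent_def projective_unit_def)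
  then show "w \<cdot> (peirce2 (face w) \<cdot> x) = w \<cdot> x"
    using symmetry_invariant(2)[OF F w(1), of x] w(2) by simp
qed

lemma tripotentI:
  assumes w: "w \<in> dual" "norm w \<le> 1" "norm_exposed_face (face w)"
    and inv: "\<And>x. w \<cdot> (peirce2 (face w) \<cdot> x) = w \<cdot> x"
  shows "geometric_tripotent w"
proof -
  have "face w \<noteq> {}" using w(3) by (simp add: norm_exposed_face_def)
  then have "norm w = 1" using norm_eq_1_if_face(2)[OF w(2)] by blast
  moreover have "w \<cdot> y = 0" if "y \<in> diamond_compl (face w)" for y
    using inv[of y] peirce_diamond_compl(1)[OF w(3) that] by simp
  moreover have "w o\<^sub>L symmetry (face w) = w"
    by (rule blinfun_eqI) (simp add: symmetry_invariant(1)[OF w(3) w(1,2)])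
  ultimately show ?thesis using w(1) symmetric_if_exposed[OF w(3)]
    by (simp add: geometric_tripotent_def projective_unit_def)
qed

text \<open>Composition with \<open>peirce2 F\<close> makes an exposing functional vanish on the
  complement; by neutrality it takes the value one at no new point of the ball.\<close>

lemma ex_tripotent:
  assumes F: "norm_exposed_face F"
  obtains w where "geometric_tripotent w" "face w = F"
proof -
  obtain u where u: "u \<in> dual" "norm u = 1" "F = face u" using F by (rule exposedE)
  define w where "w = u o\<^sub>L peirce2 F"
  have w: "w \<in> dual" unfolding w_def by (intro dual_comp u klinear_peirce F)
  have le: "norm (w \<cdot> x) \<le> norm (peirce2 F \<cdot> x)" for x
    using norm_blinfun_le[of u] u(2) by (simp add: w_def)
  have nw: "norm w \<le> 1"
    by (rule norm_blinfun_bound) (use le norm_peirce2_le[OF F] in \<open>auto intro: order_trans\<close>)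
  have fw: "face w = F"
  proof (rule Set.set_eqI)
    fix x
    show "x \<in> face w \<longleftrightarrow> x \<in> F"
    proof
      assume x: "x \<in> face w"
      then have "norm (peirce2 F \<cdot> x) = norm x"
        using le[of x] norm_peirce2_le[OF F, of x] by (simp add: mem_face)
      then have "peirce2 F \<cdot> x = x" by (rule peirce2_neutral[OF F])
      with x show "x \<in> F" using u(3) by (simp add: mem_face w_def)
    next
      assume x: "x \<in> F"
      then have "peirce2 F \<cdot> x = x"
        using peirce_closed_span(1)[OF F] face_subset_closed_span[OF F] by blast
      with x show "x \<in> face w" using u(3) by (simp add: mem_face w_def)
    qed
  qed
  have "w \<cdot> (peirce2 (face w) \<cdot> x) = w \<cdot> x" for x
    using peirce_closed_span(1)[OF F peirce_mem(1)[OF F]] by (simp add: fw) (simp add: w_def)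
  then have "geometric_tripotent w" using w nw fw F by (intro tripotentI) auto
  with fw show ?thesis using that by blast
qed

text \<open>A tripotent factors through \<open>peirce2\<close> of its face, whose range lies in the
  closed span of the face.\<close>

lemma tripotent_unique:
  assumes "geometric_tripotent w" "geometric_tripotent w'" "face w = face w'"
  shows "w = w'"
proof (rule blinfun_eqI)
  fix x
  note F = exposed_face_tripotent[OF assms(1)]
  have "w \<cdot> (peirce2 (face w) \<cdot> x) = w' \<cdot> (peirce2 (face w) \<cdot> x)"
    by (rule dual_eq_on_closed_span[OF F tripotentD(1)[OF assms(1)] tripotentD(1)[OF assms(2)] _ peirce_mem(1)[OF F]])
      (use assms(3) in \<open>auto simp: mem_face\<close>)
  then show "w \<cdot> x = w' \<cdot> x"
    using tripotentD(3)[OF assms(1)] tripotentD(3)[OF assms(2)] assms(3) by simp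
qed

end

subsection \<open>Extreme points of the unit ball\<close>

locale atomic_sfs = neutral_sfs scale
  for scale :: "'k::real_or_complex \<Rightarrow> 'z::real_normed_vector \<Rightarrow> 'z" +
  assumes atomic_space: atomic
    and point_exposed_space: point_exposed
begin

abbreviation ext :: "'z \<Rightarrow> bool" where
  "ext z \<equiv> z extreme_point_of cball 0 1"

abbreviation sym_at :: "'z \<Rightarrow> 'z \<Rightarrow>\<^sub>L 'z" where
  "sym_at z \<equiv> symmetry {z}"

abbreviation perp :: "'z \<Rightarrow> 'z \<Rightarrow>\<^sub>L 'z" where
  "perp z \<equiv> peirce0 {z}"

definition tri :: "'z \<Rightarrow> 'z \<Rightarrow>\<^sub>L 'k" where
  "tri z = (SOME w. geometric_tripotent w \<and> face w = {z})"

lemma exposed_contains_ext: "norm_exposed_face F \<Longrightarrow> \<exists>z\<in>F. ext z"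
  using atomic_space symmetric_if_exposed by (simp add: atomic_def)

context
  fixes z assumes z: "ext z"
begin

lemma exposed_ext: "norm_exposed_face {z}"
  using point_exposed_space z by (simp add: point_exposed_def)

lemma norm_ext [simp]: "norm z = 1"
  using norm_exposed[OF exposed_ext] by simp

lemma tripotent_tri: "geometric_tripotent (tri z)" and face_tri: "face (tri z) = {z}"
proof -
  obtain w where "geometric_tripotent w \<and> face w = {z}" using ex_tripotent[OF exposed_ext] by metis
  then have "geometric_tripotent (tri z) \<and> face (tri z) = {z}" unfolding tri_def by (rule someI)
  then show "geometric_tripotent (tri z)" "face (tri z) = {z}" by simp_all
qed

lemma tri_dual: "tri z \<in> dual" and norm_tri [simp]: "norm (tri z) = 1"
  using tripotentD[OF tripotent_tri] by simp_all

lemma norm_tri_le: "norm (tri z \<cdot> x) \<le> norm x"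
  by (rule norm_blinfun_le) simp

lemma tri_self [simp]: "tri z \<cdot> z = 1"
  using face_tri by (auto simp: set_eq_iff mem_face)

lemma closed_span_ext:
  assumes "x \<in> closed_span {z}"
  shows "scale (tri z \<cdot> x) z = x"
proof -
  have bl: "bounded_linear (\<lambda>x. scale (tri z \<cdot> x) z)"
  proof (rule bounded_linear_intro[of _ 1])
    show "scale (tri z \<cdot> (r *\<^sub>R x)) z = r *\<^sub>R scale (tri z \<cdot> x) z" for r x
      by (simp only: blinfun.scaleR_right scaleR_conv_of_real scale_scale[symmetric] scaleR_scale)
  qed (simp_all add: blinfun.add_right scale_left_distrib norm_scale norm_tri_le)
  have "closed_span {z} \<subseteq> {x. scale (tri z \<cdot> x) z = x}"
  proof (rule closed_span_minimal)
    show "subspace {x. scale (tri z \<cdot> x) z = x}"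
      unfolding subspace_def
      by (auto simp: blinfun.zero_right blinfun.add_right scale_left_distrib dualD[OF tri_dual] simp flip: scale_scale)
    show "closed {x. scale (tri z \<cdot> x) z = x}"
      by (intro closed_Collect_eq linear_continuous_on[OF bl] continuous_intros)
  qed simp
  with assms show ?thesis by blast
qed

lemma peirce2_ext: "peirce2 {z} \<cdot> x = scale (tri z \<cdot> x) z"
  using closed_span_ext[OF peirce_mem(1)[OF exposed_ext, of x]] tripotentD(3)[OF tripotent_tri, of x]
  by (simp add: face_tri)

lemma half_sum_sym_at: "(1/2) *\<^sub>R (x + sym_at z \<cdot> x) = scale (tri z \<cdot> x) z + perp z \<cdot> x"
  using half_sum_symmetry[OF exposed_ext, of x] by (simp add: peirce2_ext)

lemma sym_at_apply: "sym_at z \<cdot> x = 2 *\<^sub>R (scale (tri z \<cdot> x) z + perp z \<cdot> x) - x"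
  unfolding half_sum_sym_at[symmetric] by (simp add: scaleR_add_right)

lemma norm_tri_perp: "norm (tri z \<cdot> x) + norm (perp z \<cdot> x) \<le> norm x"
  using norm_peirce_add[OF exposed_ext, of x] by (simp add: peirce2_ext norm_scale)

lemma norm_perp_le: "norm (perp z \<cdot> x) \<le> norm x"
  using norm_tri_perp[of x] norm_ge_zero[of "tri z \<cdot> x"] by linarith

lemma perp_diamond: "perp z \<cdot> x \<diamondsuit> z"
  using peirce_mem(2)[OF exposed_ext, of x] by (simp add: diamond_compl_def)

lemma isoinv_sym_at: "isoinv (sym_at z)"
  by (rule isoinv_symmetry[OF exposed_ext])

lemma norm_sym_at [simp]: "norm (sym_at z \<cdot> x) = norm x"
  by (rule norm_symmetry[OF exposed_ext])

lemma sym_at_sym_at [simp]: "sym_at z \<cdot> (sym_at z \<cdot> x) = x"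
  by (rule symmetry_symmetry[OF exposed_ext])

lemma
  assumes "b \<diamondsuit> z"
  shows sym_at_diamond: "sym_at z \<cdot> b = b" and perp_of_diamond: "perp z \<cdot> b = b"
    and tri_diamond: "tri z \<cdot> b = 0"
proof -
  have b: "b \<in> diamond_compl {z}" using assms by (simp add: diamond_compl_def)
  show "sym_at z \<cdot> b = b" using symmetry_fix[OF exposed_ext] b by blast
  show "perp z \<cdot> b = b" by (rule peirce_diamond_compl(2)[OF exposed_ext b])
  have "scale (tri z \<cdot> b) z = 0" using peirce_diamond_compl(1)[OF exposed_ext b] by (simp add: peirce2_ext)
  then have "norm (scale (tri z \<cdot> b) z) = 0" by simp
  then show "tri z \<cdot> b = 0" unfolding norm_scale by simp
qed

lemma sym_at_self [simp]: "sym_at z \<cdot> z = z" and perp_self [simp]: "perp z \<cdot> z = 0"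
  using symmetry_fix[OF exposed_ext] peirce_closed_span(2)[OF exposed_ext] face_subset_closed_span[OF exposed_ext]
  by blast+

lemma tri_perp [simp]: "tri z \<cdot> (perp z \<cdot> x) = 0"
  by (simp_all add: tri_diamond perp_of_diamond perp_diamond)

lemma klinear_perp: "klinear (perp z)"
  by (rule klinear_peirce(2)[OF exposed_ext])

lemma perp_neutral: "norm (perp z \<cdot> x) = norm x \<Longrightarrow> perp z \<cdot> x = x"
  by (rule peirce0_neutral[OF exposed_ext])

lemma
  assumes g: "g \<in> dual" "norm g \<le> 1" "g \<cdot> z = 1"
  shows dual_sym_at: "g \<cdot> (sym_at z \<cdot> x) = g \<cdot> x"
    and dual_tri_perp: "g \<cdot> x = tri z \<cdot> x + g \<cdot> (perp z \<cdot> x)"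
proof -
  have F: "{z} \<subseteq> face g" using g by (simp add: mem_face)
  show "g \<cdot> (sym_at z \<cdot> x) = g \<cdot> x" by (rule symmetry_invariant(1)[OF exposed_ext g(1,2) F])
  show "g \<cdot> x = tri z \<cdot> x + g \<cdot> (perp z \<cdot> x)"
    using symmetry_invariant(2)[OF exposed_ext g(1,2) F, of x] by (simp add: peirce2_ext dualD[OF g(1)] g(3))
qed

lemma
  assumes \<phi>: "isoinv \<phi>" "\<phi> \<cdot> z = z"
  shows isoinv_sym_at_commute: "\<phi> \<cdot> (sym_at z \<cdot> x) = sym_at z \<cdot> (\<phi> \<cdot> x)"
    and tri_isoinv: "tri z \<cdot> (\<phi> \<cdot> x) = tri z \<cdot> x"
proof -
  note * = peirce_commute[OF exposed_ext \<phi>(1), of x]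
  show "\<phi> \<cdot> (sym_at z \<cdot> x) = sym_at z \<cdot> (\<phi> \<cdot> x)" using * \<phi>(2) by simp_all
  have "scale (tri z \<cdot> (\<phi> \<cdot> x)) z = \<phi> \<cdot> scale (tri z \<cdot> x) z" using *(2) \<phi>(2) by (simp add: peirce2_ext)
  also have "\<dots> = scale (tri z \<cdot> x) z" by (simp add: klinearD[OF isoinvD(1)[OF \<phi>(1)]] \<phi>(2))
  finally have "tri z \<cdot> scale (tri z \<cdot> (\<phi> \<cdot> x)) z = tri z \<cdot> scale (tri z \<cdot> x) z" by (rule arg_cong)
  then show "tri z \<cdot> (\<phi> \<cdot> x) = tri z \<cdot> x" by (simp add: dualD[OF tri_dual])
qed

end

text \<open>\<open>sym_at w\<close> fixes \<open>z\<close>, hence commutes with the projection onto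
  the line of \<open>z\<close>; the component along \<open>w\<close> is killed by
  \<open>tri z\<close>.\<close>

lemma tri_sym_at_orth:
  assumes "ext z" "ext w" "w \<diamondsuit> z"
  shows "tri z \<cdot> (sym_at w \<cdot> x) = tri z \<cdot> x"
    and "tri z \<cdot> (perp w \<cdot> x) = tri z \<cdot> x"
proof -
  have zw: "z \<diamondsuit> w" using assms(3) diamond_commute by blast
  show *: "tri z \<cdot> (sym_at w \<cdot> x) = tri z \<cdot> x"
    by (rule tri_isoinv[OF assms(1) isoinv_sym_at[OF assms(2)] sym_at_diamond[OF assms(2) zw]])
  have "tri z \<cdot> (scale (tri w \<cdot> x) w + perp w \<cdot> x) = (1/2::real) *\<^sub>R (tri z \<cdot> x + tri z \<cdot> x)"
    unfolding half_sum_sym_at[OF assms(2), symmetric] by (simp add: blinfun.scaleR_right blinfun.add_right *)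
  also have "\<dots> = tri z \<cdot> x" by (simp flip: scaleR_2)
  finally show "tri z \<cdot> (perp w \<cdot> x) = tri z \<cdot> x"
    by (simp add: blinfun.add_right dualD[OF tri_dual[OF assms(1)]] tri_diamond[OF assms(1,3)])
qed

lemma norm_tri_two:
  assumes "ext z" "ext w" "w \<diamondsuit> z"
  shows "norm (tri z \<cdot> x) + norm (tri w \<cdot> x) + norm (perp z \<cdot> (perp w \<cdot> x)) \<le> norm x"
  using norm_tri_perp[OF assms(2), of x] norm_tri_perp[OF assms(1), of "perp w \<cdot> x"] tri_sym_at_orth(2)[OF assms, of x]
  by simp

text \<open>Atomicity replaces the maximum point by an extreme point of the face that
  \<open>g\<close> exposes, and neutrality of \<open>T\<close> keeps it in \<open>W\<close>. Strong
  facial symmetry then makes \<open>g\<close> invariant under the symmetry at that point.\<close>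

lemma Bishop_Phelps_ext:
  assumes W: "subspace W" "closed W"
    and T: "klinear T" "\<And>x. T \<cdot> x \<in> W" "\<And>x. x \<in> W \<Longrightarrow> T \<cdot> x = x" "\<And>x. norm (T \<cdot> x) \<le> norm x"
    and neutral: "\<And>x. norm (T \<cdot> x) = norm x \<Longrightarrow> T \<cdot> x = x"
    and h: "h \<in> dual" and \<epsilon>: "\<epsilon> > 0" "\<epsilon> < norm (h o\<^sub>L T)"
  obtains g z where "g \<in> dual" "g o\<^sub>L T = g" "norm (g - (h o\<^sub>L T)) \<le> \<epsilon>" "norm g > 0"
    "ext z" "z \<in> W" "g \<cdot> z = of_real (norm g)" "\<And>x. g \<cdot> (sym_at z \<cdot> x) = g \<cdot> x"
    "\<And>x. g \<cdot> x = of_real (norm g) * tri z \<cdot> x + g \<cdot> (perp z \<cdot> x)"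
proof -
  obtain g w where g: "g \<in> dual" "w \<in> W" "norm w \<le> 1" "g o\<^sub>L T = g" "norm (g - (h o\<^sub>L T)) \<le> \<epsilon>"
    "norm g > 0" "g \<cdot> w = of_real (norm g)"
    using Bishop_Phelps[OF complete_space W T h \<epsilon>] by blast
  define u where "u = (1 / norm g) *\<^sub>R g"
  have u: "u \<in> dual" "norm u \<le> 1" using g by (simp_all add: u_def dual_scaleR)
  have gu: "g \<cdot> x = norm g *\<^sub>R (u \<cdot> x)" for x using g(6) by (simp add: u_def blinfun.scaleR_left)
  have "u \<cdot> w = 1" using g(6,7) by (simp add: u_def blinfun.scaleR_left scaleR_conv_of_real)
  then have "norm_exposed_face (face u)" using exposedI[OF u] g(3) by (simp add: mem_face)
  then obtain z where z: "z \<in> face u" "ext z" using exposed_contains_ext by blast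
  then have uz: "u \<cdot> z = 1" by (simp add: mem_face)
  have "u \<cdot> (T \<cdot> z) = u \<cdot> z" using g(4) by (metis gu g(6) blinfun_apply_blinfun_compose scaleR_cancel_left less_irrefl)
  then have "1 \<le> norm (T \<cdot> z)" using norm_blinfun_le[OF u(2), of "T \<cdot> z"] uz by simp
  then have "T \<cdot> z = z" using T(4)[of z] norm_ext[OF z(2)] by (intro neutral) simp
  then have zW: "z \<in> W" using T(2) by metis
  show thesis
  proof (rule that[OF g(1,4,5,6) z(2) zW])
    show "g \<cdot> z = of_real (norm g)" by (simp add: gu uz scaleR_conv_of_real)
    show "g \<cdot> (sym_at z \<cdot> x) = g \<cdot> x" for x by (simp add: gu dual_sym_at[OF z(2) u uz])
    show "g \<cdot> x = of_real (norm g) * tri z \<cdot> x + g \<cdot> (perp z \<cdot> x)" for x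
      by (subst gu, subst dual_tri_perp[OF z(2) u uz]) (simp add: gu scaleR_conv_of_real distrib_left)
  qed
qed


subsection \<open>Extreme points near a face\<close>

text \<open>The perturbed form of being an extreme point on the face of \<open>d\<close>. On the
  face, invariance of \<open>d\<close> under the symmetry is a consequence of strong facial
  symmetry; off the face it has to be demanded, up to \<delta>.\<close>

definition near :: "('z \<Rightarrow>\<^sub>L 'k) \<Rightarrow> real \<Rightarrow> 'z \<Rightarrow> bool" where
  "near d \<delta> z \<longleftrightarrow> ext z \<and> 1 - \<delta> \<le> rp (d \<cdot> z) \<and> norm ((d o\<^sub>L sym_at z) - d) \<le> \<delta>"

text \<open>The version with tolerance of the cone over the face of \<open>d\<close>, cut off at the
  unit ball.\<close>

definition dcone :: "('z \<Rightarrow>\<^sub>L 'k) \<Rightarrow> real \<Rightarrow> 'z \<Rightarrow> bool" where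
  "dcone d \<delta> q \<longleftrightarrow> norm q \<le> 1 \<and> norm q - \<delta> \<le> rp (d \<cdot> q)"

lemma near_mono: "near d \<delta> z \<Longrightarrow> \<delta> \<le> \<delta>' \<Longrightarrow> near d \<delta>' z"
  by (auto simp: near_def)

lemma near_nonneg: "near d \<delta> z \<Longrightarrow> 0 \<le> \<delta>"
  unfolding near_def by (meson norm_ge_zero order_trans)

lemma near_sym_at:
  assumes "near d \<delta> z" "norm q \<le> 1"
  shows "\<bar>rp (d \<cdot> (sym_at z \<cdot> q)) - rp (d \<cdot> q)\<bar> \<le> \<delta>"
proof -
  have "\<bar>rp (d \<cdot> (sym_at z \<cdot> q)) - rp (d \<cdot> q)\<bar> = \<bar>rp (((d o\<^sub>L sym_at z) - d) \<cdot> q)\<bar>"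
    by (simp add: blinfun.diff_left)
  also have "\<dots> \<le> norm (((d o\<^sub>L sym_at z) - d) \<cdot> q)" by (rule abs_rp_le_norm)
  also have "\<dots> \<le> norm ((d o\<^sub>L sym_at z) - d) * norm q" by (rule norm_blinfun)
  also have "\<dots> \<le> \<delta> * 1" using assms near_nonneg by (intro mult_mono) (auto simp: near_def)
  finally show ?thesis by simp
qed

lemma dcone_sym_at: "near d \<delta> z \<Longrightarrow> dcone d \<delta>' q \<Longrightarrow> dcone d (\<delta>' + \<delta>) (sym_at z \<cdot> q)"
  using near_sym_at[of d \<delta> z q] by (auto simp: dcone_def near_def)

text \<open>Averaging \<open>q\<close> with its reflection leaves v z + b with |v| + |b| \<le> |q|,
  and there \<open>d\<close> still nearly attains |q|. So \<open>d\<close> nearly attains the norm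
  on both parts, and since \<open>d z\<close> is close to one, \<open>v\<close> is nearly
  nonnegative.\<close>

lemma near_dcone:
  assumes d: "d \<in> dual" "norm d \<le> 1" and near: "near d \<delta> z" and q: "dcone d \<delta>' q"
    and \<omega>: "0 < \<omega>" "\<omega> \<le> 1" "\<delta> \<le> \<omega> ^ 4 / 100" "\<delta>' \<le> \<omega> ^ 4 / 25"
  shows "norm (tri z \<cdot> q) - \<omega> \<le> rp (tri z \<cdot> q)"
    and "norm (tri z \<cdot> q - of_real (rp (tri z \<cdot> q))) \<le> \<omega>"
    and "dcone d (\<delta>' + \<delta>) (perp z \<cdot> q)"
proof -
  have z: "ext z" and dz: "1 - \<delta> \<le> rp (d \<cdot> z)" using near by (auto simp: near_def)
  have d0: "0 \<le> \<delta>" by (rule near_nonneg[OF near])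
  define v b where "v = tri z \<cdot> q" and "b = perp z \<cdot> q"
  have q1: "norm q \<le> 1" and dq: "norm q - \<delta>' \<le> rp (d \<cdot> q)" using q by (auto simp: dcone_def)
  have vb: "norm v + norm b \<le> norm q" unfolding v_def b_def by (rule norm_tri_perp[OF z])
  have v1: "norm v \<le> 1" using vb q1 norm_ge_zero[of b] by linarith
  have ddz: "norm (d \<cdot> z) \<le> 1" using norm_blinfun_le[OF d(2), of z] z by simp
  have db: "rp (d \<cdot> b) \<le> norm b" using rp_le_norm[of "d \<cdot> b"] norm_blinfun_le[OF d(2), of b] by linarith
  have vdz: "rp (d \<cdot> scale v z) \<le> norm v"
    using rp_le_norm[of "d \<cdot> scale v z"] norm_blinfun_le[OF d(2), of "scale v z"] z by (simp add: norm_scale)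
  have "rp (d \<cdot> scale v z) + rp (d \<cdot> b) = rp (d \<cdot> ((1/2) *\<^sub>R (q + sym_at z \<cdot> q)))"
    unfolding half_sum_sym_at[OF z] v_def b_def by (simp add: blinfun.add_right)
  also have "\<dots> = (rp (d \<cdot> q) + rp (d \<cdot> (sym_at z \<cdot> q))) / 2"
    by (simp add: blinfun.scaleR_right blinfun.add_right)
  also have "\<dots> \<ge> rp (d \<cdot> q) - \<delta> / 2" using near_sym_at[OF near q1] by (simp add: abs_le_iff)
  finally have sum: "norm q - \<delta>' - \<delta> / 2 \<le> rp (d \<cdot> scale v z) + rp (d \<cdot> b)" using dq by linarith
  have "norm b \<le> 1" using vb q1 norm_ge_zero[of v] by linarith
  then show "dcone d (\<delta>' + \<delta>) (perp z \<cdot> q)"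
    using sum vdz vb d0 unfolding dcone_def b_def[symmetric] by linarith
  have w4: "\<omega> ^ 4 \<le> \<omega>\<^sup>2" "\<omega>\<^sup>2 \<le> \<omega>" using \<omega> power_decreasing[of 2 4 \<omega>] power_decreasing[of 1 2 \<omega>] by simp_all
  \<comment> \<open>First square root: \<open>d z\<close> is within sqrt(2 \<delta>) of 1. A second
    one occurs below in passing from the real part of \<open>v\<close> to its imaginary part; this
    is why \<delta> is of order \<omega>^4.\<close>
  have root: "sqrt (2 * \<delta>) \<le> 15/100 * \<omega>\<^sup>2"
  proof (rule real_le_lsqrt)
    have "(15/100 * \<omega>\<^sup>2)\<^sup>2 = 225/10000 * \<omega> ^ 4" by (simp add: power_mult_distrib power2_eq_square eval_nat_numeral)
    then show "2 * \<delta> \<le> (15/100 * \<omega>\<^sup>2)\<^sup>2" using \<omega>(3) d0 zero_le_power[of \<omega> 4] \<omega>(1) by linarith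
  qed (use d0 \<omega>(1) in auto)
  have "rp v - rp (d \<cdot> scale v z) \<ge> - (15/100 * \<omega>\<^sup>2)"
  proof -
    have "v * (d \<cdot> z) = v + v * (d \<cdot> z - 1)" by (simp add: algebra_simps)
    then have "rp (d \<cdot> scale v z) = rp v + rp (v * (d \<cdot> z - 1))" by (metis rp_add dualD[OF d(1)])
    moreover have "rp (v * (d \<cdot> z - 1)) \<le> norm v * norm (d \<cdot> z - 1)"
      using rp_le_norm[of "v * (d \<cdot> z - 1)"] by (simp add: norm_mult)
    moreover have "norm v * norm (d \<cdot> z - 1) \<le> 1 * sqrt (2 * \<delta>)"
      by (intro mult_mono v1 norm_diff_one_le[OF ddz dz]) auto
    ultimately show ?thesis using root by simp
  qed
  then have rv: "norm v - 2/10 * \<omega>\<^sup>2 \<le> rp v"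
    using sum db w4(1) \<omega>(3,4) vb d0 zero_le_power2[of \<omega>] by linarith
  then show "norm (tri z \<cdot> q) - \<omega> \<le> rp (tri z \<cdot> q)"
    using w4(2) \<omega>(1) unfolding v_def[symmetric] by linarith
  have "(norm (v - of_real (rp v)))\<^sup>2 = (norm v - rp v) * (norm v + rp v)"
    unfolding norm_minus_rp_sq by (simp add: power2_eq_square algebra_simps)
  also have "\<dots> \<le> (2/10 * \<omega>\<^sup>2) * 2"
    using rv v1 rp_le_norm[of v] abs_rp_le_norm[of v] by (intro mult_mono) linarith+
  also have "\<dots> \<le> \<omega>\<^sup>2" by simp
  finally show "norm (tri z \<cdot> q - of_real (rp (tri z \<cdot> q))) \<le> \<omega>"
    using \<omega>(1) unfolding v_def[symmetric] by (simp add: power2_le_iff_abs_le)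
qed

text \<open>When the coefficient along \<open>z\<close> nearly exhausts the norm, the orthogonal
  part has norm at most \<delta>, and only 2 z - q remains of the reflection.\<close>

lemma sym_at_approx:
  assumes z: "ext z" and q: "norm q \<le> 1" "1 - \<delta> \<le> rp (tri z \<cdot> q)" and e: "0 \<le> e" "e \<le> 1" "0 \<le> \<delta>" "\<delta> \<le> e\<^sup>2 / 25"
  shows "norm (tri z \<cdot> q - 1) \<le> 3/10 * e" "norm (sym_at z \<cdot> q - (2 *\<^sub>R z - q)) \<le> e"
proof -
  have v1: "norm (tri z \<cdot> q) \<le> 1" using norm_tri_le[OF z, of q] q(1) by linarith
  have "norm (tri z \<cdot> q - 1) \<le> sqrt (2 * \<delta>)" by (rule norm_diff_one_le[OF v1 q(2)])
  also have "sqrt (2 * \<delta>) \<le> 3/10 * e"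
  proof (rule real_le_lsqrt)
    have "(3/10 * e)\<^sup>2 = 9/100 * e\<^sup>2" by (simp add: power_mult_distrib power2_eq_square)
    then show "2 * \<delta> \<le> (3/10 * e)\<^sup>2" using e(4) zero_le_power2[of e] by linarith
  qed (use e in auto)
  finally show v: "norm (tri z \<cdot> q - 1) \<le> 3/10 * e" .
  have b: "norm (perp z \<cdot> q) \<le> \<delta>"
    using norm_tri_perp[OF z, of q] q rp_le_norm[of "tri z \<cdot> q"] by linarith
  have "sym_at z \<cdot> q - (2 *\<^sub>R z - q) = 2 *\<^sub>R (scale (tri z \<cdot> q - 1) z + perp z \<cdot> q)"
    by (simp add: sym_at_apply[OF z] scale_left_diff_distrib scaleR_add_right scaleR_diff_right)
  then have "norm (sym_at z \<cdot> q - (2 *\<^sub>R z - q)) = 2 * norm (scale (tri z \<cdot> q - 1) z + perp z \<cdot> q)" by simp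
  also have "norm (scale (tri z \<cdot> q - 1) z + perp z \<cdot> q) \<le> 3/10 * e + \<delta>"
    using norm_triangle_ineq[of "scale (tri z \<cdot> q - 1) z" "perp z \<cdot> q"] v b z by (simp add: norm_scale)
  also have "\<delta> \<le> e / 25" using e power2_eq_square[of e] mult_left_le[of e e] by simp
  finally show "norm (sym_at z \<cdot> q - (2 *\<^sub>R z - q)) \<le> e" using e by simp
qed

text \<open>
  The product of the symmetries at \<open>z'\<close> and \<open>z\<close> acts on \<open>z\<close> approximately as the translation
  by \<open>2 (z' - z)\<close>, and its powers are isometries.
\<close>

lemma ext_close:
  assumes z: "ext z" "ext z'" and n: "n > 0"
    and e: "norm (sym_at z \<cdot> z' - (2 *\<^sub>R z - z')) \<le> e" "norm (sym_at z' \<cdot> z - (2 *\<^sub>R z' - z)) \<le> e"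
  shows "norm (z' - z) \<le> 1 / real n + e + 2 * real n * e"
proof -
  define m where "m = z' - z"
  define T where "T x = sym_at z' \<cdot> (sym_at z \<cdot> x)" for x
  have T_add: "T (x + y) = T x + T y" "T (r *\<^sub>R x) = r *\<^sub>R T x" "T (x - y) = T x - T y" for x y r
    by (simp_all add: T_def blinfun.add_right blinfun.scaleR_right blinfun.diff_right)
  have T_norm: "norm (T x) = norm x" for x by (simp add: T_def z)
  have Tz: "norm (T z - (z + 2 *\<^sub>R m)) \<le> e"
    using e(2) by (simp add: T_def z m_def algebra_simps scaleR_2)
  have Sm: "norm (sym_at z \<cdot> m + m) \<le> e"
    using e(1) by (simp add: m_def blinfun.diff_right z algebra_simps scaleR_2)
  have S'm: "norm (sym_at z' \<cdot> m + m) \<le> e"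
  proof -
    have "sym_at z' \<cdot> m + m = - (sym_at z' \<cdot> z - (2 *\<^sub>R z' - z))"
      by (simp add: m_def blinfun.diff_right z algebra_simps scaleR_2)
    then show ?thesis using e(2) by (simp add: norm_minus_commute)
  qed
  have Tm: "norm (T m - m) \<le> 2 * e"
  proof -
    have "T m - m = sym_at z' \<cdot> (sym_at z \<cdot> m + m) - (sym_at z' \<cdot> m + m)"
      by (simp add: T_def blinfun.add_right)
    then have "norm (T m - m) \<le> norm (sym_at z' \<cdot> (sym_at z \<cdot> m + m)) + norm (sym_at z' \<cdot> m + m)"
      using norm_triangle_ineq4 by metis
    then show ?thesis using Sm S'm by (simp add: z)
  qed
  have e0: "0 \<le> e" using Sm norm_ge_zero order_trans by blast
  \<comment> \<open>Step k moves by 2 k m in addition, so the error of \<open>T m\<close> enters 2 k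
    times; hence the quadratic growth.\<close>
  have iter: "norm ((T ^^ k) z - (z + (2 * real k) *\<^sub>R m)) \<le> real k * e + 2 * (real k)\<^sup>2 * e" for k
  proof (induction k)
    case (Suc k)
    define r where "r = (T ^^ k) z - (z + (2 * real k) *\<^sub>R m)"
    have "(T ^^ Suc k) z = T (r + (z + (2 * real k) *\<^sub>R m))" by (simp add: r_def)
    also have "\<dots> = T r + (T z + (2 * real k) *\<^sub>R T m)" by (simp only: T_add)
    finally have eq: "(T ^^ Suc k) z - (z + (2 * real (Suc k)) *\<^sub>R m) =
        T r + ((T z - (z + 2 *\<^sub>R m)) + (2 * real k) *\<^sub>R (T m - m))"
      by (simp add: algebra_simps)
    have "norm ((T ^^ Suc k) z - (z + (2 * real (Suc k)) *\<^sub>R m)) \<le>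
        norm r + (norm (T z - (z + 2 *\<^sub>R m)) + norm ((2 * real k) *\<^sub>R (T m - m)))"
      using norm_triangle_ineq[of "T r" "(T z - (z + 2 *\<^sub>R m)) + (2 * real k) *\<^sub>R (T m - m)"]
        norm_triangle_ineq[of "T z - (z + 2 *\<^sub>R m)" "(2 * real k) *\<^sub>R (T m - m)"] T_norm[of r] unfolding eq by linarith
    also have "\<dots> \<le> (real k * e + 2 * (real k)\<^sup>2 * e) + (e + 2 * real k * (2 * e))"
      using Suc Tz Tm mult_left_mono[OF Tm, of "2 * real k"] unfolding r_def by (intro add_mono) auto
    also have "\<dots> \<le> real (Suc k) * e + 2 * (real (Suc k))\<^sup>2 * e"
      using e0 by (simp add: power2_eq_square algebra_simps)
    finally show ?case .
  qed simp
  \<comment> \<open>The iterates stay on the unit sphere, so the displacement 2 n m has norm at most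
    2 up to the error; division by 2 n bounds \<open>m\<close>.\<close>
  have "norm ((T ^^ n) z) = 1" by (induction n) (simp_all add: T_norm z)
  moreover have "norm ((2 * real n) *\<^sub>R m) \<le> norm ((T ^^ n) z) + norm z + norm ((T ^^ n) z - (z + (2 * real n) *\<^sub>R m))"
    using norm_triangle_ineq4[of "(T ^^ n) z - z" "(T ^^ n) z - (z + (2 * real n) *\<^sub>R m)"]
      norm_triangle_ineq4[of "(T ^^ n) z" z] by simp
  ultimately have "2 * real n * norm m \<le> 2 + real n * e + 2 * (real n)\<^sup>2 * e"
    using iter[of n] z by simp
  also have "\<dots> = 2 * real n * (1 / real n + e / 2 + real n * e)" using n by (simp add: power2_eq_square field_simps)
  finally have "norm m \<le> 1 / real n + e / 2 + real n * e" using n by simp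
  also have "\<dots> \<le> 1 / real n + e + 2 * real n * e" using e0 by simp
  finally show ?thesis by (simp add: m_def)
qed

text \<open>The reflections at \<open>b\<close> and then \<open>a\<close> take \<open>c\<close>
  nearly to p = 2 a - 2 b + c. Reflect \<open>p\<close> at \<open>c\<close> and apply
  \<open>tri b\<close>: the result is at most 1, while the part of \<open>p\<close> orthogonal to
  \<open>c\<close> contributes almost nonnegatively because \<open>p\<close> is almost in the cone
  of \<open>d\<close>. What is left bounds the defect of the backward coefficient of
  \<open>a\<close> along \<open>b\<close> by an increment of the coefficients along
  \<open>c\<close>.\<close>

lemma nested_triple:
  assumes d: "d \<in> dual" "norm d \<le> 1" and near: "near d \<delta> a" "near d \<delta> b" "near d \<delta> c"
    and nested: "1 - \<delta>' \<le> rp (tri a \<cdot> b)" "1 - \<delta>' \<le> rp (tri a \<cdot> c)" "1 - \<delta>' \<le> rp (tri b \<cdot> c)"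
    and \<omega>: "0 < \<omega>" "\<omega> \<le> 1" "\<delta> \<le> \<omega> ^ 4 / 100" "0 \<le> \<delta>'" "\<delta>' \<le> \<omega>\<^sup>2 / 25"
  shows "1 - rp (tri b \<cdot> a) \<le> 2 * (rp (tri c \<cdot> b) - rp (tri c \<cdot> a)) + 8 * \<omega>"
proof -
  have ext: "ext a" "ext b" "ext c" and dc: "1 - \<delta> \<le> rp (d \<cdot> c)" using near by (auto simp: near_def)
  note [simp] = norm_ext[OF ext(1)] norm_ext[OF ext(2)] norm_ext[OF ext(3)]
    norm_sym_at[OF ext(1)] norm_sym_at[OF ext(2)] norm_sym_at[OF ext(3)]
  have d0: "0 \<le> \<delta>" by (rule near_nonneg[OF near(1)])
  have ab: "norm (sym_at a \<cdot> b - (2 *\<^sub>R a - b)) \<le> \<omega>"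
    by (rule sym_at_approx(2)[OF ext(1) _ nested(1)]) (use \<omega> in auto)
  have ac: "norm (sym_at a \<cdot> c - (2 *\<^sub>R a - c)) \<le> \<omega>"
    by (rule sym_at_approx(2)[OF ext(1) _ nested(2)]) (use \<omega> in auto)
  have bc: "norm (sym_at b \<cdot> c - (2 *\<^sub>R b - c)) \<le> \<omega>" and tbc: "norm (tri b \<cdot> c - 1) \<le> 3/10 * \<omega>"
    by (rule sym_at_approx[OF ext(2) _ nested(3)]; use \<omega> in auto)+
  define p where "p = sym_at a \<cdot> (sym_at b \<cdot> c)"
  have eq: "p - (2 *\<^sub>R a - 2 *\<^sub>R b + c) = sym_at a \<cdot> (sym_at b \<cdot> c - (2 *\<^sub>R b - c)) +
      (2 *\<^sub>R (sym_at a \<cdot> b - (2 *\<^sub>R a - b)) - (sym_at a \<cdot> c - (2 *\<^sub>R a - c)))"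
    by (simp add: p_def blinfun.diff_right blinfun.scaleR_right blinfun.add_right ext algebra_simps
        flip: scaleR_add_left)
  have "norm (p - (2 *\<^sub>R a - 2 *\<^sub>R b + c)) \<le> norm (sym_at a \<cdot> (sym_at b \<cdot> c - (2 *\<^sub>R b - c))) +
      (norm (2 *\<^sub>R (sym_at a \<cdot> b - (2 *\<^sub>R a - b))) + norm (sym_at a \<cdot> c - (2 *\<^sub>R a - c)))"
    using norm_triangle_ineq[of "sym_at a \<cdot> (sym_at b \<cdot> c - (2 *\<^sub>R b - c))"
        "2 *\<^sub>R (sym_at a \<cdot> b - (2 *\<^sub>R a - b)) - (sym_at a \<cdot> c - (2 *\<^sub>R a - c))"]
      norm_triangle_ineq4[of "2 *\<^sub>R (sym_at a \<cdot> b - (2 *\<^sub>R a - b))" "sym_at a \<cdot> c - (2 *\<^sub>R a - c)"]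
    unfolding eq by linarith
  then have p_near: "norm (p - (2 *\<^sub>R a - 2 *\<^sub>R b + c)) \<le> 4 * \<omega>" using ab ac bc by simp
  have rp_p: "\<bar>rp (u \<cdot> p) - (2 * rp (u \<cdot> a) - 2 * rp (u \<cdot> b) + rp (u \<cdot> c))\<bar> \<le> 4 * \<omega>" if "norm u \<le> 1" for u
  proof -
    have "rp (u \<cdot> p) - (2 * rp (u \<cdot> a) - 2 * rp (u \<cdot> b) + rp (u \<cdot> c)) = rp (u \<cdot> (p - (2 *\<^sub>R a - 2 *\<^sub>R b + c)))"
      by (simp add: blinfun.diff_right blinfun.add_right blinfun.scaleR_right)
    then show ?thesis using abs_rp_le_norm[of "u \<cdot> (p - (2 *\<^sub>R a - 2 *\<^sub>R b + c))"]
        norm_blinfun_le[OF that, of "p - (2 *\<^sub>R a - 2 *\<^sub>R b + c)"] p_near by linarith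
  qed
  have "dcone d \<delta> c" using dc by (simp add: dcone_def)
  then have pc: "dcone d (\<delta> + \<delta> + \<delta>) p" unfolding p_def by (intro dcone_sym_at near)
  have q: "dcone d (\<delta> + \<delta> + \<delta> + \<delta>) (perp c \<cdot> p)"
    by (rule near_dcone(3)[OF d near(3) pc \<omega>(1,2,3)]) (use \<omega>(3) d0 in linarith)
  define v t q where "v = tri c \<cdot> p" and "t = tri b \<cdot> c" and "q = perp c \<cdot> p"
  have bq: "- \<omega> \<le> rp (tri b \<cdot> q)"
    using near_dcone(1)[OF d near(2) q \<omega>(1,2,3)] \<omega>(3) d0 norm_ge_zero[of "tri b \<cdot> q"] unfolding q_def by linarith
  have np: "norm p = 1" by (simp add: p_def)
  have v1: "norm v \<le> 1" using norm_tri_le[OF ext(3), of p] np by (simp add: v_def)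
  have "tri b \<cdot> (sym_at c \<cdot> p) = 2 *\<^sub>R (v * t + tri b \<cdot> q) - tri b \<cdot> p"
    by (simp add: sym_at_apply[OF ext(3)] blinfun.diff_right blinfun.add_right blinfun.scaleR_right
        dualD[OF tri_dual[OF ext(2)]] v_def t_def q_def)
  then have "rp (tri b \<cdot> (sym_at c \<cdot> p)) = 2 * (rp (v * t) + rp (tri b \<cdot> q)) - rp (tri b \<cdot> p)" by simp
  moreover have "rp (tri b \<cdot> (sym_at c \<cdot> p)) \<le> 1"
    using rp_le_norm[of "tri b \<cdot> (sym_at c \<cdot> p)"] norm_tri_le[OF ext(2), of "sym_at c \<cdot> p"] np by simp
  moreover have "rp v - 3/10 * \<omega> \<le> rp (v * t)"
  proof -
    have "v * t = v + v * (t - 1)" by (simp add: algebra_simps)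
    then have "rp (v * t) = rp v + rp (v * (t - 1))" by (metis rp_add)
    moreover have "\<bar>rp (v * (t - 1))\<bar> \<le> norm v * norm (t - 1)"
      using abs_rp_le_norm[of "v * (t - 1)"] by (simp add: norm_mult)
    moreover have "norm v * norm (t - 1) \<le> 1 * (3/10 * \<omega>)"
      using v1 tbc unfolding t_def by (intro mult_mono) auto
    ultimately show ?thesis by linarith
  qed
  moreover have "rp t \<le> 1" using rp_le_norm[of t] norm_tri_le[OF ext(2), of c] by (simp add: t_def)
  ultimately show ?thesis
    using bq rp_p[of "tri c"] rp_p[of "tri b"] ext unfolding v_def t_def by (simp add: abs_le_iff)
qed

text \<open>With \<open>c\<close> fixed as the last point, the increments in
  \<open>nested_triple\<close> telescope to at most 2, which the factor 2 turns into 4; some index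
  does no worse than the average over L - 1 terms.\<close>

lemma nested_chain:
  assumes d: "d \<in> dual" "norm d \<le> 1" and near: "\<And>i. i \<le> L \<Longrightarrow> near d \<delta> (z i)"
    and nested: "\<And>i j. i < j \<Longrightarrow> j \<le> L \<Longrightarrow> 1 - \<delta>' \<le> rp (tri (z i) \<cdot> z j)"
    and \<omega>: "0 < \<omega>" "\<omega> \<le> 1" "\<delta> \<le> \<omega> ^ 4 / 100" "0 \<le> \<delta>'" "\<delta>' \<le> \<omega>\<^sup>2 / 25"
    and L: "L \<ge> 2"
  obtains i where "Suc i < L" "1 - (4 / (real L - 1) + 8 * \<omega>) \<le> rp (tri (z (Suc i)) \<cdot> z i)"
proof -
  define K where "K = (\<lambda>j i. rp (tri (z j) \<cdot> z i))"
  have K1: "\<bar>K j i\<bar> \<le> 1" if "i \<le> L" "j \<le> L" for i j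
    using abs_rp_le_norm[of "tri (z j) \<cdot> z i"] norm_tri_le[of "z j" "z i"] norm_ext[of "z i"] near[OF that(1)] near[OF that(2)]
    unfolding K_def near_def by simp
  have step: "1 - K (Suc i) i \<le> 2 * (K L (Suc i) - K L i) + 8 * \<omega>" if "Suc i < L" for i
    unfolding K_def using that \<omega> by (intro nested_triple[OF d near near near nested nested nested]) auto
  have "(\<Sum>i<L - 1. 1 - K (Suc i) i) \<le> (\<Sum>i<L - 1. 2 * (K L (Suc i) - K L i) + 8 * \<omega>)"
    by (rule sum_mono) (use step in auto)
  also have "\<dots> = 2 * (\<Sum>i<L - 1. K L (Suc i) - K L i) + real (L - 1) * (8 * \<omega>)"
    by (simp add: sum.distrib sum_distrib_left)
  also have "(\<Sum>i<L - 1. K L (Suc i) - K L i) = K L (L - 1) - K L 0" by (rule sum_lessThan_telescope)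
  also have "2 * (K L (L - 1) - K L 0) \<le> 4" using K1[of "L - 1" L] K1[of 0 L] by (simp add: abs_le_iff)
  finally have sum: "(\<Sum>i<L - 1. 1 - K (Suc i) i) \<le> 4 + real (L - 1) * (8 * \<omega>)" by simp
  have "\<exists>i<L - 1. 1 - K (Suc i) i \<le> 4 / (real L - 1) + 8 * \<omega>"
  proof (rule ccontr)
    assume "\<not> ?thesis"
    then have "(\<Sum>i<L - 1. 4 / (real L - 1) + 8 * \<omega>) < (\<Sum>i<L - 1. 1 - K (Suc i) i)"
      using L by (intro sum_strict_mono) (auto simp: lessThan_empty_iff)
    moreover have "(\<Sum>i<L - 1. 4 / (real L - 1) + 8 * \<omega>) = 4 + real (L - 1) * (8 * \<omega>)"
      using L by (simp add: of_nat_diff field_simps)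
    ultimately show False using sum by linarith
  qed
  then obtain i where "i < L - 1" "1 - K (Suc i) i \<le> 4 / (real L - 1) + 8 * \<omega>" by blast
  then show ?thesis using that[of i] L unfolding K_def by (simp add: algebra_simps)
qed

end

subsection \<open>Directional derivatives of the dual norm\<close>

definition slope ::
  "('z::real_normed_vector \<Rightarrow>\<^sub>L 'k::real_or_complex) \<Rightarrow> ('z \<Rightarrow>\<^sub>L 'k) \<Rightarrow> real \<Rightarrow> real" where
  "slope d f t = (norm (d + t *\<^sub>R f) - 1) / t"

text \<open>For norm d = 1 this is the right derivative at 0 of t \<mapsto> norm (d + t f): the
  quotients increase with \<open>t\<close>, so infimum and limit agree. It takes the place of the
  maximum of \<open>f\<close> on the face of \<open>d\<close>, which need not be attained.\<close>

definition norm_deriv ::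
  "('z::real_normed_vector \<Rightarrow>\<^sub>L 'k::real_or_complex) \<Rightarrow> ('z \<Rightarrow>\<^sub>L 'k) \<Rightarrow> real" where
  "norm_deriv d f = (INF t\<in>{0<..}. slope d f t)"

context
  fixes d :: "'z::real_normed_vector \<Rightarrow>\<^sub>L 'k::real_or_complex"
  assumes norm_d: "norm d = 1"
begin

lemma norm_slope: "t > 0 \<Longrightarrow> norm (d + t *\<^sub>R f) = 1 + t * slope d f t"
  by (simp add: slope_def)

lemma abs_slope_le: "t > 0 \<Longrightarrow> \<bar>slope d f t\<bar> \<le> norm f"
  using norm_triangle_ineq[of d "t *\<^sub>R f"] norm_triangle_ineq2[of d "- (t *\<^sub>R f)"] norm_d
  by (simp add: slope_def abs_le_iff field_simps)

text \<open>Convexity of the norm on the segment from \<open>d\<close> to d + t f.\<close>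

lemma slope_mono:
  assumes "0 < s" "s \<le> t"
  shows "slope d f s \<le> slope d f t"
proof -
  have "t *\<^sub>R (d + s *\<^sub>R f) = (t - s) *\<^sub>R d + s *\<^sub>R (d + t *\<^sub>R f)" by (simp add: algebra_simps)
  then have "norm (t *\<^sub>R (d + s *\<^sub>R f)) \<le> norm ((t - s) *\<^sub>R d) + norm (s *\<^sub>R (d + t *\<^sub>R f))"
    using norm_triangle_ineq by metis
  then have "t * norm (d + s *\<^sub>R f) \<le> (t - s) + s * norm (d + t *\<^sub>R f)" using assms norm_d by simp
  then show ?thesis using assms by (simp add: slope_def divide_simps mult.commute algebra_simps)
qed

lemma bdd_slope: "bdd_below (slope d f ` {0<..})"
  by (rule bdd_belowI2[of _ "- norm f"]) (use abs_slope_le in \<open>auto simp: abs_le_iff minus_le_iff\<close>)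

lemma norm_deriv_le: "t > 0 \<Longrightarrow> norm_deriv d f \<le> slope d f t"
  unfolding norm_deriv_def by (rule cINF_lower[OF bdd_slope]) simp

lemma norm_deriv_ge: "(\<And>t. t > 0 \<Longrightarrow> a \<le> slope d f t) \<Longrightarrow> a \<le> norm_deriv d f"
  unfolding norm_deriv_def by (rule cINF_greatest) (auto intro: gt_ex)

lemma slope_le_norm_deriv:
  assumes "\<gamma> > 0"
  obtains t0 where "t0 > 0" "\<And>t. 0 < t \<Longrightarrow> t \<le> t0 \<Longrightarrow> slope d f t \<le> norm_deriv d f + \<gamma>"
proof -
  have "\<exists>t>0. slope d f t < norm_deriv d f + \<gamma>"
    using norm_deriv_ge[of "norm_deriv d f + \<gamma>" f] assms by (meson less_add_same_cancel1 not_le)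
  then obtain t0 where "t0 > 0" "slope d f t0 < norm_deriv d f + \<gamma>" by blast
  then show ?thesis using that[of t0] slope_mono[of _ t0 f] by force
qed

lemma abs_norm_deriv_le: "\<bar>norm_deriv d f\<bar> \<le> norm f"
proof -
  have "- norm f \<le> norm_deriv d f" using abs_slope_le[of _ f] by (intro norm_deriv_ge) (simp add: abs_le_iff minus_le_iff)
  moreover have "norm_deriv d f \<le> norm f" using norm_deriv_le[of 1 f] abs_slope_le[of 1 f] by simp
  ultimately show ?thesis by (simp add: abs_le_iff)
qed

lemma norm_deriv_add: "norm_deriv d (f + g) \<le> norm_deriv d f + norm_deriv d g"
proof (rule field_le_epsilon)
  fix \<gamma> :: real assume "\<gamma> > 0"
  then have g2: "\<gamma> / 2 > 0" by simp
  obtain s where s: "s > 0" "\<And>t. 0 < t \<Longrightarrow> t \<le> s \<Longrightarrow> slope d f t \<le> norm_deriv d f + \<gamma> / 2"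
    using slope_le_norm_deriv[OF g2, of f] by metis
  obtain r where r: "r > 0" "\<And>t. 0 < t \<Longrightarrow> t \<le> r \<Longrightarrow> slope d g t \<le> norm_deriv d g + \<gamma> / 2"
    using slope_le_norm_deriv[OF g2, of g] by metis
  define t where "t = min s r / 2"
  have t: "t > 0" "2 * t \<le> s" "2 * t \<le> r" using s(1) r(1) by (auto simp: t_def)
  have "2 *\<^sub>R (d + t *\<^sub>R (f + g)) = (d + (2 * t) *\<^sub>R f) + (d + (2 * t) *\<^sub>R g)"
    by (simp add: algebra_simps scaleR_2)
  then have "norm (2 *\<^sub>R (d + t *\<^sub>R (f + g))) \<le> norm (d + (2 * t) *\<^sub>R f) + norm (d + (2 * t) *\<^sub>R g)"
    using norm_triangle_ineq by metis
  then have "2 * norm (d + t *\<^sub>R (f + g)) \<le> norm (d + (2 * t) *\<^sub>R f) + norm (d + (2 * t) *\<^sub>R g)" by simp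
  then have "2 * (1 + t * slope d (f + g) t) \<le> 2 + (2 * t) * (slope d f (2 * t) + slope d g (2 * t))"
    using t(1) by (simp add: norm_slope distrib_left)
  then have "t * slope d (f + g) t \<le> t * (slope d f (2 * t) + slope d g (2 * t))" by simp
  then have "slope d (f + g) t \<le> slope d f (2 * t) + slope d g (2 * t)" using t(1) by simp
  then show "norm_deriv d (f + g) \<le> norm_deriv d f + norm_deriv d g + \<gamma>"
    using norm_deriv_le[OF t(1), of "f + g"] s(2)[of "2 * t"] r(2)[of "2 * t"] t by linarith
qed

lemma norm_deriv_add_le: "norm_deriv d (f + g) \<le> norm_deriv d f + norm g"
  using norm_deriv_add[of f g] abs_norm_deriv_le[of g] by linarith

lemma norm_deriv_diff_le: "norm_deriv d f \<le> norm_deriv d (f + g) + norm g"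
  using norm_deriv_add_le[of "f + g" "- g"] by simp

lemma rp_le_norm_deriv_face:
  assumes "y \<in> face d"
  shows "rp (f \<cdot> y) \<le> norm_deriv d f"
proof (rule norm_deriv_ge)
  fix t :: real assume t: "t > 0"
  have "1 + t * rp (f \<cdot> y) = rp ((d + t *\<^sub>R f) \<cdot> y)"
    using assms by (simp add: mem_face blinfun.add_left blinfun.scaleR_left)
  also have "\<dots> \<le> norm ((d + t *\<^sub>R f) \<cdot> y)" by (rule rp_le_norm)
  also have "\<dots> \<le> norm (d + t *\<^sub>R f) * norm y" by (rule norm_blinfun)
  also have "\<dots> \<le> norm (d + t *\<^sub>R f)" using assms by (intro mult_left_le) (auto simp: mem_face)
  also have "\<dots> = 1 + t * slope d f t" by (rule norm_slope[OF t])
  finally show "rp (f \<cdot> y) \<le> slope d f t" using t by simp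
qed

text \<open>Evaluate d + t f at \<open>p\<close> for a \<open>t\<close> whose quotient is within
  \<gamma>/2 of the derivative: a defect t \<gamma>/2 of \<open>d\<close> at \<open>p\<close> costs
  another \<gamma>/2.\<close>

lemma rp_le_norm_deriv:
  assumes "\<gamma> > 0"
  obtains \<delta> where "\<delta> > 0" "\<And>p. norm p \<le> 1 \<Longrightarrow> 1 - \<delta> \<le> rp (d \<cdot> p) \<Longrightarrow> rp (f \<cdot> p) \<le> norm_deriv d f + \<gamma>"
proof -
  have "\<gamma> / 2 > 0" using assms by simp
  then obtain t where t: "t > 0" "slope d f t \<le> norm_deriv d f + \<gamma> / 2"
    using slope_le_norm_deriv[of "\<gamma> / 2" f] by (metis order_refl)
  show ?thesis
  proof (rule that[of "t * \<gamma> / 2"])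
    show "t * \<gamma> / 2 > 0" using t assms by simp
    fix p :: 'z assume p: "norm p \<le> 1" "1 - t * \<gamma> / 2 \<le> rp (d \<cdot> p)"
    have "rp (d \<cdot> p) + t * rp (f \<cdot> p) = rp ((d + t *\<^sub>R f) \<cdot> p)"
      by (simp add: blinfun.add_left blinfun.scaleR_left)
    also have "\<dots> \<le> norm ((d + t *\<^sub>R f) \<cdot> p)" by (rule rp_le_norm)
    also have "\<dots> \<le> norm (d + t *\<^sub>R f) * norm p" by (rule norm_blinfun)
    also have "\<dots> \<le> norm (d + t *\<^sub>R f)" using p by (intro mult_left_le) auto
    also have "\<dots> = 1 + t * slope d f t" by (rule norm_slope[OF t(1)])
    also have "\<dots> \<le> 1 + t * (norm_deriv d f + \<gamma> / 2)" using t by simp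
    finally have "t * rp (f \<cdot> p) \<le> t * (norm_deriv d f + \<gamma>)" using p(2) by (simp add: algebra_simps)
    then show "rp (f \<cdot> p) \<le> norm_deriv d f + \<gamma>" using t(1) by simp
  qed
qed

text \<open>
  The difference quotients of \<open>\<tau> \<mapsto> norm_deriv d (f + \<tau> h)\<close> are monotone and bounded, so some
  two consecutive ones nearly agree; they bound \<open>h\<close> on the near maximizers from both sides.
\<close>

lemma perturb_one:
  assumes h: "norm h \<le> 1" and \<epsilon>: "\<epsilon> > 0"
  obtains \<tau> s \<gamma> \<delta> where "0 \<le> \<tau>" "\<tau> \<le> \<epsilon>" "\<gamma> > 0" "\<delta> > 0"
    "\<And>p. norm p \<le> 1 \<Longrightarrow> 1 - \<delta> \<le> rp (d \<cdot> p) \<Longrightarrow>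
      norm_deriv d (f + \<tau> *\<^sub>R h) - \<gamma> \<le> rp ((f + \<tau> *\<^sub>R h) \<cdot> p) \<Longrightarrow> s - \<epsilon> \<le> rp (h \<cdot> p) \<and> rp (h \<cdot> p) \<le> s + \<epsilon>"
proof -
  obtain J :: nat where J: "J > 0" "2 / real J < \<epsilon> / 2"
  proof -
    obtain n :: nat where n: "4 / \<epsilon> < real n" using reals_Archimedean2 by blast
    have "0 < 4 / \<epsilon>" using \<epsilon> by simp
    then have "n > 0" using n by (metis less_trans of_nat_0_less_iff)
    moreover have "2 / real n < \<epsilon> / 2" using n \<epsilon> \<open>n > 0\<close> by (simp add: field_simps)
    ultimately show ?thesis using that by blast
  qed
  \<comment> \<open>J + 1 consecutive quotients lie in [-1, 1], so some step between neighbours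
    rises by at most 2/J. They use J + 2 nodes, and this mesh keeps all nodes below
    \<epsilon>.\<close>
  define \<kappa> where "\<kappa> = \<epsilon> / (real J + 2)"
  have \<kappa>: "\<kappa> > 0" using \<epsilon> by (simp add: \<kappa>_def)
  define \<theta> where "\<theta> j = norm_deriv d (f + (real j * \<kappa>) *\<^sub>R h)" for j
  define s where "s j = (\<theta> (Suc j) - \<theta> j) / \<kappa>" for j
  have s1: "\<bar>s j\<bar> \<le> 1" for j
  proof -
    have eq: "f + (real (Suc j) * \<kappa>) *\<^sub>R h = (f + (real j * \<kappa>) *\<^sub>R h) + \<kappa> *\<^sub>R h" by (simp add: algebra_simps)
    have "norm (\<kappa> *\<^sub>R h) \<le> \<kappa>" using h \<kappa> mult_left_le[of "norm h" \<kappa>] by simp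
    then have "\<bar>\<theta> (Suc j) - \<theta> j\<bar> \<le> \<kappa>"
      using norm_deriv_add_le[of "f + (real j * \<kappa>) *\<^sub>R h" "\<kappa> *\<^sub>R h"] norm_deriv_diff_le[of "f + (real j * \<kappa>) *\<^sub>R h" "\<kappa> *\<^sub>R h"]
      unfolding \<theta>_def eq by (simp add: abs_le_iff)
    then show ?thesis using \<kappa> by (simp add: s_def abs_divide)
  qed
  have "\<exists>j<J. s (Suc j) - s j \<le> 2 / real J"
  proof (rule ccontr)
    assume "\<not> ?thesis"
    then have "(\<Sum>j<J. 2 / real J) < (\<Sum>j<J. s (Suc j) - s j)"
      using J(1) by (intro sum_strict_mono) (auto simp: lessThan_empty_iff)
    also have "\<dots> = s J - s 0" by (rule sum_lessThan_telescope)
    also have "\<dots> \<le> 2" using s1[of J] s1[of 0] by (simp add: abs_le_iff)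
    finally show False using J(1) by simp
  qed
  then obtain j where j: "j < J" "s (Suc j) - s j \<le> 2 / real J" by blast
  \<comment> \<open>The middle one of three nodes: comparison with the next bounds \<open>h\<close>
    from above, comparison with the previous from below. The slack \<gamma> costs 2
    \<gamma>/\<kappa> = \<epsilon>/4 on each side.\<close>
  define \<tau> where "\<tau> = real (Suc j) * \<kappa>"
  define \<gamma> where "\<gamma> = \<epsilon> * \<kappa> / 8"
  have \<gamma>: "\<gamma> > 0" using \<epsilon> \<kappa> by (simp add: \<gamma>_def)
  obtain \<delta>1 where \<delta>1: "\<delta>1 > 0" "\<And>p. norm p \<le> 1 \<Longrightarrow> 1 - \<delta>1 \<le> rp (d \<cdot> p) \<Longrightarrow>
      rp ((f + (real (Suc (Suc j)) * \<kappa>) *\<^sub>R h) \<cdot> p) \<le> \<theta> (Suc (Suc j)) + \<gamma>"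
    using rp_le_norm_deriv[OF \<gamma>, of "f + (real (Suc (Suc j)) * \<kappa>) *\<^sub>R h"] unfolding \<theta>_def by metis
  obtain \<delta>2 where \<delta>2: "\<delta>2 > 0" "\<And>p. norm p \<le> 1 \<Longrightarrow> 1 - \<delta>2 \<le> rp (d \<cdot> p) \<Longrightarrow>
      rp ((f + (real j * \<kappa>) *\<^sub>R h) \<cdot> p) \<le> \<theta> j + \<gamma>"
    using rp_le_norm_deriv[OF \<gamma>, of "f + (real j * \<kappa>) *\<^sub>R h"] unfolding \<theta>_def by metis
  show ?thesis
  proof (rule that[of \<tau> \<gamma> "min \<delta>1 \<delta>2" "s j"])
    show "0 \<le> \<tau>" using \<kappa> by (simp add: \<tau>_def)
    have "\<tau> \<le> (real J + 2) * \<kappa>" unfolding \<tau>_def using j(1) \<kappa> by (intro mult_right_mono) auto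
    also have "\<dots> = \<epsilon>" by (simp add: \<kappa>_def add_pos_pos)
    finally show "\<tau> \<le> \<epsilon>" .
    show "\<gamma> > 0" "min \<delta>1 \<delta>2 > 0" using \<gamma> \<delta>1(1) \<delta>2(1) by simp_all
    fix p assume p: "norm p \<le> 1" "1 - min \<delta>1 \<delta>2 \<le> rp (d \<cdot> p)"
      "norm_deriv d (f + \<tau> *\<^sub>R h) - \<gamma> \<le> rp ((f + \<tau> *\<^sub>R h) \<cdot> p)"
    have top: "\<theta> (Suc j) - \<gamma> \<le> rp (f \<cdot> p) + real (Suc j) * \<kappa> * rp (h \<cdot> p)"
      using p(3) by (simp add: \<theta>_def \<tau>_def blinfun.add_left blinfun.scaleR_left)
    have "rp (f \<cdot> p) + real (Suc (Suc j)) * \<kappa> * rp (h \<cdot> p) \<le> \<theta> (Suc (Suc j)) + \<gamma>"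
      using \<delta>1(2)[OF p(1)] p(2) by (simp add: blinfun.add_left blinfun.scaleR_left)
    with top have "\<kappa> * rp (h \<cdot> p) \<le> \<theta> (Suc (Suc j)) - \<theta> (Suc j) + 2 * \<gamma>" by (simp add: algebra_simps)
    also have "\<dots> = \<kappa> * (s (Suc j) + \<epsilon> / 4)" using \<kappa> by (simp add: s_def \<gamma>_def field_simps)
    finally have up: "rp (h \<cdot> p) \<le> s (Suc j) + \<epsilon> / 4" using \<kappa> by simp
    have "rp (f \<cdot> p) + real j * \<kappa> * rp (h \<cdot> p) \<le> \<theta> j + \<gamma>"
      using \<delta>2(2)[OF p(1)] p(2) by (simp add: blinfun.add_left blinfun.scaleR_left)
    with top have "\<theta> (Suc j) - \<theta> j - 2 * \<gamma> \<le> \<kappa> * rp (h \<cdot> p)" by (simp add: algebra_simps)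
    moreover have "\<theta> (Suc j) - \<theta> j - 2 * \<gamma> = \<kappa> * (s j - \<epsilon> / 4)" using \<kappa> by (simp add: s_def \<gamma>_def field_simps)
    ultimately have low: "s j - \<epsilon> / 4 \<le> rp (h \<cdot> p)" using \<kappa> by simp
    show "s j - \<epsilon> \<le> rp (h \<cdot> p) \<and> rp (h \<cdot> p) \<le> s j + \<epsilon>" using up low j(2) J(2) \<epsilon> by linarith
  qed
qed

end

context normed_space_over
begin

text \<open>The elements of \<open>H\<close> are treated one after another, each contributing a
  small multiple of itself; this keeps the perturbation invariant under \<open>T\<close>.\<close>

lemma perturb:
  assumes d: "norm d = 1" and H: "finite H" "\<And>h. h \<in> H \<Longrightarrow> h \<in> dual \<and> norm h \<le> 1 \<and> h o\<^sub>L T = h"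
    and "\<epsilon> > 0"
  shows "\<exists>g\<in>dual. norm g \<le> \<epsilon> \<and> g o\<^sub>L T = g \<and> (\<exists>\<eta>>0. \<exists>a. \<forall>h\<in>H. \<forall>p. norm p \<le> 1 \<longrightarrow> 1 - \<eta> \<le> rp (d \<cdot> p) \<longrightarrow>
      norm_deriv d (f + g) - \<eta> \<le> rp ((f + g) \<cdot> p) \<longrightarrow> \<bar>rp (h \<cdot> p) - a h\<bar> \<le> \<epsilon>)"
  using H \<open>\<epsilon> > 0\<close>
proof (induction H arbitrary: \<epsilon> rule: finite_induct)
  case empty
  then show ?case by (intro bexI[of _ 0] conjI exI[of _ 1]) (auto simp: dual_0 intro!: blinfun_eqI)
next
  case (insert h H)
  have "\<epsilon> / 2 > 0" using insert.prems by simp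
  then obtain g \<eta> a where g: "g \<in> dual" "norm g \<le> \<epsilon> / 2" "g o\<^sub>L T = g" "\<eta> > 0"
    and a: "\<And>h p. h \<in> H \<Longrightarrow> norm p \<le> 1 \<Longrightarrow> 1 - \<eta> \<le> rp (d \<cdot> p) \<Longrightarrow>
      norm_deriv d (f + g) - \<eta> \<le> rp ((f + g) \<cdot> p) \<Longrightarrow> \<bar>rp (h \<cdot> p) - a h\<bar> \<le> \<epsilon> / 2"
    using insert.IH[of "\<epsilon> / 2"] insert.prems(1) by (metis insertCI)
  have h: "h \<in> dual" "norm h \<le> 1" "h o\<^sub>L T = h" using insert.prems by auto
  \<comment> \<open>Adding \<tau> h moves the derivative and the value at \<open>p\<close> by at
    most \<tau> each. With \<tau> \<le> \<eta>/4, near maximizers of the new functional remain near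
    maximizers of the old one, so the earlier windows persist.\<close>
  define \<epsilon>' where "\<epsilon>' = min (\<epsilon> / 2) (\<eta> / 4)"
  have \<epsilon>': "\<epsilon>' > 0" "\<epsilon>' \<le> \<epsilon> / 2" "\<epsilon>' \<le> \<eta> / 4" using insert.prems g by (auto simp: \<epsilon>'_def)
  obtain \<tau> s \<gamma> \<delta> where \<tau>: "0 \<le> \<tau>" "\<tau> \<le> \<epsilon>'" "\<gamma> > 0" "\<delta> > 0"
    and s: "\<And>p. norm p \<le> 1 \<Longrightarrow> 1 - \<delta> \<le> rp (d \<cdot> p) \<Longrightarrow>
      norm_deriv d (f + g + \<tau> *\<^sub>R h) - \<gamma> \<le> rp ((f + g + \<tau> *\<^sub>R h) \<cdot> p) \<Longrightarrow> s - \<epsilon>' \<le> rp (h \<cdot> p) \<and> rp (h \<cdot> p) \<le> s + \<epsilon>'"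
    using perturb_one[OF d h(2) \<epsilon>'(1), of "f + g"] by metis
  have nth: "norm (\<tau> *\<^sub>R h) \<le> \<tau>" using h \<tau>(1) mult_left_le[of "norm h" \<tau>] by simp
  define \<eta>' where "\<eta>' = min (min \<gamma> \<delta>) (\<eta> / 2)"
  have \<eta>': "\<eta>' > 0" "\<eta>' \<le> \<gamma>" "\<eta>' \<le> \<delta>" "\<eta>' \<le> \<eta> / 2" using \<tau> g by (auto simp: \<eta>'_def)
  show ?case
  proof (intro bexI[of _ "g + \<tau> *\<^sub>R h"] conjI exI[of _ \<eta>'] exI[of _ "a(h := s)"] ballI allI impI)
    show "g + \<tau> *\<^sub>R h \<in> dual" using g h by (intro dual_add dual_scaleR)
    show "norm (g + \<tau> *\<^sub>R h) \<le> \<epsilon>" using norm_triangle_ineq[of g "\<tau> *\<^sub>R h"] g(2) nth \<tau> \<epsilon>' by linarith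
    show "(g + \<tau> *\<^sub>R h) o\<^sub>L T = g + \<tau> *\<^sub>R h"
    proof (rule blinfun_eqI)
      fix x
      have "g \<cdot> (T \<cdot> x) = g \<cdot> x" "h \<cdot> (T \<cdot> x) = h \<cdot> x"
        using g(3) h(3) by (metis blinfun_apply_blinfun_compose)+
      then show "((g + \<tau> *\<^sub>R h) o\<^sub>L T) \<cdot> x = (g + \<tau> *\<^sub>R h) \<cdot> x"
        by (simp add: blinfun.add_left blinfun.scaleR_left)
    qed
    show "\<eta>' > 0" by (rule \<eta>'(1))
    fix h' p assume h': "h' \<in> insert h H" and p: "norm p \<le> 1" "1 - \<eta>' \<le> rp (d \<cdot> p)"
      "norm_deriv d (f + (g + \<tau> *\<^sub>R h)) - \<eta>' \<le> rp ((f + (g + \<tau> *\<^sub>R h)) \<cdot> p)"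
    show "\<bar>rp (h' \<cdot> p) - (a(h := s)) h'\<bar> \<le> \<epsilon>"
    proof (cases "h' = h")
      case True
      have "s - \<epsilon>' \<le> rp (h \<cdot> p) \<and> rp (h \<cdot> p) \<le> s + \<epsilon>'"
        by (rule s[OF p(1)]) (use p \<eta>' in \<open>simp_all add: add.assoc\<close>)
      then show ?thesis using True \<epsilon>' insert.prems(2) by (simp add: abs_le_iff)
    next
      case False
      then have "h' \<in> H" using h' by simp
      have "rp (h \<cdot> p) \<le> 1" using rp_le_norm[of "h \<cdot> p"] norm_blinfun_le[OF h(2), of p] p(1) by linarith
      then have "\<tau> * rp (h \<cdot> p) \<le> \<tau>" using \<tau>(1) by (rule mult_left_le)
      moreover have "rp ((f + (g + \<tau> *\<^sub>R h)) \<cdot> p) = rp ((f + g) \<cdot> p) + \<tau> * rp (h \<cdot> p)"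
        by (simp add: blinfun.add_left blinfun.scaleR_left)
      moreover have "norm_deriv d (f + g) \<le> norm_deriv d (f + (g + \<tau> *\<^sub>R h)) + \<tau>"
        using norm_deriv_diff_le[OF d, of "f + g" "\<tau> *\<^sub>R h"] nth by (simp add: add.assoc)
      ultimately have "norm_deriv d (f + g) - \<eta> \<le> rp ((f + g) \<cdot> p)"
        using p(3) \<tau>(2) \<epsilon>'(3) \<eta>' by linarith
      then have "\<bar>rp (h' \<cdot> p) - a h'\<bar> \<le> \<epsilon> / 2" using a[OF \<open>h' \<in> H\<close> p(1)] p(2) \<eta>'(1,4) by simp
      then show ?thesis using False insert.prems(2) by simp
    qed
  qed
qed

end

context atomic_sfs
begin

subsection \<open>Extreme points in the closed span of a face\<close>

context
  fixes F z assumes F: "norm_exposed_face F" and z: "ext z" "z \<in> closed_span F"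
begin

lemma diamond_compl_imp_diamond: "b \<in> diamond_compl F \<Longrightarrow> b \<diamondsuit> z"
  using closed_span_diamond[OF F z(2)] diamond_commute by blast

lemma symmetry_sym_at_commute: "symmetry F \<cdot> (sym_at z \<cdot> x) = sym_at z \<cdot> (symmetry F \<cdot> x)"
  by (rule isoinv_sym_at_commute[OF z(1) isoinv_symmetry[OF F]]) (use symmetry_fix[OF F] z in blast)

text \<open>The reflected vector is fixed by the symmetry of \<open>F\<close>, so it splits as a +
  b. Comparing it with its reflection gives |h| = |a| + |b| and |a| = |h| + |b|, so b = 0.\<close>

lemma sym_at_closed_span:
  assumes h: "h \<in> closed_span F"
  shows "sym_at z \<cdot> h \<in> closed_span F"
proof -
  have "symmetry F \<cdot> (sym_at z \<cdot> h) = sym_at z \<cdot> h"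
    using symmetry_sym_at_commute[of h] symmetry_fix[OF F] h by simp
  then have "sym_at z \<cdot> h \<in> {a + b | a b. a \<in> closed_span F \<and> b \<in> diamond_compl F}"
    unfolding fixed_points[OF F, symmetric] by simp
  then obtain a b where ab: "sym_at z \<cdot> h = a + b" "a \<in> closed_span F" "b \<in> diamond_compl F" by blast
  have "h = sym_at z \<cdot> (a + b)" using ab(1) sym_at_sym_at[OF z(1), of h] by simp
  also have "\<dots> = sym_at z \<cdot> a + b"
    using sym_at_diamond[OF z(1) diamond_compl_imp_diamond[OF ab(3)]] by (simp add: blinfun.add_right)
  finally have a: "sym_at z \<cdot> a = h - b" by (simp add: algebra_simps)
  have "norm h = norm a + norm b"
    using diamond_norm_add[OF closed_span_diamond[OF F ab(2,3)]] ab(1) norm_sym_at[OF z(1), of h] by simp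
  moreover have "norm a = norm h + norm b"
    using closed_span_diamond[OF F h ab(3)] a norm_sym_at[OF z(1), of a] by (simp add: diamond_def)
  ultimately have "b = 0" by simp
  then show ?thesis using ab by simp
qed

lemma sym_at_peirce2: "sym_at z \<cdot> (peirce2 F \<cdot> x) = peirce2 F \<cdot> (sym_at z \<cdot> x)"
proof -
  have "(1/2) *\<^sub>R (sym_at z \<cdot> x + symmetry F \<cdot> (sym_at z \<cdot> x)) = sym_at z \<cdot> ((1/2) *\<^sub>R (x + symmetry F \<cdot> x))"
    by (simp add: symmetry_sym_at_commute blinfun.scaleR_right blinfun.add_right)
  also have "\<dots> = sym_at z \<cdot> (peirce2 F \<cdot> x) + peirce0 F \<cdot> x"
    unfolding half_sum_symmetry[OF F]
    using sym_at_diamond[OF z(1) diamond_compl_imp_diamond[OF peirce_mem(2)[OF F]]]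
    by (simp add: blinfun.add_right)
  finally show ?thesis
    using peirce_unique(1)[OF F sym_at_closed_span[OF peirce_mem(1)[OF F]] peirce_mem(2)[OF F]] by simp
qed

lemma tri_peirce2: "tri z \<cdot> (peirce2 F \<cdot> x) = tri z \<cdot> x"
proof -
  have "tri z \<cdot> (symmetry F \<cdot> x) = tri z \<cdot> x"
    by (rule tri_isoinv[OF z(1) isoinv_symmetry[OF F]]) (use symmetry_fix[OF F] z in blast)
  then have "tri z \<cdot> ((1/2) *\<^sub>R (x + symmetry F \<cdot> x)) = tri z \<cdot> x"
    by (simp add: blinfun.scaleR_right blinfun.add_right flip: scaleR_2)
  then show ?thesis
    unfolding half_sum_symmetry[OF F]
    using tri_diamond[OF z(1) diamond_compl_imp_diamond[OF peirce_mem(2)[OF F]]] by (simp add: blinfun.add_right)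
qed

lemma perp_peirce2: "perp z \<cdot> (peirce2 F \<cdot> x) = peirce2 F \<cdot> (perp z \<cdot> x)"
proof -
  have perp: "perp z \<cdot> y = (1/2) *\<^sub>R (y + sym_at z \<cdot> y) - scale (tri z \<cdot> y) z" for y
    using half_sum_sym_at[OF z(1), of y] by simp
  show ?thesis
    unfolding perp by (simp add: blinfun.diff_right blinfun.scaleR_right blinfun.add_right sym_at_peirce2 tri_peirce2
        klinearD[OF klinear_peirce(1)[OF F]] peirce_closed_span(1)[OF F z(2)])
qed

end

section \<open>An estimate for two orthogonal extreme points near a face\<close>

lemma rp_mult_le:
  fixes u v :: 'k
  assumes "norm (u - of_real (rp u)) \<le> \<omega>" "norm (v - of_real (rp v)) \<le> 1" "0 \<le> \<omega>"
  shows "rp (u * v) \<le> rp u * rp v + \<omega>"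
proof -
  have "u * v = of_real (rp u * rp v) + (of_real (rp u) * (v - of_real (rp v)) + of_real (rp v) * (u - of_real (rp u)) +
      (u - of_real (rp u)) * (v - of_real (rp v)))"
    by (simp add: algebra_simps)
  then have "rp (u * v) = rp (of_real (rp u * rp v) + (of_real (rp u) * (v - of_real (rp v)) +
      of_real (rp v) * (u - of_real (rp u)) + (u - of_real (rp u)) * (v - of_real (rp v))))" by (rule arg_cong)
  also have "\<dots> = rp u * rp v + rp ((u - of_real (rp u)) * (v - of_real (rp v)))"
    by (simp only: rp_add rp_of_real_mult rp_of_real rp_diff)  simp
  also have "rp ((u - of_real (rp u)) * (v - of_real (rp v))) \<le> norm (u - of_real (rp u)) * norm (v - of_real (rp v))"
    using rp_le_norm by (metis norm_mult)
  also have "\<dots> \<le> \<omega> * 1" using assms by (intro mult_mono) auto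
  finally show ?thesis by simp
qed

text \<open>The average of \<open>x\<close>, its two reflections and its double reflection is v_z(x)
  z + v_w(x) w + q. There \<open>f\<close> is at most about 3 s/4, since one of the four points is
  \<open>x\<close> itself, where \<open>f\<close> is small. Computed from the three terms it is
  nearly s, up to a multiple of 1 - v_z(x) - v_w(x). So that difference cannot be small.\<close>

lemma diamond_pair_estimate:
  assumes d: "d \<in> dual" "norm d \<le> 1" and x: "norm x \<le> 1" "d \<cdot> x = 1"
    and zw: "near d \<delta> z" "near d \<delta> w" "w \<diamondsuit> z" and \<omega>: "0 < \<omega>" "\<omega> \<le> 1" "\<delta> \<le> \<omega> ^ 4 / 100"
    and f: "f \<in> dual" "norm f \<le> B" "rp (f \<cdot> x) \<le> \<epsilon>"
    and upper: "\<And>p. norm p \<le> 1 \<Longrightarrow> 1 - 2 * \<delta> \<le> rp (d \<cdot> p) \<Longrightarrow> rp (f \<cdot> p) \<le> s + \<gamma>"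
    and top: "s - \<gamma> \<le> rp (f \<cdot> z)" "s - \<gamma> \<le> rp (f \<cdot> w)" and \<gamma>: "0 \<le> \<gamma>" "\<gamma> \<le> s"
  shows "s / 4 \<le> 2 * B * (1 - (rp (tri z \<cdot> x) + rp (tri w \<cdot> x))) + 2 * \<gamma> + 4 * \<omega> * B + \<epsilon> / 4"
proof -
  have ext: "ext z" "ext w" using zw by (auto simp: near_def)
  have \<delta>: "0 \<le> \<delta>" by (rule near_nonneg[OF zw(1)])
  have wz: "z \<diamondsuit> w" using zw(3) diamond_commute by blast
  have dx: "dcone d 0 x" using x by (simp add: dcone_def)
  note [simp] = norm_sym_at[OF ext(1)] norm_sym_at[OF ext(2)] norm_ext[OF ext(1)] norm_ext[OF ext(2)]
  have fB: "norm (f \<cdot> p) \<le> B * norm p" for p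
    using norm_blinfun[of f p] mult_right_mono[OF f(2), of "norm p"] by simp
  have B: "0 \<le> B" using f(2) norm_ge_zero[of f] by linarith
  define q where "q = perp z \<cdot> (perp w \<cdot> x)"
  define Ez where "Ez y = (1/2) *\<^sub>R (y + sym_at z \<cdot> y)" for y
  have "Ez ((1/2) *\<^sub>R (x + sym_at w \<cdot> x)) = Ez (scale (tri w \<cdot> x) w + perp w \<cdot> x)"
    by (simp add: half_sum_sym_at[OF ext(2)])
  also have "\<dots> = scale (tri z \<cdot> (perp w \<cdot> x)) z + (scale (tri w \<cdot> x) w + q)"
    unfolding Ez_def half_sum_sym_at[OF ext(1)] q_def
    by (simp add: blinfun.add_right dualD[OF tri_dual[OF ext(1)]] tri_diamond[OF ext(1) zw(3)]
        klinearD[OF klinear_perp[OF ext(1)]] perp_of_diamond[OF ext(1) zw(3)] algebra_simps)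
  also have "tri z \<cdot> (perp w \<cdot> x) = tri z \<cdot> x" by (rule tri_sym_at_orth(2)[OF ext zw(3)])
  finally have EE: "(1/4) *\<^sub>R ((x + sym_at w \<cdot> x) + (sym_at z \<cdot> x + sym_at z \<cdot> (sym_at w \<cdot> x))) =
      scale (tri z \<cdot> x) z + (scale (tri w \<cdot> x) w + q)"
    by (simp add: Ez_def blinfun.add_right blinfun.scaleR_right scaleR_add_right)
  have wx: "1 - \<delta> \<le> rp (d \<cdot> (sym_at w \<cdot> x))" and zx: "1 - \<delta> \<le> rp (d \<cdot> (sym_at z \<cdot> x))"
    using near_sym_at[OF zw(2) x(1)] near_sym_at[OF zw(1) x(1)] x(2) by (simp_all add: abs_le_iff)
  have zwx: "1 - 2 * \<delta> \<le> rp (d \<cdot> (sym_at z \<cdot> (sym_at w \<cdot> x)))"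
    using near_sym_at[OF zw(1), of "sym_at w \<cdot> x"] x wx by (simp add: abs_le_iff)
  have "rp (f \<cdot> ((1/4) *\<^sub>R ((x + sym_at w \<cdot> x) + (sym_at z \<cdot> x + sym_at z \<cdot> (sym_at w \<cdot> x))))) =
      (rp (f \<cdot> x) + rp (f \<cdot> (sym_at w \<cdot> x)) + rp (f \<cdot> (sym_at z \<cdot> x)) + rp (f \<cdot> (sym_at z \<cdot> (sym_at w \<cdot> x)))) / 4"
    by (simp add: blinfun.add_right blinfun.scaleR_right)
  also have "\<dots> \<le> (\<epsilon> + (s + \<gamma>) + (s + \<gamma>) + (s + \<gamma>)) / 4"
    using upper[of "sym_at w \<cdot> x"] upper[of "sym_at z \<cdot> x"] upper[of "sym_at z \<cdot> (sym_at w \<cdot> x)"] x wx zx zwx \<delta> f(3)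
    by simp
  finally have up: "rp (f \<cdot> scale (tri z \<cdot> x) z) + rp (f \<cdot> scale (tri w \<cdot> x) w) + rp (f \<cdot> q) \<le> (\<epsilon> + 3 * (s + \<gamma>)) / 4"
    unfolding EE by (simp add: blinfun.add_right)
  \<comment> \<open>The coefficient is almost real and almost nonnegative; its imaginary part and a
    possible negative real part cost at most \<omega> B each.\<close>
  have low: "rp (tri y \<cdot> x) * (s - \<gamma>) - 2 * \<omega> * B \<le> rp (f \<cdot> scale (tri y \<cdot> x) y)"
    if y: "near d \<delta> y" "s - \<gamma> \<le> rp (f \<cdot> y)" for y
  proof -
    have ey: "ext y" using y by (simp add: near_def)
    define v b where "v = tri y \<cdot> x" and "b = rp v"
    have fy: "norm (f \<cdot> y) \<le> B" using fB[of y] norm_ext[OF ey] by simp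
    have v: "norm v - \<omega> \<le> b" "norm (v - of_real b) \<le> \<omega>"
      unfolding v_def b_def by (rule near_dcone[OF d y(1) dx \<omega>]; use \<omega> in simp)+
    have "v * (f \<cdot> y) = of_real b * (f \<cdot> y) + (v - of_real b) * (f \<cdot> y)" by (simp add: algebra_simps)
    then have eq: "rp (f \<cdot> scale v y) = b * rp (f \<cdot> y) + rp ((v - of_real b) * (f \<cdot> y))"
      unfolding dualD[OF f(1)] by (metis rp_add rp_of_real_mult)
    have "\<bar>rp ((v - of_real b) * (f \<cdot> y))\<bar> \<le> norm (v - of_real b) * norm (f \<cdot> y)"
      using abs_rp_le_norm by (metis norm_mult)
    also have "\<dots> \<le> \<omega> * B" using v(2) fy \<omega> by (intro mult_mono) auto
    finally have err: "- (\<omega> * B) \<le> rp ((v - of_real b) * (f \<cdot> y))" by (simp add: abs_le_iff)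
    have "b * (s - \<gamma>) - \<omega> * B \<le> b * rp (f \<cdot> y)"
    proof (cases "b \<ge> 0")
      case True
      then have "b * (s - \<gamma>) \<le> b * rp (f \<cdot> y)" using y(2) by (intro mult_left_mono) auto
      then show ?thesis using \<omega>(1) B mult_nonneg_nonneg[of \<omega> B] by linarith
    next
      case False
      then have "b * (s - \<gamma>) \<le> 0" using \<gamma> by (simp add: mult_nonpos_nonneg)
      moreover have "- b * rp (f \<cdot> y) \<le> \<omega> * B"
      proof (rule mult_mono)
        show "- b \<le> \<omega>" using v(1) norm_ge_zero[of v] by linarith
        show "rp (f \<cdot> y) \<le> B" using fy rp_le_norm[of "f \<cdot> y"] by linarith
      qed (use \<omega> y(2) \<gamma> in auto)
      ultimately show ?thesis by simp
    qed
    then show ?thesis using err eq unfolding v_def[symmetric] b_def[symmetric] by linarith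
  qed
  define b b' where "b = rp (tri z \<cdot> x)" and "b' = rp (tri w \<cdot> x)"
  have nq: "norm q \<le> 1 - (b + b')"
    using norm_tri_two[OF ext zw(3), of x] x(1) rp_le_norm[of "tri z \<cdot> x"] rp_le_norm[of "tri w \<cdot> x"]
    unfolding q_def b_def b'_def by linarith
  have b1: "0 \<le> 1 - (b + b')" using nq norm_ge_zero order_trans by blast
  have "B * norm q \<le> B * (1 - (b + b'))" using nq B by (rule mult_left_mono)
  then have fq: "- (B * (1 - (b + b'))) \<le> rp (f \<cdot> q)"
    using fB[of q] abs_rp_le_norm[of "f \<cdot> q"] by (simp add: abs_le_iff)
  have sB: "s - \<gamma> \<le> B" using top(1) rp_le_norm[of "f \<cdot> z"] fB[of z] by simp
  have "b * (s - \<gamma>) - 2 * \<omega> * B + (b' * (s - \<gamma>) - 2 * \<omega> * B) - B * (1 - (b + b')) \<le> (\<epsilon> + 3 * (s + \<gamma>)) / 4"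
    using low[OF zw(1) top(1)] low[OF zw(2) top(2)] up fq unfolding b_def b'_def by linarith
  moreover have "b * (s - \<gamma>) + b' * (s - \<gamma>) = (s - \<gamma>) - (1 - (b + b')) * (s - \<gamma>)" by (simp add: algebra_simps)
  moreover have "(1 - (b + b')) * (s - \<gamma>) \<le> (1 - (b + b')) * B" using sB b1 by (rule mult_left_mono)
  ultimately have "s / 4 \<le> (1 - (b + b')) * B + B * (1 - (b + b')) + 2 * \<gamma> + 4 * \<omega> * B + \<epsilon> / 4" using \<gamma> by argo
  then show ?thesis unfolding b_def b'_def by (simp add: mult.commute mult.left_commute)
qed

section \<open>Finite orthogonal families of extreme points\<close>

definition part :: "'z set \<Rightarrow> 'z \<Rightarrow>\<^sub>L 'k" where
  "part A = (\<Sum>x\<in>A. tri x)"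

definition orthogonal_family :: "'z set \<Rightarrow> bool" where
  "orthogonal_family A \<longleftrightarrow> pairwise (\<diamondsuit>) A \<and> (\<forall>x\<in>A. ext x)"

lemma orthogonal_family_subset: "orthogonal_family A \<Longrightarrow> B \<subseteq> A \<Longrightarrow> orthogonal_family B"
  using pairwise_subset by (auto simp: orthogonal_family_def)

lemma orthogonal_family_tri:
  assumes "orthogonal_family A" "x \<in> A" "y \<in> A"
  shows "tri x \<cdot> y = (if x = y then 1 else 0)"
  using assms by (auto simp: orthogonal_family_def pairwise_def intro: tri_diamond tri_self)

lemma part_apply: "finite A \<Longrightarrow> part A \<cdot> p = (\<Sum>x\<in>A. tri x \<cdot> p)"
  unfolding part_def by (induction A rule: finite_induct) (simp_all add: blinfun.zero_left blinfun.add_left)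

text \<open>The points are peeled off one at a time: \<open>perp x\<close> does not change the
  coefficients along the other points. The remainder \<open>q\<close> is what survives all the
  projections, and its norm is paid from the same budget.\<close>

lemma family_split:
  assumes "finite A" "orthogonal_family A"
  shows "\<exists>q. (\<Sum>x\<in>A. norm (tri x \<cdot> p)) + norm q \<le> norm p \<and>
    (\<forall>g\<in>dual. norm g \<le> 1 \<longrightarrow> (\<forall>x\<in>A. g \<cdot> x = 1) \<longrightarrow> g \<cdot> p = part A \<cdot> p + g \<cdot> q)"
  using assms
proof (induction A arbitrary: p rule: finite_induct)
  case empty
  then show ?case by (intro exI[of _ p]) (simp add: part_def blinfun.zero_left)
next
  case (insert x A)
  have x: "ext x" using insert.prems by (simp add: orthogonal_family_def)
  have A: "orthogonal_family A" by (rule orthogonal_family_subset[OF insert.prems]) blast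
  have tri: "tri y \<cdot> (perp x \<cdot> p) = tri y \<cdot> p" if "y \<in> A" for y
  proof (rule tri_sym_at_orth(2)[OF _ x])
    show "ext y" "x \<diamondsuit> y" using insert that by (auto simp: orthogonal_family_def pairwise_def)
  qed
  obtain q where q: "(\<Sum>y\<in>A. norm (tri y \<cdot> (perp x \<cdot> p))) + norm q \<le> norm (perp x \<cdot> p)"
    "\<forall>g\<in>dual. norm g \<le> 1 \<longrightarrow> (\<forall>x\<in>A. g \<cdot> x = 1) \<longrightarrow> g \<cdot> (perp x \<cdot> p) = part A \<cdot> (perp x \<cdot> p) + g \<cdot> q"
    using insert.IH[OF A, of "perp x \<cdot> p"] by (elim exE conjE)
  have "part A \<cdot> (perp x \<cdot> p) = part A \<cdot> p" unfolding part_apply[OF insert.hyps(1)] using tri by simp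
  then have "g \<cdot> p = part (insert x A) \<cdot> p + g \<cdot> q"
    if "g \<in> dual" "norm g \<le> 1" "\<forall>x\<in>insert x A. g \<cdot> x = 1" for g
    using dual_tri_perp[OF x that(1,2), of p] q(2) that insert.hyps by (simp add: part_def blinfun.add_left)
  moreover have "(\<Sum>y\<in>insert x A. norm (tri y \<cdot> p)) + norm q \<le> norm p"
    using q(1) tri norm_tri_perp[OF x, of p] insert.hyps by simp
  ultimately show ?case by blast
qed

lemma sum_norm_tri_le:
  assumes "finite A" "orthogonal_family A"
  shows "(\<Sum>x\<in>A. norm (tri x \<cdot> p)) \<le> norm p"
  using family_split[OF assms, of p]
proof (elim exE conjE)
  fix q assume "(\<Sum>x\<in>A. norm (tri x \<cdot> p)) + norm q \<le> norm p"
  then show ?thesis using norm_ge_zero[of q] by linarith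
qed

lemma
  assumes A: "finite A" "orthogonal_family A"
  shows part_dual: "part A \<in> dual" and norm_part_le: "norm (part A) \<le> 1"
    and rp_part_le: "rp (part A \<cdot> p) \<le> norm p"
proof -
  show "part A \<in> dual" unfolding part_def using A by (intro dual_sum tri_dual) (auto simp: orthogonal_family_def)
  have le: "norm (part A \<cdot> p) \<le> norm p" for p
    unfolding part_apply[OF A(1)] using norm_sum sum_norm_tri_le[OF A] by (rule order_trans)
  then show "norm (part A) \<le> 1" by (intro norm_blinfun_bound) simp_all
  show "rp (part A \<cdot> p) \<le> norm p" using le[of p] rp_le_norm[of "part A \<cdot> p"] by linarith
qed

lemma part_family:
  assumes "orthogonal_family X" "finite A" "A \<subseteq> X" "x \<in> X"
  shows "part A \<cdot> x = (if x \<in> A then 1 else 0)"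
proof -
  have "part A \<cdot> x = (\<Sum>x'\<in>A. if x' = x then 1 else 0)"
    unfolding part_apply[OF assms(2)] using orthogonal_family_tri[OF assms(1)] assms(3,4) by (intro sum.cong refl) auto
  then show ?thesis using assms(2) by simp
qed

end

subsection \<open>Averaging operators on the span of a face\<close>

text \<open>\<open>average\<close> says that (I + R)/2 differs from the partial expansion along
  \<open>A\<close> by at most the norm not yet accounted for. \<open>X_diamond\<close> and
  \<open>smooth\<close> are the form in which distributivity enters; \<open>exhaust\<close> says
  that the coefficients of a point of the face sum to one.\<close>

locale face_averaging = atomic_sfs scale
  for scale :: "'k::real_or_complex \<Rightarrow> 'z::real_normed_vector \<Rightarrow> 'z" +
  fixes d :: "'z \<Rightarrow>\<^sub>L 'k" and R :: "'z \<Rightarrow>\<^sub>L 'z" and X :: "'z set"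
  assumes tripotent_d: "geometric_tripotent d"
    and X_def: "X = {x \<in> face d. x extreme_point_of cball 0 1}"
    and X_diamond: "pairwise (\<diamondsuit>) X"
    and klinear_R: "klinear R"
    and norm_R_le: "p \<in> closed_span (face d) \<Longrightarrow> norm (R \<cdot> p) \<le> norm p"
    and d_R: "p \<in> closed_span (face d) \<Longrightarrow> d \<cdot> (R \<cdot> p) = d \<cdot> p"
    and average: "finite A \<Longrightarrow> A \<subseteq> X \<Longrightarrow> p \<in> closed_span (face d) \<Longrightarrow>
      norm ((1/2) *\<^sub>R (p + R \<cdot> p) - (\<Sum>x\<in>A. scale (tri x \<cdot> p) x)) \<le> norm p - (\<Sum>x\<in>A. norm (tri x \<cdot> p))"
    and exhaust: "y \<in> face d \<Longrightarrow> \<epsilon> > 0 \<Longrightarrow> \<exists>A. finite A \<and> A \<subseteq> X \<and> 1 - \<epsilon> \<le> (\<Sum>x\<in>A. rp (tri x \<cdot> y))"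
    and smooth: "g \<in> dual \<Longrightarrow> norm g \<le> 1 \<Longrightarrow> y \<in> face d \<Longrightarrow> g \<cdot> y = 1 \<Longrightarrow> x \<in> X \<Longrightarrow> tri x \<cdot> y \<noteq> 0 \<Longrightarrow> g \<cdot> x = 1"
begin

abbreviation V where "V \<equiv> closed_span (face d)"
abbreviation proj where "proj \<equiv> peirce2 (face d)"

lemmas exposed_d = exposed_face_tripotent[OF tripotent_d]

lemma dual_d: "d \<in> dual" and norm_d: "norm d = 1" and d_proj: "d \<cdot> (proj \<cdot> x) = d \<cdot> x"
  by (rule tripotentD[OF tripotent_d])+

lemma
  assumes "x \<in> X"
  shows X_ext: "ext x" and X_span: "x \<in> V" and d_X: "d \<cdot> x = 1"
  using assms face_subset_closed_span[OF exposed_d] by (auto simp: X_def mem_face)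

lemma X_near: "x \<in> X \<Longrightarrow> near d 0 x"
proof -
  assume x: "x \<in> X"
  have "d o\<^sub>L sym_at x = d"
    by (rule blinfun_eqI) (simp add: dual_sym_at[OF X_ext[OF x] dual_d _ d_X[OF x]] norm_d)
  then show ?thesis using x by (simp add: near_def X_ext d_X)
qed

lemma X_family: "orthogonal_family X"
  using X_diamond X_ext by (simp add: orthogonal_family_def)

lemmas X_subset = orthogonal_family_subset[OF X_family]

text \<open>Take A = {x} in \<open>average\<close>: the norm left over is zero.\<close>

lemma R_X: "x \<in> X \<Longrightarrow> R \<cdot> x = x"
proof -
  assume x: "x \<in> X"
  then have "norm ((1/2) *\<^sub>R (x + R \<cdot> x) - x) \<le> 0"
    using average[of "{x}" x] X_span[OF x] norm_ext[OF X_ext[OF x]] tri_self[OF X_ext[OF x]] by simp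
  then have "(1/2) *\<^sub>R (x + R \<cdot> x) = x" by simp
  then have "2 *\<^sub>R ((1/2) *\<^sub>R (x + R \<cdot> x)) = 2 *\<^sub>R x" by simp
  then show ?thesis by (simp add: scaleR_2)
qed

lemma part_proj:
  assumes "finite A" "A \<subseteq> X"
  shows "part A \<cdot> (proj \<cdot> p) = part A \<cdot> p"
  unfolding part_apply[OF assms(1)] using assms X_ext X_span
  by (intro sum.cong refl) (simp add: tri_peirce2[OF exposed_d] subset_iff)

text \<open>Take half the difference of \<open>h\<close> and its composition with \<open>R\<close>,
  where \<open>h\<close> norms y - R y: it vanishes at the points fixed by \<open>R\<close>, in
  particular on \<open>X\<close>. Since \<open>R\<close> is controlled on \<open>V\<close> only,
  \<open>proj\<close> is applied first.\<close>

lemma ex_functional: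
  assumes y: "y \<in> face d" "R \<cdot> y \<noteq> y"
  obtains f where "f \<in> dual" "norm f \<le> 1" "f o\<^sub>L proj = f" "rp (f \<cdot> y) > 0" "\<And>x. x \<in> X \<Longrightarrow> f \<cdot> x = 0"
proof -
  have yV: "y \<in> V" using y face_subset_closed_span[OF exposed_d] by blast
  note kp = klinear_peirce(1)[OF exposed_d]
  obtain h where h: "h \<in> dual" "norm h \<le> 1" "h \<cdot> (y - R \<cdot> y) = of_real (norm (y - R \<cdot> y))"
    by (rule ex_dual_norming)
  define f where "f = (1/2) *\<^sub>R ((h o\<^sub>L proj) - ((h o\<^sub>L R) o\<^sub>L proj))"
  have f: "f \<cdot> x = (1/2) *\<^sub>R (h \<cdot> (proj \<cdot> x) - h \<cdot> (R \<cdot> (proj \<cdot> x)))" for x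
    by (simp add: f_def blinfun.scaleR_left blinfun.diff_left)
  have pV: "proj \<cdot> x = x" if "x \<in> V" for x by (rule peirce_closed_span(1)[OF exposed_d that])
  show thesis
  proof
    show "f \<in> dual" unfolding f_def by (intro dual_scaleR dual_diff dual_comp h kp klinear_R)
    show "norm f \<le> 1"
    proof (rule norm_blinfun_bound)
      fix x
      have 1: "norm (h \<cdot> (proj \<cdot> x)) \<le> norm x"
        using norm_blinfun_le[OF h(2)] norm_peirce2_le[OF exposed_d] by (rule order_trans)
      have 2: "norm (h \<cdot> (R \<cdot> (proj \<cdot> x))) \<le> norm x"
        using norm_blinfun_le[OF h(2)] order_trans[OF norm_R_le[OF peirce_mem(1)[OF exposed_d]] norm_peirce2_le[OF exposed_d]]
        by (rule order_trans)
      have "norm (f \<cdot> x) \<le> (norm (h \<cdot> (proj \<cdot> x)) + norm (h \<cdot> (R \<cdot> (proj \<cdot> x)))) / 2"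
        unfolding f using norm_triangle_ineq4[of "h \<cdot> (proj \<cdot> x)"] by simp
      also have "\<dots> \<le> (norm x + norm x) / 2"
        using add_mono[OF 1 2] by simp
      finally show "norm (f \<cdot> x) \<le> 1 * norm x" by simp
    qed simp
    show "f o\<^sub>L proj = f"
      by (rule blinfun_eqI) (simp add: f pV[OF peirce_mem(1)[OF exposed_d]])
    have "f \<cdot> y = (1/2) *\<^sub>R (h \<cdot> (y - R \<cdot> y))" by (simp add: f pV[OF yV] blinfun.diff_right)
    then show "rp (f \<cdot> y) > 0" using y(2) by (simp add: h(3))
    show "f \<cdot> x = 0" if "x \<in> X" for x by (simp add: f pV[OF X_span[OF that]] R_X[OF that])
  qed
qed

text \<open>With \<tau> = d - part A, the quantity
  \<open>norm_deriv d (f - m *\<^sub>R \<tau>)\<close> is at most 1 for m = 1 and stays above c/2 up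
  to m = 2^J, so some doubling of \<open>m\<close> lowers it by at most 1/J. A near maximizer for
  \<open>M\<close> cannot then do much better for M/2, and this caps M \<tau>.\<close>

lemma ex_concentrated:
  assumes f: "f \<in> dual" "norm f \<le> 1" and y: "y \<in> face d" "c = rp (f \<cdot> y)" "c > 0" and \<eta>: "\<eta> > 0"
  obtains A M \<gamma> where "finite A" "A \<subseteq> X" "2 \<le> M" "\<gamma> > 0"
    "c / 2 \<le> norm_deriv d (f - M *\<^sub>R (d - part A))"
    "\<And>p. norm p \<le> 1 \<Longrightarrow> 1 - \<gamma> \<le> rp (d \<cdot> p) \<Longrightarrow>
      norm_deriv d (f - M *\<^sub>R (d - part A)) - \<gamma> \<le> rp ((f - M *\<^sub>R (d - part A)) \<cdot> p) \<Longrightarrow> M * rp ((d - part A) \<cdot> p) \<le> \<eta>"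
proof -
  obtain J :: nat where J: "J > 0" "1 / real J < \<eta> / 4"
  proof -
    obtain n :: nat where n: "4 / \<eta> < real n" using reals_Archimedean2 by blast
    have "0 < 4 / \<eta>" using \<eta> by simp
    then have "n > 0" using n by (metis less_trans of_nat_0_less_iff)
    moreover have "1 / real n < \<eta> / 4" using n \<eta> \<open>n > 0\<close> by (simp add: field_simps)
    ultimately show ?thesis using that by blast
  qed
  \<comment> \<open>\<open>A\<close> is chosen after \<open>J\<close>: even the largest multiple 2^J
    of \<tau> takes at most c/2 away from the value c at \<open>y\<close>.\<close>
  have "c / (2 * 2 ^ J) > 0" using y(3) by simp
  then obtain A where A: "finite A" "A \<subseteq> X" "1 - c / (2 * 2 ^ J) \<le> (\<Sum>x\<in>A. rp (tri x \<cdot> y))"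
    using exhaust[OF y(1)] by meson
  define \<tau> where "\<tau> = d - part A"
  define \<phi> where "\<phi> m = norm_deriv d (f - m *\<^sub>R \<tau>)" for m
  have neg: "norm_deriv d (- (m *\<^sub>R \<tau>)) \<le> 0" if "m > 0" for m
  proof -
    have "norm (d + (1 / m) *\<^sub>R (- (m *\<^sub>R \<tau>))) \<le> 1" using that norm_part_le[OF A(1) X_subset[OF A(2)]] by (simp add: \<tau>_def)
    then have "slope d (- (m *\<^sub>R \<tau>)) (1 / m) \<le> 0" using that by (simp add: slope_def mult_nonpos_nonneg)
    then show ?thesis using norm_deriv_le[OF norm_d, of "1 / m" "- (m *\<^sub>R \<tau>)"] that by simp
  qed
  have \<phi>1: "\<phi> 1 \<le> 1"
  proof -
    have "\<phi> 1 \<le> norm_deriv d f + norm_deriv d (- (1 *\<^sub>R \<tau>))"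
      using norm_deriv_add[OF norm_d, of f "- (1 *\<^sub>R \<tau>)"] by (simp add: \<phi>_def)
    then show ?thesis using neg[of 1] abs_norm_deriv_le[OF norm_d, of f] f(2) by simp
  qed
  have ty: "rp (\<tau> \<cdot> y) \<le> c / (2 * 2 ^ J)"
    using A(3) y(1) by (simp add: \<tau>_def blinfun.diff_left part_apply[OF A(1)] rp_sum mem_face)
  have low: "c / 2 \<le> \<phi> m" if "0 \<le> m" "m \<le> 2 ^ J" for m
  proof -
    have "m * rp (\<tau> \<cdot> y) \<le> m * (c / (2 * 2 ^ J))" using ty that(1) by (rule mult_left_mono)
    also have "\<dots> \<le> 2 ^ J * (c / (2 * 2 ^ J))" using that(2) y(3) by (intro mult_right_mono) auto
    also have "\<dots> = c / 2" by simp
    finally have "c / 2 \<le> rp ((f - m *\<^sub>R \<tau>) \<cdot> y)" using y(2) by (simp add: blinfun.diff_left blinfun.scaleR_left)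
    also have "\<dots> \<le> \<phi> m" unfolding \<phi>_def by (rule rp_le_norm_deriv_face[OF norm_d y(1)])
    finally show ?thesis .
  qed
  have "\<exists>j<J. \<phi> (2 ^ j) - \<phi> (2 ^ Suc j) \<le> 1 / real J"
  proof (rule ccontr)
    assume "\<not> ?thesis"
    then have "(\<Sum>j<J. 1 / real J) < (\<Sum>j<J. \<phi> (2 ^ j) - \<phi> (2 ^ Suc j))"
      using J(1) by (intro sum_strict_mono) (auto simp: lessThan_empty_iff not_le)
    also have "\<dots> = \<phi> (2 ^ 0) - \<phi> (2 ^ J)" by (rule sum_lessThan_telescope')
    also have "\<dots> \<le> 1" using \<phi>1 low[of "2 ^ J"] y(3) by simp
    finally show False using J(1) by simp
  qed
  then obtain j where j: "j < J" "\<phi> (2 ^ j) - \<phi> (2 ^ Suc j) \<le> 1 / real J" by blast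
  define M :: real where "M = 2 ^ Suc j"
  have M: "2 \<le> M" "M \<le> 2 ^ J" "2 ^ j = M / 2" unfolding M_def using j(1) by (simp, intro power_increasing, auto)
  have "\<eta> / 8 > 0" using \<eta> by simp
  then obtain \<delta> where \<delta>: "\<delta> > 0" "\<And>p. norm p \<le> 1 \<Longrightarrow> 1 - \<delta> \<le> rp (d \<cdot> p) \<Longrightarrow> rp ((f - (M / 2) *\<^sub>R \<tau>) \<cdot> p) \<le> \<phi> (M / 2) + \<eta> / 8"
    using rp_le_norm_deriv[OF norm_d, of "\<eta> / 8" "f - (M / 2) *\<^sub>R \<tau>"] unfolding \<phi>_def by metis
  show ?thesis
  proof (rule that[OF A(1,2) M(1), of "min \<delta> (\<eta> / 8)"])
    show "min \<delta> (\<eta> / 8) > 0" using \<delta> \<eta> by simp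
    show "c / 2 \<le> norm_deriv d (f - M *\<^sub>R (d - part A))" using low[of M] M by (simp add: \<phi>_def \<tau>_def)
    fix p assume p: "norm p \<le> 1" "1 - min \<delta> (\<eta> / 8) \<le> rp (d \<cdot> p)"
      "norm_deriv d (f - M *\<^sub>R (d - part A)) - min \<delta> (\<eta> / 8) \<le> rp ((f - M *\<^sub>R (d - part A)) \<cdot> p)"
    have "\<phi> M - \<eta> / 8 \<le> rp (f \<cdot> p) - M * rp (\<tau> \<cdot> p)"
      using p(3) by (simp add: \<phi>_def \<tau>_def blinfun.diff_left blinfun.scaleR_left)
    moreover have "rp (f \<cdot> p) - M / 2 * rp (\<tau> \<cdot> p) \<le> \<phi> (M / 2) + \<eta> / 8"
      using \<delta>(2)[OF p(1)] p(2) by (simp add: blinfun.diff_left blinfun.scaleR_left)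
    moreover have "\<phi> (M / 2) - \<phi> M \<le> 1 / real J" using j(2) unfolding M(3) M_def[symmetric] .
    ultimately show "M * rp ((d - part A) \<cdot> p) \<le> \<eta>" using J(2) unfolding \<tau>_def[symmetric] by linarith
  qed
qed


text \<open>Apply \<open>tri z\<close> to (z + R z)/2, expanded along \<open>A\<close>. The left
  side has real part at least about 1/2, because R z is again almost in the cone of
  \<open>d\<close>; the remainder is small, because the coefficients of \<open>z\<close> along
  \<open>A\<close> nearly sum to one.\<close>

lemma average_estimate:
  assumes z: "near d \<delta> z" "z \<in> V" and A: "finite A" "A \<subseteq> X" and \<theta>: "rp ((d - part A) \<cdot> z) \<le> \<theta>"
    and \<omega>: "0 < \<omega>" "\<omega> \<le> 1" "\<delta> \<le> \<omega> ^ 4 / 100"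
  shows "1 - \<omega> \<le> 2 * (\<Sum>x\<in>A. rp (tri x \<cdot> z) * rp (tri z \<cdot> x)) + 2 * (real (card A) * \<omega>) + 2 * (\<delta> + \<theta>)"
proof -
  have d1: "norm d \<le> 1" using norm_d by simp
  have ez: "ext z" and dz: "1 - \<delta> \<le> rp (d \<cdot> z)" using z by (auto simp: near_def)
  have \<delta>: "0 \<le> \<delta>" by (rule near_nonneg[OF z(1)])
  have \<delta>4: "\<delta> \<le> \<omega> ^ 4 / 25" using \<omega>(1,3) zero_le_power[of \<omega> 4] by linarith
  have nz: "norm z = 1" by (rule norm_ext[OF ez])
  have "dcone d \<delta> (R \<cdot> z)" using norm_R_le[OF z(2)] d_R[OF z(2)] dz nz by (simp add: dcone_def)
  from near_dcone(1)[OF dual_d d1 z(1) this \<omega>(1,2,3) \<delta>4]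
  have Rz: "- \<omega> \<le> rp (tri z \<cdot> (R \<cdot> z))" using norm_ge_zero[of "tri z \<cdot> (R \<cdot> z)"] by linarith
  define r where "r = (1/2) *\<^sub>R (z + R \<cdot> z) - (\<Sum>x\<in>A. scale (tri x \<cdot> z) x)"
  have "norm r \<le> 1 - (\<Sum>x\<in>A. norm (tri x \<cdot> z))" using average[OF A z(2)] nz by (simp add: r_def)
  also have "\<dots> \<le> 1 - (\<Sum>x\<in>A. rp (tri x \<cdot> z))" by (simp add: sum_mono rp_le_norm)
  also have "\<dots> = 1 - rp (d \<cdot> z) + rp ((d - part A) \<cdot> z)"
    by (simp add: blinfun.diff_left part_apply[OF A(1)] rp_sum)
  also have "\<dots> \<le> \<delta> + \<theta>" using dz \<theta> by linarith
  finally have r: "rp (tri z \<cdot> r) \<le> \<delta> + \<theta>"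
    using norm_tri_le[OF ez, of r] rp_le_norm[of "tri z \<cdot> r"] by linarith
  have "(1/2) *\<^sub>R (z + R \<cdot> z) = (\<Sum>x\<in>A. scale (tri x \<cdot> z) x) + r" by (simp add: r_def)
  then have "tri z \<cdot> ((1/2) *\<^sub>R (z + R \<cdot> z)) = tri z \<cdot> ((\<Sum>x\<in>A. scale (tri x \<cdot> z) x) + r)" by (rule arg_cong)
  then have "(1/2) *\<^sub>R (1 + tri z \<cdot> (R \<cdot> z)) = (\<Sum>x\<in>A. tri x \<cdot> z * (tri z \<cdot> x)) + tri z \<cdot> r"
    by (simp add: blinfun.scaleR_right blinfun.add_right blinfun.sum_right tri_self[OF ez] dualD[OF tri_dual[OF ez]])
  then have "rp ((1/2) *\<^sub>R (1 + tri z \<cdot> (R \<cdot> z))) = rp ((\<Sum>x\<in>A. tri x \<cdot> z * (tri z \<cdot> x)) + tri z \<cdot> r)" by (rule arg_cong)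
  then have "(1/2) * (1 + rp (tri z \<cdot> (R \<cdot> z))) = (\<Sum>x\<in>A. rp (tri x \<cdot> z * (tri z \<cdot> x))) + rp (tri z \<cdot> r)"
    by (simp add: rp_sum)
  moreover have "(\<Sum>x\<in>A. rp (tri x \<cdot> z * (tri z \<cdot> x))) \<le> (\<Sum>x\<in>A. rp (tri x \<cdot> z) * rp (tri z \<cdot> x) + \<omega>)"
  proof (rule sum_mono)
    fix x assume "x \<in> A"
    then have x: "x \<in> X" using A by blast
    have zc: "dcone d \<delta> z" using dz nz by (simp add: dcone_def)
    have "norm (tri x \<cdot> z - of_real (rp (tri x \<cdot> z))) \<le> \<omega>"
      by (rule near_dcone(2)[OF dual_d d1 near_mono[OF X_near[OF x] \<delta>] zc \<omega>(1,2,3) \<delta>4])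
    moreover have "dcone d 0 x" using norm_ext[OF X_ext[OF x]] d_X[OF x] by (simp add: dcone_def)
    then have "norm (tri z \<cdot> x - of_real (rp (tri z \<cdot> x))) \<le> \<omega>"
      by (rule near_dcone(2)[OF dual_d d1 z(1) _ \<omega>]) (use \<omega> in simp)
    ultimately show "rp (tri x \<cdot> z * (tri z \<cdot> x)) \<le> rp (tri x \<cdot> z) * rp (tri z \<cdot> x) + \<omega>"
      using \<omega> by (intro rp_mult_le) auto
  qed
  ultimately show ?thesis using Rz r by (simp add: sum.distrib)
qed

definition separated :: "('z \<Rightarrow>\<^sub>L 'k) \<Rightarrow> real \<Rightarrow> bool" where
  "separated f \<eta> \<longleftrightarrow> (\<forall>z w. near d \<eta> z \<longrightarrow> near d \<eta> w \<longrightarrow> z \<in> V \<longrightarrow> w \<in> V \<longrightarrow> w \<diamondsuit> z \<longrightarrow>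
      norm_deriv d f - \<eta> \<le> rp (f \<cdot> z) \<longrightarrow> norm_deriv d f - \<eta> \<le> rp (f \<cdot> w) \<longrightarrow> False)"

lemma ex_separated:
  assumes y: "y \<in> face d" "R \<cdot> y \<noteq> y"
  obtains f \<eta> where "f \<in> dual" "f o\<^sub>L proj = f" "\<eta> > 0" "\<And>x. x \<in> X \<Longrightarrow> rp (f \<cdot> x) < norm_deriv d f"
    "separated f \<eta>"
proof -
  obtain f1 where f1: "f1 \<in> dual" "norm f1 \<le> 1" "f1 o\<^sub>L proj = f1" "rp (f1 \<cdot> y) > 0" "\<And>x. x \<in> X \<Longrightarrow> f1 \<cdot> x = 0"
    using ex_functional[OF y] by metis
  define c where "c = rp (f1 \<cdot> y)"
  have c: "0 < c" "c \<le> 1"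
    using f1(4) rp_le_norm[of "f1 \<cdot> y"] norm_blinfun_le[OF f1(2), of y] y(1) by (auto simp: c_def mem_face)
  \<comment> \<open>4608 = 32 * 144: with \<sigma> = c/(144 M) below, the bound c/4608 on M (d -
    part A) becomes \<sigma>/32 for d - part A.\<close>
  have "c / 4608 > 0" using c by simp
  then obtain A M \<gamma>c where A: "finite A" "A \<subseteq> X" and M: "2 \<le> M" and \<gamma>c: "\<gamma>c > 0"
    "c / 2 \<le> norm_deriv d (f1 - M *\<^sub>R (d - part A))"
    and conc: "\<And>p. norm p \<le> 1 \<Longrightarrow> 1 - \<gamma>c \<le> rp (d \<cdot> p) \<Longrightarrow>
      norm_deriv d (f1 - M *\<^sub>R (d - part A)) - \<gamma>c \<le> rp ((f1 - M *\<^sub>R (d - part A)) \<cdot> p) \<Longrightarrow> M * rp ((d - part A) \<cdot> p) \<le> c / 4608"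
    using ex_concentrated[OF f1(1,2) y(1) c_def c(1)] by blast
  define \<tau> where "\<tau> = d - part A"
  define f2 where "f2 = f1 - M *\<^sub>R \<tau>"
  define n where "n = real (card A)"
  have n: "0 \<le> n" by (simp add: n_def)
  \<comment> \<open>\<open>f\<close> will have norm at most 3 M and derivative at least c/3, so the
    pair estimate reads c/12 \<le> 6 M (1 - v_z(x) - v_w(x)) + errors; 6 M \<sigma> is half of
    c/12.\<close>
  define \<sigma> where "\<sigma> = c / (144 * M)"
  have \<sigma>: "0 < \<sigma>" "\<sigma> \<le> 1" "M * \<sigma> = c / 144" using c M by (auto simp: \<sigma>_def field_simps)
  have \<tau>_dual: "\<tau> \<in> dual" unfolding \<tau>_def by (intro dual_diff dual_d part_dual A(1) X_subset A(2))
  have f2_proj: "f2 \<cdot> (proj \<cdot> x) = f2 \<cdot> x" for x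
  proof -
    have "f1 \<cdot> (proj \<cdot> x) = f1 \<cdot> x" using f1(3) by (metis blinfun_apply_blinfun_compose)
    then show ?thesis by (simp add: f2_def \<tau>_def blinfun.diff_left blinfun.scaleR_left d_proj part_proj[OF A])
  qed
  \<comment> \<open>The oscillation of the coefficients will be summed over \<open>A\<close>, hence
    the division by n + 1.\<close>
  define e where "e = min (min (c / 100) (\<sigma> / (8 * (n + 1)))) (\<gamma>c / 4)"
  have e: "0 < e" "e \<le> c / 100" "e \<le> \<sigma> / (8 * (n + 1))" "e \<le> \<gamma>c / 4"
    using c \<sigma> \<gamma>c n unfolding e_def by (simp, simp_all only: min_le_iff_disj order_refl simp_thms)
  have e_n: "8 * n * e \<le> \<sigma>"
  proof -
    have "8 * n * e \<le> 8 * (n + 1) * e" using e(1) n by (intro mult_right_mono) auto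
    also have "\<dots> \<le> 8 * (n + 1) * (\<sigma> / (8 * (n + 1)))" using e(3) n by (intro mult_left_mono) auto
    also have "\<dots> = \<sigma>" using n by (simp add: field_simps)
    finally show ?thesis .
  qed
  have H: "h \<in> dual \<and> norm h \<le> 1 \<and> h o\<^sub>L proj = h" if h: "h \<in> tri ` A" for h
  proof -
    obtain x where x: "x \<in> A" "h = tri x" using h by blast
    then have "x \<in> X" using A by blast
    then show ?thesis unfolding x(2) using tri_dual[OF X_ext] norm_tri[OF X_ext] tri_peirce2[OF exposed_d X_ext X_span]
      by (auto intro!: blinfun_eqI)
  qed
  have "finite (tri ` A)" using A by simp
  from perturb[OF norm_d this H e(1), of f2]
  obtain g where g_all: "g \<in> dual" "norm g \<le> e \<and> g o\<^sub>L proj = g \<and> (\<exists>\<eta>>0. \<exists>a. \<forall>h\<in>tri ` A. \<forall>p. norm p \<le> 1 \<longrightarrow>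
      1 - \<eta> \<le> rp (d \<cdot> p) \<longrightarrow> norm_deriv d (f2 + g) - \<eta> \<le> rp ((f2 + g) \<cdot> p) \<longrightarrow> \<bar>rp (h \<cdot> p) - a h\<bar> \<le> e)"
    by (rule bexE)
  then have g: "g \<in> dual" "norm g \<le> e" "g o\<^sub>L proj = g" by simp_all
  obtain \<eta>p where \<eta>p_all: "\<eta>p > 0 \<and> (\<exists>a. \<forall>h\<in>tri ` A. \<forall>p. norm p \<le> 1 \<longrightarrow>
      1 - \<eta>p \<le> rp (d \<cdot> p) \<longrightarrow> norm_deriv d (f2 + g) - \<eta>p \<le> rp ((f2 + g) \<cdot> p) \<longrightarrow> \<bar>rp (h \<cdot> p) - a h\<bar> \<le> e)"
    using conjunct2[OF conjunct2[OF g_all(2)]] by (rule exE)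
  note \<eta>p = conjunct1[OF \<eta>p_all]
  obtain a where osc: "\<forall>h\<in>tri ` A. \<forall>p. norm p \<le> 1 \<longrightarrow>
      1 - \<eta>p \<le> rp (d \<cdot> p) \<longrightarrow> norm_deriv d (f2 + g) - \<eta>p \<le> rp ((f2 + g) \<cdot> p) \<longrightarrow> \<bar>rp (h \<cdot> p) - a h\<bar> \<le> e"
    using conjunct2[OF \<eta>p_all] by (rule exE)
  define f where "f = f2 + g"
  define s where "s = norm_deriv d f"
  have f: "f \<in> dual" unfolding f_def f2_def by (intro dual_add dual_diff dual_scaleR f1 \<tau>_dual g)
  have f_proj: "f o\<^sub>L proj = f"
  proof (rule blinfun_eqI)
    fix x
    have "g \<cdot> (proj \<cdot> x) = g \<cdot> x" using g(3) by (metis blinfun_apply_blinfun_compose)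
    then show "(f o\<^sub>L proj) \<cdot> x = f \<cdot> x" by (simp add: f_def blinfun.add_left f2_proj)
  qed
  have gp: "\<bar>rp (g \<cdot> p)\<bar> \<le> e" if "norm p \<le> 1" for p
  proof -
    have "\<bar>rp (g \<cdot> p)\<bar> \<le> norm g * norm p" using abs_rp_le_norm norm_blinfun by (rule order_trans)
    also have "\<dots> \<le> e * 1" using g(2) that e(1) by (intro mult_mono) auto
    finally show ?thesis by simp
  qed
  have s_f2: "norm_deriv d f2 - e \<le> s"
    using norm_deriv_diff_le[OF norm_d, of f2 g] g(2) unfolding s_def f_def by linarith
  then have s: "c / 3 \<le> s" using \<gamma>c(2) e(2) c unfolding f2_def \<tau>_def by linarith
  have f_norm: "norm f \<le> 3 * M"
  proof -
    have "norm \<tau> \<le> 2" unfolding \<tau>_def using norm_triangle_ineq4[of d "part A"] norm_part_le[OF A(1) X_subset[OF A(2)]] norm_d by linarith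
    then have "norm (M *\<^sub>R \<tau>) \<le> M * 2" using M by (simp add: mult_left_mono)
    then show ?thesis
      using norm_triangle_ineq[of f2 g] norm_triangle_ineq4[of f1 "M *\<^sub>R \<tau>"] f1(2) g(2) e(2) c(2) M unfolding f_def f2_def
      by linarith
  qed
  \<comment> \<open>At points of \<open>A\<close> the subtracted term vanishes, at the other points
    of \<open>X\<close> it contributes -M; in both cases only the perturbation can be
    positive.\<close>
  have fx: "rp (f \<cdot> x) \<le> e" if x: "x \<in> X" for x
    using gp[of x] norm_ext[OF X_ext[OF x]] M f1(5)[OF x]
    by (simp add: f_def f2_def \<tau>_def blinfun.add_left blinfun.diff_left blinfun.scaleR_left part_family[OF X_family A x] d_X[OF x] abs_le_iff)
  define \<omega> where "\<omega> = min 1 (min (c / (1000 * M)) (\<sigma> / (100 * (n + 1))))"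
  have \<omega>: "0 < \<omega>" "\<omega> \<le> 1" "\<omega> \<le> c / (1000 * M)" "\<omega> \<le> \<sigma> / (100 * (n + 1))"
    using c M \<sigma> n unfolding \<omega>_def by (simp, simp_all only: min_le_iff_disj order_refl simp_thms)
  have \<omega>M: "\<omega> * M \<le> c / 1000" using \<omega>(3) M by (simp add: field_simps)
  have \<omega>n: "100 * (n + 1) * \<omega> \<le> \<sigma>" using \<omega>(4) n by (simp add: field_simps)
  define \<gamma> where "\<gamma> = min (c / 1000) (min \<eta>p (\<gamma>c / 2))"
  have \<gamma>: "0 < \<gamma>" "\<gamma> \<le> c / 1000" "\<gamma> \<le> \<eta>p" "\<gamma> \<le> \<gamma>c / 2"
    using c \<eta>p \<gamma>c(1) unfolding \<gamma>_def by (simp, simp_all only: min_le_iff_disj order_refl simp_thms)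
  obtain \<delta>u where \<delta>u: "\<delta>u > 0" "\<And>p. norm p \<le> 1 \<Longrightarrow> 1 - \<delta>u \<le> rp (d \<cdot> p) \<Longrightarrow> rp (f \<cdot> p) \<le> s + \<gamma>"
    using rp_le_norm_deriv[OF norm_d \<gamma>(1), of f] unfolding s_def by metis
  define \<delta> where "\<delta> = min (\<omega> ^ 4 / 100) (min (\<delta>u / 2) (min \<eta>p \<gamma>c))"
  have \<delta>: "0 < \<delta>" "\<delta> \<le> \<omega> ^ 4 / 100" "2 * \<delta> \<le> \<delta>u" "\<delta> \<le> \<eta>p" "\<delta> \<le> \<gamma>c"
    using \<omega>(1) \<delta>u(1) \<eta>p \<gamma>c(1) unfolding \<delta>_def by (simp_all add: min_def)
  have \<delta>\<omega>: "\<delta> \<le> \<omega>"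
    using \<delta>(2) power_decreasing[of 1 4 \<omega>] \<omega>(1,2) by simp
  show thesis
  proof (rule that[OF f f_proj, of "min \<gamma> \<delta>"])
    show "min \<gamma> \<delta> > 0" using \<gamma> \<delta> by simp
    show "rp (f \<cdot> x) < norm_deriv d f" if "x \<in> X" for x
      using fx[OF that] s e(2) c unfolding s_def by linarith
    show "separated f (min \<gamma> \<delta>)"
      unfolding separated_def
    proof (intro allI impI)
      fix z w assume near: "near d (min \<gamma> \<delta>) z" "near d (min \<gamma> \<delta>) w" and V: "z \<in> V" "w \<in> V" and wz: "w \<diamondsuit> z"
        and top: "norm_deriv d f - min \<gamma> \<delta> \<le> rp (f \<cdot> z)" "norm_deriv d f - min \<gamma> \<delta> \<le> rp (f \<cdot> w)"
      have nr: "near d \<delta> z" "near d \<delta> w" using near by (auto intro: near_mono)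
      have top': "s - \<gamma> \<le> rp (f \<cdot> z)" "s - \<gamma> \<le> rp (f \<cdot> w)" using top unfolding s_def by linarith+
      define \<theta> where "\<theta> = \<sigma> / 32"
      have d1: "norm d \<le> 1" using norm_d by simp
      have conc': "rp (\<tau> \<cdot> p) \<le> \<theta>" and osc': "x \<in> A \<Longrightarrow> \<bar>rp (tri x \<cdot> p) - a (tri x)\<bar> \<le> e"
        if p: "near d \<delta> p" "s - \<gamma> \<le> rp (f \<cdot> p)" for p x
      proof -
        have p1: "norm p \<le> 1" "1 - \<delta> \<le> rp (d \<cdot> p)" using p norm_ext[of p] by (auto simp: near_def)
        have "rp (f \<cdot> p) = rp (f2 \<cdot> p) + rp (g \<cdot> p)" by (simp add: f_def blinfun.add_left)
        then have "norm_deriv d f2 - \<gamma>c \<le> rp (f2 \<cdot> p)"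
          using p(2) gp[OF p1(1)] s_f2 e(4) \<gamma>(4) \<gamma>c(1) by (simp add: abs_le_iff)
        then have "M * rp (\<tau> \<cdot> p) \<le> c / 4608"
          using conc[OF p1(1)] p1(2) \<delta>(5) unfolding f2_def \<tau>_def by simp
        also have "\<dots> = M * \<theta>" using \<sigma>(3) by (simp add: \<theta>_def)
        finally show "rp (\<tau> \<cdot> p) \<le> \<theta>" using M by simp
        show "\<bar>rp (tri x \<cdot> p) - a (tri x)\<bar> \<le> e" if "x \<in> A"
          using osc[rule_format, of "tri x" p] that p1 p(2) \<delta>(4) \<gamma>(3) unfolding f_def[symmetric] s_def[symmetric] by simp
      qed
      have \<beta>: "rp (tri z \<cdot> x) + rp (tri w \<cdot> x) \<le> 1 - \<sigma>" if "x \<in> A" for x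
      proof -
        have x: "x \<in> X" using that A by blast
        have "s / 4 \<le> 2 * (3 * M) * (1 - (rp (tri z \<cdot> x) + rp (tri w \<cdot> x))) + 2 * \<gamma> + 4 * \<omega> * (3 * M) + e / 4"
        proof (rule diamond_pair_estimate[OF dual_d d1 _ d_X[OF x] nr wz \<omega>(1,2) \<delta>(2) f f_norm fx[OF x] _ top'])
          show "rp (f \<cdot> p) \<le> s + \<gamma>" if "norm p \<le> 1" "1 - 2 * \<delta> \<le> rp (d \<cdot> p)" for p
            using \<delta>u(2)[OF that(1)] that(2) \<delta>(3) by linarith
        qed (use norm_ext[OF X_ext[OF x]] \<gamma> s c in auto)
        then have "6 * (M * \<sigma>) \<le> 6 * (M * (1 - (rp (tri z \<cdot> x) + rp (tri w \<cdot> x))))"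
          using s \<gamma>(2) \<omega>M e(2) c unfolding \<sigma>(3) by (simp add: algebra_simps)
        then have "\<sigma> \<le> 1 - (rp (tri z \<cdot> x) + rp (tri w \<cdot> x))" using M by simp
        then show ?thesis by linarith
      qed
      \<comment> \<open>Replace v_x(w) by v_x(z), from which it differs by at most 2 e, and use
        v_z(x) + v_w(x) \<le> 1 - \<sigma>. The factor v_x(z) may be negative, but only by
        \<omega>.\<close>
      have cross: "rp (tri x \<cdot> z) * rp (tri z \<cdot> x) + rp (tri x \<cdot> w) * rp (tri w \<cdot> x) \<le>
          (1 - \<sigma>) * rp (tri x \<cdot> z) + (3 * \<omega> + 2 * e)" if xA: "x \<in> A" for x
      proof -
        have x: "x \<in> X" using xA A by blast
        have ext: "ext z" "ext w" using nr by (auto simp: near_def)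
        define u u' b b' where "u = rp (tri x \<cdot> z)" and "u' = rp (tri x \<cdot> w)" and "b = rp (tri z \<cdot> x)" and "b' = rp (tri w \<cdot> x)"
        have b: "\<bar>b\<bar> \<le> 1" "\<bar>b'\<bar> \<le> 1"
          using abs_rp_le_norm[of "tri z \<cdot> x"] abs_rp_le_norm[of "tri w \<cdot> x"] norm_tri_le[OF ext(1), of x]
            norm_tri_le[OF ext(2), of x] norm_ext[OF X_ext[OF x]] unfolding b_def b'_def by linarith+
        have zc: "dcone d \<delta> z" using nr(1) norm_ext[OF ext(1)] by (simp add: dcone_def near_def)
        have "- \<omega> \<le> u"
          using near_dcone(1)[OF dual_d d1 near_mono[OF X_near[OF x]] zc \<omega>(1,2) \<delta>(2)] \<delta>(1,2) zero_le_power[of \<omega> 4] \<omega>(1)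
            norm_ge_zero[of "tri x \<cdot> z"] unfolding u_def by linarith
        moreover have "0 \<le> 1 - \<sigma> - (b + b')" "1 - \<sigma> - (b + b') \<le> 3"
          using \<beta>[OF xA] b \<sigma>(1) unfolding b_def b'_def by (simp_all add: abs_le_iff)
        ultimately have "- \<omega> * 3 \<le> u * (1 - \<sigma> - (b + b'))"
        proof -
          have "0 \<le> (u + \<omega>) * (1 - \<sigma> - (b + b'))" using \<open>- \<omega> \<le> u\<close> \<open>0 \<le> 1 - \<sigma> - (b + b')\<close> by simp
          moreover have "\<omega> * (1 - \<sigma> - (b + b')) \<le> \<omega> * 3" using \<open>1 - \<sigma> - (b + b') \<le> 3\<close> \<omega>(1) by (intro mult_left_mono) auto
          ultimately show ?thesis by (simp add: distrib_right)
        qed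
        moreover have "(u' - u) * b' \<le> 2 * e"
        proof -
          have "\<bar>(u' - u) * b'\<bar> \<le> (2 * e) * 1" unfolding abs_mult
            using osc'[OF nr(1) top'(1) xA] osc'[OF nr(2) top'(2) xA] b e(1) unfolding u_def u'_def
            by (intro mult_mono) (auto simp: abs_le_iff)
          then show ?thesis by simp
        qed
        moreover have "u * b + u' * b' = (1 - \<sigma>) * u - u * (1 - \<sigma> - (b + b')) + (u' - u) * b'" by (simp add: algebra_simps)
        ultimately show ?thesis unfolding u_def[symmetric] u'_def[symmetric] b_def[symmetric] b'_def[symmetric] by linarith
      qed
      define S S' where "S = (\<Sum>x\<in>A. rp (tri x \<cdot> z) * rp (tri z \<cdot> x))" and "S' = (\<Sum>x\<in>A. rp (tri x \<cdot> w) * rp (tri w \<cdot> x))"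
      \<comment> \<open>The two lower bounds of about 1/2 add up to about 1, whereas summing
        \<open>cross\<close> leaves at most about 1 - \<sigma>.\<close>
      have 1: "1 - \<omega> \<le> S + S' + 2 * (n * \<omega>) + 2 * (\<delta> + \<theta>)"
        using average_estimate[OF nr(1) V(1) A conc'[OF nr(1) top'(1), unfolded \<tau>_def] \<omega>(1,2) \<delta>(2)]
          average_estimate[OF nr(2) V(2) A conc'[OF nr(2) top'(2), unfolded \<tau>_def] \<omega>(1,2) \<delta>(2)]
        unfolding n_def[symmetric] S_def[symmetric] S'_def[symmetric] by linarith
      have "S + S' = (\<Sum>x\<in>A. rp (tri x \<cdot> z) * rp (tri z \<cdot> x) + rp (tri x \<cdot> w) * rp (tri w \<cdot> x))"
        unfolding S_def S'_def by (rule sum.distrib[symmetric])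
      also have "\<dots> \<le> (\<Sum>x\<in>A. (1 - \<sigma>) * rp (tri x \<cdot> z) + (3 * \<omega> + 2 * e))"
        by (rule sum_mono) (rule cross)
      also have "\<dots> = (\<Sum>x\<in>A. (1 - \<sigma>) * rp (tri x \<cdot> z)) + n * (3 * \<omega> + 2 * e)"
        by (subst sum.distrib) (simp add: n_def)
      also have "(\<Sum>x\<in>A. (1 - \<sigma>) * rp (tri x \<cdot> z)) = (1 - \<sigma>) * rp (part A \<cdot> z)"
        unfolding part_apply[OF A(1)] rp_sum by (rule sum_distrib_left[symmetric])
      finally have 2: "S + S' \<le> (1 - \<sigma>) * rp (part A \<cdot> z) + n * (3 * \<omega> + 2 * e)" .
      have "rp (part A \<cdot> z) \<le> 1"
        using rp_part_le[OF A(1) X_subset[OF A(2)], of z] nr(1) norm_ext[of z] by (simp add: near_def)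
      then have "(1 - \<sigma>) * rp (part A \<cdot> z) \<le> (1 - \<sigma>) * 1" using \<sigma>(2) by (intro mult_left_mono) auto
      moreover have "n * (3 * \<omega> + 2 * e) = 3 * (n * \<omega>) + 2 * (n * e)" by (simp add: algebra_simps)
      ultimately have "\<sigma> \<le> \<omega> + 5 * (n * \<omega>) + 2 * \<delta> + 2 * (n * e) + 2 * \<theta>" using 1 2 by argo
      moreover have "100 * (n * \<omega>) + 100 * \<omega> \<le> \<sigma>" using \<omega>n by (simp only: distrib_right distrib_left mult.assoc mult_1 mult_1_right)
      moreover have "8 * (n * e) \<le> \<sigma>" using e_n by (simp only: mult.assoc)
      moreover have "0 \<le> n * \<omega>" using n \<omega>(1) by simp
      ultimately show False using \<sigma>(1) \<delta>\<omega> \<omega>(1) unfolding \<theta>_def by linarith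
    qed
  qed
qed

end

section \<open>Compactness of nested sequences of extreme points\<close>

context atomic_sfs
begin

text \<open>In an \<epsilon>-separated subsequence the chain argument would find two consecutive
  points whose coefficients along each other are both nearly one, and by \<open>ext_close\<close>
  such points are closer than \<epsilon>. So the sequence is totally bounded.\<close>

lemma convergent_subsequence:
  assumes d: "d \<in> dual" "norm d \<le> 1" and near: "\<And>\<delta>. \<delta> > 0 \<Longrightarrow> \<forall>\<^sub>F k in sequentially. near d \<delta> (z k)"
    and nested: "\<And>\<delta>. \<delta> > 0 \<Longrightarrow> \<exists>K. \<forall>i\<ge>K. \<forall>j>i. 1 - \<delta> \<le> rp (tri (z i) \<cdot> z j)"
  obtains l r where "strict_mono (r :: nat \<Rightarrow> nat)" "(z \<circ> r) \<longlonglongrightarrow> l"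
proof -
  have separated: False if \<epsilon>: "\<epsilon> > 0" and r: "strict_mono (r :: nat \<Rightarrow> nat)"
    and sep: "\<And>i j. i < j \<Longrightarrow> \<epsilon> \<le> dist (z (r i)) (z (r j))" for \<epsilon> r
  proof -
    obtain n :: nat where n: "2 / \<epsilon> < real n" using reals_Archimedean2 by blast
    moreover have "0 < 2 / \<epsilon>" using \<epsilon> by simp
    ultimately have n0: "n > 0" by (metis less_trans of_nat_0_less_iff)
    have n1: "1 / real n < \<epsilon> / 2" using n \<epsilon> n0 by (simp add: field_simps)
    \<comment> \<open>\<open>n\<close> and \<open>e\<close> bring the bound of
      \<open>ext_close\<close> below \<epsilon>. Then \<omega> and \<open>L\<close> are such that 8
      \<omega> and 4/(L - 1) are at most e^2/50 each, together the tolerance e^2/25 of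
      \<open>sym_at_approx\<close>.\<close>
    define e where "e = min 1 (\<epsilon> / (2 * (1 + 2 * real n)))"
    have e: "0 < e" "e \<le> 1" "e + 2 * real n * e \<le> \<epsilon> / 2"
    proof -
      show "0 < e" "e \<le> 1" using \<epsilon> by (auto simp: e_def add_pos_nonneg)
      have "e \<le> \<epsilon> / (2 * (1 + 2 * real n))" by (simp add: e_def)
      moreover have "0 < 1 + 2 * real n" by (simp add: add_pos_nonneg)
      ultimately have "e * (1 + 2 * real n) \<le> \<epsilon> / 2" by (simp add: field_simps)
      then show "e + 2 * real n * e \<le> \<epsilon> / 2" by (simp add: algebra_simps)
    qed
    define \<omega> where "\<omega> = e\<^sup>2 / 400"
    have \<omega>: "0 < \<omega>" "\<omega> \<le> 1" using e power_le_one[of e 2] by (auto simp: \<omega>_def)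
    obtain L0 :: nat where L0: "200 / e\<^sup>2 < real L0" using reals_Archimedean2 by blast
    define L where "L = L0 + 2"
    have L: "L \<ge> 2" "4 / (real L - 1) \<le> e\<^sup>2 / 50"
    proof -
      show "L \<ge> 2" by (simp add: L_def)
      have "200 / e\<^sup>2 < real L - 1" using L0 by (simp add: L_def)
      then show "4 / (real L - 1) \<le> e\<^sup>2 / 50" using e(1) by (simp add: L_def field_simps)
    qed
    have "\<omega> ^ 4 / 100 > 0" "\<omega>\<^sup>2 / 25 > 0" using \<omega> by simp_all
    then obtain K1 K2 where K1: "\<And>k. k \<ge> K1 \<Longrightarrow> near d (\<omega> ^ 4 / 100) (z k)"
      and K2: "\<And>i j. i \<ge> K2 \<Longrightarrow> i < j \<Longrightarrow> 1 - \<omega>\<^sup>2 / 25 \<le> rp (tri (z i) \<cdot> z j)"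
      using near nested unfolding eventually_sequentially by metis
    define K where "K = max K1 K2"
    define u where "u i = z (r (K + i))" for i
    have rK: "K \<le> r (K + i)" for i using seq_suble[OF r, of "K + i"] by linarith
    have u_near: "near d (\<omega> ^ 4 / 100) (u i)" for i unfolding u_def by (rule K1) (use rK[of i] in \<open>simp add: K_def\<close>)
    have u_nested: "1 - \<omega>\<^sup>2 / 25 \<le> rp (tri (u i) \<cdot> u j)" if "i < j" for i j
      unfolding u_def by (rule K2) (use rK[of i] strict_monoD[OF r, of "K + i" "K + j"] that in \<open>simp_all add: K_def\<close>)
    obtain i where i: "1 - (4 / (real L - 1) + 8 * \<omega>) \<le> rp (tri (u (Suc i)) \<cdot> u i)"
      by (rule nested_chain[OF d u_near u_nested \<omega> order_refl _ order_refl L(1)]) (use \<omega> in auto)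
    have ext: "ext (u i)" "ext (u (Suc i))" using u_near by (auto simp: near_def)
    have bwd: "1 - e\<^sup>2 / 25 \<le> rp (tri (u (Suc i)) \<cdot> u i)"
      using i L(2) by (simp add: \<omega>_def)
    have fwd: "1 - e\<^sup>2 / 25 \<le> rp (tri (u i) \<cdot> u (Suc i))"
    proof -
      have "\<omega>\<^sup>2 \<le> \<omega>" using \<omega> power_decreasing[of 1 2 \<omega>] by simp
      also have "\<dots> \<le> e\<^sup>2" by (simp add: \<omega>_def)
      finally show ?thesis using u_nested[of i "Suc i"] by simp
    qed
    have "norm (u (Suc i) - u i) \<le> 1 / real n + e + 2 * real n * e"
      by (rule ext_close[OF ext n0 sym_at_approx(2)[OF ext(1) _ fwd] sym_at_approx(2)[OF ext(2) _ bwd]])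
        (use e norm_ext[OF ext(1)] norm_ext[OF ext(2)] in auto)
    then have "dist (u i) (u (Suc i)) < \<epsilon>" using n1 e(3) by (simp add: dist_norm norm_minus_commute)
    then show False using sep[of "K + i" "K + Suc i"] by (simp add: u_def)
  qed
  have tb: "\<exists>k. finite k \<and> range z \<subseteq> (\<Union>x\<in>k. ball x \<epsilon>)" if \<epsilon>: "\<epsilon> > 0" for \<epsilon>
  proof (rule ccontr)
    assume no: "\<not> ?thesis"
    have "\<exists>k. \<forall>i\<le>N. \<epsilon> \<le> dist (z i) (z k)" for N
    proof -
      have "\<not> range z \<subseteq> (\<Union>x\<in>z ` {..N}. ball x \<epsilon>)" using no by blast
      then obtain k where "z k \<notin> (\<Union>x\<in>z ` {..N}. ball x \<epsilon>)" by blast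
      then show ?thesis by (intro exI[of _ k]) (auto simp: not_less)
    qed
    then obtain nxt where nxt: "\<And>N i. i \<le> N \<Longrightarrow> \<epsilon> \<le> dist (z i) (z (nxt N))" by metis
    have nxt_gt: "N < nxt N" for N using nxt[of "nxt N" N] \<epsilon> by (cases "nxt N \<le> N") auto
    define r where "r n = (nxt ^^ n) 0" for n
    have r: "strict_mono r" unfolding strict_mono_Suc_iff using nxt_gt by (simp add: r_def)
    show False
    proof (rule separated[OF \<epsilon> r])
      fix i j :: nat assume "i < j"
      then obtain m where m: "j = Suc m" "i \<le> m" by (cases j) auto
      have "r i \<le> r m" using m(2) strict_mono_less_eq[OF r] by blast
      then show "\<epsilon> \<le> dist (z (r i)) (z (r j))" using nxt by (simp add: m(1) r_def)
    qed
  qed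
  have "compact (closure (range z))"
    unfolding compact_eq_totally_bounded
  proof (intro conjI allI impI)
    show "complete (closure (range z))"
      by (rule complete_closed_subset[OF closed_closure subset_UNIV complete_space])
    fix \<epsilon> :: real assume "\<epsilon> > 0"
    then obtain k where k: "finite k" "range z \<subseteq> (\<Union>x\<in>k. ball x (\<epsilon> / 2))" using tb[of "\<epsilon> / 2"] by auto
    have "closed (\<Union>x\<in>k. cball x (\<epsilon> / 2))" using k(1) by (intro closed_UN) auto
    moreover have "range z \<subseteq> (\<Union>x\<in>k. cball x (\<epsilon> / 2))" using k(2) ball_subset_cball by blast
    ultimately have "closure (range z) \<subseteq> (\<Union>x\<in>k. cball x (\<epsilon> / 2))" by (rule closure_minimal[rotated])
    also have "\<dots> \<subseteq> (\<Union>x\<in>k. ball x \<epsilon>)" using \<open>\<epsilon> > 0\<close> by auto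
    finally show "\<exists>k. finite k \<and> closure (range z) \<subseteq> (\<Union>x\<in>k. ball x \<epsilon>)" using k(1) by blast
  qed
  then have sc: "seq_compact (closure (range z))" by (simp add: compact_eq_seq_compact_metric)
  have "z n \<in> closure (range z)" for n using closure_subset[of "range z"] by (meson rangeI subsetD)
  then show ?thesis using seq_compactE[OF sc, of z] that by metis
qed

end

section \<open>Approximating extreme points and their limit\<close>

context face_averaging
begin

text \<open>
  The exposed extreme points given by Bishop--Phelps for \<open>d + t f\<close> approximate, as \<open>t\<close> tends to
  \<open>0\<close>, the near maximizers of \<open>f\<close> on the face. Since no two orthogonal extreme points are near
  maximizers, \<open>g\<close> stays away from its norm on the part orthogonal to \<open>z\<close>.
\<close>

definition approximant :: "('z \<Rightarrow>\<^sub>L 'k) \<Rightarrow> real \<Rightarrow> real \<Rightarrow> real \<Rightarrow> ('z \<Rightarrow>\<^sub>L 'k) \<Rightarrow> 'z \<Rightarrow> bool" where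
  "approximant f C \<eta> t g z \<longleftrightarrow> near d (C * t) z \<and> z \<in> V \<and> norm_deriv d f - 2 * t \<le> rp (f \<cdot> z) \<and>
     norm (g - (d + t *\<^sub>R f)) \<le> t\<^sup>2 \<and>
     (\<forall>x. g \<cdot> x = of_real (norm g) * tri z \<cdot> x + g \<cdot> (perp z \<cdot> x)) \<and>
     \<eta> / 2 * t \<le> norm g \<and>
     (\<forall>q\<in>V. q \<diamondsuit> z \<longrightarrow> rp (g \<cdot> q) \<le> (norm g - \<eta> / 2 * t) * norm q)"

text \<open>Bishop--Phelps inside \<open>V\<close> gives \<open>g\<close> and \<open>z\<close>. If
  the last clause failed, \<open>g\<close> would nearly attain its norm on the part of
  \<open>V\<close> orthogonal to \<open>z\<close>; a second application there produces an extreme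
  point orthogonal to \<open>z\<close> that is also a near maximizer, against
  \<open>separated\<close>.\<close>

lemma ex_approximant:
  assumes f: "f \<in> dual" "f o\<^sub>L proj = f" and \<eta>: "\<eta> > 0"
    and sep: "separated f \<eta>"
    and C: "C = 2 * norm f + 4 + \<eta>"
  obtains t0 where "0 < t0" "t0 \<le> 1 / 4" "\<And>t. 0 < t \<Longrightarrow> t \<le> t0 \<Longrightarrow> \<exists>g z. approximant f C \<eta> t g z"
proof -
  define F where "F = norm f"
  have F: "0 \<le> F" by (simp add: F_def)
  have C4: "C = 2 * F + 4 + \<eta>" using C by (simp add: F_def)
  have C0: "C > 0" using C4 F \<eta> by linarith
  \<comment> \<open>The bounds provide t^2 \<le> t/4, 4 t \<le> \<eta>/2, C t \<le> 1/2 to keep the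
    functionals away from 0, and C t \<le> \<eta> to meet the tolerance in
    \<open>separated\<close>.\<close>
  define t0 where "t0 = min (1 / 4) (min (\<eta> / 8) (min (1 / (2 * C)) (\<eta> / C)))"
  have t0: "0 < t0" "t0 \<le> 1 / 4" "t0 \<le> \<eta> / 8" "t0 \<le> 1 / (2 * C)" "t0 \<le> \<eta> / C"
    unfolding t0_def using \<eta> C0 by (simp, simp_all only: min_le_iff_disj order_refl simp_thms)
  note kp = klinear_peirce(1)[OF exposed_d]
  have f_proj: "f \<cdot> (proj \<cdot> x) = f \<cdot> x" for x using f(2) by (metis blinfun_apply_blinfun_compose)
  show thesis
  proof (rule that[OF t0(1,2)])
    fix t assume t: "0 < t" "t \<le> t0"
    have t_le: "t \<le> 1 / 4" "4 * t \<le> \<eta> / 2" using t t0 by linarith+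
    have "C * t \<le> C * t0" using t C0 by (intro mult_left_mono) auto
    moreover have "C * t0 \<le> 1 / 2" "C * t0 \<le> \<eta>" using t0(4,5) C0 by (simp_all add: field_simps)
    ultimately have Ct: "C * t \<le> 1 / 2" "C * t \<le> \<eta>" by linarith+
    have Ct_eq: "C * t = 2 * (t * F) + 4 * t + \<eta> * t" by (simp add: C4 algebra_simps)
    have t2: "t\<^sup>2 \<le> t / 4" using t t_le by (simp add: power2_eq_square)
    have tF: "0 \<le> t * F" "0 \<le> \<eta> * t" using t F \<eta> by simp_all
    define h where "h = d + t *\<^sub>R f"
    have h: "h \<in> dual" unfolding h_def by (intro dual_add dual_scaleR dual_d f)
    have h_proj: "h o\<^sub>L proj = h"
      by (rule blinfun_eqI) (simp add: h_def blinfun.add_left blinfun.scaleR_left d_proj f_proj)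
    have norm_h: "norm h = 1 + t * slope d f t" unfolding h_def by (rule norm_slope[OF norm_d t(1)])
    have norm_h_ge: "1 + t * norm_deriv d f \<le> norm h"
      unfolding norm_h using norm_deriv_le[OF norm_d t(1), of f] t(1) by simp
    have norm_h_ge': "1 - t * F \<le> norm h"
      unfolding norm_h using mult_left_mono[of "- F" "slope d f t" t] abs_slope_le[OF norm_d t(1), of f] t(1)
      by (simp add: F_def abs_le_iff)
    have pos: "0 < t\<^sup>2" using t by simp
    have "t\<^sup>2 < norm (h o\<^sub>L proj)" unfolding h_proj using norm_h_ge' t2 Ct(1) Ct_eq tF t by linarith
    from Bishop_Phelps_ext[OF subspace_closed_span[OF exposed_d] closed_closed_span[OF exposed_d] kp
        peirce_mem(1)[OF exposed_d] peirce_closed_span(1)[OF exposed_d] norm_peirce2_le[OF exposed_d]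
        peirce2_neutral[OF exposed_d] h pos this]
    obtain g z where g: "g \<in> dual" "g o\<^sub>L proj = g" "norm (g - h) \<le> t\<^sup>2" "norm g > 0"
      and z: "ext z" "z \<in> V" "g \<cdot> z = of_real (norm g)" "\<And>x. g \<cdot> (sym_at z \<cdot> x) = g \<cdot> x"
      and g_split: "\<And>x. g \<cdot> x = of_real (norm g) * tri z \<cdot> x + g \<cdot> (perp z \<cdot> x)"
      unfolding h_proj by metis
    have norm_g: "norm h - t\<^sup>2 \<le> norm g" using norm_triangle_ineq2[of h g] g(3) by (simp add: norm_minus_commute)
    have norm_z: "norm z = 1" by (rule norm_ext[OF z(1)])
    have gd: "norm (g - d) \<le> t * F + t\<^sup>2"
    proof -
      have "g - d = (g - h) + t *\<^sub>R f" by (simp add: h_def)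
      then have "norm (g - d) \<le> norm (g - h) + norm (t *\<^sub>R f)" using norm_triangle_ineq by metis
      then show ?thesis using g(3) t(1) by (simp add: F_def)
    qed
    \<comment> \<open>Used twice: for \<open>z\<close> with defect m = t^2, and for the orthogonal
      point \<open>w\<close>, where the assumed failure and the second perturbation raise it to 3
      t^2 + \<eta> t/2.\<close>
    have near_if: "near d (C * t) p \<and> t * norm_deriv d f - m - t\<^sup>2 \<le> t * rp (f \<cdot> p)"
      if p: "ext p" "norm h - m \<le> rp (g \<cdot> p)" and m: "m \<le> 3 * t\<^sup>2 + \<eta> / 2 * t"
        and S: "\<And>x. norm (g \<cdot> (sym_at p \<cdot> x) - g \<cdot> x) \<le> 2 * t\<^sup>2 * norm x" for p m
    proof -
      have np: "norm p = 1" by (rule norm_ext[OF p(1)])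
      have "rp (g \<cdot> p) - rp (d \<cdot> p) = rp ((g - d) \<cdot> p)" by (simp add: blinfun.diff_left)
      also have "\<dots> \<le> norm (g - d) * norm p" using rp_le_norm norm_blinfun by (rule order_trans)
      finally have 1: "rp (g \<cdot> p) - rp (d \<cdot> p) \<le> t * F + t\<^sup>2" using gd np by simp
      have dp: "1 - C * t \<le> rp (d \<cdot> p)"
        using 1 p(2) m norm_h_ge' Ct_eq t2 tF t by linarith
      have "norm ((d o\<^sub>L sym_at p) - d) \<le> C * t"
      proof (rule norm_blinfun_bound)
        show "0 \<le> C * t" using C0 t by simp
        fix x
        have "((d o\<^sub>L sym_at p) - d) \<cdot> x = (g \<cdot> (sym_at p \<cdot> x) - g \<cdot> x) - ((g - d) \<cdot> (sym_at p \<cdot> x) - (g - d) \<cdot> x)"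
          by (simp add: blinfun.diff_left)
        also have "norm \<dots> \<le> norm (g \<cdot> (sym_at p \<cdot> x) - g \<cdot> x) + (norm ((g - d) \<cdot> (sym_at p \<cdot> x)) + norm ((g - d) \<cdot> x))"
          using norm_triangle_ineq4[of "g \<cdot> (sym_at p \<cdot> x) - g \<cdot> x" "(g - d) \<cdot> (sym_at p \<cdot> x) - (g - d) \<cdot> x"]
            norm_triangle_ineq4[of "(g - d) \<cdot> (sym_at p \<cdot> x)" "(g - d) \<cdot> x"] by linarith
        also have "\<dots> \<le> 2 * t\<^sup>2 * norm x + (norm (g - d) * norm x + norm (g - d) * norm x)"
          using norm_blinfun[of "g - d" "sym_at p \<cdot> x"] unfolding norm_sym_at[OF p(1)]
          by (intro add_mono S norm_blinfun)
        also have "\<dots> = (2 * t\<^sup>2 + 2 * norm (g - d)) * norm x" by (simp add: algebra_simps)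
        also have "\<dots> \<le> C * t * norm x"
        proof (rule mult_right_mono)
          show "2 * t\<^sup>2 + 2 * norm (g - d) \<le> C * t" using gd t2 Ct_eq tF t by linarith
        qed simp
        finally show "norm (((d o\<^sub>L sym_at p) - d) \<cdot> x) \<le> C * t * norm x" .
      qed
      then have "near d (C * t) p" using p(1) dp by (simp add: near_def)
      moreover have "t * norm_deriv d f - m - t\<^sup>2 \<le> t * rp (f \<cdot> p)"
      proof -
        have "rp (g \<cdot> p) - rp (d \<cdot> p) - t * rp (f \<cdot> p) = rp ((g - h) \<cdot> p)"
          by (simp add: h_def blinfun.diff_left blinfun.add_left blinfun.scaleR_left)
        also have "\<dots> \<le> norm (g - h) * norm p" using rp_le_norm norm_blinfun by (rule order_trans)
        finally have "rp (g \<cdot> p) - rp (d \<cdot> p) - t * rp (f \<cdot> p) \<le> t\<^sup>2" using g(3) np by simp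
        moreover have "rp (d \<cdot> p) \<le> 1"
          using rp_le_norm[of "d \<cdot> p"] norm_blinfun[of d p] norm_d np by simp
        ultimately show ?thesis using p(2) norm_h_ge by linarith
      qed
      ultimately show ?thesis by simp
    qed
    have z_near: "near d (C * t) z \<and> t * norm_deriv d f - t\<^sup>2 - t\<^sup>2 \<le> t * rp (f \<cdot> z)"
    proof (rule near_if[OF z(1)])
      show "norm h - t\<^sup>2 \<le> rp (g \<cdot> z)" using norm_g z(3) by simp
      show "t\<^sup>2 \<le> 3 * t\<^sup>2 + \<eta> / 2 * t" using tF pos by (simp add: add_nonneg_nonneg)
    qed (simp add: z(4))
    have top: "norm_deriv d f - 2 * t \<le> rp (f \<cdot> z)"
    proof -
      have "t * (norm_deriv d f - 2 * t) \<le> t * rp (f \<cdot> z)" using z_near by (simp add: power2_eq_square algebra_simps)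
      then show ?thesis using t(1) by simp
    qed
    have gap: "rp (g \<cdot> q) \<le> (norm g - \<eta> / 2 * t) * norm q" if q: "q \<in> V" "q \<diamondsuit> z" for q
    proof (rule ccontr)
      assume "\<not> ?thesis"
      then have big: "(norm g - \<eta> / 2 * t) * norm q < rp (g \<cdot> q)" by simp
      define W where "W = V \<inter> diamond_compl {z}"
      \<comment> \<open>The two projections commute because \<open>z\<close> lies in
        \<open>V\<close>, so \<open>T\<close> projects onto \<open>W\<close> and inherits neutrality
        from both.\<close>
      define T where "T = proj o\<^sub>L perp z"
      note Wz = subspace_diamond_compl[OF exposed_ext[OF z(1)]] closed_diamond_compl
      have Tx: "T \<cdot> x = proj \<cdot> (perp z \<cdot> x)" "T \<cdot> x = perp z \<cdot> (proj \<cdot> x)" for x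
        by (simp_all add: T_def perp_peirce2[OF exposed_d z(1,2)])
      have gT: "g \<cdot> (T \<cdot> x) = g \<cdot> (perp z \<cdot> x)" for x
        unfolding Tx(1) using g(2) by (metis blinfun_apply_blinfun_compose)
      have W: "subspace W" "closed W"
        unfolding W_def using Wz subspace_closed_span[OF exposed_d] closed_closed_span[OF exposed_d]
        by (auto intro: subspace_inter)
      have T: "klinear T" "\<And>x. T \<cdot> x \<in> W" "\<And>x. x \<in> W \<Longrightarrow> T \<cdot> x = x" "\<And>x. norm (T \<cdot> x) \<le> norm x"
      proof -
        show "klinear T" unfolding T_def by (intro klinear_comp kp klinear_perp z(1))
        show "T \<cdot> x \<in> W" for x
          using peirce_mem(1)[OF exposed_d, of "perp z \<cdot> x"] peirce_mem(2)[OF exposed_ext[OF z(1)], of "proj \<cdot> x"]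
          unfolding W_def by (metis Tx IntI)
        show "T \<cdot> x = x" if "x \<in> W" for x
          using that unfolding W_def Tx(1)
          by (simp add: perp_of_diamond[OF z(1)] diamond_compl_def peirce_closed_span(1)[OF exposed_d])
        show "norm (T \<cdot> x) \<le> norm x" for x
          unfolding Tx(1) using norm_peirce2_le[OF exposed_d] norm_perp_le[OF z(1)] by (rule order_trans)
      qed
      have neutral: "T \<cdot> x = x" if "norm (T \<cdot> x) = norm x" for x
      proof -
        have "norm x \<le> norm (perp z \<cdot> x)" using that norm_peirce2_le[OF exposed_d, of "perp z \<cdot> x"] by (simp add: Tx(1))
        then have "perp z \<cdot> x = x" using norm_perp_le[OF z(1), of x] by (intro perp_neutral z(1)) simp
        moreover from this have "proj \<cdot> x = x" using that by (intro peirce2_neutral exposed_d) (simp add: Tx(1))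
        ultimately show ?thesis by (simp add: Tx(1))
      qed
      have qW: "q \<in> W" using q by (simp add: W_def diamond_compl_def)
      have "q \<noteq> 0" using big by auto
      have "rp (g \<cdot> q) \<le> norm ((g o\<^sub>L T) \<cdot> q)" using T(3)[OF qW] rp_le_norm by simp
      also have "\<dots> \<le> norm (g o\<^sub>L T) * norm q" by (rule norm_blinfun)
      finally have "(norm g - \<eta> / 2 * t) * norm q < norm (g o\<^sub>L T) * norm q" using big by linarith
      then have gT_big: "norm g - \<eta> / 2 * t < norm (g o\<^sub>L T)" using mult_less_cancel_right_pos \<open>q \<noteq> 0\<close> by fastforce
      have "t\<^sup>2 < norm (g o\<^sub>L T)" using gT_big norm_g norm_h_ge' t2 Ct(1) Ct_eq tF t by linarith
      from Bishop_Phelps_ext[OF W T neutral g(1) pos this]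
      obtain g' w where g': "norm (g' - (g o\<^sub>L T)) \<le> t\<^sup>2"
        and w: "ext w" "w \<in> W" "g' \<cdot> w = of_real (norm g')" "\<And>x. g' \<cdot> (sym_at w \<cdot> x) = g' \<cdot> x"
        by metis
      have wz: "w \<diamondsuit> z" "w \<in> V" using w(2) by (auto simp: W_def diamond_compl_def)
      have diff: "norm (g' \<cdot> x - g \<cdot> (T \<cdot> x)) \<le> t\<^sup>2 * norm x" for x
      proof -
        have "g' \<cdot> x - g \<cdot> (T \<cdot> x) = (g' - (g o\<^sub>L T)) \<cdot> x" by (simp add: blinfun.diff_left)
        then show ?thesis using norm_blinfun[of "g' - (g o\<^sub>L T)" x] mult_right_mono[OF g' norm_ge_zero[of x]] by simp
      qed
      have ng': "norm (g o\<^sub>L T) - t\<^sup>2 \<le> norm g'"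
        using norm_triangle_ineq2[of "g o\<^sub>L T" g'] g' by (simp add: norm_minus_commute)
      have "rp (g' \<cdot> w) - rp (g \<cdot> w) \<le> t\<^sup>2"
        using rp_le_norm[of "g' \<cdot> w - g \<cdot> w"] diff[of w] T(3)[OF w(2)] norm_ext[OF w(1)] by simp
      then have gw: "norm h - (3 * t\<^sup>2 + \<eta> / 2 * t) \<le> rp (g \<cdot> w)"
        using ng' gT_big norm_g w(3) by simp
      have "near d (C * t) w \<and> t * norm_deriv d f - (3 * t\<^sup>2 + \<eta> / 2 * t) - t\<^sup>2 \<le> t * rp (f \<cdot> w)"
      proof (rule near_if[OF w(1) gw order_refl])
        fix x
        have "g \<cdot> (sym_at w \<cdot> x) - g \<cdot> x = g \<cdot> (T \<cdot> (sym_at w \<cdot> x)) - g \<cdot> (T \<cdot> x)"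
          using g_split[of "sym_at w \<cdot> x"] g_split[of x] tri_sym_at_orth(1)[OF z(1) w(1) wz(1), of x] by (simp add: gT)
        also have "\<dots> = (g' \<cdot> x - g \<cdot> (T \<cdot> x)) - (g' \<cdot> (sym_at w \<cdot> x) - g \<cdot> (T \<cdot> (sym_at w \<cdot> x)))"
          by (simp add: w(4))
        also have "norm \<dots> \<le> t\<^sup>2 * norm x + t\<^sup>2 * norm x"
          using norm_triangle_ineq4[of "g' \<cdot> x - g \<cdot> (T \<cdot> x)" "g' \<cdot> (sym_at w \<cdot> x) - g \<cdot> (T \<cdot> (sym_at w \<cdot> x))"]
            diff[of x] diff[of "sym_at w \<cdot> x"] unfolding norm_sym_at[OF w(1)] by linarith
        finally show "norm (g \<cdot> (sym_at w \<cdot> x) - g \<cdot> x) \<le> 2 * t\<^sup>2 * norm x" by linarith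
      qed
      then have w_near: "near d (C * t) w" and le: "t * norm_deriv d f - (3 * t\<^sup>2 + \<eta> / 2 * t) - t\<^sup>2 \<le> t * rp (f \<cdot> w)"
        by (rule conjunct1, rule conjunct2)
      have "t * norm_deriv d f - (3 * t\<^sup>2 + \<eta> / 2 * t) - t\<^sup>2 = t * (norm_deriv d f - 4 * t - \<eta> / 2)"
        by (simp add: power2_eq_square algebra_simps)
      then have "t * (norm_deriv d f - 4 * t - \<eta> / 2) \<le> t * rp (f \<cdot> w)" using le by linarith
      then have "norm_deriv d f - 4 * t - \<eta> / 2 \<le> rp (f \<cdot> w)" using t(1) by simp
      then have "norm_deriv d f - \<eta> \<le> rp (f \<cdot> w)" using t_le by linarith
      moreover have "norm_deriv d f - \<eta> \<le> rp (f \<cdot> z)" using top t_le \<eta> t by linarith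
      ultimately show False
        using sep[unfolded separated_def, rule_format, OF near_mono[OF conjunct1[OF z_near] Ct(2)] near_mono[OF w_near Ct(2)] z(2) wz(2,1)] by simp
    qed
    have "\<eta> / 2 * t \<le> norm g"
      using norm_g norm_h_ge' t2 Ct(1) Ct_eq tF t by linarith
    from conjunct1[OF z_near] z(2) top g(3) g_split this gap have "approximant f C \<eta> t g z"
      unfolding approximant_def h_def by (intro conjI allI ballI impI)
    then show "\<exists>g z. approximant f C \<eta> t g z" by blast
  qed
qed

text \<open>Evaluate \<open>g\<close> at the later point \<open>w\<close>. Near maximality of
  \<open>w\<close> gives 1 + t \<open>norm_deriv d f\<close> - O(t^2) as a lower bound, the errors
  of \<open>w\<close> being quadratic because s \<le> t^2. The last clause for \<open>z\<close>
  gives norm g - (\<eta>/2) t (1 - |v_z(w)|) as an upper bound. Divide by \<open>t\<close>.\<close>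

lemma approximant_nested:
  assumes f: "f \<in> dual" and \<eta>: "\<eta> > 0" and t: "0 < t" "t \<le> 1 / 4" and s: "0 < s" "s \<le> t\<^sup>2" and C: "C \<ge> 0"
    and z: "approximant f C \<eta> t g z" and w: "approximant f C \<eta> s g' w"
  shows "\<eta> / 2 * (1 - norm (tri z \<cdot> w)) \<le> slope d f t - norm_deriv d f + (C + 4) * t"
proof -
  have ext: "ext z" "ext w" using z w by (auto simp: approximant_def near_def)
  have nw: "norm w = 1" by (rule norm_ext[OF ext(2)])
  have wV: "w \<in> V" and zV: "z \<in> V" using z w by (simp_all add: approximant_def)
  define a where "a = tri z \<cdot> w"
  define q where "q = perp z \<cdot> w"
  have qV: "q \<in> V"
    using perp_peirce2[OF exposed_d ext(1) zV, of w] peirce_closed_span(1)[OF exposed_d wV]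
      peirce_mem(1)[OF exposed_d, of "perp z \<cdot> w"] by (simp add: q_def)
  have nq: "norm q \<le> 1 - norm a" using norm_tri_perp[OF ext(1), of w] nw by (simp add: q_def a_def)
  have g: "norm (g - (d + t *\<^sub>R f)) \<le> t\<^sup>2" "\<eta> / 2 * t \<le> norm g"
    and "\<forall>x. g \<cdot> x = of_real (norm g) * tri z \<cdot> x + g \<cdot> (perp z \<cdot> x)"
    and "\<forall>q\<in>V. q \<diamondsuit> z \<longrightarrow> rp (g \<cdot> q) \<le> (norm g - \<eta> / 2 * t) * norm q"
    using z unfolding approximant_def by blast+
  then have g_split: "g \<cdot> w = of_real (norm g) * a + g \<cdot> q" and gap: "rp (g \<cdot> q) \<le> (norm g - \<eta> / 2 * t) * norm q"
    using qV perp_diamond[OF ext(1), of w] unfolding a_def q_def by blast+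
  have "rp (g \<cdot> w) = norm g * rp a + rp (g \<cdot> q)" unfolding g_split by simp
  also have "\<dots> \<le> norm g * norm a + (norm g - \<eta> / 2 * t) * (1 - norm a)"
    using gap nq g(2) by (intro add_mono mult_left_mono rp_le_norm order_trans[OF gap]) auto
  also have "\<dots> = norm g - \<eta> / 2 * t * (1 - norm a)" by (simp add: algebra_simps)
  finally have upper: "rp (g \<cdot> w) \<le> norm g - \<eta> / 2 * t * (1 - norm a)" .
  have norm_g: "norm g \<le> 1 + t * slope d f t + t\<^sup>2"
    using norm_triangle_ineq2[of g "d + t *\<^sub>R f"] g(1) norm_slope[OF norm_d t(1), of f] by simp
  have "rp (d \<cdot> w) + t * rp (f \<cdot> w) - rp (g \<cdot> w) = rp ((d + t *\<^sub>R f - g) \<cdot> w)"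
    by (simp add: blinfun.diff_left blinfun.add_left blinfun.scaleR_left)
  also have "\<dots> \<le> norm (d + t *\<^sub>R f - g) * norm w" using rp_le_norm norm_blinfun by (rule order_trans)
  finally have lower: "rp (d \<cdot> w) + t * rp (f \<cdot> w) - rp (g \<cdot> w) \<le> t\<^sup>2" using g(1) nw by (simp add: norm_minus_commute)
  have dw: "1 - C * s \<le> rp (d \<cdot> w)" and fw: "norm_deriv d f - 2 * s \<le> rp (f \<cdot> w)"
    using w by (simp_all add: approximant_def near_def)
  have Cs: "C * s \<le> C * t\<^sup>2" using s C by (intro mult_left_mono) auto
  have fw': "t * norm_deriv d f - t * (2 * s) \<le> t * rp (f \<cdot> w)"
    using mult_left_mono[OF fw less_imp_le[OF t(1)]] by (simp add: right_diff_distrib)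
  have ts: "t * (2 * s) \<le> 2 * t\<^sup>2" using mult_mono[of t 1 "2 * s" "2 * t\<^sup>2"] t s by simp
  have "\<eta> / 2 * t * (1 - norm a) \<le> t * slope d f t - t * norm_deriv d f + (C * t\<^sup>2 + 4 * t\<^sup>2)"
    using upper norm_g lower dw Cs fw' ts by linarith
  then have "t * (\<eta> / 2 * (1 - norm a)) \<le> t * (slope d f t - norm_deriv d f + (C + 4) * t)"
    by (simp add: power2_eq_square algebra_simps)
  then show ?thesis using t(1) by (simp add: a_def)
qed

lemma tendsto_rp:
  fixes u :: "'z \<Rightarrow>\<^sub>L 'k"
  assumes "\<zeta> \<longlonglongrightarrow> l"
  shows "(\<lambda>k. rp (u \<cdot> \<zeta> k)) \<longlonglongrightarrow> rp (u \<cdot> l)"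
proof -
  have "bounded_linear (rp :: 'k \<Rightarrow> real)"
    by (rule bounded_linear_intro[of _ 1]) (simp_all add: abs_rp_le_norm)
  then show ?thesis by (rule bounded_linear.tendsto) (intro tendsto_intros assms)
qed

lemma not_separated:
  assumes f: "f \<in> dual" "f o\<^sub>L proj = f" and \<eta>: "\<eta> > 0" and below: "\<And>x. x \<in> X \<Longrightarrow> rp (f \<cdot> x) < norm_deriv d f"
    and sep: "separated f \<eta>"
  shows False
proof -
  define C where "C = 2 * norm f + 4 + \<eta>"
  have C: "0 < C" unfolding C_def using \<eta> norm_ge_zero[of f] by linarith
  have d1: "norm d \<le> 1" using norm_d by simp
  obtain t0 where t0: "0 < t0" "t0 \<le> 1 / 4" "\<And>t. 0 < t \<Longrightarrow> t \<le> t0 \<Longrightarrow> \<exists>g z. approximant f C \<eta> t g z"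
    using ex_approximant[OF f \<eta> sep C_def] by blast
  then obtain G Z where GZ: "\<And>t. 0 < t \<Longrightarrow> t \<le> t0 \<Longrightarrow> approximant f C \<eta> t (G t) (Z t)" by metis
  \<comment> \<open>Iterated squaring makes each parameter at most the square of every earlier one,
    as \<open>approximant_nested\<close> requires.\<close>
  define \<tau> where "\<tau> k = t0 ^ (2 ^ k)" for k :: nat
  define \<zeta> where "\<zeta> k = Z (\<tau> k)" for k
  have \<tau>: "0 < \<tau> k" "\<tau> k \<le> t0" "\<tau> k \<le> 1 / 4" "\<tau> k \<le> (1 / 4) ^ k" for k
  proof -
    show "0 < \<tau> k" using t0 by (simp add: \<tau>_def)
    show 1: "\<tau> k \<le> t0" using power_decreasing[of 1 "2 ^ k" t0] t0 by (simp add: \<tau>_def)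
    show "\<tau> k \<le> 1 / 4" using 1 t0 by linarith
    have "\<tau> k \<le> t0 ^ k" unfolding \<tau>_def using t0 by (intro power_decreasing less_imp_le[OF less_exp]) auto
    also have "\<dots> \<le> (1 / 4) ^ k" using t0 by (intro power_mono) auto
    finally show "\<tau> k \<le> (1 / 4) ^ k" .
  qed
  have \<tau>_sq: "\<tau> j \<le> (\<tau> i)\<^sup>2" if "i < j" for i j
  proof -
    have "(2::nat) ^ Suc i \<le> 2 ^ j" using that by (intro power_increasing) auto
    then have "\<tau> j \<le> t0 ^ (2 ^ Suc i)" unfolding \<tau>_def by (rule power_decreasing) (use t0 in auto)
    also have "\<dots> = (\<tau> i)\<^sup>2" unfolding \<tau>_def power_mult[symmetric] by (simp add: mult.commute)
    finally show ?thesis .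
  qed
  have \<tau>_0: "\<tau> \<longlonglongrightarrow> 0"
  proof (rule real_tendsto_sandwich)
    show "(\<lambda>k. 0 :: real) \<longlonglongrightarrow> 0" by simp
    show "(\<lambda>k. (1 / 4 :: real) ^ k) \<longlonglongrightarrow> 0" by (rule LIMSEQ_power_zero) simp
  qed (use \<tau>(1,4) in \<open>auto intro!: always_eventually less_imp_le\<close>)
  have small: "\<forall>\<^sub>F k in sequentially. c * \<tau> k < e" if "e > 0" for c e
    using order_tendstoD(2)[OF tendsto_mult_left_zero[OF \<tau>_0], of e c] that by (simp add: mult.commute)
  have \<zeta>: "approximant f C \<eta> (\<tau> k) (G (\<tau> k)) (\<zeta> k)" for k unfolding \<zeta>_def by (rule GZ[OF \<tau>(1,2)])
  have \<zeta>_near: "near d (C * \<tau> k) (\<zeta> k)" and f_\<zeta>: "norm_deriv d f - 2 * \<tau> k \<le> rp (f \<cdot> \<zeta> k)" for k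
    using \<zeta>[of k] unfolding approximant_def by blast+
  have ext: "ext (\<zeta> k)" for k using \<zeta>_near by (simp add: near_def)
  have near: "\<forall>\<^sub>F k in sequentially. near d \<delta> (\<zeta> k)" if "\<delta> > 0" for \<delta>
    using small[OF that, of C] by eventually_elim (auto intro: near_mono \<zeta>_near)
  have nested: "\<exists>K. \<forall>i\<ge>K. \<forall>j>i. 1 - \<delta> \<le> rp (tri (\<zeta> i) \<cdot> \<zeta> j)" if \<delta>: "\<delta> > 0" for \<delta>
  proof -
    define \<omega> where "\<omega> = min 1 (\<delta> / 2)"
    have \<omega>: "0 < \<omega>" "\<omega> \<le> 1" "\<omega> \<le> \<delta> / 2" using \<delta> by (auto simp: \<omega>_def)
    have e: "\<omega> ^ 4 / 100 > 0" using \<omega> by simp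
    have e': "\<eta> * \<delta> / 8 > 0" using \<eta> \<delta> by simp
    obtain t1 where t1: "t1 > 0" "\<And>t. 0 < t \<Longrightarrow> t \<le> t1 \<Longrightarrow> slope d f t \<le> norm_deriv d f + \<eta> * \<delta> / 8"
      using slope_le_norm_deriv[OF norm_d e', of f] by metis
    have "\<forall>\<^sub>F k in sequentially. near d (\<omega> ^ 4 / 100) (\<zeta> k) \<and> 1 * \<tau> k < t1 \<and> (C + 4) * \<tau> k < \<eta> * \<delta> / 8"
      by (intro eventually_conj near e small t1 e')
    then obtain K where K: "\<And>k. k \<ge> K \<Longrightarrow> near d (\<omega> ^ 4 / 100) (\<zeta> k)" "\<And>k. k \<ge> K \<Longrightarrow> \<tau> k < t1"
      "\<And>k. k \<ge> K \<Longrightarrow> (C + 4) * \<tau> k < \<eta> * \<delta> / 8"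
      unfolding eventually_sequentially by auto
    have "1 - \<delta> \<le> rp (tri (\<zeta> i) \<cdot> \<zeta> j)" if ij: "i \<ge> K" "j > i" for i j
    proof -
      have "\<eta> / 2 * (1 - norm (tri (\<zeta> i) \<cdot> \<zeta> j)) \<le> slope d f (\<tau> i) - norm_deriv d f + (C + 4) * \<tau> i"
        by (rule approximant_nested[OF f(1) \<eta> \<tau>(1,3) \<tau>(1) \<tau>_sq[OF ij(2)] less_imp_le[OF C] \<zeta> \<zeta>])
      also have "\<dots> \<le> \<eta> / 2 * (\<delta> / 2)" using t1(2)[OF \<tau>(1), of i] K(2,3)[OF ij(1)] by simp
      finally have 1: "1 - norm (tri (\<zeta> i) \<cdot> \<zeta> j) \<le> \<delta> / 2" using \<eta> by simp
      have "near d (\<omega> ^ 4 / 100) (\<zeta> j)" using K(1) ij by simp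
      then have "dcone d (\<omega> ^ 4 / 100) (\<zeta> j)" using norm_ext[OF ext] by (simp add: dcone_def near_def)
      from near_dcone(1)[OF dual_d d1 K(1)[OF ij(1)] this \<omega>(1,2) order_refl]
      have "norm (tri (\<zeta> i) \<cdot> \<zeta> j) - \<omega> \<le> rp (tri (\<zeta> i) \<cdot> \<zeta> j)" using e by simp
      then show ?thesis using 1 \<omega>(3) by linarith
    qed
    then show ?thesis by blast
  qed
  obtain r l where r: "strict_mono (r :: nat \<Rightarrow> nat)" "(\<zeta> \<circ> r) \<longlonglongrightarrow> l"
    using convergent_subsequence[OF dual_d d1 near nested] by metis
  have lim: "(\<lambda>k. \<zeta> (r k)) \<longlonglongrightarrow> l" using r(2) by (simp add: o_def)
  have \<tau>r: "(\<lambda>k. \<tau> (r k)) \<longlonglongrightarrow> 0" using LIMSEQ_subseq_LIMSEQ[OF \<tau>_0 r(1)] by (simp add: o_def)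
  have nl: "norm l \<le> 1"
    by (rule LIMSEQ_le_const2[OF tendsto_norm[OF lim]]) (simp add: norm_ext[OF ext])
  have "1 \<le> rp (d \<cdot> l)"
  proof (rule LIMSEQ_le)
    show "(\<lambda>k. 1 - C * \<tau> (r k)) \<longlonglongrightarrow> 1" using tendsto_diff[OF tendsto_const tendsto_mult_right_zero[OF \<tau>r], of 1 C] by simp
    show "(\<lambda>k. rp (d \<cdot> \<zeta> (r k))) \<longlonglongrightarrow> rp (d \<cdot> l)" by (rule tendsto_rp[OF lim])
    show "\<exists>N. \<forall>n\<ge>N. 1 - C * \<tau> (r n) \<le> rp (d \<cdot> \<zeta> (r n))" using \<zeta>_near by (simp add: near_def)
  qed
  then have "norm (d \<cdot> l) \<le> rp (d \<cdot> l)" "norm (d \<cdot> l) = 1"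
    using norm_blinfun_le[OF d1, of l] nl rp_le_norm[of "d \<cdot> l"] by linarith+
  then have "d \<cdot> l = 1" using eq_norm_if_rp_ge[of "d \<cdot> l"] by simp
  then have l: "l \<in> face d" using nl by (simp add: mem_face)
  have fl: "norm_deriv d f \<le> rp (f \<cdot> l)"
  proof (rule LIMSEQ_le)
    show "(\<lambda>k. norm_deriv d f - 2 * \<tau> (r k)) \<longlonglongrightarrow> norm_deriv d f"
      using tendsto_diff[OF tendsto_const tendsto_mult_right_zero[OF \<tau>r], of "norm_deriv d f" 2] by simp
    show "(\<lambda>k. rp (f \<cdot> \<zeta> (r k))) \<longlonglongrightarrow> rp (f \<cdot> l)" by (rule tendsto_rp[OF lim])
    show "\<exists>N. \<forall>n\<ge>N. norm_deriv d f - 2 * \<tau> (r n) \<le> rp (f \<cdot> \<zeta> (r n))" using f_\<zeta> by simp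
  qed
  have tri_l: "\<exists>K. \<forall>k\<ge>K. 1 - \<delta> \<le> rp (tri (\<zeta> (r k)) \<cdot> l)" if \<delta>: "\<delta> > 0" for \<delta>
  proof -
    obtain K where K: "\<forall>i\<ge>K. \<forall>j>i. 1 - \<delta> \<le> rp (tri (\<zeta> i) \<cdot> \<zeta> j)" using nested[OF \<delta>] by (rule exE)
    have "1 - \<delta> \<le> rp (tri (\<zeta> (r k)) \<cdot> l)" if k: "k \<ge> K" for k
    proof (rule LIMSEQ_le_const[OF tendsto_rp[OF lim]])
      have "1 - \<delta> \<le> rp (tri (\<zeta> (r k)) \<cdot> \<zeta> (r n))" if "n \<ge> Suc k" for n
        using K seq_suble[OF r(1), of k] k strict_monoD[OF r(1), of k n] that by simp
      then show "\<exists>N. \<forall>n\<ge>N. 1 - \<delta> \<le> rp (tri (\<zeta> (r k)) \<cdot> \<zeta> (r n))" by blast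
    qed
    then show ?thesis by blast
  qed
  obtain A where A: "finite A" "A \<subseteq> X" "1 - 1 / 2 \<le> (\<Sum>x\<in>A. rp (tri x \<cdot> l))" using exhaust[OF l, of "1 / 2"] by auto
  have "\<exists>x\<in>A. tri x \<cdot> l \<noteq> 0"
  proof (rule ccontr)
    assume "\<not> ?thesis"
    then have "(\<Sum>x\<in>A. rp (tri x \<cdot> l)) = 0" by (intro sum.neutral) simp
    then show False using A(3) by simp
  qed
  then obtain x where x: "x \<in> X" "tri x \<cdot> l \<noteq> 0" using A(2) by blast
  have nx: "norm x = 1" by (rule norm_ext[OF X_ext[OF x(1)]])
  \<comment> \<open>Otherwise the functionals of the approximants stay at most 1 - \<epsilon> at
    \<open>x\<close> while their values at \<open>l\<close> tend to 1. The constraints g(l) \<ge> 1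
    and g(x) \<le> 1 - \<epsilon> are then compatible with norm g \<le> 1, and Hahn--Banach supplies
    such a \<open>g\<close> in place of a weak-star limit; it contradicts
    \<open>smooth\<close>.\<close>
  have freq: "\<exists>k\<ge>K. 1 - \<epsilon> \<le> rp (tri (\<zeta> (r k)) \<cdot> x)" if \<epsilon>: "\<epsilon> > 0" for \<epsilon> K
  proof (rule ccontr)
    assume "\<not> ?thesis"
    then have lt: "\<And>k. k \<ge> K \<Longrightarrow> rp (tri (\<zeta> (r k)) \<cdot> x) \<le> 1 - \<epsilon>" by (meson linear)
    have bound: "s - q * (1 - \<epsilon>) \<le> 1 * norm (s *\<^sub>R l - q *\<^sub>R x)" if sq: "s \<ge> 0" "q \<ge> 0" for s q
    proof (rule field_le_epsilon)
      fix e :: real assume e: "e > 0"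
      then have "e / (s + 1) > 0" using sq by simp
      then obtain K' where K': "\<forall>k\<ge>K'. 1 - e / (s + 1) \<le> rp (tri (\<zeta> (r k)) \<cdot> l)" using tri_l by blast
      define k where "k = max K K'"
      have "rp (tri (\<zeta> (r k)) \<cdot> (s *\<^sub>R l - q *\<^sub>R x)) \<le> norm (s *\<^sub>R l - q *\<^sub>R x)"
        using rp_le_norm norm_tri_le[OF ext] by (rule order_trans)
      then have "s * rp (tri (\<zeta> (r k)) \<cdot> l) - q * rp (tri (\<zeta> (r k)) \<cdot> x) \<le> norm (s *\<^sub>R l - q *\<^sub>R x)"
        by (simp add: blinfun.diff_right blinfun.scaleR_right)
      moreover have "s * (1 - e / (s + 1)) \<le> s * rp (tri (\<zeta> (r k)) \<cdot> l)"
        using K' sq by (intro mult_left_mono) (auto simp: k_def)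
      moreover have "q * rp (tri (\<zeta> (r k)) \<cdot> x) \<le> q * (1 - \<epsilon>)"
        using lt sq by (intro mult_left_mono) (auto simp: k_def)
      moreover have "s * (e / (s + 1)) \<le> e" using sq e by (simp add: field_simps)
      moreover have "s * (1 - e / (s + 1)) = s - s * (e / (s + 1))" by (simp add: right_diff_distrib)
      ultimately show "s - q * (1 - \<epsilon>) \<le> 1 * norm (s *\<^sub>R l - q *\<^sub>R x) + e" by linarith
    qed
    define D where "D = {(s *\<^sub>R l - q *\<^sub>R x, s - q * (1 - \<epsilon>)) | s q. s \<ge> 0 \<and> q \<ge> (0::real)}"
    have DI: "(s *\<^sub>R l - q *\<^sub>R x, s - q * (1 - \<epsilon>)) \<in> D" if "s \<ge> 0" "q \<ge> 0" for s q
      using that unfolding D_def by blast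
    obtain g :: "'z \<Rightarrow>\<^sub>L 'k" where g: "g \<in> dual" "norm g \<le> 1" "\<And>c a. (c, a) \<in> D \<Longrightarrow> a \<le> rp (g \<cdot> c)"
    proof (rule ex_dual_constrained[of 1 D])
      show "0 \<in> D" using DI[of 0 0] by (simp add: zero_prod_def)
      show "\<forall>c\<in>D. \<forall>c'\<in>D. c + c' \<in> D"
      proof (intro ballI)
        fix c c' assume "c \<in> D" "c' \<in> D"
        then obtain s q s' q' where *: "c = (s *\<^sub>R l - q *\<^sub>R x, s - q * (1 - \<epsilon>))" "s \<ge> 0" "q \<ge> 0"
          "c' = (s' *\<^sub>R l - q' *\<^sub>R x, s' - q' * (1 - \<epsilon>))" "s' \<ge> 0" "q' \<ge> 0" unfolding D_def by blast
        from *(1,4) have "c + c' = ((s + s') *\<^sub>R l - (q + q') *\<^sub>R x, (s + s') - (q + q') * (1 - \<epsilon>))"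
          by (simp add: algebra_simps)
        moreover have "\<dots> \<in> D" using * by (intro DI) simp_all
        ultimately show "c + c' \<in> D" by simp
      qed
      show "\<forall>c\<in>D. \<forall>a>0. a *\<^sub>R c \<in> D"
      proof (intro ballI allI impI)
        fix c and a :: real assume "c \<in> D" "a > 0"
        then obtain s q where *: "c = (s *\<^sub>R l - q *\<^sub>R x, s - q * (1 - \<epsilon>))" "s \<ge> 0" "q \<ge> 0" unfolding D_def by blast
        from *(1) have "a *\<^sub>R c = ((a * s) *\<^sub>R l - (a * q) *\<^sub>R x, a * s - (a * q) * (1 - \<epsilon>))"
          by (simp add: algebra_simps)
        moreover have "\<dots> \<in> D" using * \<open>a > 0\<close> by (intro DI) simp_all
        ultimately show "a *\<^sub>R c \<in> D" by simp
      qed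
      show "\<forall>c\<in>D. snd c \<le> 1 * norm (fst c)" using bound unfolding D_def by auto
    qed auto
    have gl: "1 \<le> rp (g \<cdot> l)" using g(3)[OF DI[of 1 0]] by simp
    then have "norm (g \<cdot> l) \<le> rp (g \<cdot> l)" "norm (g \<cdot> l) = 1"
      using norm_blinfun_le[OF g(2), of l] nl rp_le_norm[of "g \<cdot> l"] by linarith+
    then have "g \<cdot> l = 1" using eq_norm_if_rp_ge[of "g \<cdot> l"] by simp
    then have "g \<cdot> x = 1" using smooth[OF g(1,2) l _ x] by simp
    moreover have "rp (g \<cdot> x) \<le> 1 - \<epsilon>" using g(3)[OF DI[of 0 1]] by (simp add: blinfun.minus_right)
    ultimately show False using \<epsilon> by simp
  qed
  \<comment> \<open>For an approximant z with v_z(x) close to 1, the reflection of \<open>x\<close>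
    at z is nearly 2 z - x and has norm one; let z tend to \<open>l\<close> along such
    indices.\<close>
  have "norm (2 *\<^sub>R l - x) \<le> 1"
  proof (rule field_le_epsilon)
    fix e0 :: real assume e0: "e0 > 0"
    define e where "e = min 1 (e0 / 3)"
    have e: "0 < e" "e \<le> 1" "3 * e \<le> e0" using e0 by (auto simp: e_def)
    obtain K where K: "\<And>k. k \<ge> K \<Longrightarrow> norm (\<zeta> (r k) - l) < e" using LIMSEQ_D[OF lim e(1)] by metis
    have "e\<^sup>2 / 25 > 0" using e by simp
    then obtain k where k: "k \<ge> K" "1 - e\<^sup>2 / 25 \<le> rp (tri (\<zeta> (r k)) \<cdot> x)" using freq by blast
    define z where "z = \<zeta> (r k)"
    have z: "ext z" "norm (z - l) < e" using ext K[OF k(1)] by (simp_all add: z_def)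
    have "norm (sym_at z \<cdot> x - (2 *\<^sub>R z - x)) \<le> e"
      by (rule sym_at_approx(2)[OF z(1) _ k(2)[folded z_def]]) (use e nx in auto)
    moreover have eq: "2 *\<^sub>R l - x = (sym_at z \<cdot> x - (sym_at z \<cdot> x - (2 *\<^sub>R z - x))) - 2 *\<^sub>R (z - l)"
      by (simp add: algebra_simps)
    have "norm (2 *\<^sub>R l - x) \<le> norm (sym_at z \<cdot> x) + norm (sym_at z \<cdot> x - (2 *\<^sub>R z - x)) + norm (2 *\<^sub>R (z - l))"
      using norm_triangle_ineq4[of "sym_at z \<cdot> x - (sym_at z \<cdot> x - (2 *\<^sub>R z - x))" "2 *\<^sub>R (z - l)"]
        norm_triangle_ineq4[of "sym_at z \<cdot> x" "sym_at z \<cdot> x - (2 *\<^sub>R z - x)"] unfolding eq[symmetric] by linarith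
    ultimately show "norm (2 *\<^sub>R l - x) \<le> 1 + e0" using e(3) z(2) nx by (simp add: norm_sym_at[OF z(1)])
  qed
  moreover have "d \<cdot> (2 *\<^sub>R l - x) = 1"
    using l d_X[OF x(1)] by (simp add: mem_face blinfun.diff_right blinfun.add_right scaleR_2)
  ultimately have "2 *\<^sub>R l - x \<in> face d" by (simp add: mem_face)
  then have "rp (f \<cdot> (2 *\<^sub>R l - x)) \<le> norm_deriv d f" by (rule rp_le_norm_deriv_face[OF norm_d])
  then have "2 * rp (f \<cdot> l) - rp (f \<cdot> x) \<le> norm_deriv d f" by (simp add: blinfun.diff_right blinfun.scaleR_right)
  then show False using fl below[OF x(1)] by linarith
qed

lemma R_face:
  assumes "y \<in> face d"
  shows "R \<cdot> y = y"
proof (rule ccontr)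
  assume "R \<cdot> y \<noteq> y"
  from ex_separated[OF assms this] show False using not_separated by metis
qed

end

subsection \<open>The Boolean algebra of tripotents\<close>

locale boolean_sfs = atomic_sfs scale
  for scale :: "'k::real_or_complex \<Rightarrow> 'z::real_normed_vector \<Rightarrow> 'z" +
  fixes e :: "'z \<Rightarrow>\<^sub>L 'k"
  assumes tripotent_e: "geometric_tripotent e"
    and Z2_e: "Z2 e = UNIV"
    and boolean: "nabla_boolean e"
begin

text \<open>The points serve as indices instead of the tripotents \<open>tri x\<close>, whose faces
  are singletons and which are therefore the atoms of the Boolean algebra.\<close>

definition atoms :: "'z set" where
  "atoms = {x \<in> face e. ext x}"

lemmas exposed_e = exposed_face_tripotent[OF tripotent_e]

lemma dual_e: "e \<in> dual" and norm_e: "norm e \<le> 1"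
  using tripotentD[OF tripotent_e] by simp_all

lemma span_e: "closed_span (face e) = UNIV"
proof -
  have "x \<in> closed_span (face e)" for x
  proof -
    have "x \<in> range (\<lambda>y. peirce2 (face e) \<cdot> y)" using Z2_e unfolding Z2_def by simp
    then show ?thesis using peirce_mem(1)[OF exposed_e] by auto
  qed
  then show ?thesis by (auto intro: Set.set_eqI)
qed

lemma atoms_ext: "x \<in> atoms \<Longrightarrow> ext x" and atoms_face: "x \<in> atoms \<Longrightarrow> x \<in> face e"
  and e_atoms: "x \<in> atoms \<Longrightarrow> e \<cdot> x = 1"
  by (auto simp: atoms_def mem_face)

lemma nabla_cases:
  assumes "u \<in> nabla e"
  obtains "geometric_tripotent u" "face u \<subseteq> face e" | "u = 0"
  using assms by (auto simp: nabla_def)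

lemma face_0: "face (0 :: 'z \<Rightarrow>\<^sub>L 'k) = {}"
  by (auto simp: mem_face blinfun.zero_left)

lemma zero_nabla: "0 \<in> nabla e"
  by (simp add: nabla_def)

lemma e_nabla: "e \<in> nabla e"
  using tripotent_e by (simp add: nabla_def)

lemma nabla_dual: "u \<in> nabla e \<Longrightarrow> u \<in> dual"
  by (elim nabla_cases) (simp_all only: tripotentD(1) dual_0)

lemma nabla_norm: "u \<in> nabla e \<Longrightarrow> norm u \<le> 1"
  by (elim nabla_cases) (simp_all only: tripotentD(2) order_refl norm_zero zero_le_one)

lemma nabla_face: "u \<in> nabla e \<Longrightarrow> face u \<subseteq> face e"
  by (elim nabla_cases) (simp_all only: face_0 empty_subsetI)

lemma nabla_eq:
  assumes "u \<in> nabla e" "v \<in> nabla e" "face u = face v"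
  shows "u = v"
proof -
  have "face w \<noteq> {}" if "geometric_tripotent w" for w :: "'z \<Rightarrow>\<^sub>L 'k"
    using exposed_face_tripotent[OF that] by (simp add: norm_exposed_face_def)
  then have "u = 0 \<longleftrightarrow> v = 0" using assms face_0 unfolding nabla_def by blast
  then show ?thesis using assms tripotent_unique unfolding nabla_def by blast
qed

lemma ex_nabla:
  assumes "h \<in> dual" "norm h \<le> 1" "face h \<subseteq> face e"
  obtains w where "w \<in> nabla e" "face w = face h"
proof (cases "face h = {}")
  case True
  then show ?thesis using that[OF zero_nabla] face_0 by simp
next
  case False
  then have "norm_exposed_face (face h)" using exposedI[OF assms(1,2)] by blast
  then obtain w where "geometric_tripotent w" "face w = face h" by (rule ex_tripotent)
  then show ?thesis using that[of w] assms(3) by (simp add: nabla_def)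
qed

lemma nabla_order_simps [simp]:
  "carrier (nabla_order e) = nabla e" "u \<sqsubseteq>\<^bsub>nabla_order e\<^esub> v \<longleftrightarrow> face u \<subseteq> face v"
  by (simp_all add: nabla_order_def)

text \<open>Joins and meets are given by choice of an extremal bound, so a candidate is recognized
  by its order property and then identified through \<open>nabla_eq\<close>.\<close>

lemma join_nabla:
  assumes w: "w \<in> nabla e" "face u \<subseteq> face w" "face v \<subseteq> face w"
    and le: "\<And>w'. w' \<in> nabla e \<Longrightarrow> face u \<subseteq> face w' \<Longrightarrow> face v \<subseteq> face w' \<Longrightarrow> face w \<subseteq> face w'"
    and uv: "u \<in> nabla e" "v \<in> nabla e"
  shows "u \<squnion>\<^bsub>nabla_order e\<^esub> v = w"
  unfolding join_def sup_def
proof (rule some_equality)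
  show least: "least (nabla_order e) w (Upper (nabla_order e) {u, v})"
    using w le uv by (auto simp: least_def Upper_def)
  fix w' assume "least (nabla_order e) w' (Upper (nabla_order e) {u, v})"
  then have "w' \<in> nabla e" "face w' \<subseteq> face w" "face w \<subseteq> face w'"
    using least by (auto simp: least_def)
  then show "w' = w" using nabla_eq w(1) by blast
qed

lemma meet_nabla:
  assumes w: "w \<in> nabla e" "face w = face u \<inter> face v" and uv: "u \<in> nabla e" "v \<in> nabla e"
  shows "u \<sqinter>\<^bsub>nabla_order e\<^esub> v = w"
  unfolding meet_def inf_def
proof (rule some_equality)
  show greatest: "greatest (nabla_order e) w (Lower (nabla_order e) {u, v})"
    using w uv by (auto simp: greatest_def Lower_def)
  fix w' assume "greatest (nabla_order e) w' (Lower (nabla_order e) {u, v})"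
  then have "w' \<in> nabla e" "face w' \<subseteq> face w" "face w \<subseteq> face w'"
    using greatest by (auto simp: greatest_def)
  then show "w' = w" using nabla_eq w(1) by blast
qed

text \<open>1 is an extreme point of the unit disc, so the average of two values in it equals 1 only
  if both do. This provides the meets in \<open>nabla e\<close>.\<close>

lemma face_half_sum:
  assumes "norm u \<le> 1" "norm v \<le> 1"
  shows "norm ((1/2) *\<^sub>R (u + v)) \<le> 1" "face ((1/2) *\<^sub>R (u + v)) = face u \<inter> face (v :: 'z \<Rightarrow>\<^sub>L 'k)"
proof -
  show "norm ((1/2) *\<^sub>R (u + v)) \<le> 1" using norm_triangle_ineq[of u v] assms by simp
  have "u \<cdot> y = 1 \<and> v \<cdot> y = 1" if y: "norm y \<le> 1" "(1/2) *\<^sub>R (u \<cdot> y + v \<cdot> y) = 1" for y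
  proof -
    have "rp ((1/2) *\<^sub>R (u \<cdot> y + v \<cdot> y)) = 1" by (simp only: y(2) rp_1)
    then have "rp (u \<cdot> y) + rp (v \<cdot> y) = 2" by simp
    then have "norm (u \<cdot> y) \<le> rp (u \<cdot> y)" "norm (u \<cdot> y) = 1" "norm (v \<cdot> y) \<le> rp (v \<cdot> y)" "norm (v \<cdot> y) = 1"
      using norm_blinfun_le[OF assms(1), of y] norm_blinfun_le[OF assms(2), of y] y(1)
        rp_le_norm[of "u \<cdot> y"] rp_le_norm[of "v \<cdot> y"] by linarith+
    then show ?thesis using eq_norm_if_rp_ge[of "u \<cdot> y"] eq_norm_if_rp_ge[of "v \<cdot> y"] by simp
  qed
  then show "face ((1/2) *\<^sub>R (u + v)) = face u \<inter> face v"
    by (auto simp: mem_face blinfun.scaleR_left blinfun.add_left simp flip: scaleR_2)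
qed

lemma ex_meet:
  assumes "u \<in> nabla e" "v \<in> dual" "norm v \<le> 1"
  obtains w where "w \<in> nabla e" "face w = face u \<inter> face v"
proof -
  note half = face_half_sum[OF nabla_norm[OF assms(1)] assms(3)]
  have "(1/2) *\<^sub>R (u + v) \<in> dual" using assms nabla_dual by (intro dual_scaleR dual_add) auto
  then obtain w where "w \<in> nabla e" "face w = face ((1/2) *\<^sub>R (u + v))"
    using ex_nabla half nabla_face[OF assms(1)] by blast
  then show ?thesis using that half(2) by simp
qed

text \<open>By \<open>dual_tri_perp\<close> this functional is e - tri x, the complement of
  \<open>tri x\<close>. At a point where it is 1 the orthogonal part carries the whole norm, so
  neutrality of \<open>perp x\<close> makes the point orthogonal to \<open>x\<close>.\<close>

lemma face_perp:
  assumes x: "x \<in> atoms"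
  shows "norm (e o\<^sub>L perp x) \<le> 1" "face (e o\<^sub>L perp x) = {y \<in> face e. tri x \<cdot> y = 0}"
    and "y \<in> face (e o\<^sub>L perp x) \<Longrightarrow> y \<diamondsuit> x"
proof -
  note ex = atoms_ext[OF x]
  have split: "e \<cdot> y = tri x \<cdot> y + e \<cdot> (perp x \<cdot> y)" for y
    by (rule dual_tri_perp[OF ex dual_e norm_e e_atoms[OF x]])
  show "norm (e o\<^sub>L perp x) \<le> 1"
  proof (rule norm_blinfun_bound)
    show "norm ((e o\<^sub>L perp x) \<cdot> y) \<le> 1 * norm y" for y
      using order_trans[OF norm_blinfun_le[OF norm_e] norm_perp_le[OF ex]] by simp
  qed simp
  have perp: "perp x \<cdot> y = y" if y: "norm y \<le> 1" "e \<cdot> (perp x \<cdot> y) = 1" for y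
  proof (rule perp_neutral[OF ex])
    show "norm (perp x \<cdot> y) = norm y"
      using norm_blinfun_le[OF norm_e, of "perp x \<cdot> y"] norm_perp_le[OF ex, of y] y by simp
  qed
  show "y \<diamondsuit> x" if "y \<in> face (e o\<^sub>L perp x)" for y
    using perp[of y] perp_diamond[OF ex, of y] that by (simp add: mem_face)
  show "face (e o\<^sub>L perp x) = {y \<in> face e. tri x \<cdot> y = 0}"
  proof (intro Set.set_eqI iffI)
    fix y assume "y \<in> face (e o\<^sub>L perp x)"
    then have y: "norm y \<le> 1" "e \<cdot> (perp x \<cdot> y) = 1" by (simp_all add: mem_face)
    have "tri x \<cdot> (perp x \<cdot> y) = 0" by (rule tri_perp[OF ex])
    then show "y \<in> {y \<in> face e. tri x \<cdot> y = 0}" using y perp[OF y] by (simp add: mem_face)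
  next
    fix y assume "y \<in> {y \<in> face e. tri x \<cdot> y = 0}"
    then have y: "norm y \<le> 1" "e \<cdot> y = 1" "tri x \<cdot> y = 0" by (simp_all add: mem_face)
    then have "e \<cdot> (perp x \<cdot> y) = 1" using split[of y] by (metis add_0)
    then show "y \<in> face (e o\<^sub>L perp x)" using y(1) by (simp add: mem_face)
  qed
qed

text \<open>
  The tripotent of \<open>x\<close> and the one of the part of \<open>face e\<close> on which \<open>tri x\<close> vanishes have join \<open>e\<close>,
  so distributivity splits every \<open>u\<close> accordingly.
\<close>

lemma dichotomy:
  assumes u: "u \<in> nabla e" and x: "x \<in> atoms" and xu: "x \<notin> face u" and y: "y \<in> face u"
  shows "y \<diamondsuit> x" "tri x \<cdot> y = 0"
proof -
  note ex = atoms_ext[OF x]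
  define h where "h = e o\<^sub>L perp x"
  have h: "h \<in> dual" unfolding h_def by (intro dual_comp dual_e klinear_perp ex)
  note fh = face_perp[OF x, folded h_def]
  obtain g where g: "g \<in> nabla e" "face g = face h" by (rule ex_nabla[OF h fh(1)]) (use fh(2) in auto)
  have t: "tri x \<in> nabla e" using tripotent_tri[OF ex] face_tri[OF ex] atoms_face[OF x] by (simp add: nabla_def)
  \<comment> \<open>For \<open>p\<close> in the face of \<open>e\<close>, equality in |a| + |b|
    \<le> 1 forces \<open>e\<close> to attain the norm of the orthogonal part \<open>b\<close>,
    which after normalization lies in the face of \<open>g\<close>. So every upper bound
    \<open>w\<close> agrees with \<open>e\<close> at \<open>p\<close>.\<close>
  have "tri x \<squnion>\<^bsub>nabla_order e\<^esub> g = e"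
  proof (rule join_nabla[OF e_nabla nabla_face[OF t] nabla_face[OF g(1)] _ t g(1)])
    fix w assume w: "w \<in> nabla e" "face (tri x) \<subseteq> face w" "face g \<subseteq> face w"
    then have wx: "w \<cdot> x = 1" using face_tri[OF ex] by (auto simp: mem_face)
    show "face e \<subseteq> face w"
    proof
      fix p assume p: "p \<in> face e"
      define a b where "a = tri x \<cdot> p" and "b = perp x \<cdot> p"
      have ab: "norm a + norm b \<le> 1" using norm_tri_perp[OF ex, of p] p by (simp add: a_def b_def mem_face)
      have "e \<cdot> p = a + e \<cdot> b" unfolding a_def b_def by (rule dual_tri_perp[OF ex dual_e norm_e e_atoms[OF x]])
      then have sum: "a + e \<cdot> b = 1" using p by (simp add: mem_face)
      then have "rp a + rp (e \<cdot> b) = 1" by (metis rp_add rp_1)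
      then have "norm a \<le> rp a" "norm (e \<cdot> b) \<le> rp (e \<cdot> b)" "norm (e \<cdot> b) = norm b"
        using ab rp_le_norm[of a] rp_le_norm[of "e \<cdot> b"] norm_blinfun_le[OF norm_e, of b] by linarith+
      then have eb: "e \<cdot> b = of_real (norm b)" using eq_norm_if_rp_ge[of "e \<cdot> b"] by simp
      have "w \<cdot> b = of_real (norm b)"
      proof (cases "b = 0")
        case False
        define q where "q = b /\<^sub>R norm b"
        have "e \<cdot> q = 1" using False by (simp add: q_def blinfun.scaleR_right eb scaleR_conv_of_real)
        moreover have "tri x \<cdot> q = 0" by (simp add: q_def b_def blinfun.scaleR_right tri_perp[OF ex])
        ultimately have "q \<in> face g" using False by (simp add: g(2) fh(2) mem_face q_def)
        then have "w \<cdot> q = 1" using w(3) by (auto simp: mem_face)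
        moreover have "b = norm b *\<^sub>R q" using False by (simp add: q_def)
        ultimately show ?thesis by (metis blinfun.scaleR_right of_real_def)
      qed (simp add: blinfun.zero_right)
      moreover have "w \<cdot> p = a + w \<cdot> b"
        unfolding a_def b_def by (rule dual_tri_perp[OF ex nabla_dual[OF w(1)] nabla_norm[OF w(1)] wx])
      ultimately show "p \<in> face w" using sum eb p by (simp add: mem_face)
    qed
  qed
  then have "u \<sqinter>\<^bsub>nabla_order e\<^esub> e = (u \<sqinter>\<^bsub>nabla_order e\<^esub> tri x) \<squnion>\<^bsub>nabla_order e\<^esub> (u \<sqinter>\<^bsub>nabla_order e\<^esub> g)"
    using boolean u t g(1) unfolding nabla_boolean_def by metis
  moreover have "u \<sqinter>\<^bsub>nabla_order e\<^esub> e = u"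
    by (rule meet_nabla[OF u _ u e_nabla]) (use nabla_face[OF u] in blast)
  moreover have "u \<sqinter>\<^bsub>nabla_order e\<^esub> tri x = 0"
    by (rule meet_nabla[OF zero_nabla _ u t]) (use xu face_tri[OF ex] face_0 in auto)
  moreover obtain m where m: "m \<in> nabla e" "face m = face u \<inter> face g"
    using ex_meet[OF u nabla_dual[OF g(1)] nabla_norm[OF g(1)]] by blast
  moreover have "u \<sqinter>\<^bsub>nabla_order e\<^esub> g = m" by (rule meet_nabla[OF m u g(1)])
  moreover have "0 \<squnion>\<^bsub>nabla_order e\<^esub> m = m"
    by (rule join_nabla[OF m(1) _ order_refl _ zero_nabla m(1)]) (auto simp: face_0)
  ultimately have "u = m" by simp
  then have "y \<in> face h" using y m(2) g(2) by blast
  then show "y \<diamondsuit> x" "tri x \<cdot> y = 0" using fh(2,3) by auto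
qed

lemma atoms_diamond: "pairwise (\<diamondsuit>) atoms"
proof (rule pairwiseI)
  fix x y assume xy: "x \<in> atoms" "y \<in> atoms" "x \<noteq> y"
  note ex = atoms_ext[OF xy(1)]
  have "tri x \<in> nabla e" using tripotent_tri[OF ex] face_tri[OF ex] atoms_face[OF xy(1)] by (simp add: nabla_def)
  then show "x \<diamondsuit> y" using dichotomy(1)[OF _ xy(2)] xy(3) face_tri[OF ex] by auto
qed

lemma atoms_family: "orthogonal_family atoms"
  using atoms_diamond atoms_ext by (simp add: orthogonal_family_def)

lemmas atoms_subset = orthogonal_family_subset[OF atoms_family]

text \<open>The intersection of the faces of \<open>e\<close> and \<open>g\<close> is the face of an
  element of \<open>nabla e\<close>; by \<open>dichotomy\<close> an atom outside it has coefficient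
  zero at each of its points.\<close>

lemma smooth_atoms:
  assumes g: "g \<in> dual" "norm g \<le> 1" "y \<in> face e" "g \<cdot> y = 1" and x: "x \<in> atoms" "tri x \<cdot> y \<noteq> 0"
  shows "g \<cdot> x = 1"
proof -
  obtain w where w: "w \<in> nabla e" "face w = face e \<inter> face g"
    using ex_meet[OF e_nabla g(1,2)] by blast
  have "y \<in> face w" using g w by (simp add: mem_face)
  then have "x \<in> face w" using dichotomy(2)[OF w(1) x(1)] x(2) by blast
  then show ?thesis using w(2) by (simp add: mem_face)
qed

end

text \<open>Completeness is given as a property of \<open>UNIV\<close>, so the limit comes from the
  Cauchy filter of the finite partial sums, whose distances are controlled by tails of the
  norms.\<close>

lemma summable_on_if_abs_summable:
  fixes f :: "'i \<Rightarrow> 'z::real_normed_vector"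
  assumes complete: "complete (UNIV :: 'z set)" and abs: "f abs_summable_on A"
  shows "f summable_on A"
proof -
  obtain L where L: "((\<lambda>x. norm (f x)) has_sum L) A" using abs by (auto simp: summable_on_def)
  define G where "G = filtermap (sum f) (finite_subsets_at_top A)"
  have "cauchy_filter G"
    unfolding G_def cauchy_filter_metric_filtermap
  proof (intro allI impI)
    fix \<epsilon> :: real assume \<epsilon>: "\<epsilon> > 0"
    then obtain F0 where F0: "finite F0" "F0 \<subseteq> A" "dist (\<Sum>x\<in>F0. norm (f x)) L \<le> \<epsilon> / 3"
      using has_sum_finite_approximation[OF L, of "\<epsilon> / 3"] by auto
    have close: "dist (sum f F) (sum f F0) \<le> \<epsilon> / 3" if F: "finite F" "F0 \<subseteq> F" "F \<subseteq> A" for F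
    proof -
      have "sum f F - sum f F0 = sum f (F - F0)" using F by (simp add: sum_diff)
      then have "dist (sum f F) (sum f F0) \<le> (\<Sum>x\<in>F - F0. norm (f x))" by (simp add: dist_norm norm_sum)
      also have "\<dots> = (\<Sum>x\<in>F. norm (f x)) - (\<Sum>x\<in>F0. norm (f x))" using F by (simp add: sum_diff)
      also have "(\<Sum>x\<in>F. norm (f x)) \<le> L" using F by (intro finite_sum_le_has_sum[OF L]) auto
      finally show ?thesis using F0(3) unfolding dist_real_def by linarith
    qed
    have "eventually (\<lambda>F. finite F \<and> F0 \<subseteq> F \<and> F \<subseteq> A) (finite_subsets_at_top A)"
      unfolding eventually_finite_subsets_at_top by (intro exI[of _ F0]) (simp add: F0(1,2))
    moreover have "dist (sum f F) (sum f F') < \<epsilon>"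
      if "finite F \<and> F0 \<subseteq> F \<and> F \<subseteq> A" "finite F' \<and> F0 \<subseteq> F' \<and> F' \<subseteq> A" for F F'
      using close[of F] close[of F'] that dist_triangle2[of "sum f F" "sum f F'" "sum f F0"] \<epsilon> by linarith
    ultimately show "\<exists>P. eventually P (finite_subsets_at_top A) \<and> (\<forall>F F'. P F \<and> P F' \<longrightarrow> dist (sum f F) (sum f F') < \<epsilon>)"
      by (intro exI[of _ "\<lambda>F. finite F \<and> F0 \<subseteq> F \<and> F \<subseteq> A"]) simp
  qed
  moreover have "G \<noteq> bot" by (simp add: G_def filtermap_bot_iff)
  ultimately obtain l where "G \<le> nhds l" using complete[unfolded complete_uniform] by auto
  then have "(f has_sum l) A" by (simp add: has_sum_def filterlim_def G_def)
  then show ?thesis by (auto simp: summable_on_def)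
qed

context boolean_sfs
begin

subsection \<open>Faces spanned by finitely many atoms\<close>

lemma klinear_eq_on_closed_span:
  assumes "klinear S" "klinear T" "\<And>y. y \<in> F \<Longrightarrow> S \<cdot> y = T \<cdot> y" "x \<in> closed_span F"
  shows "S \<cdot> x = T \<cdot> x"
proof -
  have "closed_span F \<subseteq> {x. S \<cdot> x = T \<cdot> x}"
  proof (rule closed_span_minimal)
    show "subspace {x. S \<cdot> x = T \<cdot> x}"
      using klinearD[OF assms(1)] klinearD[OF assms(2)] by (auto simp: subspace_def blinfun.zero_right blinfun.add_right)
    show "closed {x. S \<cdot> x = T \<cdot> x}"
      by (intro closed_Collect_eq continuous_intros)
  qed (use assms(3) in auto)
  then show ?thesis using assms(4) by blast
qed

definition expand :: "'z set \<Rightarrow> 'z \<Rightarrow>\<^sub>L 'z" where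
  "expand A = (\<Sum>x\<in>A. peirce2 {x})"

lemma expand_apply:
  assumes "finite A" "A \<subseteq> atoms"
  shows "expand A \<cdot> p = (\<Sum>x\<in>A. scale (tri x \<cdot> p) x)"
  using assms unfolding expand_def
  by (induction A rule: finite_induct) (simp_all add: blinfun.zero_left blinfun.add_left peirce2_ext atoms_ext)

lemma klinear_expand: "finite A \<Longrightarrow> A \<subseteq> atoms \<Longrightarrow> klinear (expand A)"
  by (simp add: klinear_def expand_apply scale_sum_right dualD[OF tri_dual[OF atoms_ext]] subset_iff)

text \<open>For the lower bound the functionals \<open>tri x\<close>, biorthogonal to the atoms,
  recover the coefficients.\<close>

lemma norm_sum_atoms:
  assumes "finite A" "A \<subseteq> atoms"
  shows "norm (\<Sum>x\<in>A. scale (c x) x) = (\<Sum>x\<in>A. norm (c x))"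
proof (rule antisym)
  show "norm (\<Sum>x\<in>A. scale (c x) x) \<le> (\<Sum>x\<in>A. norm (c x))"
    using assms atoms_ext by (intro sum_norm_le) (auto simp: norm_scale)
  have "tri x \<cdot> (\<Sum>y\<in>A. scale (c y) y) = c x" if x: "x \<in> A" for x
  proof -
    have "tri x \<cdot> (\<Sum>y\<in>A. scale (c y) y) = (\<Sum>y\<in>A. if x = y then c y else 0)"
      unfolding blinfun.sum_right
    proof (intro sum.cong refl)
      fix y assume "y \<in> A"
      then have "x \<in> atoms" "y \<in> atoms" using x assms(2) by auto
      then show "tri x \<cdot> scale (c y) y = (if x = y then c y else 0)"
        by (simp add: dualD[OF tri_dual[OF atoms_ext]] orthogonal_family_tri[OF atoms_family])
    qed
    then show ?thesis using assms(1) x by simp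
  qed
  then have "(\<Sum>x\<in>A. norm (c x)) = (\<Sum>x\<in>A. norm (tri x \<cdot> (\<Sum>y\<in>A. scale (c y) y)))"
    by (intro sum.cong refl) simp
  also have "\<dots> \<le> norm (\<Sum>y\<in>A. scale (c y) y)"
    by (rule sum_norm_tri_le[OF assms(1) atoms_subset[OF assms(2)]])
  finally show "(\<Sum>x\<in>A. norm (c x)) \<le> norm (\<Sum>x\<in>A. scale (c x) x)" .
qed

text \<open>On the face of \<open>part A\<close> the coefficients along \<open>A\<close> use up the
  whole norm, so the remainder in \<open>family_split\<close> vanishes and \<open>e\<close> takes
  the same value as \<open>part A\<close>.\<close>

lemma face_part_subset:
  assumes A: "finite A" "A \<subseteq> atoms"
  shows "face (part A) \<subseteq> face e"
proof
  fix y assume y: "y \<in> face (part A)"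
  obtain q where q: "(\<Sum>x\<in>A. norm (tri x \<cdot> y)) + norm q \<le> norm y"
    "\<forall>g\<in>dual. norm g \<le> 1 \<longrightarrow> (\<forall>x\<in>A. g \<cdot> x = 1) \<longrightarrow> g \<cdot> y = part A \<cdot> y + g \<cdot> q"
    using family_split[OF A(1) atoms_subset[OF A(2)], of y] by (elim exE conjE)
  have split: "e \<cdot> y = part A \<cdot> y + e \<cdot> q" using q(2) dual_e norm_e e_atoms A(2) by blast
  have "1 \<le> (\<Sum>x\<in>A. norm (tri x \<cdot> y))"
    using norm_sum[of "\<lambda>x. tri x \<cdot> y" A] y by (simp add: mem_face part_apply[OF A(1)])
  then have "norm q \<le> 0" using q(1) y unfolding mem_face by linarith
  then show "y \<in> face e" using split y by (simp add: mem_face blinfun.zero_right)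
qed

lemma part_atom: "finite A \<Longrightarrow> A \<subseteq> atoms \<Longrightarrow> x \<in> atoms \<Longrightarrow> part A \<cdot> x = (if x \<in> A then 1 else 0)"
  by (rule part_family[OF atoms_family])

lemma atoms_face_part:
  assumes A: "finite A" "A \<subseteq> atoms"
  shows "A = {x \<in> face (part A). x extreme_point_of cball 0 1}"
proof (intro Set.set_eqI iffI)
  fix x assume "x \<in> A"
  then show "x \<in> {x \<in> face (part A). x extreme_point_of cball 0 1}"
    using A part_atom[OF A, of x] norm_ext[OF atoms_ext, of x] by (auto simp: mem_face atoms_ext)
next
  fix x assume x: "x \<in> {x \<in> face (part A). x extreme_point_of cball 0 1}"
  then have "x \<in> atoms" using face_part_subset[OF A] by (auto simp: atoms_def)
  then show "x \<in> A" using x part_atom[OF A, of x] by (auto simp: mem_face split: if_splits)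
qed

context
  fixes A assumes A: "finite A" "A \<subseteq> atoms" "A \<noteq> {}"
begin

lemma exposed_part: "norm_exposed_face (face (part A))"
proof -
  obtain x where "x \<in> A" using A(3) by blast
  then have "x \<in> face (part A)" using atoms_face_part[OF A(1,2)] by blast
  then show ?thesis using exposedI part_dual[OF A(1) atoms_subset] norm_part_le[OF A(1) atoms_subset] A(2) by blast
qed

lemma atom_span_part: "x \<in> A \<Longrightarrow> x \<in> closed_span (face (part A))"
  using face_subset_closed_span[OF exposed_part] atoms_face_part[OF A(1,2)] by blast

lemma tri_peirce2_part: "x \<in> A \<Longrightarrow> tri x \<cdot> (peirce2 (face (part A)) \<cdot> p) = tri x \<cdot> p"
  using tri_peirce2[OF exposed_part _ atom_span_part] atoms_ext A(2) by blast

lemma tripotent_part: "geometric_tripotent (part A)"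
proof (rule tripotentI[OF part_dual[OF A(1) atoms_subset[OF A(2)]] norm_part_le[OF A(1) atoms_subset[OF A(2)]] exposed_part])
  show "part A \<cdot> (peirce2 (face (part A)) \<cdot> p) = part A \<cdot> p" for p
    unfolding part_apply[OF A(1)] by (intro sum.cong refl tri_peirce2_part)
qed

text \<open>The real parts sum to 1 and the moduli to at most 1, so no coefficient can differ from
  its modulus.\<close>

lemma tri_face_part:
  assumes y: "y \<in> face (part A)" and x: "x \<in> A"
  shows "tri x \<cdot> y = of_real (norm (tri x \<cdot> y))"
proof -
  have "(\<Sum>x\<in>A. norm (tri x \<cdot> y) - rp (tri x \<cdot> y)) \<le> 0"
    using sum_norm_tri_le[OF A(1) atoms_subset[OF A(2)], of y] y
    by (simp add: sum_subtractf mem_face part_apply[OF A(1)] flip: rp_sum)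
  moreover have "0 \<le> norm (tri x \<cdot> y) - rp (tri x \<cdot> y)" for x using rp_le_norm[of "tri x \<cdot> y"] by simp
  ultimately have "(\<Sum>x\<in>A. norm (tri x \<cdot> y) - rp (tri x \<cdot> y)) = 0" by (meson antisym sum_nonneg)
  then have "norm (tri x \<cdot> y) - rp (tri x \<cdot> y) = 0"
    using sum_nonneg_eq_0_iff[OF A(1)] rp_le_norm x by (metis (no_types, lifting) diff_ge_0_iff_ge)
  then show ?thesis by (intro eq_norm_if_rp_ge) simp
qed

end

text \<open>
  The projection of a point of the face of \<open>A\<close> orthogonal to one atom lies in a multiple of the face of
  the others, so the symmetries at the atoms average as required.
\<close>

lemma expand_face_part:
  assumes "finite A" "A \<subseteq> atoms" "y \<in> face (part A)"
  shows "expand A \<cdot> y = y"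
  using assms
proof (induction A arbitrary: y rule: finite_psubset_induct)
  case (psubset A)
  have fam: "orthogonal_family A" by (rule atoms_subset[OF psubset.prems(1)])
  have ne: "A \<noteq> {}"
    using psubset.prems(2) by (auto simp: part_def mem_face blinfun.zero_left)
  note A = psubset.hyps(1) psubset.prems(1) ne
  obtain x where x: "x \<in> A" using ne by blast
  have xa: "x \<in> atoms" using x A(2) by blast
  note ex = atoms_ext[OF xa]
  have half_face: "(1/2) *\<^sub>R (p + sym_at x \<cdot> p) = expand A \<cdot> p" if p: "p \<in> face (part A)" for p
  proof -
    define a where "a = norm (tri x \<cdot> p)"
    have ta: "tri x \<cdot> p = of_real a" unfolding a_def by (rule tri_face_part[OF A p x])
    have A': "finite (A - {x})" "A - {x} \<subseteq> atoms" "A - {x} \<subset> A" using A x by auto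
    have split: "expand A \<cdot> p = scale (tri x \<cdot> p) x + expand (A - {x}) \<cdot> p"
      unfolding expand_apply[OF A(1,2)] expand_apply[OF A'(1,2)] by (rule sum.remove[OF A(1) x])
    have tri_p: "tri y \<cdot> (perp x \<cdot> p) = tri y \<cdot> p" if "y \<in> A - {x}" for y
    proof (rule tri_sym_at_orth(2)[OF _ ex])
      show "ext y" "x \<diamondsuit> y" using fam that x by (auto simp: orthogonal_family_def pairwise_def)
    qed
    have "part (A - {x}) \<cdot> (perp x \<cdot> p) = part (A - {x}) \<cdot> p"
      unfolding part_apply[OF A'(1)] using tri_p by simp
    also have "\<dots> = part A \<cdot> p - tri x \<cdot> p"
      unfolding part_apply[OF A'(1)] part_apply[OF A(1)] using sum.remove[OF A(1) x, of "\<lambda>x. tri x \<cdot> p"] by simp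
    finally have part_p: "part (A - {x}) \<cdot> (perp x \<cdot> p) = (1 - a) *\<^sub>R 1" using p by (simp add: mem_face ta scaleR_conv_of_real)
    have np: "norm (perp x \<cdot> p) \<le> 1 - a" using norm_tri_perp[OF ex, of p] p by (simp add: mem_face a_def)
    have exp_p: "expand (A - {x}) \<cdot> (perp x \<cdot> p) = expand (A - {x}) \<cdot> p"
      unfolding expand_apply[OF A'(1,2)] using tri_p by simp
    have "expand (A - {x}) \<cdot> (perp x \<cdot> p) = perp x \<cdot> p"
    proof (cases "a = 1")
      case True
      then show ?thesis using np by (simp add: blinfun.zero_right)
    next
      case False
      then have a1: "a < 1" using np norm_ge_zero[of "perp x \<cdot> p"] by linarith
      define q where "q = (1 / (1 - a)) *\<^sub>R (perp x \<cdot> p)"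
      have "norm q \<le> 1" using np a1 by (simp add: q_def)
      moreover have "part (A - {x}) \<cdot> q = 1" using part_p a1 by (simp add: q_def blinfun.scaleR_right)
      ultimately have "q \<in> face (part (A - {x}))" by (simp add: mem_face)
      then have "expand (A - {x}) \<cdot> q = q" by (rule psubset.IH[OF A'(3,2)])
      moreover have "perp x \<cdot> p = (1 - a) *\<^sub>R q" using a1 by (simp add: q_def)
      ultimately show ?thesis by (simp add: blinfun.scaleR_right)
    qed
    then show ?thesis unfolding half_sum_sym_at[OF ex] split exp_p by simp
  qed
  have half_span: "(1/2) *\<^sub>R (p + sym_at x \<cdot> p) = expand A \<cdot> p" if p: "p \<in> closed_span (face (part A))" for p
  proof -
    define E where "E = (1/2) *\<^sub>R (id_blinfun + sym_at x)"
    have E: "E \<cdot> p = (1/2) *\<^sub>R (p + sym_at x \<cdot> p)" for p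
      by (simp add: E_def blinfun.scaleR_left blinfun.add_left)
    have "klinear E"
      unfolding klinear_def E klinearD[OF isoinvD(1)[OF isoinv_sym_at[OF ex]]]
      by (simp only: scale_right_distrib[symmetric] scaleR_scale[symmetric] scale_scale mult.commute simp_thms)
    then have "E \<cdot> p = expand A \<cdot> p"
      by (rule klinear_eq_on_closed_span[OF _ klinear_expand[OF A(1,2)] _ p]) (simp add: E half_face)
    then show ?thesis by (simp add: E)
  qed
  interpret face_averaging scale "part A" "sym_at x" A
  proof
    show "geometric_tripotent (part A)" by (rule tripotent_part[OF A])
    show "A = {x \<in> face (part A). x extreme_point_of cball 0 1}" by (rule atoms_face_part[OF A(1,2)])
    show "pairwise (\<diamondsuit>) A" using fam by (simp add: orthogonal_family_def)
    show "klinear (sym_at x)" by (rule isoinvD(1)[OF isoinv_sym_at[OF ex]])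
    show "norm (sym_at x \<cdot> p) \<le> norm p" for p by (simp add: norm_sym_at[OF ex])
    show "part A \<cdot> (sym_at x \<cdot> p) = part A \<cdot> p" for p
      using part_atom[OF A(1,2) xa] x by (intro dual_sym_at[OF ex part_dual[OF A(1) fam] norm_part_le[OF A(1) fam]]) simp
    show "norm ((1/2) *\<^sub>R (p + sym_at x \<cdot> p) - (\<Sum>x\<in>B. scale (tri x \<cdot> p) x)) \<le> norm p - (\<Sum>x\<in>B. norm (tri x \<cdot> p))"
      if B: "finite B" "B \<subseteq> A" and p: "p \<in> closed_span (face (part A))" for B p
    proof -
      have "(1/2) *\<^sub>R (p + sym_at x \<cdot> p) - (\<Sum>x\<in>B. scale (tri x \<cdot> p) x) = (\<Sum>x\<in>A - B. scale (tri x \<cdot> p) x)"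
        unfolding half_span[OF p] expand_apply[OF A(1,2)] using A(1) B by (simp add: sum_diff)
      also have "norm \<dots> \<le> (\<Sum>x\<in>A - B. norm (tri x \<cdot> p))"
        using A by (intro order_trans[OF norm_sum] sum_mono) (auto simp: norm_scale norm_ext[OF atoms_ext])
      also have "\<dots> = (\<Sum>x\<in>A. norm (tri x \<cdot> p)) - (\<Sum>x\<in>B. norm (tri x \<cdot> p))" using A(1) B by (simp add: sum_diff)
      also have "\<dots> \<le> norm p - (\<Sum>x\<in>B. norm (tri x \<cdot> p))" using sum_norm_tri_le[OF A(1) fam, of p] by simp
      finally show ?thesis .
    qed
    show "\<exists>B. finite B \<and> B \<subseteq> A \<and> 1 - \<epsilon> \<le> (\<Sum>x\<in>B. rp (tri x \<cdot> p))" if "p \<in> face (part A)" "\<epsilon> > 0" for p \<epsilon>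
      using that A(1) by (intro exI[of _ A]) (simp add: mem_face part_apply[OF A(1)] flip: rp_sum)
    show "g \<cdot> x = 1" if "g \<in> dual" "norm g \<le> 1" "p \<in> face (part A)" "g \<cdot> p = 1" "x \<in> A" "tri x \<cdot> p \<noteq> 0" for g p x
      using that A(2) face_part_subset[OF A(1,2)] by (intro smooth_atoms[of g p x]) auto
  qed
  \<comment> \<open>\<open>R_face\<close> says that the symmetry at \<open>x\<close> fixes the face;
    its average with the identity was identified with \<open>expand A\<close> above.\<close>
  have "(1/2) *\<^sub>R (y + sym_at x \<cdot> y) = y" unfolding R_face[OF psubset.prems(2)] by (simp flip: scaleR_2)
  then show ?case using half_face[OF psubset.prems(2)] by simp
qed

text \<open>\<open>expand A\<close> is the identity on the span of the face, and its coefficients do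
  not distinguish \<open>p\<close> from its projection.\<close>

lemma peirce2_part:
  assumes A: "finite A" "A \<subseteq> atoms" "A \<noteq> {}"
  shows "peirce2 (face (part A)) \<cdot> p = expand A \<cdot> p"
proof -
  have "expand A \<cdot> (peirce2 (face (part A)) \<cdot> p) = id_blinfun \<cdot> (peirce2 (face (part A)) \<cdot> p)"
    by (rule klinear_eq_on_closed_span[OF klinear_expand[OF A(1,2)] klinear_id _ peirce_mem(1)[OF exposed_part[OF A]]])
      (simp add: expand_face_part[OF A(1,2)])
  then show ?thesis unfolding expand_apply[OF A(1,2)] using tri_peirce2_part[OF A] by simp
qed


subsection \<open>Expansion along all atoms\<close>

lemma sum_norm_atoms_le: "finite A \<Longrightarrow> A \<subseteq> atoms \<Longrightarrow> (\<Sum>x\<in>A. norm (tri x \<cdot> p)) \<le> norm p"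
  by (rule sum_norm_tri_le[OF _ atoms_subset])

lemma abs_summable_tri: "(\<lambda>x. tri x \<cdot> p) abs_summable_on atoms"
  unfolding abs_summable_iff_bdd_above
  by (rule bdd_aboveI2[of _ _ "norm p"]) (use sum_norm_atoms_le in auto)

text \<open>The sum of all \<open>tri x\<close> is realized by a functional \<open>s\<close> that is
  1 at every atom, so the common face of \<open>s\<close> and \<open>e\<close>, that of
  \<open>w\<close>, contains all atoms. If \<open>y\<close> had a part orthogonal to this face,
  \<open>h\<close> would expose a face whose extreme point is an atom orthogonal to itself. So
  \<open>y\<close> lies in the span of the face of \<open>w\<close>, where \<open>s\<close> and
  \<open>e\<close> agree.\<close>

lemma exhaust_atoms:
  assumes y: "y \<in> face e" and \<epsilon>: "\<epsilon> > 0"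
  shows "\<exists>A. finite A \<and> A \<subseteq> atoms \<and> 1 - \<epsilon> \<le> (\<Sum>x\<in>A. rp (tri x \<cdot> y))"
proof -
  define \<phi> where "\<phi> p = (\<Sum>\<^sub>\<infinity>x\<in>atoms. rp (tri x \<cdot> p))" for p
  have summable: "(\<lambda>x. rp (tri x \<cdot> p)) summable_on atoms" for p
    by (rule abs_summable_summable, rule summable_on_comparison_test[OF abs_summable_tri[of p]]) (simp_all add: abs_rp_le_norm)
  have lin: "linear \<phi>"
  proof (rule linearI)
    show "\<phi> (p + q) = \<phi> p + \<phi> q" for p q
      unfolding \<phi>_def by (simp add: blinfun.add_right infsum_add summable)
    show "\<phi> (r *\<^sub>R p) = r *\<^sub>R \<phi> p" for r p
      unfolding \<phi>_def by (simp add: blinfun.scaleR_right infsum_cmult_right')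
  qed
  have le: "\<phi> p \<le> 1 * norm p" for p
    unfolding \<phi>_def
  proof (rule infsum_le_finite_sums[OF summable])
    fix F assume "finite F" "F \<subseteq> atoms"
    then show "(\<Sum>x\<in>F. rp (tri x \<cdot> p)) \<le> 1 * norm p"
      using order_trans[OF sum_mono[of F, OF rp_le_norm] sum_norm_atoms_le] by simp
  qed
  obtain s where s: "s \<in> dual" "norm s \<le> 1" "\<And>p. rp (s \<cdot> p) = \<phi> p"
    using ex_dual_with_rp[OF lin le] by auto
  have s_atom: "s \<cdot> x = 1" if x: "x \<in> atoms" for x
  proof -
    have "(\<Sum>x'\<in>{x}. rp (tri x' \<cdot> x)) \<le> \<phi> x"
      unfolding \<phi>_def using x orthogonal_family_tri[OF atoms_family _ x] by (intro finite_sum_le_infsum summable) auto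
    then have "1 \<le> rp (s \<cdot> x)" using tri_self[OF atoms_ext[OF x]] by (simp add: s(3))
    then have "norm (s \<cdot> x) \<le> rp (s \<cdot> x)" "norm (s \<cdot> x) = 1"
      using norm_blinfun_le[OF s(2), of x] norm_ext[OF atoms_ext[OF x]] rp_le_norm[of "s \<cdot> x"] by linarith+
    then show ?thesis using eq_norm_if_rp_ge[of "s \<cdot> x"] by simp
  qed
  obtain w where w: "w \<in> nabla e" "face w = face e \<inter> face s" using ex_meet[OF e_nabla s(1,2)] by blast
  have atoms_w: "x \<in> face w" if "x \<in> atoms" for x
    using s_atom[OF that] atoms_face[OF that] w(2) by (simp add: mem_face)
  obtain x0 where "x0 \<in> face e" "ext x0" using exposed_contains_ext[OF exposed_e] by blast
  then have "x0 \<in> atoms" by (simp add: atoms_def)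
  then have Fw: "norm_exposed_face (face w)" by (rule exposedI[OF nabla_dual[OF w(1)] nabla_norm[OF w(1)] atoms_w])
  define b where "b = peirce0 (face w) \<cdot> y"
  have y1: "norm y \<le> 1" "e \<cdot> y = 1" using y by (simp_all add: mem_face)
  have sum: "e \<cdot> (peirce2 (face w) \<cdot> y) + e \<cdot> b = 1"
    using symmetry_invariant(2)[OF Fw dual_e norm_e nabla_face[OF w(1)], of y] y1 by (simp add: b_def)
  have "b = 0"
  proof (rule ccontr)
    assume b0: "b \<noteq> 0"
    define h where "h = e o\<^sub>L peirce0 (face w)"
    have h: "h \<in> dual" unfolding h_def by (intro dual_comp dual_e klinear_peirce Fw)
    have h1: "norm h \<le> 1"
      by (rule norm_blinfun_bound)
        (use order_trans[OF norm_blinfun_le[OF norm_e] norm_peirce0_le[OF Fw]] in \<open>auto simp: h_def\<close>)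
    have "rp (e \<cdot> (peirce2 (face w) \<cdot> y)) + rp (e \<cdot> b) = 1" using arg_cong[OF sum, of rp] by simp
    then have "norm (e \<cdot> b) \<le> rp (e \<cdot> b)" "norm (e \<cdot> b) = norm b"
      using norm_peirce_add[OF Fw, of y] y1(1) rp_le_norm[of "e \<cdot> b"] norm_blinfun_le[OF norm_e, of b]
        rp_le_norm[of "e \<cdot> (peirce2 (face w) \<cdot> y)"] norm_blinfun_le[OF norm_e, of "peirce2 (face w) \<cdot> y"]
      unfolding b_def[symmetric] by linarith+
    then have eb: "e \<cdot> b = of_real (norm b)" using eq_norm_if_rp_ge[of "e \<cdot> b"] by simp
    have "h \<cdot> b = e \<cdot> b" unfolding h_def b_def by (simp add: peirce_diamond_compl(2)[OF Fw peirce_mem(2)[OF Fw]])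
    then have "h \<cdot> (b /\<^sub>R norm b) = 1" using b0 by (simp add: blinfun.scaleR_right eb scaleR_conv_of_real)
    then have "b /\<^sub>R norm b \<in> face h" using b0 by (simp add: mem_face)
    then obtain z where z: "z \<in> face h" "ext z" using exposed_contains_ext[OF exposedI[OF h h1]] by blast
    have ez: "e \<cdot> (peirce0 (face w) \<cdot> z) = 1" using z by (simp add: mem_face h_def)
    then have "1 \<le> norm (peirce0 (face w) \<cdot> z)" using norm_blinfun_le[OF norm_e, of "peirce0 (face w) \<cdot> z"] by simp
    then have P0z: "peirce0 (face w) \<cdot> z = z"
      using norm_peirce0_le[OF Fw, of z] norm_ext[OF z(2)] by (intro peirce0_neutral[OF Fw]) simp
    then have "z \<in> atoms" using ez z(2) norm_ext[OF z(2)] by (simp add: atoms_def mem_face)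
    then have "z \<in> face w" by (rule atoms_w)
    moreover have "z \<in> diamond_compl (face w)" using peirce_mem(2)[OF Fw, of z] P0z by simp
    ultimately have "z \<diamondsuit> z" by (simp add: diamond_compl_def)
    then show False using diamond_self norm_ext[OF z(2)] by force
  qed
  then have e2: "e \<cdot> (peirce2 (face w) \<cdot> y) = 1" using sum by (simp add: blinfun.zero_right)
  then have "1 \<le> norm (peirce2 (face w) \<cdot> y)" using norm_blinfun_le[OF norm_e, of "peirce2 (face w) \<cdot> y"] by simp
  then have "peirce2 (face w) \<cdot> y = y"
    using norm_peirce2_le[OF Fw, of y] y1(1) by (intro peirce2_neutral[OF Fw]) simp
  then have "y \<in> closed_span (face w)" using peirce_mem(1)[OF Fw, of y] by simp
  then have "s \<cdot> y = e \<cdot> y"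
    by (rule dual_eq_on_closed_span[OF Fw s(1) dual_e, rotated]) (use w(2) in \<open>auto simp: mem_face\<close>)
  then have "\<phi> y = 1" using s(3)[of y] y1(2) by simp
  then have "((\<lambda>x. rp (tri x \<cdot> y)) has_sum 1) atoms" using has_sum_infsum[OF summable[of y]] by (simp add: \<phi>_def)
  from has_sum_finite_approximation[OF this \<epsilon>] obtain F where
    "finite F" "F \<subseteq> atoms" "dist (\<Sum>x\<in>F. rp (tri x \<cdot> y)) 1 \<le> \<epsilon>" by blast
  then show ?thesis by (intro exI[of _ F]) (simp add: dist_real_def abs_le_iff)
qed

abbreviation finite_atoms :: "'z set filter" where
  "finite_atoms \<equiv> finite_subsets_at_top atoms"

lemma eventually_finite_atoms:
  assumes "finite A" "A \<subseteq> atoms"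
  shows "\<forall>\<^sub>F B in finite_atoms. finite B \<and> A \<subseteq> B \<and> B \<subseteq> atoms"
  unfolding eventually_finite_subsets_at_top using assms by (intro exI[of _ A]) simp

lemma eventually_finite_atoms_nonempty: "\<forall>\<^sub>F B in finite_atoms. finite B \<and> B \<subseteq> atoms \<and> B \<noteq> {}"
proof -
  obtain x where "x \<in> face e" "ext x" using exposed_contains_ext[OF exposed_e] by blast
  then have "{x} \<subseteq> atoms" by (simp add: atoms_def)
  from eventually_finite_atoms[OF _ this] show ?thesis by (rule eventually_mono) auto
qed

lemma summable_atoms:
  fixes c :: "'z \<Rightarrow> 'k"
  assumes "c abs_summable_on atoms"
  shows "(\<lambda>x. scale (c x) x) summable_on atoms"
proof (rule summable_on_if_abs_summable[OF complete_space])
  show "(\<lambda>x. scale (c x) x) abs_summable_on atoms"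
    by (rule summable_on_comparison_test[OF assms]) (simp_all add: norm_scale norm_ext[OF atoms_ext])
qed

definition expansion :: "'z \<Rightarrow> 'z" where
  "expansion p = (\<Sum>\<^sub>\<infinity>x\<in>atoms. scale (tri x \<cdot> p) x)"

lemma has_sum_expansion: "((\<lambda>x. scale (tri x \<cdot> p) x) has_sum expansion p) atoms"
  unfolding expansion_def by (rule has_sum_infsum[OF summable_atoms[OF abs_summable_tri]])

lemma expand_tendsto: "((\<lambda>A. expand A \<cdot> p) \<longlongrightarrow> expansion p) finite_atoms"
proof (rule Lim_transform_eventually)
  show "((\<lambda>A. \<Sum>x\<in>A. scale (tri x \<cdot> p) x) \<longlongrightarrow> expansion p) finite_atoms"
    using has_sum_expansion by (simp add: has_sum_def)
  show "\<forall>\<^sub>F A in finite_atoms. (\<Sum>x\<in>A. scale (tri x \<cdot> p) x) = expand A \<cdot> p"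
    using eventually_finite_atoms_nonempty by (rule eventually_mono) (simp add: expand_apply)
qed

text \<open>Pass to the limit over finite supersets of \<open>A\<close>. The result is the
  \<open>average\<close> condition for the full expansion.\<close>

lemma norm_expand_diff_le:
  assumes "finite A" "A \<subseteq> atoms"
  shows "norm (expansion p - expand A \<cdot> p) \<le> norm p - (\<Sum>x\<in>A. norm (tri x \<cdot> p))"
proof (rule tendsto_upperbound[OF tendsto_norm[OF tendsto_diff[OF expand_tendsto tendsto_const]]])
  show "\<forall>\<^sub>F B in finite_atoms. norm (expand B \<cdot> p - expand A \<cdot> p) \<le> norm p - (\<Sum>x\<in>A. norm (tri x \<cdot> p))"
    using eventually_finite_atoms[OF assms]
  proof (rule eventually_mono)
    fix B assume B: "finite B \<and> A \<subseteq> B \<and> B \<subseteq> atoms"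
    then have "expand B \<cdot> p - expand A \<cdot> p = (\<Sum>x\<in>B - A. scale (tri x \<cdot> p) x)"
      using assms by (simp add: expand_apply sum_diff)
    also have "norm \<dots> \<le> (\<Sum>x\<in>B - A. norm (tri x \<cdot> p))"
      using B by (intro order_trans[OF norm_sum] sum_mono) (auto simp: norm_scale norm_ext[OF atoms_ext])
    also have "\<dots> = (\<Sum>x\<in>B. norm (tri x \<cdot> p)) - (\<Sum>x\<in>A. norm (tri x \<cdot> p))" using B by (simp add: sum_diff)
    finally show "norm (expand B \<cdot> p - expand A \<cdot> p) \<le> norm p - (\<Sum>x\<in>A. norm (tri x \<cdot> p))"
      using sum_norm_atoms_le[of B p] B by linarith
  qed
qed simp

lemma norm_expansion_le: "norm (expansion p) \<le> norm p"
  using norm_expand_diff_le[of "{}" p] by (simp add: expand_def blinfun.zero_left)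

lemma expansion_add: "expansion (p + q) = expansion p + expansion q"
  by (rule tendsto_unique[OF _ expand_tendsto]) (simp_all add: blinfun.add_right tendsto_add expand_tendsto)

lemma bounded_linear_scale: "bounded_linear (scale c)"
  by (rule bounded_linear_intro[of _ "norm c"])
    (simp_all add: scale_right_distrib norm_scale mult.commute flip: scaleR_scale)

lemma expansion_scale: "expansion (scale c p) = scale c (expansion p)"
proof (rule tendsto_unique[OF _ expand_tendsto])
  have "((\<lambda>A. scale c (expand A \<cdot> p)) \<longlongrightarrow> scale c (expansion p)) finite_atoms"
    by (rule bounded_linear.tendsto[OF bounded_linear_scale expand_tendsto])
  then show "((\<lambda>A. expand A \<cdot> scale c p) \<longlongrightarrow> scale c (expansion p)) finite_atoms"
  proof (rule Lim_transform_eventually)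
    show "\<forall>\<^sub>F A in finite_atoms. scale c (expand A \<cdot> p) = expand A \<cdot> scale c p"
      using eventually_finite_atoms_nonempty by (rule eventually_mono) (simp add: klinearD klinear_expand)
  qed
qed simp

definition expand_all :: "'z \<Rightarrow>\<^sub>L 'z" where
  "expand_all = Blinfun expansion"

lemma expand_all_apply [simp]: "expand_all \<cdot> p = expansion p"
proof -
  have "bounded_linear expansion"
    by (rule bounded_linear_intro[of _ 1])
      (simp_all add: expansion_add norm_expansion_le expansion_scale flip: scaleR_scale)
  then show ?thesis by (simp add: expand_all_def bounded_linear_Blinfun_apply)
qed

lemma klinear_expand_all: "klinear expand_all"
  by (simp add: klinear_def expansion_scale)

text \<open>By \<open>norm_peirce_add\<close> the orthogonal part has at most the norm that the
  coefficients along \<open>A\<close> leave over, and on the face of \<open>e\<close> these exhaust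
  1.\<close>

lemma peirce0_part_tendsto:
  assumes y: "y \<in> face e"
  shows "((\<lambda>A. peirce0 (face (part A)) \<cdot> y) \<longlongrightarrow> 0) finite_atoms"
proof (rule tendstoI)
  fix \<epsilon> :: real assume \<epsilon>: "\<epsilon> > 0"
  then have "\<epsilon> / 2 > 0" by simp
  then obtain A where A: "finite A" "A \<subseteq> atoms" "1 - \<epsilon> / 2 \<le> (\<Sum>x\<in>A. rp (tri x \<cdot> y))"
    using exhaust_atoms[OF y] by blast
  show "\<forall>\<^sub>F B in finite_atoms. dist (peirce0 (face (part B)) \<cdot> y) 0 < \<epsilon>"
    using eventually_conj[OF eventually_finite_atoms[OF A(1,2)] eventually_finite_atoms_nonempty]
  proof (rule eventually_mono)
    fix B assume "(finite B \<and> A \<subseteq> B \<and> B \<subseteq> atoms) \<and> finite B \<and> B \<subseteq> atoms \<and> B \<noteq> {}"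
    then have B: "finite B" "B \<subseteq> atoms" "B \<noteq> {}" "A \<subseteq> B" by simp_all
    have "norm (peirce2 (face (part B)) \<cdot> y) = (\<Sum>x\<in>B. norm (tri x \<cdot> y))"
      unfolding peirce2_part[OF B(1-3)] expand_apply[OF B(1,2)] by (rule norm_sum_atoms[OF B(1,2)])
    also have "\<dots> \<ge> (\<Sum>x\<in>A. norm (tri x \<cdot> y))" using B by (intro sum_mono2) auto
    also have "(\<Sum>x\<in>A. norm (tri x \<cdot> y)) \<ge> (\<Sum>x\<in>A. rp (tri x \<cdot> y))" by (intro sum_mono rp_le_norm)
    finally show "dist (peirce0 (face (part B)) \<cdot> y) 0 < \<epsilon>"
      using norm_peirce_add[OF exposed_part[OF B(1-3)], of y] y A(3) \<epsilon> by (simp add: mem_face)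
  qed
qed

text \<open>
  As a strong limit of symmetries, \<open>2 Q - I\<close> is isometric for the expansion \<open>Q\<close> along all atoms.
\<close>

lemma symmetry_part_tendsto:
  "((\<lambda>A. symmetry (face (part A)) \<cdot> p) \<longlongrightarrow> 2 *\<^sub>R expansion p - p) finite_atoms"
proof -
  define D where "D = {p. ((\<lambda>A. symmetry (face (part A)) \<cdot> p) \<longlongrightarrow> 2 *\<^sub>R expansion p - p) finite_atoms}"
  have on_face: "y \<in> D" if y: "y \<in> face e" for y
  proof -
    have "((\<lambda>A. 2 *\<^sub>R (expand A \<cdot> y + peirce0 (face (part A)) \<cdot> y) - y) \<longlongrightarrow> 2 *\<^sub>R (expansion y + 0) - y) finite_atoms"
      by (intro tendsto_intros expand_tendsto peirce0_part_tendsto y)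
    then have "((\<lambda>A. symmetry (face (part A)) \<cdot> y) \<longlongrightarrow> 2 *\<^sub>R (expansion y + 0) - y) finite_atoms"
    proof (rule Lim_transform_eventually)
      show "\<forall>\<^sub>F A in finite_atoms. 2 *\<^sub>R (expand A \<cdot> y + peirce0 (face (part A)) \<cdot> y) - y = symmetry (face (part A)) \<cdot> y"
        using eventually_finite_atoms_nonempty
      proof (rule eventually_mono)
        fix A assume "finite A \<and> A \<subseteq> atoms \<and> A \<noteq> {}"
        then have A: "finite A" "A \<subseteq> atoms" "A \<noteq> {}" by simp_all
        show "2 *\<^sub>R (expand A \<cdot> y + peirce0 (face (part A)) \<cdot> y) - y = symmetry (face (part A)) \<cdot> y"
          unfolding peirce2_part[OF A, symmetric] half_sum_symmetry[OF exposed_part[OF A], symmetric] by simp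
      qed
    qed
    then show ?thesis by (simp add: D_def)
  qed
  have "closed_span (face e) \<subseteq> D"
  proof (rule closed_span_minimal)
    show "face e \<subseteq> D" using on_face by blast
    show "subspace D"
      unfolding subspace_def
    proof (intro conjI ballI allI)
      show "0 \<in> D" using expansion_scale[of 0 0] by (simp add: D_def blinfun.zero_right)
      show "p + q \<in> D" if "p \<in> D" "q \<in> D" for p q
      proof -
        have eq: "2 *\<^sub>R expansion (p + q) - (p + q) = (2 *\<^sub>R expansion p - p) + (2 *\<^sub>R expansion q - q)"
          by (simp add: expansion_add scaleR_add_right)
        show ?thesis using that unfolding D_def mem_Collect_eq blinfun.add_right eq by (rule tendsto_add)
      qed
      show "scale c p \<in> D" if p: "p \<in> D" for c p
      proof -
        have "((\<lambda>A. scale c (symmetry (face (part A)) \<cdot> p)) \<longlongrightarrow> scale c (2 *\<^sub>R expansion p - p)) finite_atoms"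
          using p unfolding D_def by (intro bounded_linear.tendsto[OF bounded_linear_scale]) simp
        moreover have "scale c (2 *\<^sub>R expansion p - p) = 2 *\<^sub>R expansion (scale c p) - scale c p"
          by (simp only: expansion_scale scale_right_diff_distrib scaleR_scale[symmetric] scale_scale mult.commute)
        ultimately have "((\<lambda>A. scale c (symmetry (face (part A)) \<cdot> p)) \<longlongrightarrow> 2 *\<^sub>R expansion (scale c p) - scale c p) finite_atoms"
          by simp
        then have "((\<lambda>A. symmetry (face (part A)) \<cdot> scale c p) \<longlongrightarrow> 2 *\<^sub>R expansion (scale c p) - scale c p) finite_atoms"
        proof (rule Lim_transform_eventually)
          show "\<forall>\<^sub>F A in finite_atoms. scale c (symmetry (face (part A)) \<cdot> p) = symmetry (face (part A)) \<cdot> scale c p"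
            using eventually_finite_atoms_nonempty
            by (rule eventually_mono) (simp add: klinearD[OF klinear_symmetry[OF exposed_part]])
        qed
        then show ?thesis by (simp add: D_def)
      qed
    qed
    show "closed D"
      unfolding closed_sequential_limits
    proof (intro allI impI, elim conjE)
      fix u l assume u: "\<forall>n. u n \<in> D" and lim: "u \<longlonglongrightarrow> l"
      have "((\<lambda>A. symmetry (face (part A)) \<cdot> l) \<longlongrightarrow> 2 *\<^sub>R expansion l - l) finite_atoms"
      proof (rule tendstoI)
        fix \<epsilon> :: real assume \<epsilon>: "\<epsilon> > 0"
        \<comment> \<open>Five fifths: convergence at \<open>u n\<close>, the isometry applied to
          the difference, twice the contraction \<open>expansion\<close>, and the identity.\<close>
        then obtain n where n: "norm (u n - l) < \<epsilon> / 5" using LIMSEQ_D[OF lim, of "\<epsilon> / 5"] by auto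
        define q where "q = u n"
        have q: "q \<in> D" "norm (q - l) < \<epsilon> / 5" using u n by (simp_all add: q_def)
        have \<epsilon>5: "\<epsilon> / 5 > 0" using \<epsilon> by simp
        have "((\<lambda>A. symmetry (face (part A)) \<cdot> q) \<longlongrightarrow> 2 *\<^sub>R expansion q - q) finite_atoms"
          using q(1) by (simp add: D_def)
        from tendstoD[OF this \<epsilon>5]
        have "\<forall>\<^sub>F A in finite_atoms. dist (symmetry (face (part A)) \<cdot> q) (2 *\<^sub>R expansion q - q) < \<epsilon> / 5" .
        with eventually_finite_atoms_nonempty
        show "\<forall>\<^sub>F A in finite_atoms. dist (symmetry (face (part A)) \<cdot> l) (2 *\<^sub>R expansion l - l) < \<epsilon>"
        proof eventually_elim
          fix A assume A: "finite A \<and> A \<subseteq> atoms \<and> A \<noteq> {}"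
            and close: "dist (symmetry (face (part A)) \<cdot> q) (2 *\<^sub>R expansion q - q) < \<epsilon> / 5"
          define S where "S = symmetry (face (part A))"
          have exl: "expansion q = expansion l + expansion (q - l)" using expansion_add[of l "q - l"] by simp
          have eq: "S \<cdot> l - (2 *\<^sub>R expansion l - l) = (S \<cdot> q - (2 *\<^sub>R expansion q - q)) - (S \<cdot> (q - l)) + 2 *\<^sub>R expansion (q - l) - (q - l)"
            by (simp add: blinfun.diff_right exl scaleR_add_right)
          have "norm (S \<cdot> (q - l)) = norm (q - l)"
            unfolding S_def using norm_symmetry[OF exposed_part] A by blast
          moreover have "norm (2 *\<^sub>R expansion (q - l)) \<le> 2 * norm (q - l)" using norm_expansion_le[of "q - l"] by simp
          ultimately have "norm (S \<cdot> l - (2 *\<^sub>R expansion l - l)) < \<epsilon>"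
            unfolding eq using close[folded S_def, unfolded dist_norm] q(2)
              norm_triangle_ineq4[of "(S \<cdot> q - (2 *\<^sub>R expansion q - q)) - (S \<cdot> (q - l)) + 2 *\<^sub>R expansion (q - l)" "q - l"]
              norm_triangle_ineq[of "(S \<cdot> q - (2 *\<^sub>R expansion q - q)) - (S \<cdot> (q - l))" "2 *\<^sub>R expansion (q - l)"]
              norm_triangle_ineq4[of "S \<cdot> q - (2 *\<^sub>R expansion q - q)" "S \<cdot> (q - l)"] by linarith
          then show "dist (symmetry (face (part A)) \<cdot> l) (2 *\<^sub>R expansion l - l) < \<epsilon>" by (simp add: dist_norm S_def)
        qed
      qed
      then show "l \<in> D" by (simp add: D_def)
    qed
  qed
  then show ?thesis using span_e unfolding D_def by blast
qed

lemma expansion_face: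
  assumes y: "y \<in> face e"
  shows "expansion y = y"
proof -
  define R where "R = 2 *\<^sub>R expand_all - id_blinfun"
  have R: "R \<cdot> p = 2 *\<^sub>R expansion p - p" for p
    by (simp add: R_def blinfun.diff_left blinfun.scaleR_left)
  have R_half: "(1/2) *\<^sub>R (p + R \<cdot> p) = expansion p" for p by (simp add: R)
  have lim: "((\<lambda>A. symmetry (face (part A)) \<cdot> p) \<longlongrightarrow> R \<cdot> p) finite_atoms" for p
    unfolding R by (rule symmetry_part_tendsto)
  interpret face_averaging scale e R atoms
  proof
    show "geometric_tripotent e" by (rule tripotent_e)
    show "atoms = {x \<in> face e. x extreme_point_of cball 0 1}" by (simp add: atoms_def)
    show "pairwise (\<diamondsuit>) atoms" by (rule atoms_diamond)
    show "klinear R"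
      unfolding klinear_def R
      by (simp only: expansion_scale scale_right_diff_distrib scaleR_scale[symmetric] scale_scale mult.commute simp_thms)
    show "norm (R \<cdot> p) \<le> norm p" for p
    proof (rule tendsto_upperbound[OF tendsto_norm[OF lim]])
      show "\<forall>\<^sub>F A in finite_atoms. norm (symmetry (face (part A)) \<cdot> p) \<le> norm p"
        using eventually_finite_atoms_nonempty by (rule eventually_mono) (simp add: norm_symmetry[OF exposed_part])
    qed simp
    show "e \<cdot> (R \<cdot> p) = e \<cdot> p" for p
    proof (rule tendsto_unique)
      show "((\<lambda>A. e \<cdot> (symmetry (face (part A)) \<cdot> p)) \<longlongrightarrow> e \<cdot> (R \<cdot> p)) finite_atoms"
        by (intro tendsto_intros lim)
      have "\<forall>\<^sub>F A in finite_atoms. e \<cdot> p = e \<cdot> (symmetry (face (part A)) \<cdot> p)"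
        using eventually_finite_atoms_nonempty
        by (rule eventually_mono) (simp add: symmetry_invariant(1)[OF exposed_part dual_e norm_e face_part_subset])
      then show "((\<lambda>A. e \<cdot> (symmetry (face (part A)) \<cdot> p)) \<longlongrightarrow> e \<cdot> p) finite_atoms"
        by (rule Lim_transform_eventually[OF tendsto_const])
    qed simp
    show "norm ((1/2) *\<^sub>R (p + R \<cdot> p) - (\<Sum>x\<in>A. scale (tri x \<cdot> p) x)) \<le> norm p - (\<Sum>x\<in>A. norm (tri x \<cdot> p))"
      if "finite A" "A \<subseteq> atoms" for A p
      unfolding R_half using norm_expand_diff_le[OF that] by (simp add: expand_apply that)
  qed (use exhaust_atoms smooth_atoms in \<open>simp_all add: mem_face\<close>)
  show ?thesis using R_half[of y] unfolding R_face[OF y] by (simp flip: scaleR_2)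
qed

lemma expansion_eq: "expansion p = p"
proof -
  have "expand_all \<cdot> p = id_blinfun \<cdot> p"
    by (rule klinear_eq_on_closed_span[OF klinear_expand_all klinear_id, of "face e"]) (simp_all add: expansion_face span_e)
  then show ?thesis by simp
qed

lemma has_sum_atoms: "((\<lambda>x. scale (tri x \<cdot> p) x) has_sum p) atoms"
  using has_sum_expansion[of p] by (simp add: expansion_eq)

lemma norm_eq_infsum: "norm p = (\<Sum>\<^sub>\<infinity>x\<in>atoms. norm (tri x \<cdot> p))"
proof (rule antisym)
  have "norm (infsum (\<lambda>x. scale (tri x \<cdot> p) x) atoms) \<le> (\<Sum>\<^sub>\<infinity>x\<in>atoms. norm (scale (tri x \<cdot> p) x))"
    by (rule norm_infsum_bound, rule summable_on_comparison_test[OF abs_summable_tri[of p]])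
      (simp_all add: norm_scale norm_ext[OF atoms_ext])
  also have "infsum (\<lambda>x. scale (tri x \<cdot> p) x) atoms = p" by (rule infsumI[OF has_sum_atoms])
  also have "(\<Sum>\<^sub>\<infinity>x\<in>atoms. norm (scale (tri x \<cdot> p) x)) = (\<Sum>\<^sub>\<infinity>x\<in>atoms. norm (tri x \<cdot> p))"
    by (rule infsum_cong) (simp add: norm_scale norm_ext[OF atoms_ext])
  finally show "norm p \<le> (\<Sum>\<^sub>\<infinity>x\<in>atoms. norm (tri x \<cdot> p))" .
  show "(\<Sum>\<^sub>\<infinity>x\<in>atoms. norm (tri x \<cdot> p)) \<le> norm p"
    by (rule infsum_le_finite_sums[OF abs_summable_tri sum_norm_atoms_le])
qed


subsection \<open>Minimal tripotents and the isomorphism\<close>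

lemma diamond_scaled_atoms:
  assumes x: "x \<in> atoms" "y \<in> atoms" "x \<noteq> y"
  shows "scale c x \<diamondsuit> scale d y"
proof -
  have norm: "norm (scale a x + scale b y) = norm a + norm b" for a b
    using norm_sum_atoms[of "{x, y}" "\<lambda>w. if w = x then a else b"] x by simp
  have "scale c x - scale d y = scale c x + scale (- d) y" by simp
  then show ?thesis
    using norm[of c d] norm[of c "- d"] norm_ext[OF atoms_ext[OF x(1)]] norm_ext[OF atoms_ext[OF x(2)]]
    by (simp add: diamond_def norm_scale)
qed

text \<open>A coefficient with 0 < |c| < 1 makes \<open>z\<close> a convex combination of the
  normalized term along \<open>x\<close> and another vector of the ball; extremality then forces
  \<open>z\<close> to be that term, whose coefficient has modulus one.\<close>

lemma ext_eq_scale_atom: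
  assumes z: "ext z"
  obtains x c where "x \<in> atoms" "norm c = 1" "z = scale c x"
proof -
  have nz: "norm z = 1" by (rule norm_ext[OF z])
  have "\<exists>x\<in>atoms. tri x \<cdot> z \<noteq> 0"
  proof (rule ccontr)
    assume "\<not> ?thesis"
    then have "norm z = 0" unfolding norm_eq_infsum by (intro infsum_0) auto
    then show False using nz by simp
  qed
  then obtain x where x: "x \<in> atoms" "tri x \<cdot> z \<noteq> 0" by blast
  define c where "c = tri x \<cdot> z"
  have c: "0 < norm c" using x(2) by (simp add: c_def)
  have nx: "norm x = 1" by (rule norm_ext[OF atoms_ext[OF x(1)]])
  have diff: "norm (z - scale c x) \<le> 1 - norm c"
    using norm_expand_diff_le[of "{x}" z] x(1) nz by (simp add: expansion_eq expand_apply c_def)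
  have "norm c = 1"
  proof (rule ccontr)
    assume "norm c \<noteq> 1"
    moreover have "0 \<le> 1 - norm c" using diff norm_ge_zero order_trans by blast
    ultimately have c1: "norm c < 1" by simp
    define a where "a = (1 / norm c) *\<^sub>R scale c x"
    \<comment> \<open>The rest has norm at most 1 - |c| by the tail estimate, so this quotient stays
      in the ball.\<close>
    define b where "b = (1 / (1 - norm c)) *\<^sub>R (z - scale c x)"
    have a: "norm a = 1" using c nx by (simp add: a_def norm_scale)
    have b: "norm b \<le> 1" using diff c1 by (simp add: b_def)
    have zab: "z = (1 - norm c) *\<^sub>R b + norm c *\<^sub>R a" using c c1 by (simp add: a_def b_def)
    have "z = a"
    proof (rule ccontr)
      assume "z \<noteq> a"
      have "b \<noteq> a"
      proof
        assume "b = a"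
        then have "z = a" using zab by (simp flip: scaleR_add_left)
        then show False using \<open>z \<noteq> a\<close> by simp
      qed
      then have "z \<in> open_segment b a"
        unfolding in_segment using c c1 zab by (intro conjI exI[of _ "norm c"]) auto
      moreover have "b \<in> cball 0 1" "a \<in> cball 0 1" using a b by simp_all
      ultimately show False using z unfolding extreme_point_of_def by blast
    qed
    then have "tri x \<cdot> z = (1 / norm c) *\<^sub>R c"
      using tri_self[OF atoms_ext[OF x(1)]]
      by (simp add: a_def blinfun.scaleR_right dualD[OF tri_dual[OF atoms_ext[OF x(1)]]])
    then have "norm c = 1" using c unfolding c_def[symmetric] by (metis norm_scaleR abs_norm_cancel abs_divide abs_one nonzero_eq_divide_eq less_irrefl times_divide_eq_left mult_1)
    then show False using c1 by simp
  qed
  moreover from this have "z = scale c x" using diff by simp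
  ultimately show ?thesis using that x(1) by blast
qed

text \<open>Both functionals are compared term by term in the expansion of \<open>p\<close>: all
  other atoms are orthogonal to the scaled one.\<close>

lemma tri_scaled_atom:
  assumes x: "x \<in> atoms" and z: "ext (scale c x)" and c: "norm c = 1"
  shows "tri (scale c x) \<cdot> p = inverse c * tri x \<cdot> p"
proof -
  define z where "z = scale c x"
  note ez = z[folded z_def]
  have other: "tri z \<cdot> y = 0" if "y \<in> atoms" "y \<noteq> x" for y
    using tri_diamond[OF ez] diamond_scaled_atoms[OF that(1) x that(2), of 1 c] by (simp add: z_def)
  have "c * tri z \<cdot> x = 1" using tri_self[OF ez] dualD[OF tri_dual[OF ez], of c x] by (simp add: z_def)
  then have self: "tri z \<cdot> x = inverse c" by (simp add: inverse_unique)
  have "((\<lambda>y. tri z \<cdot> scale (tri y \<cdot> p) y) has_sum tri z \<cdot> p) atoms"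
    by (rule has_sum_bounded_linear[OF blinfun.bounded_linear_right has_sum_atoms])
  moreover have "((\<lambda>y. tri z \<cdot> scale (tri y \<cdot> p) y) has_sum tri x \<cdot> p * inverse c) atoms"
  proof (subst has_sum_cong_neutral[where T = "{x}" and g = "\<lambda>y. tri y \<cdot> p * inverse c"])
    show "((\<lambda>y. tri y \<cdot> p * inverse c) has_sum tri x \<cdot> p * inverse c) {x}" by (rule has_sum_finiteI) simp_all
  qed (use x other self in \<open>auto simp: dualD[OF tri_dual[OF ez]]\<close>)
  ultimately have "tri z \<cdot> p = tri x \<cdot> p * inverse c" by (rule has_sum_unique)
  then show ?thesis by (simp add: z_def mult.commute)
qed

lemma tri_in_U0:
  assumes "ext z" "ext w" "w \<diamondsuit> z"
  shows "tri z \<in> U0 (tri w)"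
proof -
  have "tri z = tri z o\<^sub>L perp w" by (rule blinfun_eqI) (simp add: tri_sym_at_orth(2)[OF assms])
  then show ?thesis using tri_dual[OF assms(1)] unfolding U0_def face_tri[OF assms(2)] by blast
qed

text \<open>The Peirce projection of an extreme point has rank one, so each f P2 is f(z) times
  \<open>tri z\<close>.\<close>

lemma minimal_tri:
  assumes z: "ext z"
  shows "minimal_tripotent (tri z)"
proof -
  interpret D: vector_space dual_scale by (rule vector_space_dual_scale)
  have nonzero: "tri z \<noteq> 0" using norm_tri[OF z] by force
  have "U2 (tri z) \<subseteq> D.span {tri z}"
  proof
    fix u assume "u \<in> U2 (tri z)"
    then obtain f where f: "f \<in> dual" "u = f o\<^sub>L peirce2 {z}" by (auto simp: U2_def face_tri[OF z])
    have "u = dual_scale (f \<cdot> z) (tri z)"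
      by (rule blinfun_eqI) (simp add: f(2) peirce2_ext[OF z] dualD[OF f(1)] mult.commute)
    then show "u \<in> D.span {tri z}" by (auto simp: D.span_singleton)
  qed
  moreover have "tri z = tri z o\<^sub>L peirce2 {z}"
    by (rule blinfun_eqI) (simp add: peirce2_ext[OF z] dualD[OF tri_dual[OF z]] tri_self[OF z])
  then have "tri z \<in> U2 (tri z)" using tri_dual[OF z] unfolding U2_def face_tri[OF z] by blast
  ultimately have "D.dim (U2 (tri z)) = 1"
    by (intro D.dim_unique[of "{tri z}"]) (auto simp: D.dependent_single nonzero)
  then show ?thesis using tripotent_tri[OF z] by (simp add: minimal_tripotent_def)
qed

text \<open>For an extreme point \<open>z\<close> on the face of \<open>w\<close>, both
  \<open>w\<close> and \<open>tri z\<close> belong to the one-dimensional \<open>U2 w\<close>, and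
  both are 1 at \<open>z\<close>.\<close>

lemma minimal_tripotent_tri:
  assumes w: "minimal_tripotent w"
  obtains z where "ext z" "w = tri z"
proof -
  interpret D: vector_space dual_scale by (rule vector_space_dual_scale)
  have tw: "geometric_tripotent w" and dim: "D.dim (U2 w) = 1" using w by (simp_all add: minimal_tripotent_def)
  note Fw = exposed_face_tripotent[OF tw]
  obtain z where z: "z \<in> face w" "ext z" using exposed_contains_ext[OF Fw] by blast
  obtain B where B: "U2 w \<subseteq> D.span B" "card B = 1" using D.basis_exists[of "U2 w"] dim by metis
  obtain v where v: "B = {v}" using B(2) card_1_singletonE by blast
  have "w = w o\<^sub>L peirce2 (face w)" by (rule blinfun_eqI) (simp add: tripotentD(3)[OF tw])
  then have "w \<in> U2 w" using tripotentD(1)[OF tw] unfolding U2_def by blast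
  then obtain a where a: "w = dual_scale a v" using B(1) unfolding v by (auto simp: D.span_singleton)
  have "z \<in> closed_span (face w)" using z(1) face_subset_closed_span[OF Fw] by blast
  then have "tri z = tri z o\<^sub>L peirce2 (face w)" by (intro blinfun_eqI) (simp add: tri_peirce2[OF Fw z(2)])
  then have "tri z \<in> U2 w" using tri_dual[OF z(2)] unfolding U2_def by blast
  then obtain b where b: "tri z = dual_scale b v" using B(1) unfolding v by (auto simp: D.span_singleton)
  have "w \<cdot> z = 1" "tri z \<cdot> z = 1" using z tri_self[OF z(2)] by (simp_all add: mem_face)
  then have "a * v \<cdot> z = 1" "b * v \<cdot> z = 1" unfolding a b by simp_all
  then have "a = b" by (metis mult_cancel_right mult_zero_right zero_neq_one)
  then show ?thesis using that[OF z(2)] a b by simp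
qed

text \<open>The coordinates are the values of the members of \<open>T\<close>. A minimal tripotent
  need not lie below \<open>e\<close>, so a member of \<open>T\<close> belongs to an atom only up to
  a phase \<open>k t\<close>; orthogonality makes this assignment injective and maximality makes it
  surjective.\<close>

lemma isometrically_isomorphic:
  assumes T: "maximal_orthogonal_family T"
  shows "isometrically_isomorphic_ell1 T"
proof -
  have rep: "\<exists>x k. x \<in> atoms \<and> norm k = 1 \<and> ext (scale k x) \<and> t = tri (scale k x)" if "t \<in> T" for t
  proof -
    have "minimal_tripotent t" using T that by (simp add: maximal_orthogonal_family_def)
    then obtain z where z: "ext z" "t = tri z" by (rule minimal_tripotent_tri)
    obtain x c where "x \<in> atoms" "norm c = 1" "z = scale c x" by (rule ext_eq_scale_atom[OF z(1)])
    then show ?thesis using z by blast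
  qed
  then obtain a k where a: "\<And>t. t \<in> T \<Longrightarrow> a t \<in> atoms" and k: "\<And>t. t \<in> T \<Longrightarrow> norm (k t) = 1"
    and ext_t: "\<And>t. t \<in> T \<Longrightarrow> ext (scale (k t) (a t))" and t_tri: "\<And>t. t \<in> T \<Longrightarrow> t = tri (scale (k t) (a t))"
    by metis
  have t_apply: "t \<cdot> p = inverse (k t) * tri (a t) \<cdot> p" if "t \<in> T" for t p
    using tri_scaled_atom[OF a[OF that] ext_t[OF that] k[OF that]] t_tri[OF that] by simp
  have norm_t: "norm (t \<cdot> p) = norm (tri (a t) \<cdot> p)" if "t \<in> T" for t p
    by (simp add: t_apply[OF that] norm_mult norm_inverse k[OF that])
  have inj: "inj_on a T"
  proof (rule inj_onI, rule ccontr)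
    fix t t' assume t: "t \<in> T" "t' \<in> T" "a t = a t'" "t \<noteq> t'"
    then have "tripotent_orthogonal t t'" using T by (simp add: maximal_orthogonal_family_def pairwise_def)
    then obtain f where f: "t = f o\<^sub>L peirce0 (face t')" by (auto simp: tripotent_orthogonal_def U0_def)
    define z where "z = scale (k t') (a t')"
    have z: "ext z" "t' = tri z" using ext_t[OF t(2)] t_tri[OF t(2)] by (simp_all add: z_def)
    have "t \<cdot> z = 0" unfolding f z(2) face_tri[OF z(1)] by (simp add: perp_self[OF z(1)] blinfun.zero_right)
    moreover have "t \<cdot> z = inverse (k t) * k t'"
      using t a[OF t(1)] tri_self[OF atoms_ext, of "a t"] dualD[OF tri_dual[OF atoms_ext[OF a[OF t(1)]]]]
      by (simp add: t_apply[OF t(1)] z_def)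
    ultimately show False using k[OF t(1)] k[OF t(2)] by auto
  qed
  have surj: "atoms \<subseteq> a ` T"
  proof (rule ccontr)
    assume "\<not> ?thesis"
    then obtain x where x: "x \<in> atoms" "x \<notin> a ` T" by blast
    note ex = atoms_ext[OF x(1)]
    have "tripotent_orthogonal (tri x) t" if t: "t \<in> T" for t
    proof -
      have "scale (k t) (a t) \<diamondsuit> x"
        using diamond_scaled_atoms[OF a[OF t] x(1), of "k t" 1] x(2) t by auto
      then have "tri x \<in> U0 t" using tri_in_U0[OF ex ext_t[OF t]] t_tri[OF t] by simp
      moreover have "geometric_tripotent t" using tripotent_tri[OF ext_t[OF t]] t_tri[OF t] by simp
      ultimately show ?thesis using tripotent_tri[OF ex] by (simp add: tripotent_orthogonal_def)
    qed
    then show False using T minimal_tri[OF ex] unfolding maximal_orthogonal_family_def by blast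
  qed
  have bij: "bij_betw a T atoms" using inj surj a by (auto simp: bij_betw_def)
  define \<Phi> where "\<Phi> p = (\<lambda>t. if t \<in> T then t \<cdot> p else 0)" for p
  have norm_\<Phi>: "ell1_norm T (\<Phi> p) = norm p" for p
  proof -
    have "ell1_norm T (\<Phi> p) = (\<Sum>\<^sub>\<infinity>t\<in>T. norm (tri (a t) \<cdot> p))"
      unfolding ell1_norm_def \<Phi>_def by (rule infsum_cong) (simp add: norm_t)
    also have "\<dots> = norm p" unfolding norm_eq_infsum by (rule infsum_reindex_bij_betw[OF bij])
    finally show ?thesis .
  qed
  have dual_t: "t \<in> dual" if "t \<in> T" for t using tri_dual[OF ext_t[OF that]] t_tri[OF that] by simp
  have add: "\<Phi> (p + q) = (\<lambda>t. \<Phi> p t + \<Phi> q t)" for p q by (auto simp: \<Phi>_def blinfun.add_right)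
  have scale: "\<Phi> (scale c p) = (\<lambda>t. c * \<Phi> p t)" for c p by (auto simp: \<Phi>_def dualD[OF dual_t])
  have "inj \<Phi>"
  proof (rule injI)
    fix p q assume "\<Phi> p = \<Phi> q"
    then have "t \<cdot> p = t \<cdot> q" if "t \<in> T" for t using that unfolding \<Phi>_def by (metis (full_types))
    then have "\<Phi> (p - q) = (\<lambda>t. 0)" by (auto simp: \<Phi>_def blinfun.diff_right)
    then have "norm (p - q) = 0" using norm_\<Phi>[of "p - q"] by (simp add: ell1_norm_def)
    then show "p = q" by simp
  qed
  moreover have "\<Phi> p \<in> ell1 T" for p
  proof -
    have "(\<lambda>t. norm (tri (a t) \<cdot> p)) summable_on T"
      using abs_summable_tri unfolding summable_on_reindex_bij_betw[OF bij, of "\<lambda>x. norm (tri x \<cdot> p)"] .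
    then have "(\<lambda>t. norm (\<Phi> p t)) summable_on T"
      by (rule summable_on_cong[THEN iffD1, rotated]) (simp add: \<Phi>_def norm_t)
    then show ?thesis by (simp add: ell1_def \<Phi>_def)
  qed
  moreover have "\<exists>p. \<Phi> p = l" if l: "l \<in> ell1 T" for l
  proof -
    define b where "b = the_inv_into T a"
    have b: "b x \<in> T" "a (b x) = x" if "x \<in> atoms" for x
      using that surj inj f_the_inv_into_f[OF inj, of x] the_inv_into_into[OF inj, of x T] unfolding b_def by auto
    have ba: "b (a t) = t" if "t \<in> T" for t unfolding b_def by (rule the_inv_into_f_f[OF inj that])
    \<comment> \<open>The phase cancels the factor \<open>inverse (k t)\<close> in the values of
      \<open>t\<close>.\<close>
    define c where "c x = l (b x) * k (b x)" for x
    have nc: "norm (c (a t)) = norm (l t)" if "t \<in> T" for t by (simp add: c_def ba that norm_mult k)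
    have "(\<lambda>t. norm (c (a t))) summable_on T"
      by (rule summable_on_cong[THEN iffD1, rotated, of "\<lambda>t. norm (l t)"]) (use l in \<open>simp_all add: ell1_def nc\<close>)
    then have "c abs_summable_on atoms" unfolding summable_on_reindex_bij_betw[OF bij, of "\<lambda>x. norm (c x)"] .
    then have "((\<lambda>x. scale (c x) x) has_sum (\<Sum>\<^sub>\<infinity>x\<in>atoms. scale (c x) x)) atoms"
      by (intro has_sum_infsum summable_atoms)
    then obtain p where p: "((\<lambda>x. scale (c x) x) has_sum p) atoms" by blast
    have tri_p: "tri x \<cdot> p = c x" if x: "x \<in> atoms" for x
    proof -
      have "((\<lambda>y. tri x \<cdot> scale (c y) y) has_sum tri x \<cdot> p) atoms"
        by (rule has_sum_bounded_linear[OF blinfun.bounded_linear_right p])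
      moreover have "((\<lambda>y. tri x \<cdot> scale (c y) y) has_sum c x) atoms"
      proof (subst has_sum_cong_neutral[where T = "{x}" and g = c])
        show "(c has_sum c x) {x}" by (rule has_sum_finiteI) simp_all
      qed (use x orthogonal_family_tri[OF atoms_family x] in \<open>auto simp: dualD[OF tri_dual[OF atoms_ext[OF x]]]\<close>)
      ultimately show ?thesis by (rule has_sum_unique)
    qed
    have "\<Phi> p t = l t" for t
    proof (cases "t \<in> T")
      case True
      then have "t \<cdot> p = (inverse (k t) * k t) * l t" by (simp add: t_apply tri_p a c_def ba mult.commute mult.left_commute)
      moreover have "k t \<noteq> 0" using k[OF True] by auto
      ultimately show ?thesis using True by (simp add: \<Phi>_def)
    qed (use l in \<open>simp add: \<Phi>_def ell1_def\<close>)
    then show ?thesis by blast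
  qed
  ultimately have "bij_betw \<Phi> UNIV (ell1 T)" unfolding bij_betw_def image_def by blast
  then show ?thesis unfolding isometrically_isomorphic_ell1_def using add scale norm_\<Phi> by blast
qed

end

theorem theorem3p5:
  fixes scale :: "'k::real_or_complex \<Rightarrow> 'z::real_normed_vector \<Rightarrow> 'z"
    and e :: "'z \<Rightarrow>\<^sub>L 'k"
    and T :: "('z \<Rightarrow>\<^sub>L 'k) set"
  assumes "normed_space_over scale"
    and "complete (UNIV :: 'z set)"
    and "normed_space_over.SFS scale"
    and "normed_space_over.neutral scale"
    and "normed_space_over.atomic scale"
    and "normed_space_over.point_exposed scale"
    and "normed_space_over.geometric_tripotent scale e"
    and "normed_space_over.Z2 scale e = UNIV"
    and "normed_space_over.nabla_boolean scale e"
    and "normed_space_over.maximal_orthogonal_family scale T"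
  shows "normed_space_over.isometrically_isomorphic_ell1 scale T"
proof -
  interpret normed_space_over scale by (rule assms(1))
  interpret boolean_sfs scale e
    by unfold_locales (rule assms)+
  show ?thesis by (rule isometrically_isomorphic[OF assms(10)])
qed

end
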